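(* Let $s\in\{0,1\}$. There exists a constant $C$, depending only on $d$, $\Omega$, $\vartheta_{\mathcal{T}}$ and $p$, such that $$|S_{\mathcal{T}}(w,v)|\le C\,|w|_{J,\mathcal{T}}\,|v|_{J,\mathcal{T}}\qquad\forall w,v\in V^s_{\mathcal{T}},$$ where the bilinear form $S_{\mathcal{T}}\colon V^s_{\mathcal{T}}\times V^s_{\mathcal{T}}\to\mathbb{R}$ is $$\begin{aligned}S_{\mathcal{T}}(w,v)=&\int_\Omega\left[\nabla^2w:\nabla^2v-\Delta w\,\Delta v\right]\\&-\int_{\mathcal{F}}\left[\nabla_T\{\nabla w\cdot\mathbf{n}\}\cdot[\![\nabla_Tv]\!]+\nabla_T\{\nabla v\cdot\mathbf{n}\}\cdot[\![\nabla_Tw]\!]\right]\\&+\int_{\mathcal{F}^I}\left[\{\Delta_Tw\}[\![\nabla v\cdot\mathbf{n}]\!]+\{\Delta_Tv\}[\![\nabla w\cdot\mathbf{n}]\!]\right].\end{aligned}$$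
   Context: Let $d\in\{2,3\}$ and let $\Omega\subset\mathbb{R}^d$ be a bounded convex polytopal open set. $\mathcal{T}$ is a finite conforming partition of $\Omega$ into closed simplices, with shape-regularity parameter $\vartheta_{\mathcal{T}}=\max_{K\in\mathcal{T}}\mathrm{diam}(K)/\rho_K$, $\rho_K$ the diameter of the largest ball inscribed in $K$. $\mathcal{F}$ is the set of closed $(d-1)$-dimensional faces, $\mathcal{F}^I$ and $\mathcal{F}^B$ the interior and boundary faces. Each face $F$ has a fixed unit normal $\mathbf{n}=\mathbf{n}_F$ (outward to $\Omega$ if $F\in\mathcal{F}^B$). The mesh-size function $h_{\mathcal{T}}$ equals $|K|^{1/d}$ on the interior of $K\in\mathcal{T}$ and $(\mathcal{H}^{d-1}(F))^{1/(d-1)}$ on $F\in\mathcal{F}$. For $F\in\mathcal{F}^I$ shared by $K,K'$, with $\mathbf{n}_F$ outward to $K$: jump $[\![v]\!]=v|_K-v|_{K'}$ and average $\{v\}=\frac12(v|_K+v|_{K'})$ (traces on $F$); for $F\in\mathcal{F}^B$, $[\![v]\!]=\{v\}=v|_F$; componentwise for vector fields. $\int_{\mathcal{G}}=\sum_{F\in\mathcal{G}}\int_F$ for $\mathcal{G}\subset\mathcal{F}$. $\nabla_T$ and $\Delta_T$ denote the tangential (surface) gradient and tangential Laplacian on faces (applied to traces from each element). Fix $p\ge2$; $V^0_{\mathcal{T}}=\{v\in L^2(\Omega): v|_K\in\mathbb{P}_p\ \forall K\in\mathcal{T}\}$ (total degree at most $p$), $V^1_{\mathcal{T}}=V^0_{\mathcal{T}}\cap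 H^1_0(\Omega)$. $\nabla$, $\nabla^2$, $\Delta$ denote piecewise gradient, Hessian and Laplacian, and $:$ the Frobenius inner product. $|v|_{J,\mathcal{T}}^2=\int_{\mathcal{F}^I}h_{\mathcal{T}}^{-1}|[\![\nabla v]\!]|^2+\int_{\mathcal{F}}h_{\mathcal{T}}^{-3}|[\![v]\!]|^2$. *)

theory Defs
  imports "HOL-Analysis.Analysis"
begin

section \<open>Differential operators on $\mathbb{R}^d$\<close>

definition partial_deriv :: "'n::finite \<Rightarrow> (real^'n \<Rightarrow> real) \<Rightarrow> real^'n \<Rightarrow> real" where
  "partial_deriv i f x = frechet_derivative f (at x) (axis i 1)"

definition grad :: "(real^'n::finite \<Rightarrow> real) \<Rightarrow> real^'n \<Rightarrow> real^'n" where
  "grad f x = (\<chi> i. partial_deriv i f x)"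

definition hessian :: "(real^'n::finite \<Rightarrow> real) \<Rightarrow> real^'n \<Rightarrow> real^'n^'n" where
  "hessian f x = (\<chi> i j. partial_deriv i (partial_deriv j f) x)"

definition divergence :: "(real^'n::finite \<Rightarrow> real^'n) \<Rightarrow> real^'n \<Rightarrow> real" where
  "divergence u x = (\<Sum>i\<in>UNIV. partial_deriv i (\<lambda>y. u y $ i) x)"

definition laplacian :: "(real^'n::finite \<Rightarrow> real) \<Rightarrow> real^'n \<Rightarrow> real" where
  "laplacian f = divergence (grad f)"

text \<open>
  Tangential operators on a hyperplane with unit normal \<open>\<nu>\<close>, for functions defined in a
  neighbourhood. On the hyperplane the results depend only on the restriction of \<open>f\<close> to it.
  The field \<open>surf_grad \<nu> f\<close> is tangential and \<open>\<nu>\<close> is constant, so its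
  surface divergence is the full divergence minus the normal derivative of its normal component,
  and the latter vanishes.
\<close>

definition surf_grad :: "real^'n::finite \<Rightarrow> (real^'n \<Rightarrow> real) \<Rightarrow> real^'n \<Rightarrow> real^'n" where
  "surf_grad \<nu> f x = grad f x - (grad f x \<bullet> \<nu>) *\<^sub>R \<nu>"

definition surf_laplacian :: "real^'n::finite \<Rightarrow> (real^'n \<Rightarrow> real) \<Rightarrow> real^'n \<Rightarrow> real" where
  "surf_laplacian \<nu> f = divergence (surf_grad \<nu> f)"


section \<open>Lebesgue and Sobolev spaces\<close>

text \<open>
  Elements of the function spaces are represented by functions on the whole space; only their
  values almost everywhere in \<open>\<Omega>\<close> matter.
\<close>

definition L2 :: "(real^'n::finite) set \<Rightarrow> (real^'n \<Rightarrow> 'b::euclidean_space) set" where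
  "L2 \<Omega> = {f. set_borel_measurable lebesgue \<Omega> f \<and> set_integrable lebesgue \<Omega> (\<lambda>x. (norm (f x))\<^sup>2)}"

text \<open>\<open>C\<^sup>\<infinity>\<close>: all iterated partial derivatives exist and are differentiable everywhere.\<close>

definition smooth :: "(real^'n::finite \<Rightarrow> real) \<Rightarrow> bool" where
  "smooth f \<longleftrightarrow> (\<forall>is x. foldr partial_deriv is f differentiable (at x))"

definition test_functions :: "(real^'n::finite) set \<Rightarrow> (real^'n \<Rightarrow> real) set" where
  "test_functions \<Omega> = {\<phi>. smooth \<phi> \<and> compact (closure {x. \<phi> x \<noteq> 0}) \<and> closure {x. \<phi> x \<noteq> 0} \<subseteq> \<Omega>}"

definition weak_gradient ::
    "(real^'n::finite) set \<Rightarrow> (real^'n \<Rightarrow> real) \<Rightarrow> (real^'n \<Rightarrow> real^'n) \<Rightarrow> bool" where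
  "weak_gradient \<Omega> v g \<longleftrightarrow>
     (\<forall>\<phi>\<in>test_functions \<Omega>. \<forall>i.
        (LINT x:\<Omega>|lebesgue. v x * partial_deriv i \<phi> x) = - (LINT x:\<Omega>|lebesgue. g x $ i * \<phi> x))"

text \<open>The closure of the test functions in \<open>H\<^sup>1(\<Omega>)\<close>.\<close>

definition H10 :: "(real^'n::finite) set \<Rightarrow> (real^'n \<Rightarrow> real) set" where
  "H10 \<Omega> = {v \<in> L2 \<Omega>. \<exists>g \<in> L2 \<Omega>. weak_gradient \<Omega> v g \<and>
     (\<exists>\<phi>. (\<forall>k::nat. \<phi> k \<in> test_functions \<Omega>) \<and>
        (\<lambda>k. (LINT x:\<Omega>|lebesgue. (v x - \<phi> k x)\<^sup>2)
            + (LINT x:\<Omega>|lebesgue. (norm (g x - grad (\<phi> k) x))\<^sup>2)) \<longlonglongrightarrow> 0)}"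


section \<open>Hausdorff measure\<close>

text \<open>
  The Hausdorff measure of dimension \<open>s\<close>, normalised by the volume of the unit ball in
  dimension \<open>s\<close> so that it coincides with Lebesgue measure on \<open>s\<close>-dimensional planes.
  Boundedness of the covering sets is required explicitly because \<^const>\<open>diameter\<close> is
  unspecified on unbounded sets; empty covering sets are skipped because \<open>0 ^ 0 = 1\<close>.
\<close>

definition hausdorff_pre :: "nat \<Rightarrow> real \<Rightarrow> 'a::metric_space set \<Rightarrow> ennreal" where
  "hausdorff_pre s \<delta> A =
     Inf {\<Sum>j. if U j = {} then 0 else ennreal (unit_ball_vol (real s) * (diameter (U j) / 2) ^ s) |
            U :: nat \<Rightarrow> 'a set.
            A \<subseteq> (\<Union>j. U j) \<and> (\<forall>j. bounded (U j) \<and> diameter (U j) \<le> \<delta>)}"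

definition hausdorff_outer :: "nat \<Rightarrow> 'a::metric_space set \<Rightarrow> ennreal" where
  "hausdorff_outer s A = (SUP \<delta>\<in>{0<..}. hausdorff_pre s \<delta> A)"

definition hausdorff_measure :: "nat \<Rightarrow> 'a::metric_space measure" where
  "hausdorff_measure s = measure_of UNIV (sets borel) (hausdorff_outer s)"

definition surface_measure :: "(real^'n::finite) measure" where
  "surface_measure = hausdorff_measure (CARD('n) - 1)"


section \<open>Meshes\<close>

definition conforming_mesh :: "(real^'n::finite) set \<Rightarrow> (real^'n) set set \<Rightarrow> bool" where
  "conforming_mesh \<Omega> \<T> \<longleftrightarrow>
     triangulation \<T> \<and> (\<forall>K\<in>\<T>. int CARD('n) simplex K) \<and> \<Union>\<T> = closure \<Omega>"

definition inball_diameter :: "(real^'n::finite) set \<Rightarrow> real" where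
  "inball_diameter K = Sup {2 * r |r x. 0 < r \<and> cball x r \<subseteq> K}"

definition shape_regularity :: "(real^'n::finite) set set \<Rightarrow> real" where
  "shape_regularity \<T> = Max ((\<lambda>K. diameter K / inball_diameter K) ` \<T>)"

definition faces :: "(real^'n::finite) set set \<Rightarrow> (real^'n) set set" where
  "faces \<T> = {F. \<exists>K\<in>\<T>. F facet_of K}"

definition boundary_faces :: "(real^'n::finite) set \<Rightarrow> (real^'n) set set \<Rightarrow> (real^'n) set set" where
  "boundary_faces \<Omega> \<T> = {F \<in> faces \<T>. F \<subseteq> frontier \<Omega>}"

definition interior_faces :: "(real^'n::finite) set \<Rightarrow> (real^'n) set set \<Rightarrow> (real^'n) set set" where
  "interior_faces \<Omega> \<T> = faces \<T> - boundary_faces \<Omega> \<T>"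

definition unit_normal_to :: "real^'n::finite \<Rightarrow> (real^'n) set \<Rightarrow> bool" where
  "unit_normal_to \<nu> F \<longleftrightarrow> norm \<nu> = 1 \<and> (\<forall>x\<in>F. \<forall>y\<in>F. \<nu> \<bullet> (y - x) = 0)"

text \<open>For a normal \<open>\<nu>\<close> to a face \<open>F\<close> of the convex set \<open>K\<close>: \<open>\<nu>\<close> points out of \<open>K\<close>.\<close>

definition outward_on :: "real^'n::finite \<Rightarrow> (real^'n) set \<Rightarrow> (real^'n) set \<Rightarrow> bool" where
  "outward_on \<nu> F K \<longleftrightarrow> (\<forall>x\<in>F. \<forall>y\<in>K. \<nu> \<bullet> (y - x) \<le> 0)"

definition face_normals ::
    "(real^'n::finite) set \<Rightarrow> (real^'n) set set \<Rightarrow> ((real^'n) set \<Rightarrow> real^'n) \<Rightarrow> bool" where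
  "face_normals \<Omega> \<T> n \<longleftrightarrow>
     (\<forall>F\<in>faces \<T>. unit_normal_to (n F) F) \<and> (\<forall>F\<in>boundary_faces \<Omega> \<T>. outward_on (n F) F \<Omega>)"

definition face_size :: "(real^'n::finite) set \<Rightarrow> real" where
  "face_size F = root (CARD('n) - 1) (measure surface_measure F)"

text \<open>
  The element to which \<open>n F\<close> is outward (for a boundary face, the only element containing it),
  and, for interior faces, the element on the other side.
\<close>

definition elem_in ::
    "(real^'n::finite) set set \<Rightarrow> ((real^'n) set \<Rightarrow> real^'n) \<Rightarrow> (real^'n) set \<Rightarrow> (real^'n) set" where
  "elem_in \<T> n F = (THE K. K \<in> \<T> \<and> F facet_of K \<and> outward_on (n F) F K)"

definition elem_out ::
    "(real^'n::finite) set set \<Rightarrow> ((real^'n) set \<Rightarrow> real^'n) \<Rightarrow> (real^'n) set \<Rightarrow> (real^'n) set" where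
  "elem_out \<T> n F = (THE K. K \<in> \<T> \<and> F facet_of K \<and> outward_on (- n F) F K)"

text \<open>
  Jumps and averages act on broken fields, i.e. families \<open>g\<close> indexed by the elements such that
  \<open>g K\<close> is the smooth extension to the whole space of the field on \<open>K\<close>.
\<close>

definition jump ::
    "(real^'n::finite) set \<Rightarrow> (real^'n) set set \<Rightarrow> ((real^'n) set \<Rightarrow> real^'n) \<Rightarrow> (real^'n) set
     \<Rightarrow> ((real^'n) set \<Rightarrow> real^'n \<Rightarrow> 'b::real_vector) \<Rightarrow> real^'n \<Rightarrow> 'b" where
  "jump \<Omega> \<T> n F g x =
     (if F \<in> interior_faces \<Omega> \<T> then g (elem_in \<T> n F) x - g (elem_out \<T> n F) x
      else g (elem_in \<T> n F) x)"

definition avg ::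
    "(real^'n::finite) set \<Rightarrow> (real^'n) set set \<Rightarrow> ((real^'n) set \<Rightarrow> real^'n) \<Rightarrow> (real^'n) set
     \<Rightarrow> ((real^'n) set \<Rightarrow> real^'n \<Rightarrow> 'b::real_vector) \<Rightarrow> real^'n \<Rightarrow> 'b" where
  "avg \<Omega> \<T> n F g x =
     (if F \<in> interior_faces \<Omega> \<T> then (1/2) *\<^sub>R (g (elem_in \<T> n F) x + g (elem_out \<T> n F) x)
      else g (elem_in \<T> n F) x)"


section \<open>Finite element spaces\<close>

definition polys :: "nat \<Rightarrow> (real^'n::finite \<Rightarrow> real) set" where
  "polys p = {q. \<exists>c :: ('n \<Rightarrow> nat) \<Rightarrow> real. \<forall>x.
     q x = (\<Sum>\<alpha> | (\<Sum>i\<in>UNIV. \<alpha> i) \<le> p. c \<alpha> * (\<Prod>i\<in>UNIV. (x $ i) ^ \<alpha> i))}"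

definition V0 :: "nat \<Rightarrow> (real^'n::finite) set \<Rightarrow> (real^'n) set set \<Rightarrow> (real^'n \<Rightarrow> real) set" where
  "V0 p \<Omega> \<T> = {v \<in> L2 \<Omega>. \<forall>K\<in>\<T>. \<exists>q\<in>polys p. AE x in lebesgue. x \<in> K \<longrightarrow> v x = q x}"

definition V1 :: "nat \<Rightarrow> (real^'n::finite) set \<Rightarrow> (real^'n) set set \<Rightarrow> (real^'n \<Rightarrow> real) set" where
  "V1 p \<Omega> \<T> = V0 p \<Omega> \<T> \<inter> H10 \<Omega>"

definition FE_space ::
    "nat \<Rightarrow> nat \<Rightarrow> (real^'n::finite) set \<Rightarrow> (real^'n) set set \<Rightarrow> (real^'n \<Rightarrow> real) set" where
  "FE_space s p \<Omega> \<T> = (if s = 0 then V0 p \<Omega> \<T> else V1 p \<Omega> \<T>)"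

text \<open>
  The restriction \<open>v|\<^sub>K\<close> of a piecewise polynomial, as the unique polynomial on the whole space that
  agrees with \<open>v\<close> almost everywhere on \<open>K\<close>. Its values on the faces of \<open>K\<close> are the traces of \<open>v|\<^sub>K\<close>.
\<close>

definition piece :: "(real^'n::finite \<Rightarrow> real) \<Rightarrow> (real^'n) set \<Rightarrow> real^'n \<Rightarrow> real" where
  "piece v K = (THE q. (\<exists>p. q \<in> polys p) \<and> (AE x in lebesgue. x \<in> K \<longrightarrow> v x = q x))"


section \<open>The jump seminorm and the bilinear form\<close>

definition jump_seminorm ::
    "(real^'n::finite) set \<Rightarrow> (real^'n) set set \<Rightarrow> ((real^'n) set \<Rightarrow> real^'n)
     \<Rightarrow> (real^'n \<Rightarrow> real) \<Rightarrow> real" where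
  "jump_seminorm \<Omega> \<T> n v = sqrt (
     (\<Sum>F\<in>interior_faces \<Omega> \<T>. LINT x:F|surface_measure.
        inverse (face_size F) * (norm (jump \<Omega> \<T> n F (\<lambda>K. grad (piece v K)) x))\<^sup>2)
   + (\<Sum>F\<in>faces \<T>. LINT x:F|surface_measure.
        inverse (face_size F ^ 3) * (jump \<Omega> \<T> n F (piece v) x)\<^sup>2))"

text \<open>
  The Frobenius product of matrices is the inner product of the type \<open>real^'n^'n\<close>. The integral over
  \<open>\<Omega>\<close> of piecewise derivatives is the sum of the integrals over the elements.
\<close>

definition S_form ::
    "(real^'n::finite) set \<Rightarrow> (real^'n) set set \<Rightarrow> ((real^'n) set \<Rightarrow> real^'n)
     \<Rightarrow> (real^'n \<Rightarrow> real) \<Rightarrow> (real^'n \<Rightarrow> real) \<Rightarrow> real" where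
  "S_form \<Omega> \<T> n w v =
     (\<Sum>K\<in>\<T>. LINT x:K|lebesgue.
        hessian (piece w K) x \<bullet> hessian (piece v K) x
        - laplacian (piece w K) x * laplacian (piece v K) x)
   - (\<Sum>F\<in>faces \<T>. LINT x:F|surface_measure.
        surf_grad (n F) (avg \<Omega> \<T> n F (\<lambda>K y. grad (piece w K) y \<bullet> n F)) x
          \<bullet> jump \<Omega> \<T> n F (\<lambda>K. surf_grad (n F) (piece v K)) x
        + surf_grad (n F) (avg \<Omega> \<T> n F (\<lambda>K y. grad (piece v K) y \<bullet> n F)) x
          \<bullet> jump \<Omega> \<T> n F (\<lambda>K. surf_grad (n F) (piece w K)) x)
   + (\<Sum>F\<in>interior_faces \<Omega> \<T>. LINT x:F|surface_measure.
        avg \<Omega> \<T> n F (\<lambda>K. surf_laplacian (n F) (piece w K)) x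
          * jump \<Omega> \<T> n F (\<lambda>K y. grad (piece v K) y \<bullet> n F) x
        + avg \<Omega> \<T> n F (\<lambda>K. surf_laplacian (n F) (piece v K)) x
          * jump \<Omega> \<T> n F (\<lambda>K y. grad (piece w K) y \<bullet> n F) x)"

end

theory Submission
  imports Defs "HOL-Computational_Algebra.Polynomial"
begin

text \<open>
  Integrating the element terms by parts, once over each element and then tangentially over each face, the
  second derivatives disappear: what remains are integrals over the ridges (the faces of dimension
  \<open>d - 2\<close>) of products of first-order traces. An interior face contributes
  \<open>[\<partial>\<^sub>n w] {\<partial>\<^sub>\<mu> v} - {\<partial>\<^sub>n v} [\<partial>\<^sub>\<mu> w]\<close>, where \<open>\<mu>\<close> is the conormal of the ridge in the face, and a boundary
  face contributes \<open>- \<partial>\<^sub>n v \<partial>\<^sub>\<mu> w\<close>. Around a ridge these terms vanish if \<open>{\<nabla>v}\<close> is replaced by one fixed vector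
  \<open>\<beta>\<close>, because each element cancels on its own. A suitable \<open>\<beta>\<close> differs from every \<open>\<nabla>v|\<^sub>K\<close> near the ridge, in the
  directions normal to the ridge, by no more than the jumps of \<open>\<nabla>v\<close> and the derivatives \<open>\<partial>\<^sub>\<mu> v\<close> on boundary
  faces: walk through the elements around the ridge and, if the ridge lies on two boundary faces that are
  not parallel, use that \<open>\<Omega>\<close> has only finitely many facet normals. Discrete trace and inverse inequalities
  then bound the ridge integrals by the jump seminorms.
\<close>

section \<open>Hausdorff measure on hyperplanes\<close>

text \<open>The seminorm penalises the full gradient jump on interior faces but on boundary faces
  only the trace of \<open>v\<close>; an inverse inequality recovers its tangential derivatives
  there, and nothing recovers the normal one. This is the obstacle: at a boundary ridge the field
  \<beta> must absorb the uncontrolled normal derivative. If all boundary faces at the ridge are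
  parallel, a vector along the common normal does so without disturbing the boundary terms;
  otherwise two independent tangential derivatives determine the whole component normal to the
  ridge, with a loss governed by the angle, which is how the constant comes to depend on \<Omega>.
  The estimate at a ridge is pointwise and unweighted, and each trace is scaled afterwards with the
  size of its own face, so sizes of neighbouring elements are never compared. The surface terms are
  Hausdorff integrals and are first identified with Lebesgue integrals over thickened hyperplanes.
  In that form all divergence theorems reduce to the fundamental theorem of calculus on lines
  parallel to an edge of a simplex, which enter and leave it through just two facets.\<close>

definition hausdorff_weight :: "nat \<Rightarrow> 'a::metric_space set \<Rightarrow> ennreal" where
  "hausdorff_weight s U = (if U = {} then 0 else ennreal (unit_ball_vol (real s) * (diameter U / 2) ^ s))"

definition fine_cover :: "real \<Rightarrow> 'a::metric_space set \<Rightarrow> (nat \<Rightarrow> 'a set) \<Rightarrow> bool" where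
  "fine_cover \<delta> A U \<longleftrightarrow> A \<subseteq> (\<Union>j. U j) \<and> (\<forall>j. bounded (U j) \<and> diameter (U j) \<le> \<delta>)"

lemma hausdorff_weight_empty [simp]: "hausdorff_weight s {} = 0"
  by (simp add: hausdorff_weight_def)

lemma hausdorff_pre_alt:
  "hausdorff_pre s \<delta> A = Inf {\<Sum>j. hausdorff_weight s (U j) | U. fine_cover \<delta> A U}"
  unfolding hausdorff_pre_def hausdorff_weight_def fine_cover_def by simp

lemma hausdorff_pre_le:
  "fine_cover \<delta> A U \<Longrightarrow> hausdorff_pre s \<delta> A \<le> (\<Sum>j. hausdorff_weight s (U j))"
  unfolding hausdorff_pre_alt by (rule Inf_lower) auto

lemma hausdorff_pre_geI:
  assumes "\<And>U. fine_cover \<delta> A U \<Longrightarrow> c \<le> (\<Sum>j. hausdorff_weight s (U j))"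
  shows "c \<le> hausdorff_pre s \<delta> A"
  unfolding hausdorff_pre_alt using assms by (auto intro: Inf_greatest)

lemma hausdorff_pre_lessE:
  assumes "hausdorff_pre s \<delta> A < c"
  obtains U where "fine_cover \<delta> A U" "(\<Sum>j. hausdorff_weight s (U j)) < c"
  using assms unfolding hausdorff_pre_alt Inf_less_iff by auto

lemma hausdorff_pre_mono: "A \<subseteq> B \<Longrightarrow> hausdorff_pre s \<delta> A \<le> hausdorff_pre s \<delta> B"
  by (rule hausdorff_pre_geI, rule hausdorff_pre_le) (auto simp: fine_cover_def)

lemma hausdorff_pre_antimono: "\<delta> \<le> \<epsilon> \<Longrightarrow> hausdorff_pre s \<epsilon> A \<le> hausdorff_pre s \<delta> A"
  by (rule hausdorff_pre_geI, rule hausdorff_pre_le) (auto simp: fine_cover_def intro: order_trans)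

lemma hausdorff_pre_empty: "0 < \<delta> \<Longrightarrow> hausdorff_pre s \<delta> {} = 0"
  using hausdorff_pre_le[of \<delta> "{}" "\<lambda>_. {}" s] by (auto simp: fine_cover_def)

text \<open>Near-optimal covers of the sets \<open>A i\<close>, with errors
  \<open>e * (1/2) ^ Suc i\<close>, are merged into one sequence by a pairing function.\<close>

lemma hausdorff_pre_countably_subadditive:
  assumes "0 < \<delta>"
  shows "hausdorff_pre s \<delta> (\<Union>i::nat. A i) \<le> (\<Sum>i. hausdorff_pre s \<delta> (A i))"
proof (rule ennreal_le_epsilon)
  fix e :: real assume e: "0 < e" and fin: "(\<Sum>i. hausdorff_pre s \<delta> (A i)) < top"
  have "\<exists>U. fine_cover \<delta> (A i) U \<and>
          (\<Sum>j. hausdorff_weight s (U j)) \<le> hausdorff_pre s \<delta> (A i) + e * (1/2) ^ Suc i" for i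
  proof -
    have "hausdorff_pre s \<delta> (A i) < top"
      using fin ennreal_suminf_lessD by blast
    then have "hausdorff_pre s \<delta> (A i) < hausdorff_pre s \<delta> (A i) + e * (1/2) ^ Suc i"
      using e by (cases "hausdorff_pre s \<delta> (A i)")
        (auto simp: ennreal_plus[symmetric] ennreal_less_iff simp del: ennreal_plus)
    then show ?thesis
      by (rule hausdorff_pre_lessE) (blast intro: less_imp_le)
  qed
  then obtain U where U: "\<And>i. fine_cover \<delta> (A i) (U i)"
    "\<And>i. (\<Sum>j. hausdorff_weight s (U i j)) \<le> hausdorff_pre s \<delta> (A i) + e * (1/2) ^ Suc i"
    by metis
  define C where "C = case_prod U \<circ> prod_decode"
  have "fine_cover \<delta> (\<Union>i. A i) C"
    using U(1) unfolding fine_cover_def C_def 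
    by (auto simp: subset_eq split: prod.splits) (metis prod.case prod_encode_inverse)
  then have "hausdorff_pre s \<delta> (\<Union>i. A i) \<le> (\<Sum>j. hausdorff_weight s (C j))"
    by (rule hausdorff_pre_le)
  also have "\<dots> = (\<Sum>n. \<Sum>i. hausdorff_weight s (U n i))"
    unfolding C_def comp_def by (rule suminf_ennreal_2dimen) simp
  also have "\<dots> \<le> (\<Sum>n. hausdorff_pre s \<delta> (A n) + e * (1/2) ^ Suc n)"
    by (intro suminf_le U) auto
  also have "\<dots> = (\<Sum>n. hausdorff_pre s \<delta> (A n)) + (\<Sum>n. ennreal e * ennreal ((1/2) ^ Suc n))"
    using e by (subst suminf_add[symmetric])
      (auto simp del: ennreal_suminf_cmult simp add: ennreal_mult[symmetric])
  also have "\<dots> = (\<Sum>n. hausdorff_pre s \<delta> (A n)) + e"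
    unfolding ennreal_suminf_cmult
    by (subst suminf_ennreal_eq[OF zero_le_power power_half_series]) auto
  finally show "hausdorff_pre s \<delta> (\<Union>i. A i) \<le> (\<Sum>i. hausdorff_pre s \<delta> (A i)) + e" .
qed

text \<open>A covering set of diameter at most \<delta> cannot meet both \<open>A\<close> and
  \<open>B\<close>, so every cover of the union splits into a cover of each.\<close>

lemma hausdorff_pre_separated:
  assumes "\<And>x y. x \<in> A \<Longrightarrow> y \<in> B \<Longrightarrow> \<delta> < dist x y" and "0 < \<delta>"
  shows "hausdorff_pre s \<delta> A + hausdorff_pre s \<delta> B \<le> hausdorff_pre s \<delta> (A \<union> B)"
proof (rule hausdorff_pre_geI)
  fix U assume U: "fine_cover \<delta> (A \<union> B) U"
  define P where "P S j = (if U j \<inter> S = {} then {} else U j)" for S j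
  have "fine_cover \<delta> S (P S)" if "S \<subseteq> A \<union> B" for S
    using U that \<open>0 < \<delta>\<close> unfolding fine_cover_def P_def by (fastforce simp: subset_eq)
  then have "hausdorff_pre s \<delta> A + hausdorff_pre s \<delta> B
      \<le> (\<Sum>j. hausdorff_weight s (P A j)) + (\<Sum>j. hausdorff_weight s (P B j))"
    by (intro add_mono hausdorff_pre_le) auto
  also have "\<dots> = (\<Sum>j. hausdorff_weight s (P A j) + hausdorff_weight s (P B j))"
    by (rule suminf_add) auto
  also have "\<dots> \<le> (\<Sum>j. hausdorff_weight s (U j))"
  proof (intro suminf_le)
    fix j
    have "U j \<inter> A = {} \<or> U j \<inter> B = {}"
    proof (rule ccontr)
      assume "\<not> ?thesis"
      then obtain x y where "x \<in> U j" "x \<in> A" "y \<in> U j" "y \<in> B" by auto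
      then show False
        using assms(1)[of x y] U diameter_bounded_bound[of "U j" x y] unfolding fine_cover_def
        by (metis less_le_trans not_less)
    qed
    then show "hausdorff_weight s (P A j) + hausdorff_weight s (P B j) \<le> hausdorff_weight s (U j)"
      by (auto simp: P_def)
  qed auto
  finally show "hausdorff_pre s \<delta> A + hausdorff_pre s \<delta> B \<le> (\<Sum>j. hausdorff_weight s (U j))" .
qed

section \<open>The outer measure and Caratheodory's criterion\<close>

lemma hausdorff_pre_le_outer: "0 < \<delta> \<Longrightarrow> hausdorff_pre s \<delta> A \<le> hausdorff_outer s A"
  unfolding hausdorff_outer_def by (rule SUP_upper) auto

lemma hausdorff_outer_leI:
  "(\<And>\<delta>. 0 < \<delta> \<Longrightarrow> hausdorff_pre s \<delta> A \<le> c) \<Longrightarrow> hausdorff_outer s A \<le> c"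
  unfolding hausdorff_outer_def by (rule SUP_least) auto

lemma hausdorff_outer_empty [simp]: "hausdorff_outer s {} = 0"
proof -
  have "hausdorff_outer s {} \<le> 0"
    by (rule hausdorff_outer_leI) (simp add: hausdorff_pre_empty)
  then show ?thesis by simp
qed

lemma hausdorff_outer_mono: "A \<subseteq> B \<Longrightarrow> hausdorff_outer s A \<le> hausdorff_outer s B"
  unfolding hausdorff_outer_def by (intro SUP_mono) (use hausdorff_pre_mono in blast)

lemma hausdorff_outer_countably_subadditive:
  "hausdorff_outer s (\<Union>i::nat. A i) \<le> (\<Sum>i. hausdorff_outer s (A i))"
proof (rule hausdorff_outer_leI)
  fix \<delta> :: real assume \<delta>: "0 < \<delta>"
  have "hausdorff_pre s \<delta> (\<Union>i. A i) \<le> (\<Sum>i. hausdorff_pre s \<delta> (A i))"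
    using \<delta> by (rule hausdorff_pre_countably_subadditive)
  also have "\<dots> \<le> (\<Sum>i. hausdorff_outer s (A i))"
    by (intro suminf_le hausdorff_pre_le_outer \<delta>) auto
  finally show "hausdorff_pre s \<delta> (\<Union>i. A i) \<le> (\<Sum>i. hausdorff_outer s (A i))" .
qed

lemma hausdorff_outer_Un_le: "hausdorff_outer s (A \<union> B) \<le> hausdorff_outer s A + hausdorff_outer s B"
proof -
  have "hausdorff_outer s (\<Union>i. binaryset A B i) \<le> (\<Sum>i. hausdorff_outer s (binaryset A B i))"
    by (rule hausdorff_outer_countably_subadditive)
  then show ?thesis
    by (simp add: UN_binaryset_eq suminf_binaryset_eq)
qed

lemma hausdorff_outer_separated:
  assumes sep: "\<And>x y. x \<in> A \<Longrightarrow> y \<in> B \<Longrightarrow> \<epsilon> \<le> dist x y" and "0 < \<epsilon>"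
  shows "hausdorff_outer s A + hausdorff_outer s B \<le> hausdorff_outer s (A \<union> B)"
proof -
  \<comment> \<open>The suprema over \<delta>1 and \<delta>2 are taken one after the other, so the
    bound is proved for unrelated parameters, both replaced by a common one below
    \<epsilon>.\<close>
  have *: "hausdorff_pre s \<delta>1 A + hausdorff_pre s \<delta>2 B \<le> hausdorff_outer s (A \<union> B)"
    if "0 < \<delta>1" "0 < \<delta>2" for \<delta>1 \<delta>2
  proof -
    define \<delta> where "\<delta> = min (\<epsilon>/2) (min \<delta>1 \<delta>2)"
    have \<delta>: "0 < \<delta>" "\<delta> < \<epsilon>" "\<delta> \<le> \<delta>1" "\<delta> \<le> \<delta>2"
      using that \<open>0 < \<epsilon>\<close> by (auto simp: \<delta>_def)
    have "hausdorff_pre s \<delta>1 A + hausdorff_pre s \<delta>2 B \<le> hausdorff_pre s \<delta> A + hausdorff_pre s \<delta> B"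
      by (intro add_mono hausdorff_pre_antimono \<delta>)
    also have "\<dots> \<le> hausdorff_pre s \<delta> (A \<union> B)"
      using sep \<delta> by (intro hausdorff_pre_separated) (auto intro: less_le_trans)
    also have "\<dots> \<le> hausdorff_outer s (A \<union> B)"
      using \<delta> by (intro hausdorff_pre_le_outer)
    finally show ?thesis .
  qed
  have "hausdorff_pre s \<delta>1 A + hausdorff_outer s B \<le> hausdorff_outer s (A \<union> B)" if "0 < \<delta>1" for \<delta>1
    unfolding hausdorff_outer_def[of s B]
    by (subst ennreal_SUP_add_right) (auto intro!: SUP_least * that)
  then show ?thesis
    unfolding hausdorff_outer_def[of s A]
    by (subst ennreal_SUP_add_left[symmetric]) (auto intro!: SUP_least)
qed

lemma hausdorff_outer_separated_UN:
  fixes R :: "nat \<Rightarrow> 'a::metric_space set"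
  assumes "\<And>i. i < m \<Longrightarrow> \<exists>\<epsilon>>0. \<forall>j<i. \<forall>x\<in>R j. \<forall>y\<in>R i. \<epsilon> \<le> dist x y"
  shows "(\<Sum>i<m. hausdorff_outer s (R i)) \<le> hausdorff_outer s (\<Union>i<m. R i)"
  using assms
proof (induction m)
  case (Suc m)
  obtain \<epsilon> where \<epsilon>: "\<epsilon> > 0" "\<forall>j<m. \<forall>x\<in>R j. \<forall>y\<in>R m. \<epsilon> \<le> dist x y"
    using Suc.prems[of m] by auto
  have "(\<Sum>i<Suc m. hausdorff_outer s (R i)) \<le> hausdorff_outer s (\<Union>i<m. R i) + hausdorff_outer s (R m)"
    using Suc by (auto intro: add_right_mono)
  also have "\<dots> \<le> hausdorff_outer s ((\<Union>i<m. R i) \<union> R m)"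
    by (rule hausdorff_outer_separated[of _ _ \<epsilon>]) (use \<epsilon> in auto)
  also have "(\<Union>i<m. R i) \<union> R m = (\<Union>i<Suc m. R i)"
    by (auto simp: less_Suc_eq)
  finally show ?case .
qed simp

text \<open>Caratheodory's criterion: the part of \<open>T\<close> outside \<open>C\<close> is cut into the annuli \<open>R k\<close>, and annuli whose
  indices differ by at least two have positive distance.\<close>

lemma hausdorff_outer_caratheodory:
  fixes C T :: "'a::metric_space set"
  assumes "closed C"
  shows "hausdorff_outer s (T \<inter> C) + hausdorff_outer s (T - C) \<le> hausdorff_outer s T"
proof (cases "C = {} \<or> hausdorff_outer s T = top")
  case True
  then show ?thesis by auto
next
  case False
  then have C: "C \<noteq> {}" and fin: "hausdorff_outer s T < top"
    by (auto simp: top.not_eq_extremum)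
  let ?h = "hausdorff_outer s"
  \<comment> \<open>The part of \<open>T\<close> at distance at least
    \<open>1 / real (Suc k)\<close> from \<open>C\<close>; it is separated from
    \<open>T \<inter> C\<close>.\<close>
  define S where "S k = {x \<in> T. 1 / real (Suc k) \<le> infdist x C}" for k
  define R where "R k = S (Suc k) - S k" for k
  have Ssub: "S k \<subseteq> T - C" for k
    using C by (auto simp: S_def)
  have S_mono: "S k \<subseteq> S l" if "k \<le> l" for k l
  proof -
    have "1 / real (Suc l) \<le> 1 / real (Suc k)"
      using that by (intro divide_left_mono) auto
    then show ?thesis by (auto simp: S_def)
  qed
  have SC: "?h (T \<inter> C) + ?h (S k) \<le> ?h T" for k
  proof -
    have "?h (T \<inter> C) + ?h (S k) \<le> ?h (T \<inter> C \<union> S k)"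
    proof (rule hausdorff_outer_separated)
      fix x y assume "x \<in> T \<inter> C" "y \<in> S k"
      then show "1 / real (Suc k) \<le> dist x y"
        using infdist_le[of x C y] by (auto simp: S_def dist_commute)
    qed simp
    also have "\<dots> \<le> ?h T"
      by (intro hausdorff_outer_mono) (auto simp: S_def)
    finally show ?thesis .
  qed
  have Rdist: "1 / real (Suc (Suc k)) - 1 / real (Suc l) \<le> dist x y" if "x \<in> R k" "y \<in> R l" "k < l" for x y k l
  proof -
    have "infdist x C \<le> infdist y C + dist x y"
      by (rule infdist_triangle)
    then show ?thesis
      using that by (auto simp: R_def S_def)
  qed
  \<comment> \<open>With \<open>p = 0\<close> and \<open>p = 1\<close> these are the annuli of even
    and of odd index; two of one family have a whole annulus between them.\<close>
  have half: "(\<Sum>i<m. ?h (R (2 * i + p))) \<le> ?h T" for m p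
  proof -
    have "(\<Sum>i<m. ?h (R (2 * i + p))) \<le> ?h (\<Union>i<m. R (2 * i + p))"
    proof (rule hausdorff_outer_separated_UN)
      fix i
      show "\<exists>\<epsilon>>0. \<forall>j<i. \<forall>x\<in>R (2 * j + p). \<forall>y\<in>R (2 * i + p). \<epsilon> \<le> dist x y"
      proof (intro exI conjI allI impI ballI)
        \<comment> \<open>For \<open>i = 0\<close> there is no \<open>j < i\<close> and any positive
          number serves; the general formula would be negative for \<open>p = 0\<close>, where
          \<open>1 / 0 = 0\<close>.\<close>
        show "(if i = 0 then 1 else 1 / real (2 * i + p) - 1 / real (Suc (2 * i + p))) > 0"
          by (auto simp: divide_strict_left_mono)
        fix j x y assume j: "j < i" "x \<in> R (2 * j + p)" "y \<in> R (2 * i + p)"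
        have "1 / real (2 * i + p) \<le> 1 / real (Suc (Suc (2 * j + p)))"
          using j by (intro divide_left_mono) auto
        then show "(if i = 0 then 1 else 1 / real (2 * i + p) - 1 / real (Suc (2 * i + p))) \<le> dist x y"
          using Rdist[OF j(2,3)] j(1) by auto
      qed
    qed
    also have "\<dots> \<le> ?h T"
      by (intro hausdorff_outer_mono) (auto simp: R_def S_def)
    finally show ?thesis .
  qed
  have partial: "(\<Sum>i<2*m. ?h (R i)) \<le> ?h T + ?h T" for m
  proof -
    have "(\<Sum>i<2*m. ?h (R i)) = (\<Sum>i<m. ?h (R (2*i+0))) + (\<Sum>i<m. ?h (R (2*i+1)))"
      by (induction m) (auto simp: algebra_simps)
    then show ?thesis
      using add_mono[OF half half] by metis
  qed
  \<comment> \<open>Both families are bounded by the measure of \<open>T\<close>, so the series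
    converges and its tails tend to zero; a tail is all that \<open>S N\<close> can miss of
    \<open>T - C\<close>.\<close>
  have "(\<Sum>i. ?h (R i)) \<le> ?h T + ?h T"
  proof (rule suminf_le_const[OF summableI])
    fix m
    have "(\<Sum>i<m. ?h (R i)) \<le> (\<Sum>i<2*m. ?h (R i))"
      by (rule sum_mono2) auto
    then show "(\<Sum>i<m. ?h (R i)) \<le> ?h T + ?h T"
      using partial order_trans by blast
  qed
  then have Rfin: "(\<Sum>i. ?h (R i)) < top"
    using fin by (auto simp: le_less_trans)
  define g where "g i = enn2real (?h (R i))" for i
  have hg: "?h (R i) = ennreal (g i)" for i
    using ennreal_suminf_lessD[OF Rfin, of i] by (simp add: g_def)
  have g0: "0 \<le> g i" for i by (simp add: g_def)
  have summ: "summable g"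
  proof (rule summable_suminf_not_top)
    show "(\<Sum>i. ennreal (g i)) \<noteq> top" using Rfin hg by auto
  qed (rule g0)
  show ?thesis
  proof (rule ennreal_le_epsilon)
    fix e :: real assume "0 < e"
    obtain N where N: "norm (\<Sum>i. g (i + N)) < e"
      using suminf_exist_split[OF \<open>0 < e\<close> summ] by blast
    have "T - C \<subseteq> S N \<union> (\<Union>i. R (i + N))"
    proof
      fix x assume x: "x \<in> T - C"
      have "0 < infdist x C"
        using x C assms infdist_nonneg[of x C] in_closed_iff_infdist_zero[of C x] by (auto simp: less_le)
      then obtain k where "1 / real (Suc k) < infdist x C"
        by (meson nat_approx_posE)
      then have "\<exists>k. x \<in> S k" using x by (auto simp: S_def intro: exI[of _ k])
      then have k: "x \<in> S (LEAST k. x \<in> S k)" and least: "\<And>j. j < (LEAST k. x \<in> S k) \<Longrightarrow> x \<notin> S j"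
        by (auto intro: LeastI_ex dest: not_less_Least)
      show "x \<in> S N \<union> (\<Union>i. R (i + N))"
      proof (cases "(LEAST k. x \<in> S k) \<le> N")
        case True
        then show ?thesis using k S_mono by blast
      next
        case False
        then obtain i where i: "(LEAST k. x \<in> S k) = Suc (i + N)"
          by (metis add.commute add_Suc_right less_imp_Suc_add linorder_not_le)
        then have "x \<in> R (i + N)"
          using k least[of "i + N"] by (auto simp: R_def)
        then show ?thesis by auto
      qed
    qed
    then have "?h (T - C) \<le> ?h (S N) + ?h (\<Union>i. R (i + N))"
      using hausdorff_outer_mono hausdorff_outer_Un_le order_trans by blast
    also have "?h (\<Union>i. R (i + N)) \<le> (\<Sum>i. ?h (R (i + N)))"
      by (rule hausdorff_outer_countably_subadditive)
    also have "\<dots> = ennreal (\<Sum>i. g (i + N))"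
      unfolding hg by (rule suminf_ennreal2) (use g0 summ in \<open>auto simp: summable_iff_shift\<close>)
    also have "\<dots> \<le> ennreal e"
      using N by (intro ennreal_leI) auto
    finally have "?h (T - C) \<le> ?h (S N) + ennreal e"
      by (simp add: add_left_mono)
    then have "?h (T \<inter> C) + ?h (T - C) \<le> ?h (T \<inter> C) + ?h (S N) + ennreal e"
      by (simp add: add_left_mono add.assoc)
    also have "\<dots> \<le> ?h T + ennreal e"
      by (intro add_right_mono SC)
    finally show "?h (T \<inter> C) + ?h (T - C) \<le> ?h T + ennreal e" .
  qed
qed

text \<open>\<open>measure_of\<close> yields \<open>hausdorff_outer\<close> only once that function
  is known to be a measure on the Borel sets. Closed sets satisfy Caratheodory's criterion, hence so
  does the sigma-algebra they generate.\<close>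

lemma measure_space_hausdorff:
  "measure_space UNIV (sets borel) (hausdorff_outer s :: 'a::metric_space set \<Rightarrow> ennreal)"
proof -
  let ?h = "hausdorff_outer s :: 'a set \<Rightarrow> ennreal"
  let ?L = "lambda_system UNIV UNIV ?h"
  have "outer_measure_space UNIV ?h"
    by (auto simp: outer_measure_space_def positive_def increasing_def countably_subadditive_def
        intro: hausdorff_outer_mono hausdorff_outer_countably_subadditive)
  then have L: "measure_space UNIV ?L ?h"
    using sigma_algebra.caratheodory_lemma[OF sigma_algebra_Pow, of UNIV ?h] by simp
  have "C \<in> ?L" if "closed C" for C
  proof -
    have "?h (C \<inter> T) + ?h ((UNIV - C) \<inter> T) = ?h T" for T
    proof (rule antisym)
      show "?h (C \<inter> T) + ?h ((UNIV - C) \<inter> T) \<le> ?h T"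
        using hausdorff_outer_caratheodory[OF that, of s T] by (simp add: Int_commute Diff_eq)
      have "T = C \<inter> T \<union> ((UNIV - C) \<inter> T)" by auto
      then show "?h T \<le> ?h (C \<inter> T) + ?h ((UNIV - C) \<inter> T)"
        using hausdorff_outer_Un_le by metis
    qed
    then show ?thesis by (simp add: lambda_system_def)
  qed
  then have "sigma_sets UNIV (Collect closed) \<subseteq> ?L"
    using L by (intro sigma_algebra.sigma_sets_subset) (auto simp: measure_space_def)
  then have "sets borel \<subseteq> ?L"
    by (simp add: borel_eq_closed)
  then show ?thesis
    using L sets.sigma_algebra_axioms[of "borel :: 'a measure"]
    unfolding measure_space_def countably_additive_def by (auto simp: positive_def)
qed

lemma sets_hausdorff_measure [simp, measurable_cong]: "sets (hausdorff_measure s) = sets borel"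
  by (simp add: hausdorff_measure_def sets.sigma_sets_eq[of borel, simplified])

lemma emeasure_hausdorff_measure:
  "A \<in> sets borel \<Longrightarrow> emeasure (hausdorff_measure s) A = hausdorff_outer s A"
  using measure_space_hausdorff[of s] unfolding hausdorff_measure_def measure_space_def
  by (intro emeasure_measure_of_sigma) auto

section \<open>Isometries\<close>

lemma hausdorff_weight_isometry:
  assumes "\<And>x y. x \<in> U \<Longrightarrow> y \<in> U \<Longrightarrow> dist (f x) (f y) = dist x y"
  shows "hausdorff_weight s (f ` U) = hausdorff_weight s U" "diameter (f ` U) = diameter U"
    "bounded (f ` U) = bounded U"
proof -
  show *: "diameter (f ` U) = diameter U"
  proof -
    have "(SUP (x,y)\<in>f ` U \<times> f ` U. dist x y) = (SUP (x,y)\<in>U \<times> U. dist x y)"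
      using assms by (intro arg_cong[of _ _ Sup]) (auto simp: image_iff, force+)
    then show ?thesis by (simp add: diameter_def)
  qed
  show "hausdorff_weight s (f ` U) = hausdorff_weight s U"
    by (simp add: hausdorff_weight_def *)
  show "bounded (f ` U) = bounded U"
    unfolding bounded_two_points using assms by auto
qed

lemma hausdorff_outer_isometry:
  assumes iso: "\<And>x y. dist (f x) (f y) = dist x y"
  shows "hausdorff_outer s (f ` A) = hausdorff_outer s A"
proof -
  have "hausdorff_pre s \<delta> (f ` A) = hausdorff_pre s \<delta> A" if "0 < \<delta>" for \<delta>
  proof (rule antisym; rule hausdorff_pre_geI)
    fix U assume "fine_cover \<delta> A U"
    then have "fine_cover \<delta> (f ` A) (\<lambda>j. f ` U j)"
      using iso by (auto simp: fine_cover_def hausdorff_weight_isometry subset_eq) blast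
    from hausdorff_pre_le[OF this] show "hausdorff_pre s \<delta> (f ` A) \<le> (\<Sum>j. hausdorff_weight s (U j))"
      using iso by (simp add: hausdorff_weight_isometry)
  next
    fix U assume U: "fine_cover \<delta> (f ` A) U"
    \<comment> \<open>\<open>f\<close> may fail to be onto: a covering set of the image is pulled
      back, and its preimage may have smaller diameter, so only inequalities hold.\<close>
    have bd: "bounded (f -` U j) \<and> diameter (f -` U j) \<le> diameter (U j) \<and>
       hausdorff_weight s (f -` U j) \<le> hausdorff_weight s (U j)" for j
    proof -
      have bU: "bounded (U j)" using U by (auto simp: fine_cover_def)
      have b: "bounded (f ` (f -` U j))" by (rule bounded_subset[OF bU]) auto
      then have b': "bounded (f -` U j)" using iso hausdorff_weight_isometry(3) by metis
      have "diameter (f ` (f -` U j)) \<le> diameter (U j)"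
        by (rule diameter_subset[OF _ bU]) auto
      then have d: "diameter (f -` U j) \<le> diameter (U j)" using iso hausdorff_weight_isometry(2) by metis
      have "0 \<le> unit_ball_vol (real s)" by simp
      then have "hausdorff_weight s (f -` U j) \<le> hausdorff_weight s (U j)"
        using d diameter_ge_0[OF b'] unfolding hausdorff_weight_def
        by (auto intro!: ennreal_leI mult_left_mono power_mono)
      with d b' show ?thesis by auto
    qed
    have "fine_cover \<delta> A (\<lambda>j. f -` U j)"
      using U bd unfolding fine_cover_def by (fastforce intro: order_trans)
    from hausdorff_pre_le[OF this, of s] 
    have "hausdorff_pre s \<delta> A \<le> (\<Sum>j. hausdorff_weight s (f -` U j))" .
    also have "\<dots> \<le> (\<Sum>j. hausdorff_weight s (U j))"
      using bd by (intro suminf_le) auto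
    finally show "hausdorff_pre s \<delta> A \<le> (\<Sum>j. hausdorff_weight s (U j))" .
  qed
  then show ?thesis unfolding hausdorff_outer_def by (intro SUP_cong) auto
qed

text \<open>Uniqueness of Haar measure: evaluate \<open>\<integral>\<integral> 1\<^sub>A(x + y) 1\<^sub>B(y)\<close> in two orders.\<close>

lemma translation_invariant_measure_unique:
  fixes \<mu> :: "'a::euclidean_space measure"
  assumes [measurable_cong, simp]: "sets \<mu> = sets borel" and "sigma_finite_measure \<mu>"
    and inv: "\<And>a. distr \<mu> borel (\<lambda>x. x + a) = \<mu>"
    and A [measurable]: "A \<in> sets borel" and B [measurable]: "B \<in> sets borel"
  shows "emeasure \<mu> A * emeasure lborel B = emeasure lborel A * emeasure \<mu> (uminus -` B)"
proof -
  interpret \<mu>: sigma_finite_measure \<mu> by fact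
  interpret P: pair_sigma_finite \<mu> "lborel :: 'a measure" ..
  have inv_int: "(\<integral>\<^sup>+x. f (x + a) \<partial>\<mu>) = (\<integral>\<^sup>+x. f x \<partial>\<mu>)" if [measurable]: "f \<in> borel_measurable borel" for f a
  proof -
    have "(\<integral>\<^sup>+x. f x \<partial>\<mu>) = (\<integral>\<^sup>+x. f x \<partial>distr \<mu> borel (\<lambda>x. x + a))" by (simp add: inv)
    also have "\<dots> = (\<integral>\<^sup>+x. f (x + a) \<partial>\<mu>)" by (rule nn_integral_distr) auto
    finally show ?thesis ..
  qed
  have linv: "(\<integral>\<^sup>+y. f (y + a) \<partial>lborel) = (\<integral>\<^sup>+y. f y \<partial>lborel)" if [measurable]: "f \<in> borel_measurable borel" for f and a :: 'a
    by (subst (2) lborel_affine[of 1 a]) (simp_all add: density_1 nn_integral_distr add.commute)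
  have "emeasure \<mu> A * emeasure lborel B = (\<integral>\<^sup>+y. indicator B y * emeasure \<mu> A \<partial>lborel)"
    by (simp add: nn_integral_multc mult.commute)
  also have "\<dots> = (\<integral>\<^sup>+y. \<integral>\<^sup>+x. indicator B y * indicator A (x + y) \<partial>\<mu> \<partial>lborel)"
  proof (intro nn_integral_cong)
    fix y
    have "(\<integral>\<^sup>+x. indicator B y * indicator A (x + y) \<partial>\<mu>) = indicator B y * (\<integral>\<^sup>+x. indicator A (x + y) \<partial>\<mu>)"
      by (rule nn_integral_cmult) measurable
    also have "(\<integral>\<^sup>+x. indicator A (x + y) \<partial>\<mu>) = emeasure \<mu> A"
      using inv_int[of "indicator A" y] by simp
    finally show "indicator B y * emeasure \<mu> A = (\<integral>\<^sup>+x. indicator B y * indicator A (x + y) \<partial>\<mu>)" ..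
  qed
  also have "\<dots> = (\<integral>\<^sup>+x. \<integral>\<^sup>+y. indicator B y * indicator A (x + y) \<partial>lborel \<partial>\<mu>)"
    by (rule P.Fubini') measurable
  also have "\<dots> = (\<integral>\<^sup>+x. \<integral>\<^sup>+y. indicator B (y - x) * indicator A y \<partial>lborel \<partial>\<mu>)"
  proof (rule nn_integral_cong)
    fix x :: 'a
    show "(\<integral>\<^sup>+y. indicator B y * indicator A (x + y) \<partial>lborel) = (\<integral>\<^sup>+y. indicator B (y - x) * (indicator A y :: ennreal) \<partial>lborel)"
      using linv[of "\<lambda>y. indicator B (y - x) * (indicator A y :: ennreal)" x] by (simp add: add.commute)
  qed
  also have "\<dots> = (\<integral>\<^sup>+y. \<integral>\<^sup>+x. indicator B (y - x) * indicator A y \<partial>\<mu> \<partial>lborel)"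
    by (rule P.Fubini'[symmetric]) measurable
  also have "\<dots> = (\<integral>\<^sup>+y. indicator A y * emeasure \<mu> (uminus -` B) \<partial>lborel)"
  proof (intro nn_integral_cong)
    fix y
    have "(\<integral>\<^sup>+x. indicator B (y - x) * indicator A y \<partial>\<mu>) = (\<integral>\<^sup>+x. indicator B (y - x) \<partial>\<mu>) * indicator A y"
      by (rule nn_integral_multc) measurable
    also have "(\<integral>\<^sup>+x. indicator B (y - x) \<partial>\<mu>) = (\<integral>\<^sup>+x. indicator B (y - (x + y)) \<partial>\<mu>)"
      by (subst inv_int) auto
    also have "\<dots> = (\<integral>\<^sup>+x. indicator (uminus -` B) x \<partial>\<mu>)"
      by (intro nn_integral_cong) (auto simp: indicator_def)
    also have "\<dots> = emeasure \<mu> (uminus -` B)"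
      by (rule nn_integral_indicator) (use measurable_sets_borel[of uminus borel B] in auto)
    finally show "(\<integral>\<^sup>+x. indicator B (y - x) * indicator A y \<partial>\<mu>) = indicator A y * emeasure \<mu> (uminus -` B)"
      by (simp add: mult.commute)
  qed
  also have "\<dots> = emeasure lborel A * emeasure \<mu> (uminus -` B)"
    by (simp add: nn_integral_multc)
  finally show ?thesis .
qed

text \<open>The image measure is translation invariant because \<open>f\<close> is linear and onto.
  By uniqueness it is a multiple of \<open>lborel\<close>, and the unit ball, which \<open>f\<close>
  preserves, shows that the factor is 1.\<close>

lemma lborel_distr_isometry:
  fixes f :: "'a::euclidean_space \<Rightarrow> 'b::euclidean_space"
  assumes lin: "linear f" and norm: "\<And>x. norm (f x) = norm x" and surj: "surj f"
    and dim: "DIM('a) = DIM('b)"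
  shows "distr lborel borel f = lborel"
proof (rule measure_eqI)
  let ?\<mu> = "distr lborel borel f"
  interpret f: linear f by fact
  have [measurable]: "f \<in> borel_measurable borel"
    using lin by (simp add: borel_measurable_continuous_onI linear_continuous_on linear_linear)
  have ball: "f -` ball 0 r = ball 0 r" for r by (auto simp: norm)
  have mball: "emeasure ?\<mu> (ball 0 r) = emeasure lborel (ball (0::'b) r)" if "0 \<le> r" for r
    using that by (simp add: emeasure_distr ball emeasure_ball dim)
  have sf: "sigma_finite_measure ?\<mu>"
  proof
    show "\<exists>A. countable A \<and> A \<subseteq> sets ?\<mu> \<and> \<Union>A = space ?\<mu> \<and> (\<forall>a\<in>A. emeasure ?\<mu> a \<noteq> \<infinity>)"
    proof (intro exI conjI)
      show "\<Union>(range (\<lambda>n. ball (0::'b) (real n))) = space ?\<mu>"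
        by (auto simp: reals_Archimedean2)
    qed (auto simp: mball emeasure_ball)
  qed
  have inv: "distr ?\<mu> borel (\<lambda>x. x + b) = ?\<mu>" for b
  proof -
    obtain a where a: "b = f a" using surj by auto
    have "distr ?\<mu> borel (\<lambda>x. x + b) = distr lborel borel (f \<circ> (\<lambda>x. a + x))"
      by (subst distr_distr) (auto simp: o_def a f.add add.commute)
    also have "\<dots> = distr (distr lborel borel (\<lambda>x. a + x)) borel f"
      by (subst distr_distr) auto
    also have "distr lborel borel (\<lambda>x. a + x) = (lborel :: 'a measure)"
      using lborel_affine[of 1 a] by (simp add: density_1)
    finally show ?thesis .
  qed
  fix A assume A: "A \<in> sets ?\<mu>"
  have "uminus -` ball (0::'b) 1 = ball 0 1" by auto
  then have "emeasure ?\<mu> A * emeasure lborel (ball (0::'b) 1) = emeasure lborel A * emeasure lborel (ball (0::'b) 1)"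
    using translation_invariant_measure_unique[OF _ sf inv, of A "ball 0 1"] A mball[of 1] by simp
  moreover have "emeasure lborel (ball (0::'b) 1) \<noteq> 0" "emeasure lborel (ball (0::'b) 1) \<noteq> top"
    using unit_ball_vol_pos[of "real DIM('b)"] by (auto simp: emeasure_ball simp del: unit_ball_vol_pos)
  ultimately show "emeasure ?\<mu> A = emeasure lborel A"
    by (metis ennreal_mult_cancel_left mult.commute)
qed simp

section \<open>Isodiametric inequalities\<close>

text \<open>The isodiametric inequality on the line; it also bounds the slices of the symmetrised
  plane set.\<close>

lemma emeasure_lborel_real_le:
  fixes A :: "real set"
  assumes "\<And>x y. x \<in> A \<Longrightarrow> y \<in> A \<Longrightarrow> \<bar>x - y\<bar> \<le> r" and "0 \<le> r"
  shows "emeasure lborel A \<le> ennreal r"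
proof (cases "A = {}")
  case False
  then obtain a where a: "a \<in> A" by auto
  have bdd: "bdd_above A" "bdd_below A"
    using assms(1)[of _ a] a by (auto intro!: bdd_aboveI[of _ "a + r"] bdd_belowI[of _ "a - r"] simp: abs_le_iff algebra_simps)
  have "Sup A \<le> Inf A + r"
  proof (rule cSup_least[OF False])
    fix x assume x: "x \<in> A"
    have "x - r \<le> Inf A"
      by (rule cInf_greatest[OF False]) (use assms(1)[OF x] in \<open>force simp: abs_le_iff\<close>)
    then show "x \<le> Inf A + r" by simp
  qed
  have "A \<subseteq> {Inf A..Sup A}"
    using bdd by (auto intro: cInf_lower cSup_upper)
  then have "emeasure lborel A \<le> emeasure lborel {Inf A..Sup A}"
    by (intro emeasure_mono) auto
  also have "\<dots> \<le> ennreal r"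
    using \<open>Sup A \<le> Inf A + r\<close> assms(2) by (cases "Inf A \<le> Sup A") (auto intro: ennreal_leI)
  finally show ?thesis .
qed simp

text \<open>The isodiametric inequality in the plane, by Steiner symmetrisation in both coordinate directions:
  \<open>T\<close> is the symmetrisation of \<open>S\<close> in the second coordinate, and its slices in the first coordinate are
  no longer than those of the disc.\<close>

lemma isodiametric_plane:
  fixes S :: "(real \<times> real) set"
  assumes S: "compact S" and "S \<noteq> {}"
  shows "emeasure lborel S \<le> emeasure lborel (cball (0 :: real \<times> real) (diameter S / 2))"
proof -
  define D where "D = diameter S"
  have D: "0 \<le> D" using S by (simp add: D_def diameter_ge_0 compact_imp_bounded)
  have SD: "(fst p - fst q)\<^sup>2 + (snd p - snd q)\<^sup>2 \<le> D\<^sup>2" if "p \<in> S" "q \<in> S" for p q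
  proof -
    have "dist p q \<le> D"
      using diameter_bounded_bound[OF compact_imp_bounded[OF S] that] by (simp add: D_def)
    then have "(dist p q)\<^sup>2 \<le> D\<^sup>2" by (intro power_mono) auto
    then show ?thesis by (simp add: dist_prod_def dist_real_def)
  qed
  have [measurable]: "S \<in> sets borel" using S by (simp add: borel_compact)
  then have S2 [measurable]: "S \<in> sets (lborel \<Otimes>\<^sub>M lborel)"
    by (metis lborel_prod sets_lborel)
  define m where "m x = emeasure lborel (Pair x -` S)" for x
  have m_meas [measurable]: "m \<in> borel_measurable borel"
    using lborel.measurable_emeasure_Pair[OF S2] by (simp add: m_def[abs_def])
  define X where "X = fst ` S"
  have "compact X" using S unfolding X_def by (intro compact_continuous_image continuous_intros)
  then have [measurable]: "X \<in> sets borel" by (rule borel_compact)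
  define T where "T = {p. fst p \<in> X \<and> ennreal (2 * \<bar>snd p\<bar>) \<le> m (fst p)}"
  have "T = (fst -` X \<inter> space (borel \<Otimes>\<^sub>M borel)) \<inter> {p \<in> space (borel \<Otimes>\<^sub>M borel). ennreal (2 * \<bar>snd p\<bar>) \<le> m (fst p)}"
    by (auto simp: T_def space_pair_measure)
  also have "\<dots> \<in> sets (borel \<Otimes>\<^sub>M borel)"
    by measurable
  finally have T [measurable]: "T \<in> sets (lborel \<Otimes>\<^sub>M lborel)"
    by (metis lborel_prod sets_lborel borel_prod)
  have slice: "compact (Pair x -` S)" for x
  proof -
    have "Pair x -` S = snd ` (S \<inter> ({x} \<times> UNIV))" by force
    moreover have "compact (S \<inter> ({x} \<times> UNIV))"
      by (intro compact_Int_closed S closed_Times) auto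
    ultimately show ?thesis by (simp add: compact_continuous_image continuous_on_snd)
  qed
  \<comment> \<open>What counts is the extent between the lowest and the highest point of a slice,
    since these belong to \<open>S\<close> by compactness; it is at least the length
    \<open>m x\<close>.\<close>
  have slice_extent: "\<exists>a b. (x, a) \<in> S \<and> (x, b) \<in> S \<and> m x \<le> ennreal (b - a) \<and> a \<le> b" if "x \<in> X" for x
  proof -
    let ?A = "Pair x -` S"
    have ne: "?A \<noteq> {}" using that by (force simp: X_def)
    have ab: "Inf ?A \<in> ?A" "Sup ?A \<in> ?A"
      using closed_contains_Inf[OF ne bounded_imp_bdd_below compact_imp_closed]
            closed_contains_Sup[OF ne bounded_imp_bdd_above compact_imp_closed] slice[of x]
      by (auto simp: compact_imp_bounded)
    have sub: "?A \<subseteq> {Inf ?A..Sup ?A}"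
      using slice[of x] by (auto intro!: cInf_lower cSup_upper bounded_imp_bdd_below bounded_imp_bdd_above compact_imp_bounded)
    then have le: "Inf ?A \<le> Sup ?A" using ne by fastforce
    have "m x \<le> emeasure lborel {Inf ?A..Sup ?A}"
      unfolding m_def by (rule emeasure_mono[OF sub]) auto
    then show ?thesis using ab le by auto
  qed
  have mfin: "m x < top" for x
    unfolding m_def using emeasure_compact_finite[OF slice] by simp
  have m0: "m x = 0" if "x \<notin> X" for x
  proof -
    have "Pair x -` S = {}" using that by (force simp: X_def)
    then show ?thesis by (simp add: m_def)
  qed
  have "emeasure lborel S = (\<integral>\<^sup>+x. m x \<partial>lborel)"
    using lborel.emeasure_pair_measure_alt[OF S2] by (simp add: lborel_prod m_def)
  also have "\<dots> = (\<integral>\<^sup>+x. emeasure lborel (Pair x -` T) \<partial>lborel)"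
  proof (intro nn_integral_cong)
    fix x
    show "m x = emeasure lborel (Pair x -` T)"
    proof (cases "x \<in> X")
      case True
      obtain r where r: "m x = ennreal r" "0 \<le> r" using mfin[of x] by (cases "m x") auto
      have "Pair x -` T = {- (r/2)..r/2}"
        using True r by (auto simp: T_def abs_le_iff)
      then show ?thesis using r by simp
    next
      case False
      then have "Pair x -` T = {}" by (auto simp: T_def)
      then show ?thesis using m0[OF False] by simp
    qed
  qed
  also have "\<dots> = emeasure lborel T"
    using lborel.emeasure_pair_measure_alt[OF T] by (simp add: lborel_prod)
  also have "\<dots> = (\<integral>\<^sup>+y. emeasure lborel ((\<lambda>x. (x, y)) -` T) \<partial>lborel)"
    using lborel_pair.emeasure_pair_measure_alt2[OF T] by (simp add: lborel_prod)
  also have "\<dots> \<le> (\<integral>\<^sup>+y. emeasure lborel ((\<lambda>x. (x, y)) -` cball (0 :: real \<times> real) (D / 2)) \<partial>lborel)"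
  proof (intro nn_integral_mono)
    fix y :: real
    let ?Ty = "(\<lambda>x. (x, y)) -` T"
    \<comment> \<open>The numbers \<open>b - a'\<close> and \<open>b' - a\<close> have the same sum
      as the two slice extents, so one of them is at least \<open>2 * \<bar>y\<bar>\<close>. The
      points of \<open>S\<close> that realise it are at distance at most \<open>D\<close>.\<close>
    have key: "(x - x')\<^sup>2 + (2 * y)\<^sup>2 \<le> D\<^sup>2" if "x \<in> ?Ty" "x' \<in> ?Ty" for x x'
    proof -
      have x: "x \<in> X" "ennreal (2 * \<bar>y\<bar>) \<le> m x" and x': "x' \<in> X" "ennreal (2 * \<bar>y\<bar>) \<le> m x'"
        using that by (auto simp: T_def)
      obtain a b where ab: "(x, a) \<in> S" "(x, b) \<in> S" "m x \<le> ennreal (b - a)" "a \<le> b"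
        using slice_extent[OF x(1)] by auto
      obtain a' b' where ab': "(x', a') \<in> S" "(x', b') \<in> S" "m x' \<le> ennreal (b' - a')" "a' \<le> b'"
        using slice_extent[OF x'(1)] by auto
      have "2 * \<bar>y\<bar> \<le> b - a" "2 * \<bar>y\<bar> \<le> b' - a'"
        using order_trans[OF x(2) ab(3)] order_trans[OF x'(2) ab'(3)] ab(4) ab'(4)
        by (auto simp: ennreal_le_iff)
      then consider "2 * \<bar>y\<bar> \<le> b - a'" | "2 * \<bar>y\<bar> \<le> b' - a" by linarith
      then show ?thesis
      proof cases
        case 1
        then have "(2 * \<bar>y\<bar>)\<^sup>2 \<le> (b - a')\<^sup>2" by (intro power_mono) auto
        then show ?thesis using SD[OF ab(2) ab'(1)] by (simp add: power_mult_distrib)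
      next
        case 2
        then have "(2 * \<bar>y\<bar>)\<^sup>2 \<le> (a - b')\<^sup>2" by (subst power2_commute[of a]) (intro power_mono; simp)
        then show ?thesis using SD[OF ab(1) ab'(2)] by (simp add: power_mult_distrib)
      qed
    qed
    show "emeasure lborel ?Ty \<le> emeasure lborel ((\<lambda>x. (x, y)) -` cball (0 :: real \<times> real) (D / 2))"
    proof (cases "?Ty = {}")
      case False
      then obtain x0 where "x0 \<in> ?Ty" by auto
      then have y: "(2 * y)\<^sup>2 \<le> D\<^sup>2" using key[of x0 x0] by auto
      \<comment> \<open>The length, at height \<open>y\<close>, of the chord of the disc of diameter
        \<open>D\<close>.\<close>
      define r where "r = sqrt (D\<^sup>2 - (2 * y)\<^sup>2)"
      have r: "0 \<le> r" "r\<^sup>2 = D\<^sup>2 - (2 * y)\<^sup>2" using y by (auto simp: r_def)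
      have "\<bar>x - x'\<bar> \<le> r" if "x \<in> ?Ty" "x' \<in> ?Ty" for x x'
      proof -
        have "(x - x')\<^sup>2 \<le> r\<^sup>2" using key[OF that] r(2) by linarith
        then show ?thesis using r(1) abs_le_square_iff[of "x - x'" r] by simp
      qed
      then have "emeasure lborel ?Ty \<le> ennreal r"
        by (rule emeasure_lborel_real_le) (use r in auto)
      also have "ennreal r = emeasure lborel {- (r/2)..r/2}" using r by simp
      also have "{- (r/2)..r/2} = (\<lambda>x. (x, y)) -` cball (0 :: real \<times> real) (D / 2)"
      proof -
        have "x \<in> {- (r/2)..r/2} \<longleftrightarrow> (x, y) \<in> cball (0 :: real \<times> real) (D / 2)" for x
        proof -
          have "(x, y) \<in> cball (0 :: real \<times> real) (D / 2) \<longleftrightarrow> sqrt (x\<^sup>2 + y\<^sup>2) \<le> D / 2"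
            by (simp add: norm_Pair)
          also have "\<dots> \<longleftrightarrow> x\<^sup>2 + y\<^sup>2 \<le> (D / 2)\<^sup>2"
          proof -
            have "sqrt ((D / 2)\<^sup>2) = D / 2" using D by (subst real_sqrt_abs) simp
            then show ?thesis by (metis real_sqrt_le_iff)
          qed
          also have "\<dots> \<longleftrightarrow> x\<^sup>2 \<le> (r / 2)\<^sup>2"
            using r by (auto simp: power_divide power_mult_distrib field_simps)
          also have "\<dots> \<longleftrightarrow> \<bar>x\<bar> \<le> r / 2"
            using r by (simp add: abs_le_square_iff[symmetric])
          finally show ?thesis by (auto simp: abs_le_iff)
        qed
        then show ?thesis by auto
      qed
      finally show ?thesis .
    qed simp
  qed
  also have "\<dots> = emeasure lborel (cball (0 :: real \<times> real) (D / 2))"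
  proof -
    have "cball (0 :: real \<times> real) (D / 2) \<in> sets (lborel \<Otimes>\<^sub>M lborel)"
      by (metis lborel_prod sets_lborel closed_cball borel_closed)
    from lborel_pair.emeasure_pair_measure_alt2[OF this] show ?thesis by (simp add: lborel_prod)
  qed
  finally show ?thesis by (simp add: D_def)
qed

section \<open>Comparison of Hausdorff and Lebesgue measure\<close>

text \<open>Pre-measures use covers indexed by the naturals, while Vitali families are merely
  countable. \<open>None\<close> pads a finite family, and injectivity keeps sums free of
  repetitions.\<close>

lemma countable_enumeration:
  assumes "countable C"
  obtains c :: "nat \<Rightarrow> 'i option" where "\<And>i. i \<in> C \<Longrightarrow> \<exists>n. c n = Some i"
    "\<And>n i. c n = Some i \<Longrightarrow> i \<in> C" "\<And>m n i. c m = Some i \<Longrightarrow> c n = Some i \<Longrightarrow> m = n"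
proof
  let ?c = "\<lambda>n. if n \<in> to_nat_on C ` C then Some (inv_into C (to_nat_on C) n) else None"
  have inj: "inj_on (to_nat_on C) C" using assms by (rule inj_on_to_nat_on)
  show "\<exists>n. ?c n = Some i" if "i \<in> C" for i
    using that inj by (intro exI[of _ "to_nat_on C i"]) auto
  show "i \<in> C" if "?c n = Some i" for n i
    using that by (auto split: if_splits simp: inv_into_into)
  show "m = n" if "?c m = Some i" "?c n = Some i" for m n i
    using that by (auto split: if_splits simp: f_inv_into_f inj)
qed

lemma hausdorff_pre_Un_le:
  assumes "0 < \<delta>"
  shows "hausdorff_pre s \<delta> (A \<union> B) \<le> hausdorff_pre s \<delta> A + hausdorff_pre s \<delta> B"
proof -
  have "hausdorff_pre s \<delta> (\<Union>i. binaryset A B i) \<le> (\<Sum>i. hausdorff_pre s \<delta> (binaryset A B i))"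
    by (rule hausdorff_pre_countably_subadditive) fact
  then show ?thesis
    using assms by (simp add: UN_binaryset_eq suminf_binaryset_eq hausdorff_pre_empty)
qed

text \<open>By the normalisation of the weight, a ball weighs as much as its volume. Enlarging
  disjoint balls inside \<open>G\<close> by the factor \<open>k\<close> multiplies their total
  volume by \<open>k ^ DIM('a)\<close>.\<close>

lemma hausdorff_pre_enlarged_balls:
  fixes a :: "'i \<Rightarrow> 'a::euclidean_space"
  assumes C: "countable C"
    and dj: "pairwise (\<lambda>i j. disjnt (cball (a i) (r i)) (cball (a j) (r j))) C"
    and r: "\<And>i. i \<in> C \<Longrightarrow> 0 < r i \<and> 2 * (k * r i) \<le> \<delta> \<and> cball (a i) (r i) \<subseteq> G"
    and k: "0 < k" and \<delta>: "0 < \<delta>" and G: "G \<in> sets borel"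
  shows "hausdorff_pre DIM('a) \<delta> (\<Union>i\<in>C. cball (a i) (k * r i)) \<le> ennreal (k ^ DIM('a)) * emeasure lborel G"
proof -
  obtain c :: "nat \<Rightarrow> 'i option" where c: "\<And>i. i \<in> C \<Longrightarrow> \<exists>n. c n = Some i"
    "\<And>n i. c n = Some i \<Longrightarrow> i \<in> C" "\<And>m n i. c m = Some i \<Longrightarrow> c n = Some i \<Longrightarrow> m = n"
    by (rule countable_enumeration[OF C]) blast
  define U where "U n = (case c n of None \<Rightarrow> {} | Some i \<Rightarrow> cball (a i) (k * r i))" for n
  define V where "V n = (case c n of None \<Rightarrow> {} | Some i \<Rightarrow> cball (a i) (r i))" for n
  have "fine_cover \<delta> (\<Union>i\<in>C. cball (a i) (k * r i)) U"
    unfolding fine_cover_def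
  proof (intro conjI allI)
    show "(\<Union>i\<in>C. cball (a i) (k * r i)) \<subseteq> \<Union> (range U)"
    proof clarify
      fix x i assume "i \<in> C" "x \<in> cball (a i) (k * r i)"
      moreover obtain n where "c n = Some i" using c(1) \<open>i \<in> C\<close> by auto
      ultimately show "x \<in> \<Union> (range U)" by (auto simp: U_def intro!: exI[of _ n])
    qed
    fix j
    show "bounded (U j)" by (auto simp: U_def split: option.splits)
    show "diameter (U j) \<le> \<delta>"
    proof (cases "c j")
      case (Some i)
      then have "2 * (k * r i) \<le> \<delta>" "0 < k * r i" using r[OF c(2)[OF Some]] k by auto
      then show ?thesis by (simp add: U_def Some)
    qed (use \<delta> in \<open>simp add: U_def\<close>)
  qed
  then have "hausdorff_pre DIM('a) \<delta> (\<Union>i\<in>C. cball (a i) (k * r i)) \<le> (\<Sum>n. hausdorff_weight DIM('a) (U n))"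
    by (rule hausdorff_pre_le)
  also have "\<dots> = (\<Sum>n. ennreal (k ^ DIM('a)) * emeasure lborel (V n))"
  proof (intro suminf_cong)
    fix n
    show "hausdorff_weight DIM('a) (U n) = ennreal (k ^ DIM('a)) * emeasure lborel (V n)"
    proof (cases "c n")
      case None
      then show ?thesis by (simp add: U_def V_def)
    next
      case (Some i)
      then have ri: "0 < r i" using c(2) r by blast
      then have kri: "0 < k * r i" using k by simp
      let ?v = "unit_ball_vol (real DIM('a))"
      have "hausdorff_weight DIM('a) (U n) = ennreal (?v * (k * r i) ^ DIM('a))"
        using kri by (simp add: U_def Some hausdorff_weight_def)
      also have "\<dots> = ennreal (k ^ DIM('a) * (?v * r i ^ DIM('a)))"
        by (simp add: power_mult_distrib mult.left_commute)
      also have "\<dots> = ennreal (k ^ DIM('a)) * ennreal (?v * r i ^ DIM('a))"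
        using ri k by (intro ennreal_mult) auto
      also have "ennreal (?v * r i ^ DIM('a)) = emeasure lborel (V n)"
        using ri by (simp add: V_def Some emeasure_cball)
      finally show ?thesis .
    qed
  qed
  also have "\<dots> = ennreal (k ^ DIM('a)) * (\<Sum>n. emeasure lborel (V n))"
    by simp
  also have "(\<Sum>n. emeasure lborel (V n)) = emeasure lborel (\<Union>n. V n)"
  proof (rule suminf_emeasure)
    show "range V \<subseteq> sets lborel" by (auto simp: V_def split: option.splits)
    show "disjoint_family V"
      unfolding disjoint_family_on_def
    proof (intro ballI impI)
      fix m n :: nat assume "m \<noteq> n"
      show "V m \<inter> V n = {}"
      proof (cases "c m = None \<or> c n = None")
        case True then show ?thesis by (auto simp: V_def)
      next
        case False
        then obtain i j where ij: "c m = Some i" "c n = Some j" by auto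
        then have "i \<noteq> j" using c(3) \<open>m \<noteq> n\<close> by metis
        then have "disjnt (cball (a i) (r i)) (cball (a j) (r j))"
          using dj c(2) ij unfolding pairwise_def by blast
        then show ?thesis using ij by (simp add: V_def disjnt_def)
      qed
    qed
  qed
  also have "emeasure lborel (\<Union>n. V n) \<le> emeasure lborel G"
  proof (rule emeasure_mono)
    have "V n \<subseteq> G" for n
    proof (cases "c n")
      case (Some i)
      then show ?thesis using r[OF c(2)[OF Some]] by (simp add: V_def)
    qed (simp add: V_def)
    then show "(\<Union>n. V n) \<subseteq> G" by blast
  qed (use G in simp)
  finally show ?thesis by (simp add: mult_left_mono)
qed

text \<open>Inside an open superset of small measure, Vitali's lemma selects disjoint balls whose
  fivefold enlargements still cover the set.\<close>

lemma hausdorff_pre_negligible: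
  fixes N :: "'a::euclidean_space set"
  assumes N: "negligible N" and \<delta>: "0 < \<delta>"
  shows "hausdorff_pre DIM('a) \<delta> N = 0"
proof -
  have "hausdorff_pre DIM('a) \<delta> N \<le> 0 + ennreal e" if e: "0 < e" for e
  proof -
    have N': "N \<in> sets lebesgue" using N by (simp add: negligible_iff_null_sets null_setsD2)
    have e': "0 < e / 5 ^ DIM('a)" using e by simp
    obtain G where G: "open G" "N \<subseteq> G" "emeasure lebesgue (G - N) < ennreal (e / 5 ^ DIM('a))"
      by (rule sets_lebesgue_outer_open[OF N' e']) blast
    have "emeasure lebesgue G = emeasure lebesgue (G - N)"
      using N G(1) by (intro emeasure_Diff_null_set[symmetric]) (auto simp: negligible_iff_null_sets)
    then have Gm: "emeasure lborel G \<le> ennreal (e / 5 ^ DIM('a))"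
      using G(1,3) by (simp add: emeasure_completion[of G lborel])
    \<comment> \<open>The fivefold enlargement must have diameter at most \<delta>, hence the bound
      \<open>\<delta> / 10\<close> on the radius.\<close>
    have "\<exists>\<rho>. 0 < \<rho> \<and> \<rho> \<le> \<delta> / 10 \<and> cball x \<rho> \<subseteq> G" if x: "x \<in> N" for x
    proof -
      obtain \<rho> where "0 < \<rho>" "cball x \<rho> \<subseteq> G"
        using G(1) subsetD[OF G(2) x] unfolding open_contains_cball by blast
      moreover have "cball x (min \<rho> (\<delta> / 10)) \<subseteq> cball x \<rho>" by (rule subset_cball) simp
      ultimately show ?thesis using \<delta> by (intro exI[of _ "min \<rho> (\<delta> / 10)"] conjI) (simp, simp, blast)
    qed
    then obtain \<rho> where \<rho>: "\<And>x. x \<in> N \<Longrightarrow> 0 < \<rho> x \<and> \<rho> x \<le> \<delta> / 10 \<and> cball x (\<rho> x) \<subseteq> G"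
      by metis
    have \<rho>': "\<And>i. i \<in> N \<Longrightarrow> 0 < \<rho> i \<and> \<rho> i \<le> \<delta> / 10" using \<rho> by blast
    obtain C where C: "countable C" "C \<subseteq> N"
      "pairwise (\<lambda>i j. disjnt (cball i (\<rho> i)) (cball j (\<rho> j))) C"
      "\<And>i. i \<in> N \<Longrightarrow> \<exists>j. j \<in> C \<and> \<not> disjnt (cball i (\<rho> i)) (cball j (\<rho> j)) \<and> cball i (\<rho> i) \<subseteq> ball j (5 * \<rho> j)"
      by (rule Vitali_covering_lemma_cballs_balls[OF \<rho>', where a = "\<lambda>x. x"]) blast+
    have "N \<subseteq> (\<Union>i\<in>C. cball i (5 * \<rho> i))"
    proof
      fix x assume "x \<in> N"
      then obtain j where "j \<in> C" "cball x (\<rho> x) \<subseteq> ball j (5 * \<rho> j)" using C(4) by blast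
      moreover have "x \<in> cball x (\<rho> x)" using \<rho>[OF \<open>x \<in> N\<close>] by simp
      ultimately show "x \<in> (\<Union>i\<in>C. cball i (5 * \<rho> i))" using ball_subset_cball by fastforce
    qed
    then have "hausdorff_pre DIM('a) \<delta> N \<le> hausdorff_pre DIM('a) \<delta> (\<Union>i\<in>C. cball i (5 * \<rho> i))"
      by (rule hausdorff_pre_mono)
    also have "\<dots> \<le> ennreal (5 ^ DIM('a)) * emeasure lborel G"
    proof (rule hausdorff_pre_enlarged_balls[OF C(1,3)])
      fix i assume "i \<in> C"
      then have "0 < \<rho> i \<and> \<rho> i \<le> \<delta> / 10 \<and> cball i (\<rho> i) \<subseteq> G" using C(2) \<rho> by blast
      then show "0 < \<rho> i \<and> 2 * (5 * \<rho> i) \<le> \<delta> \<and> cball i (\<rho> i) \<subseteq> G" by auto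
    qed (use \<delta> G(1) in auto)
    also have "\<dots> \<le> ennreal (5 ^ DIM('a)) * ennreal (e / 5 ^ DIM('a))"
      using Gm by (rule mult_left_mono) simp
    also have "\<dots> = ennreal e" using e by (simp add: ennreal_mult[symmetric])
    finally show ?thesis by simp
  qed
  then have "hausdorff_pre DIM('a) \<delta> N \<le> 0" by (rule ennreal_le_epsilon) blast
  then show ?thesis by simp
qed

text \<open>From above: disjoint small balls inside a slightly larger open set cover all of
  \<open>A\<close> but a negligible part. From below: by the isodiametric inequality no covering set
  has more volume than weight. That inequality is a hypothesis so that the line and the plane are
  treated together.\<close>

lemma hausdorff_outer_eq_lborel:
  fixes A :: "'a::euclidean_space set"
  assumes isodiametric: "\<And>S::'a set. compact S \<Longrightarrow> S \<noteq> {} \<Longrightarrow>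
      emeasure lborel S \<le> emeasure lborel (cball (0::'a) (diameter S / 2))"
    and A: "A \<in> sets borel"
  shows "hausdorff_outer DIM('a) A = emeasure lborel A"
proof (rule antisym)
  show "hausdorff_outer DIM('a) A \<le> emeasure lborel A"
  proof (rule hausdorff_outer_leI, rule ennreal_le_epsilon)
    fix \<delta> e :: real assume \<delta>: "0 < \<delta>" and e: "0 < e"
    obtain G where G: "open G" "A \<subseteq> G" "emeasure lborel (G - A) \<le> ennreal e"
      using outer_regular_lborel_le[OF A e] by metis
    have "emeasure lborel G = emeasure lborel A + emeasure lborel (G - A)"
      using G A by (subst plus_emeasure) (auto intro: arg_cong[of _ _ "emeasure lborel"])
    then have Gm: "emeasure lborel G \<le> emeasure lborel A + ennreal e"
      using G(3) by (simp add: add_left_mono)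
    define K where "K = {(x, r). 0 < r \<and> 2 * r \<le> \<delta> \<and> cball x r \<subseteq> G}"
    obtain C where C: "countable C" "C \<subseteq> K"
      "pairwise (\<lambda>i j. disjnt (cball (fst i) (snd i)) (cball (fst j) (snd j))) C"
      "negligible (A - (\<Union>i\<in>C. cball (fst i) (snd i)))"
    proof (rule Vitali_covering_theorem_cballs[of K snd A fst])
      fix x d assume x: "x \<in> A" and d: "(0::real) < d"
      obtain \<rho> where \<rho>: "0 < \<rho>" "cball x \<rho> \<subseteq> G"
        using G(1) subsetD[OF G(2) x] unfolding open_contains_cball by blast
      define \<rho>' where "\<rho>' = min \<rho> (min (\<delta> / 2) (d / 2))"
      have \<rho>': "0 < \<rho>'" "2 * \<rho>' \<le> \<delta>" "\<rho>' < d" "\<rho>' \<le> \<rho>"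
        using \<rho>(1) \<delta> d by (auto simp: \<rho>'_def)
      have "cball x \<rho>' \<subseteq> G" using subset_cball[OF \<rho>'(4)] \<rho>(2) by blast
      then show "\<exists>i. i \<in> K \<and> x \<in> cball (fst i) (snd i) \<and> snd i < d"
        using \<rho>' by (intro exI[of _ "(x, \<rho>')"]) (simp add: K_def)
    next
      fix i assume "i \<in> K" then show "0 < snd i" by (auto simp: K_def)
    next
      fix C' assume "countable C'" "C' \<subseteq> K" "pairwise (\<lambda>i j. disjnt (cball (fst i) (snd i)) (cball (fst j) (snd j))) C'"
        "negligible (A - (\<Union>i\<in>C'. cball (fst i) (snd i)))"
      then show thesis by (rule that)
    qed
    let ?B = "\<Union>i\<in>C. cball (fst i) (snd i)"
    have "hausdorff_pre DIM('a) \<delta> A \<le> hausdorff_pre DIM('a) \<delta> (?B \<union> (A - ?B))"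
      by (rule hausdorff_pre_mono) auto
    also have "\<dots> \<le> hausdorff_pre DIM('a) \<delta> ?B + hausdorff_pre DIM('a) \<delta> (A - ?B)"
      using \<delta> by (rule hausdorff_pre_Un_le)
    also have "hausdorff_pre DIM('a) \<delta> (A - ?B) = 0"
      using C(4) \<delta> by (rule hausdorff_pre_negligible)
    also have "hausdorff_pre DIM('a) \<delta> ?B \<le> emeasure lborel G"
    proof -
      have "0 < snd i \<and> 2 * (1 * snd i) \<le> \<delta> \<and> cball (fst i) (snd i) \<subseteq> G" if "i \<in> C" for i
        using subsetD[OF C(2) that] by (auto simp: K_def)
      then show ?thesis
        using hausdorff_pre_enlarged_balls[OF C(1,3), of 1 \<delta> G] \<delta> G(1) by simp
    qed
    finally show "hausdorff_pre DIM('a) \<delta> A \<le> emeasure lborel A + ennreal e"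
      using Gm by simp
  qed
  \<comment> \<open>The fineness 1 is an arbitrary choice: the isodiametric inequality holds for
    covering sets of every diameter.\<close>
  have "emeasure lborel A \<le> hausdorff_pre DIM('a) 1 A"
  proof (rule hausdorff_pre_geI)
    fix U assume U: "fine_cover 1 A U"
    have "emeasure lborel A \<le> emeasure lborel (\<Union>j. closure (U j))"
      using U A closure_subset by (intro emeasure_mono) (auto simp: fine_cover_def, blast)
    also have "\<dots> \<le> (\<Sum>j. emeasure lborel (closure (U j)))"
      by (intro emeasure_subadditive_countably) auto
    also have "\<dots> \<le> (\<Sum>j. hausdorff_weight DIM('a) (U j))"
    proof (intro suminf_le)
      fix j
      have b: "bounded (U j)" using U by (auto simp: fine_cover_def)
      show "emeasure lborel (closure (U j)) \<le> hausdorff_weight DIM('a) (U j)"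
      proof (cases "U j = {}")
        case False
        have "emeasure lborel (closure (U j)) \<le> emeasure lborel (cball (0::'a) (diameter (closure (U j)) / 2))"
          using b False by (intro isodiametric) auto
        then show ?thesis
          using False b diameter_ge_0[OF b] by (simp add: diameter_closure emeasure_cball hausdorff_weight_def)
      qed simp
    qed auto
    finally show "emeasure lborel A \<le> (\<Sum>j. hausdorff_weight DIM('a) (U j))" .
  qed
  also have "\<dots> \<le> hausdorff_outer DIM('a) A" by (rule hausdorff_pre_le_outer) simp
  finally show "emeasure lborel A \<le> hausdorff_outer DIM('a) A" .
qed

text \<open>An isometric chart \<open>'a\<close> of the hyperplane; together with the normal coordinate it is an isometry
  of \<open>'a \<times> real\<close> onto the whole space.\<close>

lemma surface_measure_hyperplane_chart:
  fixes A :: "(real^'n::finite) set" and \<nu> :: "real^'n"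
  assumes isodiametric: "\<And>S::'a::euclidean_space set. compact S \<Longrightarrow> S \<noteq> {} \<Longrightarrow>
      emeasure lborel S \<le> emeasure lborel (cball (0::'a) (diameter S / 2))"
    and dim: "CARD('n) = DIM('a) + 1"
    and \<nu>: "norm \<nu> = 1" and A: "A \<in> sets borel" "A \<subseteq> {x. \<nu> \<bullet> x = c}"
  shows "emeasure surface_measure A = emeasure lborel {x. 0 \<le> \<nu> \<bullet> x - c \<and> \<nu> \<bullet> x - c \<le> 1 \<and> x - (\<nu> \<bullet> x - c) *\<^sub>R \<nu> \<in> A}"
    and "bounded A \<Longrightarrow> A \<noteq> {} \<Longrightarrow> emeasure surface_measure A \<le> ennreal (unit_ball_vol (CARD('n) - 1) * (diameter A / 2) ^ (CARD('n) - 1))"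
proof -
  have nz: "\<nu> \<noteq> 0" using \<nu> by auto
  have nn: "\<nu> \<bullet> \<nu> = 1" using \<nu> by (simp add: dot_square_norm)
  have dimS: "dim (UNIV :: 'a set) = dim {x. \<nu> \<bullet> x = 0}"
    using dim_hyperplane[OF nz] dim by simp
  obtain f :: "'a \<Rightarrow> real^'n" where f: "linear f" "range f = {x. \<nu> \<bullet> x = 0}" "\<And>x. norm (f x) = norm x"
    using isometries_subspaces[OF subspace_UNIV subspace_hyperplane[of \<nu>] dimS] by (metis UNIV_I)
  interpret f: linear f by fact
  have fperp: "\<nu> \<bullet> f y = 0" for y using f(2) by auto
  define \<psi> where "\<psi> y = f y + c *\<^sub>R \<nu>" for y
  define B where "B = \<psi> -` A"
  have iso: "dist (\<psi> x) (\<psi> y) = dist x y" for x y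
    by (simp add: \<psi>_def dist_norm f.diff[symmetric] f(3))
  have [measurable]: "f \<in> borel_measurable borel"
    using f(1) by (simp add: borel_measurable_continuous_onI linear_continuous_on linear_linear)
  have B: "B \<in> sets borel"
    using A(1) measurable_sets_borel[of \<psi> borel A] unfolding B_def \<psi>_def by measurable
  have AB: "A = \<psi> ` B"
  proof
    show "A \<subseteq> \<psi> ` B"
    proof
      fix x assume x: "x \<in> A"
      then have "\<nu> \<bullet> (x - c *\<^sub>R \<nu>) = 0" using A(2) nn by (auto simp: inner_diff_right)
      then obtain y where "x - c *\<^sub>R \<nu> = f y" using f(2) by auto
      then have "\<psi> y = x" by (simp add: \<psi>_def algebra_simps)
      then show "x \<in> \<psi> ` B" using x by (auto simp: B_def)
    qed
  qed (auto simp: B_def)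
  have card: "CARD('n) - 1 = DIM('a)" using dim by simp
  have "emeasure surface_measure A = hausdorff_outer DIM('a) A"
    unfolding surface_measure_def card using A(1) by (rule emeasure_hausdorff_measure)
  also have "\<dots> = emeasure lborel B"
    unfolding AB using hausdorff_outer_isometry[OF iso] hausdorff_outer_eq_lborel[OF isodiametric B] by simp
  finally have AB': "emeasure surface_measure A = emeasure lborel B" .
  define \<Phi> where "\<Phi> p = f (fst p) + snd p *\<^sub>R \<nu>" for p
  have lin: "linear \<Phi>"
    unfolding \<Phi>_def by (intro linearI) (auto simp: f.add f.scale algebra_simps)
  have \<Phi>norm: "norm (\<Phi> p) = norm p" for p
  proof -
    have "(norm (\<Phi> p))\<^sup>2 = (norm (f (fst p)))\<^sup>2 + (snd p)\<^sup>2"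
      unfolding \<Phi>_def power2_norm_eq_inner by (simp add: inner_simps fperp inner_commute[of "f _" \<nu>] nn power2_eq_square)
    also have "\<dots> = (norm p)\<^sup>2" by (simp add: f(3) norm_prod_def)
    finally show ?thesis by (simp add: power2_eq_iff_nonneg)
  qed
  have \<Phi>surj: "surj \<Phi>"
  proof -
    have "\<exists>p. x = \<Phi> p" for x
    proof -
    have "\<nu> \<bullet> (x - (\<nu> \<bullet> x) *\<^sub>R \<nu>) = 0" using nn by (simp add: inner_diff_right)
    then obtain y where "x - (\<nu> \<bullet> x) *\<^sub>R \<nu> = f y" using f(2) by auto
    then have "\<Phi> (y, \<nu> \<bullet> x) = x" by (simp add: \<Phi>_def algebra_simps)
    then show ?thesis by metis
    qed
    then show ?thesis unfolding surj_def by blast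
  qed
  have distr: "distr lborel borel \<Phi> = lborel"
    using lin \<Phi>norm \<Phi>surj by (rule lborel_distr_isometry) (use dim in simp)
  let ?Z = "{x. 0 \<le> \<nu> \<bullet> x - c \<and> \<nu> \<bullet> x - c \<le> 1 \<and> x - (\<nu> \<bullet> x - c) *\<^sub>R \<nu> \<in> A}"
  have Z: "?Z \<in> sets borel"
    using A(1) by measurable
  have "emeasure lborel ?Z = emeasure (distr lborel borel \<Phi>) ?Z" by (simp add: distr)
  also have "\<dots> = emeasure lborel (\<Phi> -` ?Z)"
    using Z lin by (subst emeasure_distr) (auto simp: borel_measurable_continuous_onI linear_continuous_on linear_linear)
  also have "\<Phi> -` ?Z = B \<times> {c..c+1}"
    by (auto simp: \<Phi>_def B_def \<psi>_def inner_simps fperp nn algebra_simps)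
  also have "emeasure lborel (B \<times> {c..c+1}) = emeasure lborel B"
    using B lborel.emeasure_pair_measure_Times[of B lborel "{c..c+1}"] by (simp add: lborel_prod)
  finally show "emeasure surface_measure A = emeasure lborel ?Z" using AB' by simp
  \<comment> \<open>The isodiametric inequality, applied in the chart, bounds an area by a power of
    the diameter; face sizes are compared with element diameters in this way.\<close>
  assume bA: "bounded A" "A \<noteq> {}"
  have bB: "bounded B" "diameter B = diameter A"
    using hausdorff_weight_isometry(2,3)[of B \<psi>] iso bA AB by auto
  have "emeasure lborel B \<le> emeasure lborel (closure B)"
    using closure_subset by (intro emeasure_mono) auto
  also have "\<dots> \<le> emeasure lborel (cball (0::'a) (diameter (closure B) / 2))"
    using bB bA AB by (intro isodiametric) auto
  also have "\<dots> = ennreal (unit_ball_vol (CARD('n) - 1) * (diameter A / 2) ^ (CARD('n) - 1))"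
    unfolding card using bB diameter_ge_0[OF bB(1)] by (simp add: emeasure_cball diameter_closure)
  finally show "emeasure surface_measure A \<le> ennreal (unit_ball_vol (CARD('n) - 1) * (diameter A / 2) ^ (CARD('n) - 1))"
    by (simp add: AB')
qed

text \<open>The chart is the line for \<open>d = 2\<close> and \<open>real \<times> real\<close> for
  \<open>d = 3\<close>. Thickening \<open>A\<close> by unit length along the normal makes every
  surface integral a Lebesgue integral over the whole space.\<close>

lemma surface_measure_hyperplane:
  fixes A :: "(real^'n::finite) set" and \<nu> :: "real^'n"
  assumes "CARD('n) \<in> {2, 3}"
    and "norm \<nu> = 1" "A \<in> sets borel" "A \<subseteq> {x. \<nu> \<bullet> x = c}"
  shows "emeasure surface_measure A = emeasure lborel {x. 0 \<le> \<nu> \<bullet> x - c \<and> \<nu> \<bullet> x - c \<le> 1 \<and> x - (\<nu> \<bullet> x - c) *\<^sub>R \<nu> \<in> A}" (is ?eq)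
    and "bounded A \<Longrightarrow> A \<noteq> {} \<Longrightarrow> emeasure surface_measure A \<le> ennreal (unit_ball_vol (CARD('n) - 1) * (diameter A / 2) ^ (CARD('n) - 1))" (is "PROP ?le")
proof -
  have iso1: "emeasure lborel S \<le> emeasure lborel (cball (0::real) (diameter S / 2))"
    if S: "compact S" "S \<noteq> {}" for S :: "real set"
  proof -
    have "emeasure lborel S \<le> ennreal (diameter S)"
      using diameter_bounded_bound[OF compact_imp_bounded[OF S(1)]] diameter_ge_0[OF compact_imp_bounded[OF S(1)]]
      by (intro emeasure_lborel_real_le) (auto simp: dist_real_def)
    then show ?thesis
      using diameter_ge_0[OF compact_imp_bounded[OF S(1)]] by (simp add: cball_eq_atLeastAtMost)
  qed
  have "?eq \<and> (bounded A \<longrightarrow> A \<noteq> {} \<longrightarrow> emeasure surface_measure A \<le> ennreal (unit_ball_vol (CARD('n) - 1) * (diameter A / 2) ^ (CARD('n) - 1)))"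
  proof (cases "CARD('n) = 2")
    case True
    then have "CARD('n) = DIM(real) + 1" by simp
    from surface_measure_hyperplane_chart[OF iso1 this assms(2-4)] show ?thesis by blast
  next
    case False
    then have "CARD('n) = DIM(real \<times> real) + 1" using assms(1) by simp
    from surface_measure_hyperplane_chart[OF isodiametric_plane this assms(2-4)] show ?thesis by blast
  qed
  then show ?eq "PROP ?le" by blast+
qed

section \<open>Integration along fibres\<close>

abbreviation "slab \<equiv> indicator {0..1::real}"

text \<open>A class of integrands that are integrable without further checks and that survives the
  oblique projections used below.\<close>

definition bounded_support :: "('a::euclidean_space \<Rightarrow> real) \<Rightarrow> bool" where
  "bounded_support f \<longleftrightarrow> f \<in> borel_measurable borel \<and> bounded (range f) \<and> bounded {x. f x \<noteq> 0}"

lemma bounded_supportI: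
  assumes "f \<in> borel_measurable borel" "bounded S" "\<And>x. x \<notin> S \<Longrightarrow> f x = 0" "\<And>x. x \<in> S \<Longrightarrow> \<bar>f x\<bar> \<le> M"
  shows "bounded_support f"
proof -
  have "bounded (range f)"
    unfolding bounded_real
  proof (intro exI ballI)
    fix y assume "y \<in> range f"
    then obtain x where "y = f x" by auto
    then show "\<bar>y\<bar> \<le> \<bar>M\<bar>" using assms(3)[of x] assms(4)[of x] by (cases "x \<in> S") auto
  qed
  moreover have "bounded {x. f x \<noteq> 0}"
    using assms(2) by (rule bounded_subset) (use assms(3) in blast)
  ultimately show ?thesis using assms(1) by (simp add: bounded_support_def)
qed

lemma bounded_support_measurable: "bounded_support f \<Longrightarrow> f \<in> borel_measurable borel"
  by (simp add: bounded_support_def)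

lemma bounded_support_integrable:
  assumes "bounded_support f" shows "integrable lborel f"
proof -
  obtain R where R: "\<And>x. f x \<noteq> 0 \<Longrightarrow> norm x \<le> R"
    using assms by (auto simp: bounded_support_def bounded_iff)
  obtain M where M: "\<And>x. \<bar>f x\<bar> \<le> M"
    using assms by (auto simp: bounded_support_def bounded_real)
  have "emeasure lborel (cball 0 R :: 'a set) < \<infinity>"
    by (intro emeasure_bounded_finite) auto
  then have "integrable lborel (\<lambda>x. indicator (cball 0 R :: 'a set) x *\<^sub>R M)"
    by (intro integrable_real_indicator integrable_scaleR_left) auto
  then show ?thesis
  proof (rule Bochner_Integration.integrable_bound)
    show "f \<in> borel_measurable lborel" using assms by (simp add: bounded_support_def)
    show "AE x in lborel. norm (f x) \<le> norm (indicator (cball 0 R) x *\<^sub>R M)"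
    proof (intro AE_I2)
      fix x
      show "norm (f x) \<le> norm (indicator (cball 0 R) x *\<^sub>R M)"
        using R[of x] M[of x] by (cases "f x = 0") (auto simp: indicator_def)
    qed
  qed
qed

lemma nn_integral_translate:
  fixes f :: "'a::euclidean_space \<Rightarrow> ennreal"
  assumes "f \<in> borel_measurable borel"
  shows "(\<integral>\<^sup>+x. f (x + a) \<partial>lborel) = (\<integral>\<^sup>+x. f x \<partial>lborel)"
  using assms by (subst (2) lborel_affine[of 1 a]) (simp_all add: density_1 nn_integral_distr add.commute)

lemma lborel_integral_translate:
  fixes f :: "'a::euclidean_space \<Rightarrow> real"
  assumes "f \<in> borel_measurable borel"
  shows "(\<integral>x. f (x + a) \<partial>lborel) = (\<integral>x. f x \<partial>lborel)"
  using assms by (subst (2) lborel_affine[of 1 a]) (simp_all add: density_1 integral_distr add.commute)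

text \<open>Integration along the lines in direction \<open>u\<close>; the lines are parametrised by the slab
  \<open>0 \<le> m \<bullet> x \<le> 1\<close>, which meets every line in a segment of unit parameter length.\<close>

lemma nn_integral_fibre:
  fixes f :: "'a::euclidean_space \<Rightarrow> ennreal"
  assumes [measurable]: "f \<in> borel_measurable borel" and mu: "m \<bullet> u = 1"
  shows "(\<integral>\<^sup>+x. slab (m \<bullet> x) * (\<integral>\<^sup>+t. f (x + t *\<^sub>R u) \<partial>lborel) \<partial>lborel) = (\<integral>\<^sup>+x. f x \<partial>lborel)"
proof -
  have "(\<integral>\<^sup>+x. slab (m \<bullet> x) * (\<integral>\<^sup>+t. f (x + t *\<^sub>R u) \<partial>lborel) \<partial>lborel)
      = (\<integral>\<^sup>+x. \<integral>\<^sup>+t. slab (m \<bullet> x) * f (x + t *\<^sub>R u) \<partial>lborel \<partial>lborel)"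
    by (intro nn_integral_cong nn_integral_cmult[symmetric]) measurable
  also have "\<dots> = (\<integral>\<^sup>+t. \<integral>\<^sup>+x. slab (m \<bullet> x) * f (x + t *\<^sub>R u) \<partial>lborel \<partial>lborel)"
    by (rule lborel_pair.Fubini'[symmetric]) measurable
  also have "\<dots> = (\<integral>\<^sup>+t. \<integral>\<^sup>+x. slab (m \<bullet> x - t) * f x \<partial>lborel \<partial>lborel)"
  proof (rule nn_integral_cong)
    fix t :: real
    show "(\<integral>\<^sup>+x. slab (m \<bullet> x) * f (x + t *\<^sub>R u) \<partial>lborel) = (\<integral>\<^sup>+x. slab (m \<bullet> x - t) * f x \<partial>lborel)"
      by (subst (2) nn_integral_translate[symmetric, of _ "t *\<^sub>R u"]) (simp_all add: inner_add_right mu)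
  qed
  also have "\<dots> = (\<integral>\<^sup>+x. \<integral>\<^sup>+t. slab (m \<bullet> x - t) * f x \<partial>lborel \<partial>lborel)"
    by (rule lborel_pair.Fubini') measurable
  also have "\<dots> = (\<integral>\<^sup>+x. f x \<partial>lborel)"
  proof (rule nn_integral_cong)
    fix x :: 'a
    have "(\<integral>\<^sup>+t. slab (m \<bullet> x - t) * f x \<partial>lborel) = (\<integral>\<^sup>+t. indicator {m \<bullet> x - 1..m \<bullet> x} t * f x \<partial>lborel)"
      by (intro nn_integral_cong) (auto simp: indicator_def)
    also have "\<dots> = f x"
      by (subst nn_integral_multc) auto
    finally show "(\<integral>\<^sup>+t. slab (m \<bullet> x - t) * f x \<partial>lborel) = f x" .
  qed
  finally show ?thesis .
qed

lemma integral_fibre: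
  fixes f :: "'a::euclidean_space \<Rightarrow> real"
  assumes f: "integrable lborel f" and mu: "m \<bullet> u = 1"
  shows "(\<integral>x. slab (m \<bullet> x) * (\<integral>t. f (x + t *\<^sub>R u) \<partial>lborel) \<partial>lborel) = (\<integral>x. f x \<partial>lborel)"
    and "integrable lborel (\<lambda>x. slab (m \<bullet> x) * (\<integral>t. f (x + t *\<^sub>R u) \<partial>lborel))"
proof -
  have [measurable]: "f \<in> borel_measurable borel"
    using borel_measurable_integrable[OF f] by simp
  \<comment> \<open>Substituting \<open>x - t *\<^sub>R u\<close> for \<open>x\<close> turns
    \<open>F\<close> into \<open>G\<close>. Both must be integrable on the product, since the order
    of integration is exchanged once before and once after the substitution.\<close>
  define F where "F x t = slab (m \<bullet> x) * f (x + t *\<^sub>R u)" for x and t :: real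
  define G where "G x t = slab (m \<bullet> x - t) * f x" for x and t :: real
  have Fm [measurable]: "case_prod F \<in> borel_measurable (lborel \<Otimes>\<^sub>M lborel)"
    unfolding F_def by measurable
  have Gm [measurable]: "case_prod G \<in> borel_measurable (lborel \<Otimes>\<^sub>M lborel)"
    unfolding G_def by measurable
  have nF: "(\<integral>\<^sup>+x. \<integral>\<^sup>+t. ennreal (norm (F x t)) \<partial>lborel \<partial>lborel) = (\<integral>\<^sup>+x. ennreal (norm (f x)) \<partial>lborel)"
  proof -
    have "(\<integral>\<^sup>+x. \<integral>\<^sup>+t. ennreal (norm (F x t)) \<partial>lborel \<partial>lborel)
        = (\<integral>\<^sup>+x. slab (m \<bullet> x) * (\<integral>\<^sup>+t. ennreal (norm (f (x + t *\<^sub>R u))) \<partial>lborel) \<partial>lborel)"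
      by (intro nn_integral_cong, subst nn_integral_cmult[symmetric])
         (auto simp: F_def abs_mult indicator_def intro!: nn_integral_cong)
    also have "\<dots> = (\<integral>\<^sup>+x. ennreal (norm (f x)) \<partial>lborel)"
      by (rule nn_integral_fibre[OF _ mu]) measurable
    finally show ?thesis .
  qed
  have Fint: "integrable (lborel \<Otimes>\<^sub>M lborel) (case_prod F)"
  proof (rule integrableI_bounded)
    have "(\<integral>\<^sup>+p. ennreal (norm (case_prod F p)) \<partial>(lborel \<Otimes>\<^sub>M lborel))
        = (\<integral>\<^sup>+x. \<integral>\<^sup>+t. ennreal (norm (F x t)) \<partial>lborel \<partial>lborel)"
      by (subst lborel.nn_integral_fst[symmetric]) auto
    then show "(\<integral>\<^sup>+p. ennreal (norm (case_prod F p)) \<partial>(lborel \<Otimes>\<^sub>M lborel)) < \<infinity>"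
      using f nF by (simp add: integrable_iff_bounded)
  qed measurable
  have Gint: "integrable (lborel \<Otimes>\<^sub>M lborel) (case_prod G)"
  proof (rule integrableI_bounded)
    have "(\<integral>\<^sup>+p. ennreal (norm (case_prod G p)) \<partial>(lborel \<Otimes>\<^sub>M lborel))
        = (\<integral>\<^sup>+x. \<integral>\<^sup>+t. ennreal (norm (G x t)) \<partial>lborel \<partial>lborel)"
      by (subst lborel.nn_integral_fst[symmetric]) auto
    also have "\<dots> = (\<integral>\<^sup>+x. ennreal (norm (f x)) \<partial>lborel)"
    proof (rule nn_integral_cong)
      fix x :: 'a
      have "(\<integral>\<^sup>+t. ennreal (norm (G x t)) \<partial>lborel) = (\<integral>\<^sup>+t. indicator {m \<bullet> x - 1..m \<bullet> x} t * ennreal (norm (f x)) \<partial>lborel)"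
        by (intro nn_integral_cong) (auto simp: indicator_def G_def)
      also have "\<dots> = ennreal (norm (f x))"
        by (subst nn_integral_multc) auto
      finally show "(\<integral>\<^sup>+t. ennreal (norm (G x t)) \<partial>lborel) = ennreal (norm (f x))" .
    qed
    finally show "(\<integral>\<^sup>+p. ennreal (norm (case_prod G p)) \<partial>(lborel \<Otimes>\<^sub>M lborel)) < \<infinity>"
      using f by (simp add: integrable_iff_bounded)
  qed measurable
  have "(\<integral>x. slab (m \<bullet> x) * (\<integral>t. f (x + t *\<^sub>R u) \<partial>lborel) \<partial>lborel) = (\<integral>x. \<integral>t. F x t \<partial>lborel \<partial>lborel)"
    by (simp add: F_def)
  also have "\<dots> = (\<integral>t. \<integral>x. F x t \<partial>lborel \<partial>lborel)"
    by (rule lborel_pair.Fubini_integral[OF Fint, symmetric])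
  also have "\<dots> = (\<integral>t. \<integral>x. G x t \<partial>lborel \<partial>lborel)"
  proof (rule Bochner_Integration.integral_cong[OF refl])
    fix t :: real
    show "(\<integral>x. F x t \<partial>lborel) = (\<integral>x. G x t \<partial>lborel)"
      unfolding F_def G_def
      by (subst (2) lborel_integral_translate[symmetric, of _ "t *\<^sub>R u"]) (simp_all add: inner_add_right mu)
  qed
  also have "\<dots> = (\<integral>x. \<integral>t. G x t \<partial>lborel \<partial>lborel)"
    by (rule lborel_pair.Fubini_integral[OF Gint])
  also have "\<dots> = (\<integral>x. f x \<partial>lborel)"
  proof (rule Bochner_Integration.integral_cong[OF refl])
    fix x :: 'a
    have "(\<integral>t. G x t \<partial>lborel) = (\<integral>t. indicator {m \<bullet> x - 1..m \<bullet> x} t * f x \<partial>lborel)"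
      by (intro Bochner_Integration.integral_cong) (auto simp: indicator_def G_def)
    also have "\<dots> = f x" by simp
    finally show "(\<integral>t. G x t \<partial>lborel) = f x" .
  qed
  finally show "(\<integral>x. slab (m \<bullet> x) * (\<integral>t. f (x + t *\<^sub>R u) \<partial>lborel) \<partial>lborel) = (\<integral>x. f x \<partial>lborel)" .
  have "integrable lborel (\<lambda>x. \<integral>t. F x t \<partial>lborel)"
    using lborel_pair.integrable_fst[OF Fint] by simp
  then show "integrable lborel (\<lambda>x. slab (m \<bullet> x) * (\<integral>t. f (x + t *\<^sub>R u) \<partial>lborel))"
    by (simp add: F_def)
qed

section \<open>Shears and changes of cross-section\<close>

text \<open>Along each line in direction \<open>w\<close> the value \<open>m \<bullet> x\<close> is
  constant, so the shear acts there as a translation; integration along these lines reduces the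
  claim to translation invariance.\<close>

lemma lborel_distr_shear:
  fixes m w :: "'a::euclidean_space"
  assumes "m \<bullet> w = 0"
  shows "distr lborel borel (\<lambda>x. x + (m \<bullet> x + c) *\<^sub>R w) = lborel"
proof (cases "w = 0")
  case True
  then show ?thesis by (simp add: distr_id2)
next
  case False
  show ?thesis
  proof (rule measure_eqI)
    fix A :: "'a set" assume "A \<in> sets (distr lborel borel (\<lambda>x. x + (m \<bullet> x + c) *\<^sub>R w))"
    then have A [measurable]: "A \<in> sets borel" by simp
    define k where "k = (1 / (w \<bullet> w)) *\<^sub>R w"
    have k: "k \<bullet> w = 1" using False by (simp add: k_def)
    have "emeasure (distr lborel borel (\<lambda>x. x + (m \<bullet> x + c) *\<^sub>R w)) A = (\<integral>\<^sup>+x. indicator A x \<partial>distr lborel borel (\<lambda>x. x + (m \<bullet> x + c) *\<^sub>R w))"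
      by simp
    also have "\<dots> = (\<integral>\<^sup>+x. indicator A (x + (m \<bullet> x + c) *\<^sub>R w) \<partial>lborel)"
      by (rule nn_integral_distr) auto
    also have "\<dots> = (\<integral>\<^sup>+x. slab (k \<bullet> x) * (\<integral>\<^sup>+t. indicator A (x + t *\<^sub>R w + (m \<bullet> (x + t *\<^sub>R w) + c) *\<^sub>R w) \<partial>lborel) \<partial>lborel)"
      by (rule nn_integral_fibre[OF _ k, symmetric]) measurable
    also have "\<dots> = (\<integral>\<^sup>+x. slab (k \<bullet> x) * (\<integral>\<^sup>+t. indicator A (x + t *\<^sub>R w) \<partial>lborel) \<partial>lborel)"
    proof (rule nn_integral_cong)
      fix x
      have "(\<integral>\<^sup>+t. indicator A (x + t *\<^sub>R w + (m \<bullet> (x + t *\<^sub>R w) + c) *\<^sub>R w) \<partial>lborel)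
          = (\<integral>\<^sup>+t. indicator A (x + (t + (m \<bullet> x + c)) *\<^sub>R w) \<partial>lborel)"
        by (simp add: inner_add_right assms algebra_simps)
      also have "\<dots> = (\<integral>\<^sup>+t. indicator A (x + t *\<^sub>R w) \<partial>lborel)"
        by (rule nn_integral_translate[where f="\<lambda>t. indicator A (x + t *\<^sub>R w)"]) measurable
      finally show "slab (k \<bullet> x) * (\<integral>\<^sup>+t. indicator A (x + t *\<^sub>R w + (m \<bullet> (x + t *\<^sub>R w) + c) *\<^sub>R w) \<partial>lborel)
          = slab (k \<bullet> x) * (\<integral>\<^sup>+t. indicator A (x + t *\<^sub>R w) \<partial>lborel)" by simp
    qed
    also have "\<dots> = (\<integral>\<^sup>+x. indicator A x \<partial>lborel)"
      by (rule nn_integral_fibre[OF _ k]) measurable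
    finally show "emeasure (distr lborel borel (\<lambda>x. x + (m \<bullet> x + c) *\<^sub>R w)) A = emeasure lborel A" by simp
  qed simp
qed

lemma lborel_integral_shear:
  fixes f :: "'a::euclidean_space \<Rightarrow> real"
  assumes "m \<bullet> w = 0" and [measurable]: "f \<in> borel_measurable borel"
  shows "(\<integral>x. f (x + (m \<bullet> x + c) *\<^sub>R w) \<partial>lborel) = (\<integral>x. f x \<partial>lborel)"
    and "integrable lborel (\<lambda>x. f (x + (m \<bullet> x + c) *\<^sub>R w)) \<longleftrightarrow> integrable lborel f"
  by (subst (2) lborel_distr_shear[OF assms(1), of c, symmetric], subst integral_distr; measurable)
     (subst (2) lborel_distr_shear[OF assms(1), of c, symmetric], subst integrable_distr_eq; measurable)


lemma integral_indicator_affine: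
  fixes s a :: real
  assumes "s \<noteq> 0" and [measurable]: "A \<in> sets borel"
  shows "\<bar>s\<bar> * (\<integral>t. indicator A (a + t * s) \<partial>lborel) = measure lborel A"
proof -
  have "(\<integral>t. indicator A t \<partial>lborel) = \<bar>s\<bar> *\<^sub>R (\<integral>t. indicator A (a + s * t) \<partial>lborel :: real)"
    by (rule lborel_integral_real_affine) fact
  then show ?thesis by (simp add: mult.commute)
qed

text \<open>\<Phi> is constant on the lines in direction \<open>u\<close>, and such a line spends
  parameter length \<open>measure lborel A / \<bar>m \<bullet> u\<bar>\<close> in the region cut out
  by \<open>A\<close>.\<close>

lemma integral_slab_base:
  fixes \<Phi> :: "'a::euclidean_space \<Rightarrow> real"
  assumes inv: "\<And>x t. \<Phi> (x + t *\<^sub>R u) = \<Phi> x" and m: "m \<bullet> u \<noteq> 0" and k: "k \<bullet> u = 1"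
    and A: "A \<in> sets borel" and int: "integrable lborel (\<lambda>x. indicator A (m \<bullet> x + c) * \<Phi> x)"
  shows "\<bar>m \<bullet> u\<bar> * (\<integral>x. indicator A (m \<bullet> x + c) * \<Phi> x \<partial>lborel) = measure lborel A * (\<integral>x. slab (k \<bullet> x) * \<Phi> x \<partial>lborel)"
proof -
  have "(\<integral>x. indicator A (m \<bullet> x + c) * \<Phi> x \<partial>lborel)
     = (\<integral>x. slab (k \<bullet> x) * (\<integral>t. indicator A (m \<bullet> (x + t *\<^sub>R u) + c) * \<Phi> (x + t *\<^sub>R u) \<partial>lborel) \<partial>lborel)"
    by (rule integral_fibre(1)[OF int k, symmetric])
  also have "\<dots> = (\<integral>x. slab (k \<bullet> x) * ((\<integral>t. indicator A ((m \<bullet> x + c) + t * (m \<bullet> u)) \<partial>lborel) * \<Phi> x) \<partial>lborel)"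
    by (simp add: inv inner_add_right algebra_simps)
  also have "\<bar>m \<bullet> u\<bar> * \<dots> = (\<integral>x. slab (k \<bullet> x) * ((\<bar>m \<bullet> u\<bar> * (\<integral>t. indicator A ((m \<bullet> x + c) + t * (m \<bullet> u)) \<partial>lborel)) * \<Phi> x) \<partial>lborel)"
    by (subst integral_mult_right_zero[symmetric]) (simp add: algebra_simps)
  also have "\<dots> = (\<integral>x. measure lborel A * (slab (k \<bullet> x) * \<Phi> x) \<partial>lborel)"
    by (simp only: integral_indicator_affine[OF m A]) (simp add: algebra_simps)
  also have "\<dots> = measure lborel A * (\<integral>x. slab (k \<bullet> x) * \<Phi> x \<partial>lborel)"
    by simp
  finally show ?thesis .
qed

text \<open>Exchanges one slab transversal to \<open>u\<close> for another: both sides are the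
  integral of \<Phi> per unit of parameter along the lines.\<close>

lemma integral_slab:
  fixes \<Phi> :: "'a::euclidean_space \<Rightarrow> real"
  assumes inv: "\<And>x t. \<Phi> (x + t *\<^sub>R u) = \<Phi> x" and m: "m \<bullet> u \<noteq> 0" and m': "m' \<bullet> u \<noteq> 0"
    and "integrable lborel (\<lambda>x. slab (m \<bullet> x + c) * \<Phi> x)"
    and "integrable lborel (\<lambda>x. slab (m' \<bullet> x + c') * \<Phi> x)"
  shows "\<bar>m \<bullet> u\<bar> * (\<integral>x. slab (m \<bullet> x + c) * \<Phi> x \<partial>lborel) = \<bar>m' \<bullet> u\<bar> * (\<integral>x. slab (m' \<bullet> x + c') * \<Phi> x \<partial>lborel)"
proof -
  have k: "((1 / (m \<bullet> u)) *\<^sub>R m) \<bullet> u = 1" using m by simp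
  show ?thesis
    using integral_slab_base[OF inv m k, of "{0..1}" c] integral_slab_base[OF inv m' k, of "{0..1}" c'] assms(4,5) by simp
qed

text \<open>The analogue with two directions of invariance. It compares cross-sections of different
  shape: the disc around a ridge and the unit square cut out by two slabs.\<close>

lemma integral_two_slabs_base:
  fixes \<Phi> :: "'a::euclidean_space \<Rightarrow> real"
  assumes inv: "\<And>x t. \<Phi> (x + t *\<^sub>R n) = \<Phi> x" "\<And>x t. \<Phi> (x + t *\<^sub>R \<mu>) = \<Phi> x"
    and on: "norm n = 1" "norm \<mu> = 1" "n \<bullet> \<mu> = 0"
    and A: "A \<in> sets borel" "bounded A"
    and int: "integrable lborel (\<lambda>x. indicator A (n \<bullet> x - c, \<mu> \<bullet> x - c') * \<Phi> x)"
  shows "(\<integral>x. indicator A (n \<bullet> x - c, \<mu> \<bullet> x - c') * \<Phi> x \<partial>lborel)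
     = measure lborel A * (\<integral>x. slab (n \<bullet> x) * slab (\<mu> \<bullet> x) * \<Phi> x \<partial>lborel)"
proof -
  have nn: "n \<bullet> n = 1" "\<mu> \<bullet> \<mu> = 1" "\<mu> \<bullet> n = 0" using on by (auto simp: dot_square_norm inner_commute)
  have finA: "emeasure lborel A < \<infinity>" using A(2) by (rule emeasure_bounded_finite)
  have indA: "integrable (lborel \<Otimes>\<^sub>M lborel) (\<lambda>p. indicator A p :: real)"
    using A(1) finA by (simp add: lborel_prod)
  define a where "a r = (\<integral>t. indicator A (r, t) \<partial>lborel :: real)" for r
  have a_int: "(\<integral>r. a r \<partial>lborel) = measure lborel A"
    using lborel_pair.integral_fst'[of "\<lambda>p. indicator A p :: real", OF indA] by (simp add: a_def lborel_prod)
  have trans: "(\<integral>t. h (s + t) \<partial>lborel) = (\<integral>t. h t \<partial>lborel)" if [measurable]: "h \<in> borel_measurable borel" for h :: "real \<Rightarrow> real" and s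
    using lborel_integral_translate[OF that, of s] by (simp add: add.commute)
  have [measurable]: "(\<lambda>t. indicator A (r, t) :: real) \<in> borel_measurable borel" for r
  proof -
    have "A \<in> sets (borel \<Otimes>\<^sub>M borel)" using A(1) by (simp only: borel_prod)
    then show ?thesis by measurable
  qed
  have a_meas [measurable]: "a \<in> borel_measurable borel"
    using borel_measurable_integrable[OF lborel_pair.integrable_fst'[of "\<lambda>p. indicator A p :: real", OF indA]] by (simp add: a_def[abs_def])
  have in1: "(\<integral>t. indicator A (n \<bullet> (x + t *\<^sub>R \<mu>) - c, \<mu> \<bullet> (x + t *\<^sub>R \<mu>) - c') * \<Phi> (x + t *\<^sub>R \<mu>) \<partial>lborel) = a (n \<bullet> x - c) * \<Phi> x" for x
  proof -
    have "(\<integral>t. indicator A (n \<bullet> (x + t *\<^sub>R \<mu>) - c, \<mu> \<bullet> (x + t *\<^sub>R \<mu>) - c') * \<Phi> (x + t *\<^sub>R \<mu>) \<partial>lborel)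
      = (\<integral>t. indicator A (n \<bullet> x - c, (\<mu> \<bullet> x - c') + t) \<partial>lborel) * \<Phi> x"
      by (simp add: inv inner_add_right on nn algebra_simps)
    also have "(\<integral>t. indicator A (n \<bullet> x - c, (\<mu> \<bullet> x - c') + t) \<partial>lborel) = a (n \<bullet> x - c)"
      unfolding a_def by (rule trans[of "\<lambda>t. indicator A (n \<bullet> x - c, t)"]) measurable
    finally show ?thesis .
  qed
  have eq1: "(\<integral>x. indicator A (n \<bullet> x - c, \<mu> \<bullet> x - c') * \<Phi> x \<partial>lborel) = (\<integral>x. slab (\<mu> \<bullet> x) * (a (n \<bullet> x - c) * \<Phi> x) \<partial>lborel)"
    and int2: "integrable lborel (\<lambda>x. slab (\<mu> \<bullet> x) * (a (n \<bullet> x - c) * \<Phi> x))"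
    using integral_fibre[OF int nn(2)] by (simp_all only: in1)
  note eq1
  also have "(\<integral>x. slab (\<mu> \<bullet> x) * (a (n \<bullet> x - c) * \<Phi> x) \<partial>lborel)
      = (\<integral>x. slab (n \<bullet> x) * (\<integral>t. slab (\<mu> \<bullet> (x + t *\<^sub>R n)) * (a (n \<bullet> (x + t *\<^sub>R n) - c) * \<Phi> (x + t *\<^sub>R n)) \<partial>lborel) \<partial>lborel)"
    by (rule integral_fibre(1)[OF int2 nn(1), symmetric])
  also have "\<dots> = (\<integral>x. measure lborel A * (slab (n \<bullet> x) * slab (\<mu> \<bullet> x) * \<Phi> x) \<partial>lborel)"
  proof (rule Bochner_Integration.integral_cong[OF refl])
    fix x
    have "(\<integral>t. slab (\<mu> \<bullet> (x + t *\<^sub>R n)) * (a (n \<bullet> (x + t *\<^sub>R n) - c) * \<Phi> (x + t *\<^sub>R n)) \<partial>lborel)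
        = (\<integral>t. (slab (\<mu> \<bullet> x) * \<Phi> x) * a ((n \<bullet> x - c) + t) \<partial>lborel)"
      by (simp add: inv inner_add_right on nn algebra_simps)
    also have "\<dots> = slab (\<mu> \<bullet> x) * \<Phi> x * measure lborel A"
      by (simp add: trans a_int)
    finally show "slab (n \<bullet> x) * (\<integral>t. slab (\<mu> \<bullet> (x + t *\<^sub>R n)) * (a (n \<bullet> (x + t *\<^sub>R n) - c) * \<Phi> (x + t *\<^sub>R n)) \<partial>lborel)
        = measure lborel A * (slab (n \<bullet> x) * slab (\<mu> \<bullet> x) * \<Phi> x)"
      by (simp add: algebra_simps)
  qed
  finally show ?thesis by simp
qed

text \<open>If \<open>x\<close> lies in the slab and its shifted point in the support of
  \<open>H\<close>, the shift along \<open>u\<close> changes \<open>m \<bullet> x\<close> by a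
  bounded amount, and \<open>m \<bullet> u \<noteq> 0\<close> then bounds the shift itself.\<close>

lemma bounded_support_oblique:
  fixes H :: "'a::euclidean_space \<Rightarrow> real"
  assumes H: "bounded_support H" and m: "m \<bullet> u \<noteq> 0"
  shows "bounded_support (\<lambda>x. slab (m \<bullet> x + c) * H (x + (g \<bullet> x + d) *\<^sub>R u))"
proof -
  have [measurable]: "H \<in> borel_measurable borel" using H by (rule bounded_support_measurable)
  obtain M where M: "\<And>x. \<bar>H x\<bar> \<le> M" using H by (auto simp: bounded_support_def bounded_real)
  obtain R where R: "\<And>x. H x \<noteq> 0 \<Longrightarrow> norm x \<le> R" using H by (auto simp: bounded_support_def bounded_iff)
  define B where "B = R + (1 + \<bar>c\<bar> + norm m * R) / \<bar>m \<bullet> u\<bar> * norm u"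
  show ?thesis
  proof (rule bounded_supportI[of _ "cball (0::'a) B" M])
    fix x assume "x \<notin> cball (0::'a) B"
    show "slab (m \<bullet> x + c) * H (x + (g \<bullet> x + d) *\<^sub>R u) = 0"
    proof (rule ccontr)
      let ?s = "g \<bullet> x + d"
      let ?y = "x + ?s *\<^sub>R u"
      assume "\<not> ?thesis"
      then have s: "0 \<le> m \<bullet> x + c" "m \<bullet> x + c \<le> 1" and "norm ?y \<le> R"
        using R[of ?y] by (auto simp: indicator_def split: if_splits)
      have "?s * (m \<bullet> u) = m \<bullet> ?y - m \<bullet> x" by (simp add: inner_add_right)
      then have "\<bar>?s\<bar> * \<bar>m \<bullet> u\<bar> \<le> \<bar>m \<bullet> ?y\<bar> + (1 + \<bar>c\<bar>)"
        using s by (simp add: abs_mult[symmetric])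
      also have "\<bar>m \<bullet> ?y\<bar> \<le> norm m * R"
        using Cauchy_Schwarz_ineq2[of m ?y] mult_left_mono[OF \<open>norm ?y \<le> R\<close>, of "norm m"] by simp
      finally have "\<bar>?s\<bar> \<le> (1 + \<bar>c\<bar> + norm m * R) / \<bar>m \<bullet> u\<bar>"
        using m by (simp add: field_simps)
      then have "\<bar>?s\<bar> * norm u \<le> (1 + \<bar>c\<bar> + norm m * R) / \<bar>m \<bullet> u\<bar> * norm u"
        by (rule mult_right_mono) simp
      moreover have "norm x \<le> norm ?y + norm (?s *\<^sub>R u)"
        by (metis add_diff_cancel_right' norm_triangle_ineq4)
      ultimately have "norm x \<le> B" using \<open>norm ?y \<le> R\<close> by (simp add: B_def)
      then show False using \<open>x \<notin> cball (0::'a) B\<close> by simp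
    qed
  next
    fix x :: 'a
    show "\<bar>slab (m \<bullet> x + c) * H (x + (g \<bullet> x + d) *\<^sub>R u)\<bar> \<le> M"
      using M[of "x + (g \<bullet> x + d) *\<^sub>R u"] abs_ge_zero[of "H 0"] M[of 0] by (auto simp: indicator_def)
  qed auto
qed

text \<open>The integral of \<open>H\<close> over the hyperplane \<open>g \<bullet> x + c = 0\<close>, divided by \<open>norm g\<close>: the hyperplane is
  thickened to a slab of unit width.\<close>

definition flux :: "'a::euclidean_space \<Rightarrow> real \<Rightarrow> ('a \<Rightarrow> real) \<Rightarrow> real" where
  "flux g c H = (\<integral>x. slab (- (g \<bullet> x + c) / norm g) * H (x - ((g \<bullet> x + c) / (g \<bullet> g)) *\<^sub>R g) \<partial>lborel) / norm g"

text \<open>The flux depends neither on the slab nor on the direction of projection. The slab is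
  first made parallel to the hyperplane; a shear along the hyperplane then turns the projection
  along \<open>u\<close> into the orthogonal one.\<close>

lemma flux_oblique:
  fixes H :: "'a::euclidean_space \<Rightarrow> real"
  assumes H: "bounded_support H" and gu: "g \<bullet> u = -1" and m: "m \<bullet> u \<noteq> 0"
  shows "\<bar>m \<bullet> u\<bar> * (\<integral>x. slab (m \<bullet> x + d) * H (x + (g \<bullet> x + c) *\<^sub>R u) \<partial>lborel) = flux g c H"
proof -
  have g0: "g \<noteq> 0" using gu by auto
  have Hm [measurable]: "H \<in> borel_measurable borel" using H by (rule bounded_support_measurable)
  define u' where "u' = (- 1 / (g \<bullet> g)) *\<^sub>R g"
  have gu': "g \<bullet> u' = -1" using g0 by (simp add: u'_def)
  define w where "w = u' - u"
  have gw: "g \<bullet> w = 0" using gu gu' by (simp add: w_def inner_diff_right)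
  have inv: "H (x + t *\<^sub>R v + (g \<bullet> (x + t *\<^sub>R v) + c) *\<^sub>R v) = H (x + (g \<bullet> x + c) *\<^sub>R v)" if "g \<bullet> v = -1" for x t v
    by (simp add: inner_add_right that algebra_simps)
  have int: "integrable lborel (\<lambda>x. slab (k \<bullet> x + e) * H (x + (g \<bullet> x + c) *\<^sub>R v))" if "k \<bullet> v \<noteq> 0" for k e v
    by (intro bounded_support_integrable bounded_support_oblique H that)
  have "\<bar>m \<bullet> u\<bar> * (\<integral>x. slab (m \<bullet> x + d) * H (x + (g \<bullet> x + c) *\<^sub>R u) \<partial>lborel)
      = \<bar>g \<bullet> u\<bar> * (\<integral>x. slab (g \<bullet> x + c) * H (x + (g \<bullet> x + c) *\<^sub>R u) \<partial>lborel)"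
    using gu m by (intro integral_slab int inv) auto
  also have "\<dots> = (\<integral>x. slab (g \<bullet> x + c) * H (x + (g \<bullet> x + c) *\<^sub>R u) \<partial>lborel)"
    using gu by simp
  also have "\<dots> = (\<integral>x. slab (g \<bullet> (x + (g \<bullet> x + c) *\<^sub>R w) + c) * H ((x + (g \<bullet> x + c) *\<^sub>R w) + (g \<bullet> (x + (g \<bullet> x + c) *\<^sub>R w) + c) *\<^sub>R u) \<partial>lborel)"
    by (rule lborel_integral_shear(1)[OF gw, symmetric]) measurable
  also have "\<dots> = \<bar>g \<bullet> u'\<bar> * (\<integral>x. slab (g \<bullet> x + c) * H (x + (g \<bullet> x + c) *\<^sub>R u') \<partial>lborel)"
  proof -
    have 1: "g \<bullet> (x + (g \<bullet> x + c) *\<^sub>R w) + c = g \<bullet> x + c" for x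
      by (simp add: inner_add_right gw)
    have 2: "x + s *\<^sub>R w + s *\<^sub>R u = x + s *\<^sub>R u'" for x s
      by (simp add: w_def algebra_simps)
    show ?thesis unfolding 1 2 by (simp add: gu')
  qed
  also have "\<dots> = \<bar>((- 1 / norm g) *\<^sub>R g) \<bullet> u'\<bar> * (\<integral>x. slab (((- 1 / norm g) *\<^sub>R g) \<bullet> x + (- c / norm g)) * H (x + (g \<bullet> x + c) *\<^sub>R u') \<partial>lborel)"
    using gu' g0 by (intro integral_slab int inv) auto
  also have "((- 1 / norm g) *\<^sub>R g) \<bullet> u' = 1 / norm g" using gu' by simp
  also have "(\<integral>x. slab (((- 1 / norm g) *\<^sub>R g) \<bullet> x + (- c / norm g)) * H (x + (g \<bullet> x + c) *\<^sub>R u') \<partial>lborel)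
     = (\<integral>x. slab (- (g \<bullet> x + c) / norm g) * H (x - ((g \<bullet> x + c) / (g \<bullet> g)) *\<^sub>R g) \<partial>lborel)"
    by (intro Bochner_Integration.integral_cong) (auto simp: u'_def add_divide_distrib diff_divide_distrib)
  finally show ?thesis by (simp add: flux_def)
qed

text \<open>A line in direction \<open>u\<close> enters \<open>Q\<close> through the hyperplane of
  \<open>ga\<close> and leaves it through that of \<open>gb\<close>, while \<open>Z\<close> is
  constant along it. The fundamental theorem of calculus on this chord is integrated over all
  lines.\<close>

lemma fibre_divergence:
  fixes f g :: "'a::euclidean_space \<Rightarrow> real"
  assumes deriv: "\<And>x t. ((\<lambda>t. f (x + t *\<^sub>R u)) has_real_derivative g (x + t *\<^sub>R u)) (at t)"
    and cf: "continuous_on UNIV f" and cg: "continuous_on UNIV g"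
    and ga: "ga \<bullet> u = 1" and gb: "gb \<bullet> u = -1"
    and Z: "\<And>x t. Z (x + t *\<^sub>R u) \<longleftrightarrow> Z x"
    and Q: "Q = {x. Z x \<and> 0 \<le> ga \<bullet> x + a0 \<and> 0 \<le> gb \<bullet> x + b0}" "Q \<in> sets borel" "bounded Q"
  shows "(\<integral>x. indicator Q x * g x \<partial>lborel) = flux gb b0 (\<lambda>x. indicator Q x * f x) - flux ga a0 (\<lambda>x. indicator Q x * f x)"
proof -
  have [measurable]: "f \<in> borel_measurable borel" "g \<in> borel_measurable borel" "Q \<in> sets borel"
    using cf cg Q(2) by (auto intro: borel_measurable_continuous_onI)
  have bs: "bounded_support (\<lambda>x. indicator Q x * h x)" if "continuous_on UNIV h" for h :: "'a \<Rightarrow> real"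
  proof -
    have "compact (h ` closure Q)"
      using Q(3) that by (intro compact_continuous_image) (auto intro: continuous_on_subset simp: compact_closure)
    then obtain M where M: "\<And>x. x \<in> closure Q \<Longrightarrow> \<bar>h x\<bar> \<le> M"
      using compact_imp_bounded by (force simp: bounded_real)
    have [measurable]: "h \<in> borel_measurable borel" using that by (rule borel_measurable_continuous_onI)
    show ?thesis
      by (rule bounded_supportI[OF _ Q(3), of _ M]) (use M closure_subset in \<open>auto simp: indicator_def\<close>)
  qed
  let ?H = "\<lambda>x. indicator Q x * f x"
  have inner: "(\<integral>t. indicator Q (x + t *\<^sub>R u) * g (x + t *\<^sub>R u) \<partial>lborel)
     = ?H (x + (gb \<bullet> x + b0) *\<^sub>R u) - ?H (x + (ga \<bullet> x + a0) *\<^sub>R (- u))" for x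
  proof -
    let ?a = "ga \<bullet> x + a0" and ?b = "gb \<bullet> x + b0"
    have mm: "x - ?a *\<^sub>R u = x + (- ?a) *\<^sub>R u"
      by (simp only: scaleR_minus_left diff_conv_add_uminus)
    have mem: "x + t *\<^sub>R u \<in> Q \<longleftrightarrow> Z x \<and> - ?a \<le> t \<and> t \<le> ?b" for t
      by (auto simp: Q(1) Z inner_add_right ga gb)
    have memb: "x + ?b *\<^sub>R u \<in> Q \<longleftrightarrow> Z x \<and> - ?a \<le> ?b"
      using mem[of ?b] by auto
    have mema: "x - ?a *\<^sub>R u \<in> Q \<longleftrightarrow> Z x \<and> - ?a \<le> ?b"
      using mem[of "- ?a"] by (simp only: mm order.refl simp_thms)
    show ?thesis
    proof (cases "Z x \<and> - ?a \<le> ?b")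
      case True
      have "(\<integral>t. indicator Q (x + t *\<^sub>R u) * g (x + t *\<^sub>R u) \<partial>lborel) = (\<integral>t. g (x + t *\<^sub>R u) * indicator {- ?a..?b} t \<partial>lborel)"
        using True mem by (intro Bochner_Integration.integral_cong) (auto simp: indicator_def)
      also have "\<dots> = f (x + ?b *\<^sub>R u) - f (x + (- ?a) *\<^sub>R u)"
      proof (rule integral_FTC_Icc_real)
        show "isCont (\<lambda>t. g (x + t *\<^sub>R u)) t" for t
          using continuous_on_compose2[OF cg, of UNIV "\<lambda>t. x + t *\<^sub>R u"]
          by (auto intro!: continuous_intros simp: continuous_on_eq_continuous_at)
      qed (use True deriv in auto)
      also have "\<dots> = f (x + ?b *\<^sub>R u) - f (x - ?a *\<^sub>R u)" by (simp only: mm)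
      finally show ?thesis using True mema memb by simp
    next
      case False
      then have "x + t *\<^sub>R u \<notin> Q" for t
        using mem[of t] order_trans[of "- ?a" t ?b] by blast
      moreover have "x + ?b *\<^sub>R u \<notin> Q" "x - ?a *\<^sub>R u \<notin> Q"
        using False mema memb by blast+
      ultimately show ?thesis by simp
    qed
  qed
  have "(\<integral>x. indicator Q x * g x \<partial>lborel) = (\<integral>x. slab (ga \<bullet> x) * (\<integral>t. indicator Q (x + t *\<^sub>R u) * g (x + t *\<^sub>R u) \<partial>lborel) \<partial>lborel)"
    by (rule integral_fibre(1)[OF bounded_support_integrable[OF bs[OF cg]] ga, symmetric])
  also have "\<dots> = (\<integral>x. slab (ga \<bullet> x + 0) * ?H (x + (gb \<bullet> x + b0) *\<^sub>R u) - slab (ga \<bullet> x + 0) * ?H (x + (ga \<bullet> x + a0) *\<^sub>R (- u)) \<partial>lborel)"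
    unfolding inner by (simp add: right_diff_distrib)
  also have "\<dots> = (\<integral>x. slab (ga \<bullet> x + 0) * ?H (x + (gb \<bullet> x + b0) *\<^sub>R u) \<partial>lborel)
     - (\<integral>x. slab (ga \<bullet> x + 0) * ?H (x + (ga \<bullet> x + a0) *\<^sub>R (- u)) \<partial>lborel)"
    by (rule Bochner_Integration.integral_diff)
       (intro bounded_support_integrable bounded_support_oblique[OF bs[OF cf]]; simp add: ga)+
  also have "\<dots> = flux gb b0 ?H - flux ga a0 ?H"
    using flux_oblique[OF bs[OF cf] gb, of ga 0 b0] flux_oblique[OF bs[OF cf], of ga "- u" ga 0 a0] ga by simp
  finally show ?thesis .
qed

lemma bounded_support_indicator_continuous:
  fixes h :: "'a::euclidean_space \<Rightarrow> real"
  assumes "bounded Q" "Q \<in> sets borel" "continuous_on UNIV h"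
  shows "bounded_support (\<lambda>x. indicator Q x * h x)"
proof -
  have "compact (h ` closure Q)"
    using assms(1,3) by (intro compact_continuous_image) (auto intro: continuous_on_subset simp: compact_closure)
  then obtain M where M: "\<And>x. x \<in> closure Q \<Longrightarrow> \<bar>h x\<bar> \<le> M"
    using compact_imp_bounded by (force simp: bounded_real)
  have [measurable]: "h \<in> borel_measurable borel" "Q \<in> sets borel"
    using assms by (auto intro: borel_measurable_continuous_onI)
  show ?thesis
    by (rule bounded_supportI[OF _ assms(1), of _ M]) (use M closure_subset in \<open>auto simp: indicator_def\<close>)
qed

text \<open>The surface measure on \<open>F\<close> is the image, under orthogonal projection, of
  Lebesgue measure on the prism of unit height over \<open>F\<close>. This is checked on sets and
  then passes to integrals.\<close>

lemma surface_integral_slab: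
  fixes F :: "(real^'n::finite) set" and f :: "real^'n \<Rightarrow> real"
  assumes d: "CARD('n) \<in> {2, 3}" and \<nu>: "norm \<nu> = 1"
    and F: "F \<in> sets borel" "F \<subseteq> {x. \<nu> \<bullet> x = c}" and f: "f \<in> borel_measurable borel"
  shows "(LINT x:F|surface_measure. f x) = (\<integral>x. slab (\<nu> \<bullet> x - c) * (indicator F (x - (\<nu> \<bullet> x - c) *\<^sub>R \<nu>) * f (x - (\<nu> \<bullet> x - c) *\<^sub>R \<nu>)) \<partial>lborel)"
proof -
  note [measurable] = F(1) f
  define P where "P x = x - (\<nu> \<bullet> x - c) *\<^sub>R \<nu>" for x
  have [measurable]: "P \<in> borel_measurable borel" unfolding P_def by measurable
  define S where "S = {x. 0 \<le> \<nu> \<bullet> x - c \<and> \<nu> \<bullet> x - c \<le> 1 \<and> P x \<in> F}"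
  have S [measurable]: "S \<in> sets borel" unfolding S_def by measurable
  let ?N = "distr (restrict_space lborel S) borel P"
  have sm [measurable_cong]: "sets (surface_measure :: (real^'n) measure) = sets borel"
    by (simp add: surface_measure_def)
  have "density surface_measure (indicator F) = ?N"
  proof (rule measure_eqI)
    show "sets (density surface_measure (indicator F)) = sets ?N" by (simp add: sm)
    fix A assume "A \<in> sets (density surface_measure (indicator F))"
    then have [measurable]: "A \<in> sets borel" by (simp add: sm)
    have "emeasure (density surface_measure (indicator F)) A = emeasure surface_measure (F \<inter> A)"
      by (subst emeasure_density) (simp_all add: nn_integral_indicator[symmetric] indicator_inter_arith[symmetric] del: nn_integral_indicator)
    also have "\<dots> = emeasure lborel {x. 0 \<le> \<nu> \<bullet> x - c \<and> \<nu> \<bullet> x - c \<le> 1 \<and> P x \<in> F \<inter> A}"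
      unfolding P_def by (rule surface_measure_hyperplane(1)[OF d \<nu>]) (use F in auto)
    also have "{x. 0 \<le> \<nu> \<bullet> x - c \<and> \<nu> \<bullet> x - c \<le> 1 \<and> P x \<in> F \<inter> A} = P -` A \<inter> S"
      by (auto simp: S_def)
    also have "emeasure lborel (P -` A \<inter> S) = emeasure ?N A"
    proof -
      have "P -` A \<in> sets borel" using measurable_sets_borel[of P borel A] by simp
      then show ?thesis
        by (subst emeasure_distr) (auto simp: emeasure_restrict_space space_restrict_space intro!: measurable_restrict_space1)
    qed
    finally show "emeasure (density surface_measure (indicator F)) A = emeasure ?N A" .
  qed
  moreover have "(LINT x:F|surface_measure. f x) = integral\<^sup>L (density surface_measure (indicator F)) f"
    unfolding set_lebesgue_integral_def
    using integral_density[of f surface_measure "indicator F :: real^'n \<Rightarrow> real"] by (simp add: ennreal_indicator)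
  moreover have "integral\<^sup>L ?N f = (\<integral>x. f (P x) \<partial>restrict_space lborel S)"
    by (rule integral_distr) (auto intro!: measurable_restrict_space1)
  moreover have "\<dots> = (\<integral>x. indicator S x * f (P x) \<partial>lborel)"
    by (subst integral_restrict_space) (auto simp: set_lebesgue_integral_def)
  moreover have "\<dots> = (\<integral>x. slab (\<nu> \<bullet> x - c) * (indicator F (P x) * f (P x)) \<partial>lborel)"
    by (intro Bochner_Integration.integral_cong) (auto simp: S_def indicator_def)
  ultimately show ?thesis by (simp add: P_def)
qed

lemma flux_eq_surface_integral:
  fixes Q :: "(real^'n::finite) set" and f :: "real^'n \<Rightarrow> real"
  assumes d: "CARD('n) \<in> {2, 3}" and g: "g \<noteq> 0" and Q: "compact Q" and f: "continuous_on UNIV f"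
  shows "flux g c (\<lambda>x. indicator Q x * f x) = (LINT x:(Q \<inter> {x. g \<bullet> x + c = 0})|surface_measure. f x) / norm g"
proof -
  let ?F = "Q \<inter> {x. g \<bullet> x + c = 0}"
  \<comment> \<open>The sign is chosen to match the slab in the definition of
    \<open>flux\<close>.\<close>
  define \<nu> where "\<nu> = (- 1 / norm g) *\<^sub>R g"
  have \<nu>: "norm \<nu> = 1" using g by (simp add: \<nu>_def)
  have pl: "\<nu> \<bullet> x - c / norm g = - (g \<bullet> x + c) / norm g" for x
    by (simp add: \<nu>_def add_divide_distrib diff_divide_distrib)
  have "closed {x. g \<bullet> x + c = 0}" by (intro closed_Collect_eq continuous_intros)
  then have "compact ?F" using Q by (rule compact_Int_closed[rotated])
  then have F: "?F \<in> sets borel" by (rule borel_compact)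
  have sub: "?F \<subseteq> {x. \<nu> \<bullet> x = c / norm g}"
  proof
    fix x assume "x \<in> ?F"
    then have "\<nu> \<bullet> x - c / norm g = 0" unfolding pl by simp
    then show "x \<in> {x. \<nu> \<bullet> x = c / norm g}" by simp
  qed
  have fm: "f \<in> borel_measurable borel" using f by (rule borel_measurable_continuous_onI)
  have P: "x - (\<nu> \<bullet> x - c / norm g) *\<^sub>R \<nu> = x - ((g \<bullet> x + c) / (g \<bullet> g)) *\<^sub>R g" for x
  proof -
    have "(- (g \<bullet> x + c) / norm g) * (- 1 / norm g) = (g \<bullet> x + c) / (g \<bullet> g)"
      by (simp only: times_divide_times_eq dot_square_norm power2_eq_square)
    then show ?thesis unfolding pl by (simp only: \<nu>_def scaleR_scaleR)
  qed
  have on: "g \<bullet> (x - ((g \<bullet> x + c) / (g \<bullet> g)) *\<^sub>R g) + c = 0" for x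
    using g by (simp add: inner_diff_right)
  have ind: "indicator ?F (x - ((g \<bullet> x + c) / (g \<bullet> g)) *\<^sub>R g) = (indicator Q (x - ((g \<bullet> x + c) / (g \<bullet> g)) *\<^sub>R g) :: real)" for x
    using on[of x] by (simp add: indicator_def)
  have "(LINT x:?F|surface_measure. f x) = (\<integral>x. slab (- (g \<bullet> x + c) / norm g) *
      (indicator Q (x - ((g \<bullet> x + c) / (g \<bullet> g)) *\<^sub>R g) * f (x - ((g \<bullet> x + c) / (g \<bullet> g)) *\<^sub>R g)) \<partial>lborel)"
    unfolding surface_integral_slab[OF d \<nu> F sub fm] by (simp only: P) (simp only: pl ind)
  then show ?thesis by (simp only: flux_def)
qed

text \<open>The \<open>(d-2)\<close>-dimensional integral over a ridge \<open>e\<close>, up to the factor \<open>pi\<close>: the affine hull of \<open>e\<close>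
  is thickened by discs of radius one orthogonal to it.\<close>

definition ridge_measure :: "'a::euclidean_space set \<Rightarrow> 'a measure" where
  "ridge_measure e = distr (restrict_space lborel {x. dist x (closest_point (affine hull e) x) \<le> 1 \<and> closest_point (affine hull e) x \<in> e}) borel (closest_point (affine hull e))"

lemma sets_ridge_measure [simp, measurable_cong]: "sets (ridge_measure e) = sets borel"
  and space_ridge_measure [simp]: "space (ridge_measure e) = UNIV"
  by (simp_all add: ridge_measure_def)

context
  fixes e :: "'a::euclidean_space set"
  assumes e: "compact e" "e \<noteq> {}"
begin

lemma closest_point_affine_hull_measurable [measurable]: "closest_point (affine hull e) \<in> borel_measurable borel"
  using e by (intro borel_measurable_continuous_onI continuous_on_closest_point) (auto simp: affine_imp_convex closed_affine_hull)

lemma ridge_tube_bounded: "{x. dist x (closest_point (affine hull e) x) \<le> 1 \<and> closest_point (affine hull e) x \<in> e} \<in> sets borel"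
    "bounded {x. dist x (closest_point (affine hull e) x) \<le> 1 \<and> closest_point (affine hull e) x \<in> e}"
proof -
  have [measurable]: "e \<in> sets borel" using e by (simp add: borel_compact)
  show "{x. dist x (closest_point (affine hull e) x) \<le> 1 \<and> closest_point (affine hull e) x \<in> e} \<in> sets borel"
    by measurable
  obtain R where R: "\<And>x. x \<in> e \<Longrightarrow> norm x \<le> R" using compact_imp_bounded[OF e(1)] by (auto simp: bounded_iff)
  show "bounded {x. dist x (closest_point (affine hull e) x) \<le> 1 \<and> closest_point (affine hull e) x \<in> e}"
  proof (rule bounded_subset[of "cball 0 (R + 1)"], simp, safe)
    fix x assume *: "dist x (closest_point (affine hull e) x) \<le> 1" "closest_point (affine hull e) x \<in> e"
    have "norm x \<le> norm (closest_point (affine hull e) x) + dist x (closest_point (affine hull e) x)"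
      by (simp add: dist_norm norm_triangle_sub)
    then show "x \<in> cball 0 (R + 1)" using R[OF *(2)] *(1) by simp
  qed
qed

lemma finite_ridge_measure: "finite_measure (ridge_measure e)"
proof
  show "emeasure (ridge_measure e) (space (ridge_measure e)) \<noteq> \<infinity>"
    unfolding ridge_measure_def using ridge_tube_bounded emeasure_bounded_finite[OF ridge_tube_bounded(2)]
    by (subst emeasure_distr) (auto simp: emeasure_restrict_space space_restrict_space intro!: measurable_restrict_space1)
qed

lemma AE_ridge_measure: "AE x in ridge_measure e. x \<in> e"
  unfolding ridge_measure_def
  using e(1) by (subst AE_distr_iff) (auto simp: borel_compact AE_restrict_space_iff ridge_tube_bounded intro!: measurable_restrict_space1)

lemma integrable_ridge_measure:
  fixes f :: "'a \<Rightarrow> real"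
  assumes "continuous_on UNIV f"
  shows "integrable (ridge_measure e) f"
proof -
  interpret finite_measure "ridge_measure e" by (rule finite_ridge_measure)
  have "compact (f ` e)"
    using e(1) assms by (intro compact_continuous_image) (auto intro: continuous_on_subset)
  then obtain M where M: "\<And>x. x \<in> e \<Longrightarrow> \<bar>f x\<bar> \<le> M"
    using compact_imp_bounded by (force simp: bounded_real)
  show ?thesis
  proof (rule integrable_const_bound)
    show "AE x in ridge_measure e. norm (f x) \<le> M"
      using AE_ridge_measure by eventually_elim (use M in auto)
    show "f \<in> borel_measurable (ridge_measure e)"
      using borel_measurable_continuous_onI[OF assms] by simp
  qed
qed

text \<open>The tube of \<open>ridge_measure\<close> has a disc of area \<open>pi\<close> as
  cross-section and refers to no face; here the disc is exchanged for a unit square aligned with a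
  chosen normal and conormal. All faces at a ridge therefore see the same measure.\<close>

lemma ridge_integral_frame:
  fixes f :: "'a \<Rightarrow> real"
  assumes on: "norm n = 1" "norm \<mu> = 1" "n \<bullet> \<mu> = 0" and aff: "affine hull e = {x. n \<bullet> x = c \<and> \<mu> \<bullet> x = c'}"
    and f: "continuous_on UNIV f"
  shows "(\<integral>x. f x \<partial>ridge_measure e) = pi *
    (\<integral>x. slab (n \<bullet> x - c) * slab (\<mu> \<bullet> x - c') *
         (indicator e (x - (n \<bullet> x - c) *\<^sub>R n - (\<mu> \<bullet> x - c') *\<^sub>R \<mu>) * f (x - (n \<bullet> x - c) *\<^sub>R n - (\<mu> \<bullet> x - c') *\<^sub>R \<mu>)) \<partial>lborel)"
proof -
  have nn: "n \<bullet> n = 1" "\<mu> \<bullet> \<mu> = 1" "\<mu> \<bullet> n = 0" using on by (auto simp: dot_square_norm inner_commute)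
  define \<pi> where "\<pi> x = x - (n \<bullet> x - c) *\<^sub>R n - (\<mu> \<bullet> x - c') *\<^sub>R \<mu>" for x
  have \<pi>A: "\<pi> x \<in> affine hull e" for x
    unfolding aff \<pi>_def by (simp add: inner_diff_right nn on)
  have distsq: "(dist x y)\<^sup>2 = (n \<bullet> x - c)\<^sup>2 + (\<mu> \<bullet> x - c')\<^sup>2 + (dist (\<pi> x) y)\<^sup>2" if "y \<in> affine hull e" for x y
  proof -
    have y: "n \<bullet> y = c" "\<mu> \<bullet> y = c'" using that by (auto simp: aff)
    have z: "n \<bullet> (\<pi> x - y) = 0" "\<mu> \<bullet> (\<pi> x - y) = 0"
      using \<pi>A[of x] y unfolding aff by (auto simp: inner_diff_right)
    have "x - y = (\<pi> x - y) + ((n \<bullet> x - c) *\<^sub>R n + (\<mu> \<bullet> x - c') *\<^sub>R \<mu>)" by (simp add: \<pi>_def)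
    then have "(dist x y)\<^sup>2 = (norm ((\<pi> x - y) + ((n \<bullet> x - c) *\<^sub>R n + (\<mu> \<bullet> x - c') *\<^sub>R \<mu>)))\<^sup>2"
      unfolding dist_norm by (rule arg_cong[where f = "\<lambda>v. (norm v)\<^sup>2"])
    also have "\<dots> = (norm (\<pi> x - y))\<^sup>2 + ((n \<bullet> x - c)\<^sup>2 + (\<mu> \<bullet> x - c')\<^sup>2)"
    proof -
      have 1: "orthogonal (\<pi> x - y) ((n \<bullet> x - c) *\<^sub>R n + (\<mu> \<bullet> x - c') *\<^sub>R \<mu>)"
        using z by (simp only: orthogonal_def inner_add_right inner_scaleR_right inner_commute[of "\<pi> x - y"] mult_zero_right add_0)
      have 2: "orthogonal ((n \<bullet> x - c) *\<^sub>R n) ((\<mu> \<bullet> x - c') *\<^sub>R \<mu>)"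
        using on by (simp add: orthogonal_def)
      show ?thesis
        unfolding norm_add_Pythagorean[OF 1] norm_add_Pythagorean[OF 2] by (simp add: on)
    qed
    finally show ?thesis by (simp add: dist_norm)
  qed
  have cp: "closest_point (affine hull e) x = \<pi> x" for x
  proof (rule closest_point_unique[symmetric])
    show "\<forall>z\<in>affine hull e. dist x (\<pi> x) \<le> dist x z"
    proof
      fix z assume "z \<in> affine hull e"
      then have "(dist x (\<pi> x))\<^sup>2 \<le> (dist x z)\<^sup>2" using distsq[OF \<pi>A, of x x] distsq[of z x] by simp
      then show "dist x (\<pi> x) \<le> dist x z" by (rule power2_le_imp_le) simp
    qed
  qed (use \<pi>A in \<open>auto simp: affine_imp_convex closed_affine_hull\<close>)
  have [measurable]: "\<pi> \<in> borel_measurable borel" unfolding \<pi>_def by measurable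
  have [measurable]: "f \<in> borel_measurable borel" "e \<in> sets borel"
    using f e by (auto intro: borel_measurable_continuous_onI borel_compact)
  define \<Phi> where "\<Phi> x = indicator e (\<pi> x) * f (\<pi> x)" for x
  have inv: "\<Phi> (x + t *\<^sub>R n) = \<Phi> x" "\<Phi> (x + t *\<^sub>R \<mu>) = \<Phi> x" for x t
  proof -
    have "\<pi> (x + t *\<^sub>R n) = \<pi> x" "\<pi> (x + t *\<^sub>R \<mu>) = \<pi> x"
      by (simp_all add: \<pi>_def inner_add_right nn on algebra_simps)
    then show "\<Phi> (x + t *\<^sub>R n) = \<Phi> x" "\<Phi> (x + t *\<^sub>R \<mu>) = \<Phi> x" by (simp_all add: \<Phi>_def)
  qed
  obtain R where R: "\<And>x. x \<in> e \<Longrightarrow> norm x \<le> R" using compact_imp_bounded[OF e(1)] by (auto simp: bounded_iff)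
  have "compact (f ` e)"
    using e(1) f by (intro compact_continuous_image) (auto intro: continuous_on_subset)
  then obtain M where M: "\<And>x. x \<in> e \<Longrightarrow> \<bar>f x\<bar> \<le> M"
    using compact_imp_bounded by (force simp: bounded_real)
  \<comment> \<open>The radius 2 leaves room for both the unit disc and the unit square.\<close>
  have int: "integrable lborel (\<lambda>x. indicator A (n \<bullet> x - c, \<mu> \<bullet> x - c') * \<Phi> x)"
    if A: "A \<in> sets borel" "A \<subseteq> cball 0 2" for A :: "(real \<times> real) set"
  proof (rule bounded_support_integrable, rule bounded_supportI[of _ "cball 0 (R + 2)" "\<bar>M\<bar>"])
    have [measurable]: "A \<in> sets (borel \<Otimes>\<^sub>M borel)" using A(1) by (simp only: borel_prod)
    show "(\<lambda>x. indicator A (n \<bullet> x - c, \<mu> \<bullet> x - c') * \<Phi> x) \<in> borel_measurable borel"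
      unfolding \<Phi>_def by measurable
    fix x :: 'a
    show "\<bar>indicator A (n \<bullet> x - c, \<mu> \<bullet> x - c') * \<Phi> x\<bar> \<le> \<bar>M\<bar>"
      using M[of "\<pi> x"] by (auto simp: \<Phi>_def indicator_def)
    assume x: "x \<notin> cball 0 (R + 2)"
    show "indicator A (n \<bullet> x - c, \<mu> \<bullet> x - c') * \<Phi> x = 0"
    proof (rule ccontr)
      assume "\<not> ?thesis"
      then have "(n \<bullet> x - c, \<mu> \<bullet> x - c') \<in> A" "\<pi> x \<in> e" by (auto simp: \<Phi>_def indicator_def split: if_splits)
      then have "norm (n \<bullet> x - c, \<mu> \<bullet> x - c') \<le> 2" "norm (\<pi> x) \<le> R" using A(2) R by auto
      moreover have "dist x (\<pi> x) = norm (n \<bullet> x - c, \<mu> \<bullet> x - c')"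
        using distsq[OF \<pi>A, of x x] by (simp add: norm_Pair real_sqrt_unique[symmetric] eq_commute[of "sqrt _"])
      moreover have "norm x \<le> norm (\<pi> x) + dist x (\<pi> x)" by (simp add: dist_norm norm_triangle_sub)
      ultimately show False using x by simp
    qed
  qed simp
  define B where "B = (\<integral>x. slab (n \<bullet> x) * slab (\<mu> \<bullet> x) * \<Phi> x \<partial>lborel)"
  have base: "(\<integral>x. indicator A (n \<bullet> x - c, \<mu> \<bullet> x - c') * \<Phi> x \<partial>lborel) = measure lborel A * B"
    if A: "A \<in> sets borel" "A \<subseteq> cball 0 2" for A :: "(real \<times> real) set"
    unfolding B_def using bounded_subset[OF bounded_cball A(2)]
    by (intro integral_two_slabs_base inv on int A)
  let ?S = "{x. dist x (\<pi> x) \<le> 1 \<and> \<pi> x \<in> e}"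
  have "?S \<in> sets borel" using ridge_tube_bounded(1) by (simp add: cp)
  have "(\<integral>x. f x \<partial>ridge_measure e) = (\<integral>x. f (\<pi> x) \<partial>restrict_space lborel ?S)"
    unfolding ridge_measure_def cp[abs_def] by (rule integral_distr) (auto intro!: measurable_restrict_space1)
  also have "\<dots> = (\<integral>x. indicator ?S x * f (\<pi> x) \<partial>lborel)"
    using \<open>?S \<in> sets borel\<close> by (subst integral_restrict_space) (auto simp: set_lebesgue_integral_def)
  also have "\<dots> = (\<integral>x. indicator (cball (0::real \<times> real) 1) (n \<bullet> x - c, \<mu> \<bullet> x - c') * \<Phi> x \<partial>lborel)"
  proof (rule Bochner_Integration.integral_cong[OF refl])
    fix x
    have "dist x (\<pi> x) = norm (n \<bullet> x - c, \<mu> \<bullet> x - c')"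
      using distsq[OF \<pi>A, of x x] by (simp add: norm_Pair real_sqrt_unique[symmetric] eq_commute[of "sqrt _"])
    then show "indicator ?S x * f (\<pi> x) = indicator (cball (0::real \<times> real) 1) (n \<bullet> x - c, \<mu> \<bullet> x - c') * \<Phi> x"
      by (auto simp: \<Phi>_def indicator_def)
  qed
  also have "\<dots> = pi * B"
    by (subst base) (auto simp: measure_def emeasure_cball unit_ball_vol_2)
  also have "B = (\<integral>x. indicator ({0..1} \<times> {0..1}) (n \<bullet> x - c, \<mu> \<bullet> x - c') * \<Phi> x \<partial>lborel)"
  proof (subst base)
    show "{0..1} \<times> {0..1} \<in> sets (borel :: (real \<times> real) measure)"
      by (intro borel_closed closed_Times) auto
    show "{0..1} \<times> {0..1} \<subseteq> cball (0::real \<times> real) 2"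
    proof safe
      fix a b :: real assume "a \<in> {0..1}" "b \<in> {0..1}"
      then have "norm (a, b) \<le> 2" using norm_Pair_le[of a b] by simp
      then show "(a, b) \<in> cball 0 2" by simp
    qed
    have "emeasure (lborel \<Otimes>\<^sub>M lborel) ({0..1::real} \<times> {0..1::real}) = 1"
      by (subst lborel.emeasure_pair_measure_Times) auto
    then show "B = measure lborel ({0..1::real} \<times> {0..1::real}) * B" by (simp add: measure_def lborel_prod)
  qed
  also have "\<dots> = (\<integral>x. slab (n \<bullet> x - c) * slab (\<mu> \<bullet> x - c') * \<Phi> x \<partial>lborel)"
    by (intro Bochner_Integration.integral_cong) (auto simp: indicator_def)
  finally show ?thesis by (simp add: \<Phi>_def \<pi>_def)
qed

end

section \<open>The divergence theorem in an edge direction\<close>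

lemma element_fibre_divergence:
  fixes f g :: "real^'n::finite \<Rightarrow> real"
  assumes d: "CARD('n) \<in> {2, 3}"
    and deriv: "\<And>x t. ((\<lambda>t. f (x + t *\<^sub>R u)) has_real_derivative g (x + t *\<^sub>R u)) (at t)"
    and cf: "continuous_on UNIV f" and cg: "continuous_on UNIV g"
    and ga: "ga \<bullet> u = 1" and gb: "gb \<bullet> u = -1"
    and Z: "\<And>x t. Z (x + t *\<^sub>R u) \<longleftrightarrow> Z x"
    and K: "K = {x. Z x \<and> 0 \<le> ga \<bullet> x + a0 \<and> 0 \<le> gb \<bullet> x + b0}" "compact K"
  shows "(LINT x:K|lebesgue. g x) = (LINT x:(K \<inter> {x. gb \<bullet> x + b0 = 0})|surface_measure. f x) / norm gb
     - (LINT x:(K \<inter> {x. ga \<bullet> x + a0 = 0})|surface_measure. f x) / norm ga"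
proof -
  have Kb: "K \<in> sets borel" using K(2) by (rule borel_compact)
  have nz: "ga \<noteq> 0" "gb \<noteq> 0" using ga gb by auto
  have [measurable]: "g \<in> borel_measurable borel" "K \<in> sets borel"
    using cg Kb by (auto intro: borel_measurable_continuous_onI)
  have "(LINT x:K|lebesgue. g x) = (\<integral>x. indicator K x * g x \<partial>lborel)"
    unfolding set_lebesgue_integral_def by (subst integral_completion) auto
  also have "\<dots> = flux gb b0 (\<lambda>x. indicator K x * f x) - flux ga a0 (\<lambda>x. indicator K x * f x)"
    using fibre_divergence[OF deriv cf cg ga gb Z K(1) Kb compact_imp_bounded[OF K(2)]] .
  finally show ?thesis using flux_eq_surface_integral[OF d _ K(2) cf] nz by simp
qed

text \<open>The face is thickened to a prism along \<open>n\<close> and \<open>f\<close> is replaced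
  by its values on the hyperplane of the face. The end caps of the prism are parallel to
  \<open>u\<close>, so only the two sides over the ridges contribute.\<close>

lemma face_fibre_divergence:
  fixes f g :: "real^'n::finite \<Rightarrow> real"
  assumes d: "CARD('n) \<in> {2, 3}"
    and deriv: "\<And>x t. ((\<lambda>t. f (x + t *\<^sub>R u)) has_real_derivative g (x + t *\<^sub>R u)) (at t)"
    and cf: "continuous_on UNIV f" and cg: "continuous_on UNIV g"
    and ga: "ga \<bullet> u = 1" and gb: "gb \<bullet> u = -1"
    and Z: "\<And>x t. Z (x + t *\<^sub>R u) \<longleftrightarrow> Z x"
    and n: "norm n = 1" "n \<bullet> u = 0" "n \<bullet> ga = 0" "n \<bullet> gb = 0"
    and F: "F = {x. n \<bullet> x = c \<and> Z x \<and> 0 \<le> ga \<bullet> x + a0 \<and> 0 \<le> gb \<bullet> x + b0}" "compact F"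
    and ea: "affine hull (F \<inter> {x. ga \<bullet> x + a0 = 0}) = {x. n \<bullet> x = c \<and> ga \<bullet> x + a0 = 0}" "F \<inter> {x. ga \<bullet> x + a0 = 0} \<noteq> {}"
    and eb: "affine hull (F \<inter> {x. gb \<bullet> x + b0 = 0}) = {x. n \<bullet> x = c \<and> gb \<bullet> x + b0 = 0}" "F \<inter> {x. gb \<bullet> x + b0 = 0} \<noteq> {}"
  shows "(LINT x:F|surface_measure. g x) = (\<integral>x. f x \<partial>ridge_measure (F \<inter> {x. gb \<bullet> x + b0 = 0})) / (pi * norm gb)
     - (\<integral>x. f x \<partial>ridge_measure (F \<inter> {x. ga \<bullet> x + a0 = 0})) / (pi * norm ga)"
proof -
  have nn: "n \<bullet> n = 1" using n(1) by (simp add: dot_square_norm)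
  define P where "P x = x - (n \<bullet> x - c) *\<^sub>R n" for x
  have Pn: "n \<bullet> P x = c" for x by (simp add: P_def inner_diff_right nn)
  have cP: "continuous_on UNIV P" unfolding P_def by (intro continuous_intros)
  have [measurable]: "P \<in> borel_measurable borel" using cP by (rule borel_measurable_continuous_onI)
  have Fb [measurable]: "F \<in> sets borel" using F(2) by (rule borel_compact)
  define Q where "Q = {x. 0 \<le> n \<bullet> x - c \<and> n \<bullet> x - c \<le> 1 \<and> P x \<in> F}"
  have Qb: "Q \<in> sets borel" unfolding Q_def by measurable
  have bQ: "bounded Q"
  proof -
    obtain R where R: "\<And>x. x \<in> F \<Longrightarrow> norm x \<le> R" using compact_imp_bounded[OF F(2)] by (auto simp: bounded_iff)
    show ?thesis
    proof (rule bounded_subset[of "cball 0 (R + 1)"], simp, rule subsetI)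
      fix x assume x: "x \<in> Q"
      have "norm x \<le> norm (P x) + norm ((n \<bullet> x - c) *\<^sub>R n)"
        by (metis P_def diff_add_cancel norm_triangle_ineq)
      also have "\<dots> \<le> R + 1" using x R n(1) by (intro add_mono) (auto simp: Q_def)
      finally show "x \<in> cball 0 (R + 1)" by simp
    qed
  qed
  have fm: "f \<in> borel_measurable borel" "g \<in> borel_measurable borel"
    using cf cg by (auto intro: borel_measurable_continuous_onI)
  have gP: "g' \<bullet> P x = g' \<bullet> x" if "n \<bullet> g' = 0" for g' x
    using that by (simp add: P_def inner_diff_right inner_commute)
  have Pu: "P (x + t *\<^sub>R u) = P x + t *\<^sub>R u" for x t
    by (simp add: P_def inner_add_right n(2))
  have fl: "flux g' c' (\<lambda>x. indicator Q x * f (P x)) = (\<integral>x. f x \<partial>ridge_measure (F \<inter> {x. g' \<bullet> x + c' = 0})) / (pi * norm g')"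
    if g': "g' \<noteq> 0" "n \<bullet> g' = 0" and aff: "affine hull (F \<inter> {x. g' \<bullet> x + c' = 0}) = {x. n \<bullet> x = c \<and> g' \<bullet> x + c' = 0}"
      and ne: "F \<inter> {x. g' \<bullet> x + c' = 0} \<noteq> {}" for g' c'
  proof -
    let ?e = "F \<inter> {x. g' \<bullet> x + c' = 0}"
    define \<mu> where "\<mu> = (- 1 / norm g') *\<^sub>R g'"
    have \<mu>: "norm \<mu> = 1" "n \<bullet> \<mu> = 0" using g' by (simp_all add: \<mu>_def)
    have pl: "\<mu> \<bullet> x - c' / norm g' = - (g' \<bullet> x + c') / norm g'" for x
      by (simp add: \<mu>_def add_divide_distrib diff_divide_distrib)
    have aff': "affine hull ?e = {x. n \<bullet> x = c \<and> \<mu> \<bullet> x = c' / norm g'}"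
    proof -
      have "\<mu> \<bullet> x = c' / norm g' \<longleftrightarrow> g' \<bullet> x + c' = 0" for x
        using pl[of x] g'(1) by (metis divide_eq_0_iff eq_iff_diff_eq_0 neg_equal_0_iff_equal norm_eq_zero)
      then show ?thesis unfolding aff by simp
    qed
    have "closed {x. g' \<bullet> x + c' = 0}" by (intro closed_Collect_eq continuous_intros)
    then have ce: "compact ?e" using F(2) by (rule compact_Int_closed[rotated])
    define R where "R x = x - ((g' \<bullet> x + c') / (g' \<bullet> g')) *\<^sub>R g'" for x
    have R': "R x = x - (\<mu> \<bullet> x - c' / norm g') *\<^sub>R \<mu>" for x
    proof -
      have "(- (g' \<bullet> x + c') / norm g') * (- 1 / norm g') = (g' \<bullet> x + c') / (g' \<bullet> g')"
        by (simp only: times_divide_times_eq dot_square_norm power2_eq_square)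
      then show ?thesis unfolding pl by (simp only: R_def \<mu>_def scaleR_scaleR)
    qed
    have nR: "n \<bullet> R x = n \<bullet> x" for x by (simp add: R' inner_diff_right \<mu>)
    have PR: "P (R x) = x - (n \<bullet> x - c) *\<^sub>R n - (\<mu> \<bullet> x - c' / norm g') *\<^sub>R \<mu>" for x
      unfolding P_def nR by (simp add: R')
    have gR: "g' \<bullet> P (R x) + c' = 0" for x
      using g' by (simp add: gP R_def inner_diff_right)
    have "flux g' c' (\<lambda>x. indicator Q x * f (P x)) = (\<integral>x. slab (\<mu> \<bullet> x - c' / norm g') * (indicator Q (R x) * f (P (R x))) \<partial>lborel) / norm g'"
      unfolding flux_def pl R_def ..
    also have "(\<integral>x. slab (\<mu> \<bullet> x - c' / norm g') * (indicator Q (R x) * f (P (R x))) \<partial>lborel)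
      = (\<integral>x. slab (n \<bullet> x - c) * slab (\<mu> \<bullet> x - c' / norm g') * (indicator ?e (P (R x)) * f (P (R x))) \<partial>lborel)"
      using gR by (intro Bochner_Integration.integral_cong) (auto simp: indicator_def Q_def nR)
    also have "\<dots> = (\<integral>x. f x \<partial>ridge_measure ?e) / pi"
      using ridge_integral_frame[OF ce ne n(1) \<mu>(1,2) aff' cf] by (simp add: PR)
    finally show ?thesis by simp
  qed
  have "(LINT x:F|surface_measure. g x) = (\<integral>x. slab (n \<bullet> x - c) * (indicator F (P x) * g (P x)) \<partial>lborel)"
    unfolding P_def using F(1) by (intro surface_integral_slab d n Fb fm) auto
  also have "\<dots> = (\<integral>x. indicator Q x * g (P x) \<partial>lborel)"
    by (intro Bochner_Integration.integral_cong) (auto simp: Q_def indicator_def)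
  also have "\<dots> = flux gb b0 (\<lambda>x. indicator Q x * f (P x)) - flux ga a0 (\<lambda>x. indicator Q x * f (P x))"
  proof (rule fibre_divergence[where u = u and Z = "\<lambda>x. 0 \<le> n \<bullet> x - c \<and> n \<bullet> x - c \<le> 1 \<and> Z (P x)"])
    show "((\<lambda>t. f (P (x + t *\<^sub>R u))) has_real_derivative g (P (x + t *\<^sub>R u))) (at t)" for x t
      using deriv[of "P x" t] by (simp add: Pu)
    show "continuous_on UNIV (\<lambda>x. f (P x))" "continuous_on UNIV (\<lambda>x. g (P x))"
      by (auto intro: continuous_on_compose2[OF cf cP] continuous_on_compose2[OF cg cP])
    show "Q = {x. (0 \<le> n \<bullet> x - c \<and> n \<bullet> x - c \<le> 1 \<and> Z (P x)) \<and> 0 \<le> ga \<bullet> x + a0 \<and> 0 \<le> gb \<bullet> x + b0}"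
      unfolding Q_def F(1) using n by (auto simp: gP Pn)
  qed (use ga gb n Qb bQ in \<open>auto simp: Pu Z inner_add_right\<close>)
  also have "flux gb b0 (\<lambda>x. indicator Q x * f (P x)) - flux ga a0 (\<lambda>x. indicator Q x * f (P x))
    = (\<integral>x. f x \<partial>ridge_measure (F \<inter> {x. gb \<bullet> x + b0 = 0})) / (pi * norm gb)
     - (\<integral>x. f x \<partial>ridge_measure (F \<inter> {x. ga \<bullet> x + a0 = 0})) / (pi * norm ga)"
  proof -
    have "ga \<noteq> 0" "gb \<noteq> 0" using ga gb by auto
    then show ?thesis using fl[OF _ n(3) ea] fl[OF _ n(4) eb] by simp
  qed
  finally show ?thesis .
qed

section \<open>Barycentric coordinates\<close>

text \<open>The linear subspace parallel to the affine hull.\<close>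

definition directions :: "'a::real_vector set \<Rightarrow> 'a set" where
  "directions W = span {x - y | x y. x \<in> W \<and> y \<in> W}"

text \<open>The gradient, within the affine hull of \<open>W\<close>, of the barycentric coordinate belonging to \<open>c\<close>.\<close>

definition bgrad :: "'a::euclidean_space set \<Rightarrow> 'a \<Rightarrow> 'a" where
  "bgrad W c = (SOME g. g \<in> directions W \<and> (\<forall>x\<in>W. \<forall>y\<in>W. g \<bullet> (x - y) = of_bool (x = c) - of_bool (y = c)))"

text \<open>Kept in the shape of a linear form plus a constant, which is that of the constraints in
  \<open>fibre_divergence\<close>.\<close>

definition bary :: "'a::euclidean_space set \<Rightarrow> 'a \<Rightarrow> 'a \<Rightarrow> real" where
  "bary W c x = bgrad W c \<bullet> x + (1 - bgrad W c \<bullet> c)"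

lemma subspace_directions: "subspace (directions W)"
  by (simp add: directions_def)

lemma directions_diff: "x \<in> W \<Longrightarrow> y \<in> W \<Longrightarrow> x - y \<in> directions W"
  unfolding directions_def by (rule span_base) auto

lemma directions_eqI:
  fixes g :: "'a::euclidean_space"
  assumes "g \<in> directions W" "g' \<in> directions W"
    and "\<And>x y. x \<in> W \<Longrightarrow> y \<in> W \<Longrightarrow> g \<bullet> (x - y) = g' \<bullet> (x - y)"
  shows "g = g'"
proof -
  have "orthogonal (g - g') (g - g')"
  proof (rule orthogonal_to_span)
    show "g - g' \<in> span {x - y | x y. x \<in> W \<and> y \<in> W}"
      using assms(1,2) by (simp add: directions_def span_diff)
    show "orthogonal (g - g') z" if "z \<in> {x - y | x y. x \<in> W \<and> y \<in> W}" for z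
      using that assms(3) by (auto simp: orthogonal_def inner_diff_left)
  qed
  then show ?thesis by (simp add: orthogonal_self)
qed

text \<open>By affine independence the required values on the edges from one vertex extend to a
  linear functional; its representing vector is projected orthogonally onto
  \<open>directions W\<close>.\<close>

lemma bgrad_exists:
  fixes W :: "'a::euclidean_space set"
  assumes W: "\<not> affine_dependent W"
  shows "\<exists>g. g \<in> directions W \<and> (\<forall>x\<in>W. \<forall>y\<in>W. g \<bullet> (x - y) = of_bool (x = c) - of_bool (y = c))"
proof (cases "W = {}")
  case True
  then show ?thesis by (auto simp: directions_def intro: exI[of _ 0])
next
  case False
  then obtain a where a: "a \<in> W" by auto
  let ?B = "(\<lambda>x. - a + x) ` (W - {a})"
  have ind: "independent ?B"
    using W affine_dependent_iff_dependent2[OF a] by (simp add: image_def)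
  define h :: "'a \<Rightarrow> real" where "h z = of_bool (a + z = c) - of_bool (a = c)" for z
  obtain f where f: "linear f" "\<And>z. z \<in> ?B \<Longrightarrow> f z = h z"
    using linear_independent_extend[OF ind, of h] by metis
  interpret f: linear f by fact
  have fa: "f (x - a) = of_bool (x = c) - of_bool (a = c)" if "x \<in> W" for x
  proof (cases "x = a")
    case False
    then have "- a + x \<in> ?B" using that by blast
    then show ?thesis using f(2)[of "- a + x"] by (simp add: h_def)
  qed (simp add: f.zero)
  define v where "v = adjoint f 1"
  have v: "v \<bullet> z = f z" for z
    using adjoint_works[OF f(1), of z 1] by (simp add: v_def inner_commute)
  obtain g z where gz: "g \<in> directions W" "\<And>w. w \<in> directions W \<Longrightarrow> orthogonal z w" "v = g + z"
    unfolding directions_def by (rule orthogonal_subspace_decomp_exists) blast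
  have "g \<bullet> (x - y) = of_bool (x = c) - of_bool (y = c)" if xy: "x \<in> W" "y \<in> W" for x y
  proof -
    have "z \<bullet> (x - y) = 0" using gz(2)[OF directions_diff[OF xy]] by (simp add: orthogonal_def)
    then have "g \<bullet> (x - y) = v \<bullet> (x - y)" by (simp add: gz(3) inner_add_left)
    also have "\<dots> = f ((x - a) - (y - a))" by (simp add: v)
    also have "\<dots> = f (x - a) - f (y - a)" by (rule f.diff)
    also have "\<dots> = of_bool (x = c) - of_bool (y = c)" unfolding fa[OF xy(1)] fa[OF xy(2)] by simp
    finally show ?thesis .
  qed
  then show ?thesis using gz(1) by blast
qed

locale affine_basis =
  fixes W :: "'a::euclidean_space set"
  assumes independent: "\<not> affine_dependent W"
begin

lemma finite: "finite W"
  using independent by (rule aff_independent_finite)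

lemma bgrad_mem: "bgrad W c \<in> directions W"
  and bgrad_inner: "x \<in> W \<Longrightarrow> y \<in> W \<Longrightarrow> bgrad W c \<bullet> (x - y) = of_bool (x = c) - of_bool (y = c)"
  using someI_ex[OF bgrad_exists[OF independent, of c]] unfolding bgrad_def by auto

lemma bgrad_unique:
  assumes "g \<in> directions W" "\<And>x y. x \<in> W \<Longrightarrow> y \<in> W \<Longrightarrow> g \<bullet> (x - y) = of_bool (x = c) - of_bool (y = c)"
  shows "g = bgrad W c"
  using assms by (intro directions_eqI[OF _ bgrad_mem]) (simp_all add: bgrad_inner)

lemma bary_diff: "bary W c x - bary W c y = bgrad W c \<bullet> (x - y)"
  by (simp add: bary_def inner_diff_right)

lemma bary_vertex: "c \<in> W \<Longrightarrow> x \<in> W \<Longrightarrow> bary W c x = of_bool (x = c)"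
  using bgrad_inner[of x c c] by (simp add: bary_def inner_diff_right)

lemma bary_affine_combination:
  assumes c: "c \<in> W" and u: "sum u W = 1" shows "bary W c (\<Sum>x\<in>W. u x *\<^sub>R x) = u c"
proof -
  have "bary W c (\<Sum>x\<in>W. u x *\<^sub>R x) = (\<Sum>x\<in>W. u x * (bgrad W c \<bullet> x)) + (\<Sum>x\<in>W. u x) * (1 - bgrad W c \<bullet> c)"
    by (simp add: bary_def inner_sum_right u)
  also have "\<dots> = (\<Sum>x\<in>W. u x * bary W c x)"
    by (simp add: bary_def sum_distrib_right sum.distrib[symmetric] distrib_left)
  also have "\<dots> = (\<Sum>x\<in>W. if x = c then u x else 0)"
    by (intro sum.cong) (auto simp: bary_vertex c)
  also have "\<dots> = u c" using c finite by simp
  finally show ?thesis .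
qed

lemma affine_hull_bary:
  assumes "x \<in> affine hull W"
  shows "(\<Sum>c\<in>W. bary W c x *\<^sub>R c) = x" "(\<Sum>c\<in>W. bary W c x) = 1"
proof -
  obtain u where u: "sum u W = 1" "(\<Sum>v\<in>W. u v *\<^sub>R v) = x"
    using assms by (auto simp: affine_hull_finite[OF finite])
  then have "bary W c x = u c" if "c \<in> W" for c
    using bary_affine_combination[OF that u(1)] by simp
  then show "(\<Sum>c\<in>W. bary W c x *\<^sub>R c) = x" "(\<Sum>c\<in>W. bary W c x) = 1"
    using u by simp_all
qed

lemma convex_hull_bary: "convex hull W = {x \<in> affine hull W. \<forall>c\<in>W. 0 \<le> bary W c x}"
proof (intro set_eqI iffI)
  fix x assume x: "x \<in> convex hull W"
  then obtain u where u: "\<forall>c\<in>W. 0 \<le> u c" "sum u W = 1" "(\<Sum>c\<in>W. u c *\<^sub>R c) = x"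
    by (auto simp: convex_hull_finite[OF finite])
  then have "bary W c x = u c" if "c \<in> W" for c
    using bary_affine_combination[OF that u(2)] by simp
  then show "x \<in> {x \<in> affine hull W. \<forall>c\<in>W. 0 \<le> bary W c x}"
    using u x convex_hull_subset_affine_hull by auto
next
  fix x assume "x \<in> {x \<in> affine hull W. \<forall>c\<in>W. 0 \<le> bary W c x}"
  then show "x \<in> convex hull W"
    using affine_hull_bary[of x] unfolding convex_hull_finite[OF finite]
    by (intro CollectI exI[of _ "\<lambda>c. bary W c x"]) auto
qed

text \<open>The linear counterpart of \<open>affine_hull_bary\<close>: a direction is a combination
  of vertices with total weight zero, and the gradients read off the weights.\<close>

lemma directions_expansion:
  assumes "z \<in> directions W"
  shows "(\<Sum>c\<in>W. (bgrad W c \<bullet> z) *\<^sub>R c) = z" "(\<Sum>c\<in>W. bgrad W c \<bullet> z) = 0"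
proof -
  have "\<exists>u. sum u W = 0 \<and> (\<Sum>x\<in>W. u x *\<^sub>R x) = z"
    using assms unfolding directions_def
  proof (induction rule: span_induct_alt)
    case base
    show ?case by (rule exI[of _ "\<lambda>_. 0"]) simp
  next
    case (step r d z)
    obtain x y u where *: "d = x - y" "x \<in> W" "y \<in> W" "sum u W = 0" "(\<Sum>x\<in>W. u x *\<^sub>R x) = z"
      using step by auto
    show ?case
    proof (intro exI conjI)
      let ?w = "\<lambda>v. r * (of_bool (v = x) - of_bool (v = y)) + u v"
      have 1: "(\<Sum>v\<in>W. of_bool (v = x) :: real) = 1" "(\<Sum>v\<in>W. of_bool (v = y) :: real) = 1"
        using * finite by (auto simp: of_bool_def)
      have 2: "(\<Sum>v\<in>W. of_bool (v = x) *\<^sub>R v) = x" "(\<Sum>v\<in>W. of_bool (v = y) *\<^sub>R v) = y"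
      proof -
        have "(\<Sum>v\<in>W. of_bool (v = w) *\<^sub>R v) = (\<Sum>v\<in>W. if v = w then v else 0)" for w
          by (intro sum.cong) auto
        then show "(\<Sum>v\<in>W. of_bool (v = x) *\<^sub>R v) = x" "(\<Sum>v\<in>W. of_bool (v = y) *\<^sub>R v) = y"
          using * finite by auto
      qed
      show "sum ?w W = 0"
        using * 1 by (simp add: sum.distrib sum_distrib_left[symmetric] sum_subtractf)
      show "(\<Sum>v\<in>W. ?w v *\<^sub>R v) = r *\<^sub>R d + z"
        using * 2 by (simp add: scaleR_add_left sum.distrib scaleR_scaleR[symmetric] scaleR_sum_right[symmetric] scaleR_diff_left sum_subtractf del: scaleR_scaleR)
    qed
  qed
  then obtain u where u: "sum u W = 0" "(\<Sum>x\<in>W. u x *\<^sub>R x) = z" by auto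
  have "bgrad W c \<bullet> z = u c" if c: "c \<in> W" for c
  proof -
    have "bgrad W c \<bullet> z = (\<Sum>x\<in>W. u x * (bgrad W c \<bullet> x))"
      by (simp add: u(2)[symmetric] inner_sum_right)
    also have "\<dots> = (\<Sum>x\<in>W. u x * (bgrad W c \<bullet> x)) + (\<Sum>x\<in>W. u x) * (1 - bgrad W c \<bullet> c)"
      using u(1) by simp
    also have "\<dots> = (\<Sum>x\<in>W. u x * bary W c x)"
      by (simp add: bary_def sum_distrib_right sum.distrib[symmetric] distrib_left)
    also have "\<dots> = (\<Sum>x\<in>W. if x = c then u x else 0)"
      by (intro sum.cong) (auto simp: bary_vertex c)
    also have "\<dots> = u c" using c finite by simp
    finally show ?thesis .
  qed
  then show "(\<Sum>c\<in>W. (bgrad W c \<bullet> z) *\<^sub>R c) = z" "(\<Sum>c\<in>W. bgrad W c \<bullet> z) = 0"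
    using u by simp_all
qed

lemma bgrad_nonzero:
  assumes "c \<in> W" "b \<in> W" "b \<noteq> c" shows "bgrad W c \<noteq> 0"
  using bgrad_inner[of c b c] assms by auto

lemma subset_basis: "W' \<subseteq> W \<Longrightarrow> affine_basis W'"
  using affine_dependent_subset[of W' W] independent unfolding affine_basis_def by blast

lemma directions_facet:
  assumes c: "c \<in> W"
  shows "directions (W - {c}) = {z \<in> directions W. bgrad W c \<bullet> z = 0}"
proof
  show "directions (W - {c}) \<subseteq> {z \<in> directions W. bgrad W c \<bullet> z = 0}"
    unfolding directions_def[of "W - {c}"]
  proof (rule span_minimal)
    show "subspace {z \<in> directions W. bgrad W c \<bullet> z = 0}"
      using subspace_directions[of W] by (auto simp: subspace_def inner_add_right)
    show "{x - y | x y. x \<in> W - {c} \<and> y \<in> W - {c}} \<subseteq> {z \<in> directions W. bgrad W c \<bullet> z = 0}"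
      using directions_diff bgrad_inner by auto
  qed
  show "{z \<in> directions W. bgrad W c \<bullet> z = 0} \<subseteq> directions (W - {c})"
  proof safe
    fix z assume z: "z \<in> directions W" "bgrad W c \<bullet> z = 0"
    have e: "(\<Sum>b\<in>W - {c}. (bgrad W b \<bullet> z) *\<^sub>R b) = z" "(\<Sum>b\<in>W - {c}. bgrad W b \<bullet> z) = 0"
      using directions_expansion[OF z(1)] z(2) by (simp_all add: sum.remove[OF finite c])
    show "z \<in> directions (W - {c})"
    proof (cases "W - {c} = {}")
      case True
      then have "z = 0" using e(1) by (metis sum.empty)
      then show ?thesis by (simp add: directions_def span_zero)
    next
      case False
      then obtain a where a: "a \<in> W - {c}" by auto
      have "z = (\<Sum>b\<in>W - {c}. (bgrad W b \<bullet> z) *\<^sub>R (b - a))"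
        using e by (simp add: scaleR_diff_right sum_subtractf scaleR_sum_left[symmetric])
      also have "\<dots> \<in> directions (W - {c})"
        by (intro subspace_sum subspace_directions subspace_scale directions_diff a) auto
      finally show ?thesis .
    qed
  qed
qed

lemma affine_hull_directions:
  assumes "a \<in> W" shows "x \<in> affine hull W \<longleftrightarrow> x - a \<in> directions W"
proof
  assume "x \<in> affine hull W"
  then have "x = (\<Sum>c\<in>W. bary W c x *\<^sub>R c)" "(\<Sum>c\<in>W. bary W c x) = 1" using affine_hull_bary by auto
  then have "x - a = (\<Sum>c\<in>W. bary W c x *\<^sub>R (c - a))"
    by (simp add: scaleR_diff_right sum_subtractf scaleR_sum_left[symmetric])
  also have "\<dots> \<in> directions W"
    by (intro subspace_sum subspace_directions subspace_scale directions_diff assms) auto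
  finally show "x - a \<in> directions W" .
next
  assume z: "x - a \<in> directions W"
  have "x = (\<Sum>c\<in>W. (bgrad W c \<bullet> (x - a) + of_bool (c = a)) *\<^sub>R c)"
  proof -
    have "(\<Sum>c\<in>W. of_bool (c = a) *\<^sub>R c) = (\<Sum>c\<in>W. if c = a then c else 0)"
      by (intro sum.cong) auto
    also have "\<dots> = a" using assms finite by simp
    finally show ?thesis using directions_expansion(1)[OF z] by (simp add: scaleR_add_left sum.distrib)
  qed
  moreover have "(\<Sum>c\<in>W. bgrad W c \<bullet> (x - a) + of_bool (c = a)) = 1"
    using directions_expansion(2)[OF z] assms finite by (simp add: sum.distrib of_bool_def)
  ultimately show "x \<in> affine hull W"
    unfolding affine_hull_finite[OF finite] by (intro CollectI exI conjI) (assumption, rule sym)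
qed

lemma affine_hull_facet:
  assumes c: "c \<in> W" and ne: "W - {c} \<noteq> {}"
  shows "affine hull (W - {c}) = {x \<in> affine hull W. bary W c x = 0}"
proof -
  obtain a where a: "a \<in> W" "a \<noteq> c" using ne by auto
  interpret F: affine_basis "W - {c}" by (rule subset_basis) auto
  have "bgrad W c \<bullet> (x - a) = bary W c x" for x
    using bary_diff[of c x a] bary_vertex[OF c a(1)] a by simp
  then show ?thesis
    using F.affine_hull_directions[of a] affine_hull_directions[of a] a directions_facet[OF c] by auto
qed

lemma convex_hull_facet:
  assumes c: "c \<in> W" and ne: "W - {c} \<noteq> {}"
  shows "convex hull (W - {c}) = convex hull W \<inter> {x. bary W c x = 0}"
proof
  show "convex hull (W - {c}) \<subseteq> convex hull W \<inter> {x. bary W c x = 0}"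
    using hull_mono[of "W - {c}" W convex] convex_hull_subset_affine_hull[of "W - {c}"] affine_hull_facet[OF assms] by auto
  show "convex hull W \<inter> {x. bary W c x = 0} \<subseteq> convex hull (W - {c})"
  proof safe
    fix x assume x: "x \<in> convex hull W" "bary W c x = 0"
    then have xa: "x \<in> affine hull W" "\<forall>b\<in>W. 0 \<le> bary W b x" by (auto simp: convex_hull_bary)
    have "(\<Sum>b\<in>W - {c}. bary W b x *\<^sub>R b) = x" "(\<Sum>b\<in>W - {c}. bary W b x) = 1"
      using affine_hull_bary[OF xa(1)] x(2) by (simp_all add: sum.remove[OF finite c])
    then show "x \<in> convex hull (W - {c})"
      using xa(2) finite by (subst convex_hull_finite) (auto intro!: exI[of _ "\<lambda>b. bary W b x"])
  qed
qed

text \<open>Subtracting the component along \<open>bgrad W c\<close> makes the vector tangential to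
  the facet and leaves its products with edges of the facet unchanged; uniqueness does the
  rest.\<close>

lemma bgrad_facet:
  assumes c: "c \<in> W" and b: "b \<in> W" "b \<noteq> c"
  shows "bgrad (W - {c}) b = bgrad W b - ((bgrad W b \<bullet> bgrad W c) / (bgrad W c \<bullet> bgrad W c)) *\<^sub>R bgrad W c"
    (is "_ = ?g")
proof -
  interpret F: affine_basis "W - {c}" by (rule subset_basis) auto
  have nz: "bgrad W c \<noteq> 0" using bgrad_nonzero[OF c b] .
  have "?g = bgrad (W - {c}) b"
  proof (rule F.bgrad_unique)
    show "?g \<in> directions (W - {c})"
      unfolding directions_facet[OF c]
      using nz by (auto simp: inner_diff_right inner_commute intro!: subspace_diff subspace_scale subspace_directions bgrad_mem)
    fix x y assume "x \<in> W - {c}" "y \<in> W - {c}"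
    then show "?g \<bullet> (x - y) = of_bool (x = b) - of_bool (y = b)"
      using bgrad_inner[of x y b] bgrad_inner[of x y c] by (simp add: inner_diff_left)
  qed
  then show ?thesis ..
qed

text \<open>Fibres give the divergence theorem only for the directions \<open>a - b\<close> of
  edges, where just two facets are crossed; \<open>I c\<close> is the scaled flux through the facet
  opposite \<open>c\<close>. Every direction is a combination of edges from one vertex, and
  linearity supplies the general formula.\<close>

lemma flux_from_edges:
  fixes L :: "'a \<Rightarrow> real" and I :: "'a \<Rightarrow> real"
  assumes L: "linear L" and edge: "\<And>a b. a \<in> W \<Longrightarrow> b \<in> W \<Longrightarrow> a \<noteq> b \<Longrightarrow> L (a - b) = I b - I a"
    and u: "u \<in> directions W"
  shows "L u = (\<Sum>c\<in>W. - (bgrad W c \<bullet> u) * I c)"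
proof (cases "W = {}")
  case True
  then have "u = 0" using u by (simp add: directions_def)
  then show ?thesis using True linear_0[OF L] by simp
next
  case False
  then obtain a where a: "a \<in> W" by auto
  have e: "(\<Sum>c\<in>W. (bgrad W c \<bullet> u) *\<^sub>R c) = u" "(\<Sum>c\<in>W. bgrad W c \<bullet> u) = 0"
    using directions_expansion[OF u] by auto
  have "u = (\<Sum>c\<in>W. (bgrad W c \<bullet> u) *\<^sub>R (c - a))"
    using e by (simp add: scaleR_diff_right sum_subtractf scaleR_sum_left[symmetric])
  then have "L u = (\<Sum>c\<in>W. (bgrad W c \<bullet> u) * L (c - a))"
    using linear_sum[OF L, of "\<lambda>c. (bgrad W c \<bullet> u) *\<^sub>R (c - a)" W] by (simp add: linear_scale[OF L])
  also have "\<dots> = (\<Sum>c\<in>W. (bgrad W c \<bullet> u) * (I a - I c))"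
  proof (intro sum.cong refl)
    fix c assume "c \<in> W"
    then show "(bgrad W c \<bullet> u) * L (c - a) = (bgrad W c \<bullet> u) * (I a - I c)"
      using edge[of c a] a linear_0[OF L] by (cases "c = a") auto
  qed
  also have "\<dots> = (\<Sum>c\<in>W. bgrad W c \<bullet> u) * I a + (\<Sum>c\<in>W. - (bgrad W c \<bullet> u) * I c)"
    by (simp add: right_diff_distrib sum_subtractf sum_distrib_right sum_negf)
  finally show ?thesis using e by simp
qed

end

locale full_simplex = affine_basis W for W :: "'a::euclidean_space set" +
  assumes card: "card W = DIM('a) + 1"
begin

lemma affine_hull_UNIV: "affine hull W = UNIV"
  using independent card by (intro affine_independent_span_eq) auto

lemma nonempty: "W \<noteq> {}"
  using card by auto

lemma directions_UNIV: "directions W = UNIV"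
proof -
  obtain a where a: "a \<in> W" using nonempty by auto
  have "z \<in> directions W" for z
    using affine_hull_directions[OF a, of "z + a"] affine_hull_UNIV by simp
  then show ?thesis by auto
qed

lemma other_vertex: "c \<in> W \<Longrightarrow> \<exists>b\<in>W. b \<noteq> c"
proof (rule ccontr)
  assume "c \<in> W" "\<not> (\<exists>b\<in>W. b \<noteq> c)"
  then have "W = {c}" by blast
  then have "card W = 1" by simp
  then show False using card by simp
qed

lemma bgrad_nz: "c \<in> W \<Longrightarrow> bgrad W c \<noteq> 0"
  using other_vertex bgrad_nonzero by blast

lemma facet_nonempty: "c \<in> W \<Longrightarrow> W - {c} \<noteq> {}"
  using other_vertex by blast

lemma hull_bary: "convex hull W = {x. \<forall>c\<in>W. 0 \<le> bary W c x}"
  by (simp add: convex_hull_bary affine_hull_UNIV)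

end

section \<open>Polynomials and integration by parts\<close>

lemma frechet_derivative_grad:
  fixes f :: "real^'n::finite \<Rightarrow> real"
  assumes "f differentiable (at x)"
  shows "frechet_derivative f (at x) h = grad f x \<bullet> h"
proof -
  interpret linear "frechet_derivative f (at x)" using assms by (rule linear_frechet_derivative)
  have "frechet_derivative f (at x) h = frechet_derivative f (at x) (\<Sum>i\<in>UNIV. (h $ i) *\<^sub>R axis i 1)"
    using basis_expansion[of h] by (simp only: scalar_mult_eq_scaleR)
  also have "\<dots> = grad f x \<bullet> h"
    by (simp add: sum scale grad_def partial_deriv_def inner_vec_def mult.commute)
  finally show ?thesis .
qed

lemma has_derivative_grad:
  fixes f :: "real^'n::finite \<Rightarrow> real"
  assumes "f differentiable (at x)"
  shows "(f has_derivative (\<lambda>h. grad f x \<bullet> h)) (at x)"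
  using assms frechet_derivative_works[of f "at x"] frechet_derivative_grad[OF assms] by (metis (no_types, lifting) ext)

lemma grad_eqI:
  fixes f :: "real^'n::finite \<Rightarrow> real"
  assumes "(f has_derivative (\<lambda>h. g \<bullet> h)) (at x)"
  shows "grad f x = g"
proof -
  have "frechet_derivative f (at x) = (\<lambda>h. g \<bullet> h)" using frechet_derivative_at[OF assms] by simp
  then show ?thesis by (simp add: vec_eq_iff grad_def partial_deriv_def inner_axis)
qed

lemma grad_nth: "grad f x $ i = partial_deriv i f x"
  by (simp add: grad_def)

definition c1 :: "(real^'n::finite \<Rightarrow> real) \<Rightarrow> bool" where
  "c1 f \<longleftrightarrow> (\<forall>x. f differentiable (at x)) \<and> (\<forall>i. continuous_on UNIV (partial_deriv i f))"

lemma c1_differentiable: "c1 f \<Longrightarrow> f differentiable (at x)"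
  and c1_partial: "c1 f \<Longrightarrow> continuous_on UNIV (partial_deriv i f)"
  by (simp_all add: c1_def)

lemma c1_continuous: "c1 f \<Longrightarrow> continuous_on UNIV f"
  by (intro continuous_at_imp_continuous_on ballI differentiable_imp_continuous_within c1_differentiable)

lemma c1_grad: "c1 f \<Longrightarrow> continuous_on UNIV (grad f)"
  unfolding grad_def[abs_def] by (intro continuous_on_vec_lambda c1_partial)

lemma c1_has_derivative: "c1 f \<Longrightarrow> (f has_derivative (\<lambda>h. grad f x \<bullet> h)) (at x)"
  by (intro has_derivative_grad c1_differentiable)

lemma c1I:
  assumes "\<And>x. (f has_derivative (\<lambda>h. g x \<bullet> h)) (at x)" "continuous_on UNIV g"
  shows "c1 f" "grad f x = g x"
proof -
  have g: "grad f = g" using grad_eqI[OF assms(1)] by auto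
  then show "grad f x = g x" by simp
  have "partial_deriv i f = (\<lambda>x. g x $ i)" for i using g by (auto simp: grad_nth[symmetric])
  then show "c1 f" unfolding c1_def
    using assms by (auto simp: differentiable_def intro!: continuous_intros)
qed

lemma c1_line:
  assumes "c1 f"
  shows "((\<lambda>t. f (x + t *\<^sub>R u)) has_real_derivative grad f (x + t *\<^sub>R u) \<bullet> u) (at t)"
proof -
  have "((\<lambda>t. f (x + t *\<^sub>R u)) has_derivative (\<lambda>s. grad f (x + t *\<^sub>R u) \<bullet> (s *\<^sub>R u))) (at t)"
    by (rule has_derivative_compose[OF _ c1_has_derivative[OF assms]]) (auto intro!: derivative_eq_intros)
  then show ?thesis by (simp add: has_field_derivative_def mult_commute_abs)
qed

lemma c1_add: assumes "c1 f" "c1 g" shows "c1 (\<lambda>x. f x + g x)" "grad (\<lambda>x. f x + g x) x = grad f x + grad g x"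
  by (rule c1I[where g = "\<lambda>x. grad f x + grad g x"]; use assms in \<open>auto intro!: derivative_eq_intros continuous_intros c1_has_derivative c1_grad simp: inner_add_left\<close>)+

lemma c1_diff: assumes "c1 f" "c1 g" shows "c1 (\<lambda>x. f x - g x)" "grad (\<lambda>x. f x - g x) x = grad f x - grad g x"
  by (rule c1I[where g = "\<lambda>x. grad f x - grad g x"]; use assms in \<open>auto intro!: derivative_eq_intros continuous_intros c1_has_derivative c1_grad simp: inner_diff_left\<close>)+

lemma c1_scale: assumes "c1 f" shows "c1 (\<lambda>x. r * f x)" "grad (\<lambda>x. r * f x) x = r *\<^sub>R grad f x"
  by (rule c1I[where g = "\<lambda>x. r *\<^sub>R grad f x"]; use assms in \<open>auto intro!: derivative_eq_intros continuous_intros c1_has_derivative c1_grad\<close>)+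

lemma c1_mult: assumes "c1 f" "c1 g" shows "c1 (\<lambda>x. f x * g x)" "grad (\<lambda>x. f x * g x) x = f x *\<^sub>R grad g x + g x *\<^sub>R grad f x"
  by (rule c1I[where g = "\<lambda>x. f x *\<^sub>R grad g x + g x *\<^sub>R grad f x"]; use assms in \<open>auto intro!: derivative_eq_intros continuous_intros c1_has_derivative c1_grad c1_continuous simp: inner_add_left\<close>)+

lemma c1_const: "c1 (\<lambda>x. r)" "grad (\<lambda>x. r) x = 0"
  by (rule c1I[where g = "\<lambda>x. 0"]; auto)+

lemma c1_sum:
  assumes "finite I" "\<And>i. i \<in> I \<Longrightarrow> c1 (f i)"
  shows "c1 (\<lambda>x. \<Sum>i\<in>I. f i x)" "grad (\<lambda>x. \<Sum>i\<in>I. f i x) x = (\<Sum>i\<in>I. grad (f i) x)"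
proof -
  have "c1 (\<lambda>x. \<Sum>i\<in>I. f i x) \<and> (\<forall>x. grad (\<lambda>x. \<Sum>i\<in>I. f i x) x = (\<Sum>i\<in>I. grad (f i) x))"
    using assms by (induction I) (auto simp: c1_const c1_add)
  then show "c1 (\<lambda>x. \<Sum>i\<in>I. f i x)" "grad (\<lambda>x. \<Sum>i\<in>I. f i x) x = (\<Sum>i\<in>I. grad (f i) x)" by auto
qed

section \<open>Polynomials in several variables\<close>

definition monomial :: "('n::finite \<Rightarrow> nat) \<Rightarrow> real^'n \<Rightarrow> real" where
  "monomial \<alpha> x = (\<Prod>i\<in>UNIV. (x $ i) ^ \<alpha> i)"

definition exponents :: "nat \<Rightarrow> ('n::finite \<Rightarrow> nat) set" where
  "exponents p = {\<alpha>. (\<Sum>i\<in>UNIV. \<alpha> i) \<le> p}"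

lemma polys_alt: "q \<in> polys p \<longleftrightarrow> (\<exists>c. q = (\<lambda>x. \<Sum>\<alpha>\<in>exponents p. c \<alpha> * monomial \<alpha> x))"
  unfolding polys_def exponents_def monomial_def by auto

lemma finite_exponents: "finite (exponents p :: ('n::finite \<Rightarrow> nat) set)"
proof (rule finite_subset)
  show "exponents p \<subseteq> {f :: 'n \<Rightarrow> nat. \<forall>i. (i \<in> UNIV \<longrightarrow> f i \<in> {..p}) \<and> (i \<notin> UNIV \<longrightarrow> f i = 0)}"
  proof
    fix \<alpha> :: "'n \<Rightarrow> nat" assume "\<alpha> \<in> exponents p"
    then have "\<alpha> i \<le> p" for i
      using member_le_sum[of i UNIV \<alpha>] by (simp add: exponents_def)
    then show "\<alpha> \<in> {f. \<forall>i. (i \<in> UNIV \<longrightarrow> f i \<in> {..p}) \<and> (i \<notin> UNIV \<longrightarrow> f i = 0)}" by simp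
  qed
  show "finite {f :: 'n \<Rightarrow> nat. \<forall>i. (i \<in> UNIV \<longrightarrow> f i \<in> {..p}) \<and> (i \<notin> UNIV \<longrightarrow> f i = 0)}"
    by (rule finite_set_of_finite_funs) auto
qed

lemma polys_monomial: "\<alpha> \<in> exponents p \<Longrightarrow> monomial \<alpha> \<in> polys p"
proof -
  assume \<alpha>: "\<alpha> \<in> exponents p"
  have "(\<Sum>\<beta>\<in>exponents p. of_bool (\<beta> = \<alpha>) * monomial \<beta> x) = (\<Sum>\<beta>\<in>exponents p. if \<beta> = \<alpha> then monomial \<beta> x else 0)" for x
    by (intro sum.cong) auto
  then have "monomial \<alpha> = (\<lambda>x. \<Sum>\<beta>\<in>exponents p. of_bool (\<beta> = \<alpha>) * monomial \<beta> x)"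
    using \<alpha> by (intro ext) (simp add: finite_exponents)
  then show ?thesis unfolding polys_alt by metis
qed

lemma polys_add: assumes "f \<in> polys p" "g \<in> polys p" shows "(\<lambda>x. f x + g x) \<in> polys p"
proof -
  obtain c d where "f = (\<lambda>x. \<Sum>\<alpha>\<in>exponents p. c \<alpha> * monomial \<alpha> x)" "g = (\<lambda>x. \<Sum>\<alpha>\<in>exponents p. d \<alpha> * monomial \<alpha> x)"
    using assms unfolding polys_alt by metis
  then show ?thesis unfolding polys_alt
    by (intro exI[of _ "\<lambda>\<alpha>. c \<alpha> + d \<alpha>"]) (simp add: distrib_right sum.distrib)
qed

lemma polys_scale: assumes "f \<in> polys p" shows "(\<lambda>x. r * f x) \<in> polys p"
proof -
  obtain c where "f = (\<lambda>x. \<Sum>\<alpha>\<in>exponents p. c \<alpha> * monomial \<alpha> x)"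
    using assms unfolding polys_alt by metis
  then show ?thesis unfolding polys_alt
    by (intro exI[of _ "\<lambda>\<alpha>. r * c \<alpha>"]) (simp add: sum_distrib_left mult.assoc)
qed

lemma polys_zero: "(\<lambda>x. 0) \<in> polys p"
  unfolding polys_alt by (rule exI[of _ "\<lambda>_. 0"]) simp

lemma polys_sum: "finite I \<Longrightarrow> (\<And>i. i \<in> I \<Longrightarrow> f i \<in> polys p) \<Longrightarrow> (\<lambda>x. \<Sum>i\<in>I. f i x) \<in> polys p"
  by (induction I rule: finite_induct) (auto intro: polys_add polys_zero)

lemma polys_diff: "f \<in> polys p \<Longrightarrow> g \<in> polys p \<Longrightarrow> (\<lambda>x. f x - g x) \<in> polys p"
  using polys_add[OF _ polys_scale[of g p "-1"], of f] by simp

lemma polys_mono: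
  assumes "p \<le> p'" "q \<in> polys p" shows "q \<in> polys p'"
proof -
  obtain c where c: "q = (\<lambda>x. \<Sum>\<alpha>\<in>exponents p. c \<alpha> * monomial \<alpha> x)"
    using assms(2) unfolding polys_alt by metis
  show ?thesis unfolding c
    using assms(1) by (intro polys_sum finite_exponents polys_scale polys_monomial) (auto simp: exponents_def)
qed

text \<open>For \<open>\<alpha> i = 0\<close> truncated subtraction leaves \<alpha> unchanged; the
  derivative of the monomial is still right because its coefficient \<open>real (\<alpha> i)\<close>
  vanishes.\<close>

definition lower :: "'n \<Rightarrow> ('n \<Rightarrow> nat) \<Rightarrow> 'n \<Rightarrow> nat" where
  "lower i \<alpha> = \<alpha>(i := \<alpha> i - 1)"

lemma lower_exponents: "\<alpha> \<in> exponents p \<Longrightarrow> lower i \<alpha> \<in> exponents p"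
proof -
  assume "\<alpha> \<in> exponents p"
  moreover have "(\<Sum>j\<in>UNIV. lower i \<alpha> j) \<le> (\<Sum>j\<in>UNIV. \<alpha> j)"
    by (rule sum_mono) (simp add: lower_def)
  ultimately show ?thesis by (simp add: exponents_def)
qed

lemma monomial_derivative:
  fixes \<alpha> :: "'n::finite \<Rightarrow> nat"
  shows "(monomial \<alpha> has_derivative (\<lambda>h. (\<chi> i. real (\<alpha> i) * monomial (lower i \<alpha>) x) \<bullet> h)) (at x)"
proof -
  have "((\<lambda>x. \<Prod>i\<in>UNIV. (x $ i) ^ \<alpha> i) has_derivative
      (\<lambda>h. \<Sum>i\<in>UNIV. (real (\<alpha> i) * (h $ i) * (x $ i) ^ (\<alpha> i - 1)) * (\<Prod>j\<in>UNIV - {i}. (x $ j) ^ \<alpha> j))) (at x)"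
    by (rule has_derivative_prod) (auto intro!: derivative_eq_intros bounded_linear.has_derivative[OF bounded_linear_vec_nth] simp: mult_ac)
  moreover have "(x $ i) ^ (\<alpha> i - 1) * (\<Prod>j\<in>UNIV - {i}. (x $ j) ^ \<alpha> j) = monomial (lower i \<alpha>) x" for i
  proof -
    have "monomial (lower i \<alpha>) x = (x $ i) ^ lower i \<alpha> i * (\<Prod>j\<in>UNIV - {i}. (x $ j) ^ lower i \<alpha> j)"
      unfolding monomial_def by (rule prod.remove) auto
    also have "(\<Prod>j\<in>UNIV - {i}. (x $ j) ^ lower i \<alpha> j) = (\<Prod>j\<in>UNIV - {i}. (x $ j) ^ \<alpha> j)"
      by (rule prod.cong) (auto simp: lower_def)
    finally show ?thesis unfolding lower_def by (simp only: fun_upd_same)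
  qed
  ultimately have "((\<lambda>x. \<Prod>i\<in>UNIV. (x $ i) ^ \<alpha> i) has_derivative
      (\<lambda>h. \<Sum>i\<in>UNIV. real (\<alpha> i) * (h $ i) * monomial (lower i \<alpha>) x)) (at x)"
    by (simp add: mult.assoc)
  then show ?thesis
    by (simp add: monomial_def[abs_def] inner_vec_def mult_ac)
qed

lemma continuous_monomial: "continuous_on S (monomial \<alpha>)"
  unfolding monomial_def[abs_def] by (intro continuous_intros)

lemma c1_monomial: "c1 (monomial \<alpha>)" "partial_deriv i (monomial \<alpha>) x = real (\<alpha> i) * monomial (lower i \<alpha>) x"
proof -
  have c: "continuous_on UNIV (\<lambda>x. \<chi> i. real (\<alpha> i) * monomial (lower i \<alpha>) x)"
    by (intro continuous_on_vec_lambda continuous_intros continuous_monomial)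
  show "c1 (monomial \<alpha>)" by (rule c1I(1)[OF monomial_derivative c])
  have "grad (monomial \<alpha>) x = (\<chi> i. real (\<alpha> i) * monomial (lower i \<alpha>) x)"
    by (rule c1I(2)[OF monomial_derivative c])
  then show "partial_deriv i (monomial \<alpha>) x = real (\<alpha> i) * monomial (lower i \<alpha>) x"
    by (simp add: grad_nth[symmetric])
qed

lemma polys_c1:
  assumes "q \<in> polys p" shows "c1 q" "partial_deriv i q \<in> polys p"
    "partial_deriv i (partial_deriv j q) = partial_deriv j (partial_deriv i q)"
proof -
  obtain c where q: "q = (\<lambda>x. \<Sum>\<alpha>\<in>exponents p. c \<alpha> * monomial \<alpha> x)"
    using assms unfolding polys_alt by metis
  \<comment> \<open>The map \<open>m\<close> on exponents is general because the second derivative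
    applies the formula to a sum whose exponents have already been lowered.\<close>
  have lin: "c1 (\<lambda>x. \<Sum>\<alpha>\<in>exponents p. d \<alpha> * monomial (m \<alpha>) x)"
    "partial_deriv i (\<lambda>x. \<Sum>\<alpha>\<in>exponents p. d \<alpha> * monomial (m \<alpha>) x) = (\<lambda>x. \<Sum>\<alpha>\<in>exponents p. d \<alpha> * real (m \<alpha> i) * monomial (lower i (m \<alpha>)) x)"
    for d and m :: "('a \<Rightarrow> nat) \<Rightarrow> ('a \<Rightarrow> nat)" and i
  proof -
    have 1: "c1 (\<lambda>x. d \<alpha> * monomial (m \<alpha>) x)" for \<alpha> by (intro c1_scale c1_monomial)
    show "c1 (\<lambda>x. \<Sum>\<alpha>\<in>exponents p. d \<alpha> * monomial (m \<alpha>) x)"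
      by (intro c1_sum finite_exponents 1)
    show "partial_deriv i (\<lambda>x. \<Sum>\<alpha>\<in>exponents p. d \<alpha> * monomial (m \<alpha>) x) = (\<lambda>x. \<Sum>\<alpha>\<in>exponents p. d \<alpha> * real (m \<alpha> i) * monomial (lower i (m \<alpha>)) x)"
      by (rule ext) (simp add: grad_nth[symmetric] c1_sum(2)[OF finite_exponents 1] c1_scale(2)[OF c1_monomial(1)],
          simp add: grad_nth c1_monomial mult.assoc)
  qed
  show "c1 q" unfolding q using lin(1)[of c "\<lambda>\<alpha>. \<alpha>"] by simp
  have pd: "partial_deriv i q = (\<lambda>x. \<Sum>\<alpha>\<in>exponents p. c \<alpha> * real (\<alpha> i) * monomial (lower i \<alpha>) x)" for i
    unfolding q using lin(2)[of i c "\<lambda>\<alpha>. \<alpha>"] by simp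
  show "partial_deriv i q \<in> polys p"
    unfolding pd by (intro polys_sum finite_exponents polys_scale polys_monomial lower_exponents)
  have pd2: "partial_deriv i (partial_deriv j q) = (\<lambda>x. \<Sum>\<alpha>\<in>exponents p. c \<alpha> * real (\<alpha> j) * real (lower j \<alpha> i) * monomial (lower i (lower j \<alpha>)) x)" for i j
    unfolding pd[of j] using lin(2)[of i "\<lambda>\<alpha>. c \<alpha> * real (\<alpha> j)" "lower j"] by simp
  show "partial_deriv i (partial_deriv j q) = partial_deriv j (partial_deriv i q)"
  proof (cases "i = j")
    case False
    then have "lower i (lower j \<alpha>) = lower j (lower i \<alpha>)" "lower j \<alpha> i = \<alpha> i" "lower i \<alpha> j = \<alpha> j" for \<alpha> :: "'a \<Rightarrow> nat"
      by (auto simp: lower_def fun_upd_twist)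
    then show ?thesis unfolding pd2 by (simp add: mult_ac)
  qed simp
qed

text \<open>Inverse and trace inequalities rest on this: on a fibre only polynomials of degree at
  most \<open>p\<close> in one variable occur.\<close>

lemma polys_line:
  assumes "q \<in> polys p"
  obtains P :: "real poly" where "degree P \<le> p" "\<And>t. q (x + t *\<^sub>R u) = poly P t"
proof -
  obtain c where q: "q = (\<lambda>x. \<Sum>\<alpha>\<in>exponents p. c \<alpha> * monomial \<alpha> x)"
    using assms unfolding polys_alt by metis
  define M where "M \<alpha> = (\<Prod>i\<in>UNIV. [:x $ i, u $ i:] ^ \<alpha> i)" for \<alpha>
  show thesis
  proof
    show "degree (\<Sum>\<alpha>\<in>exponents p. smult (c \<alpha>) (M \<alpha>)) \<le> p"
    proof (rule degree_sum_le[OF finite_exponents])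
      fix \<alpha> :: "'a \<Rightarrow> nat" assume \<alpha>: "\<alpha> \<in> exponents p"
      have "degree (M \<alpha>) \<le> (\<Sum>i\<in>UNIV. degree ([:x $ i, u $ i:] ^ \<alpha> i))"
        unfolding M_def by (rule order_trans[OF degree_prod_sum_le]) auto
      also have "\<dots> \<le> (\<Sum>i\<in>UNIV. \<alpha> i)"
      proof (rule sum_mono)
        fix i
        have "degree ([:x $ i, u $ i:] ^ \<alpha> i) \<le> degree [:x $ i, u $ i:] * \<alpha> i" by (rule degree_power_le)
        also have "\<dots> \<le> \<alpha> i" by simp
        finally show "degree ([:x $ i, u $ i:] ^ \<alpha> i) \<le> \<alpha> i" .
      qed
      also have "\<dots> \<le> p" using \<alpha> by (simp add: exponents_def)
      finally show "degree (smult (c \<alpha>) (M \<alpha>)) \<le> p" using degree_smult_le order_trans by blast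
    qed
    show "q (x + t *\<^sub>R u) = poly (\<Sum>\<alpha>\<in>exponents p. smult (c \<alpha>) (M \<alpha>)) t" for t
      by (simp add: q poly_sum M_def poly_prod monomial_def)
  qed
qed

section \<open>Divergence theorems on elements and faces\<close>

lemma sets_surface_measure [simp, measurable_cong]: "sets surface_measure = sets borel"
  by (simp add: surface_measure_def)

lemma emeasure_surface_finite:
  fixes F :: "(real^'n::finite) set"
  assumes "CARD('n) \<in> {2, 3}" "compact F" "F \<subseteq> {x. n \<bullet> x = c}" "norm n = 1"
  shows "emeasure surface_measure F < \<infinity>"
proof (cases "F = {}")
  case False
  have "emeasure surface_measure F \<le> ennreal (unit_ball_vol (CARD('n) - 1) * (diameter F / 2) ^ (CARD('n) - 1))"
    using assms False by (intro surface_measure_hyperplane(2)[where \<nu> = n and c = c]) (auto simp: borel_compact compact_imp_bounded)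
  then show ?thesis by (simp add: le_less_trans)
qed simp

lemma surface_integrable:
  fixes F :: "(real^'n::finite) set" and f :: "real^'n \<Rightarrow> real"
  assumes "CARD('n) \<in> {2, 3}" "compact F" "F \<subseteq> {x. n \<bullet> x = c}" "norm n = 1" "continuous_on UNIV f"
  shows "set_integrable surface_measure F f"
proof -
  have "compact (f ` F)"
    using assms(2,5) by (intro compact_continuous_image) (auto intro: continuous_on_subset)
  then obtain M where M: "\<And>x. x \<in> F \<Longrightarrow> \<bar>f x\<bar> \<le> M"
    using compact_imp_bounded by (force simp: bounded_real)
  show ?thesis
    unfolding set_integrable_def
  proof (rule integrableI_bounded_set_indicator)
    show "f \<in> borel_measurable surface_measure"
      using borel_measurable_continuous_onI[OF assms(5)] by (simp cong: measurable_cong_sets)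
    show "AE x in surface_measure. x \<in> F \<longrightarrow> norm (f x) \<le> M" using M by auto
  qed (use assms emeasure_surface_finite[OF assms(1-4)] in \<open>auto simp: borel_compact\<close>)
qed

text \<open>The unit normal, within the affine hull of \<open>W\<close>, to the facet opposite
  \<open>c\<close>; it points outwards because the barycentric coordinate of \<open>c\<close>
  decreases towards that facet. For an element this is a face normal, for a face the conormal of a
  ridge.\<close>

definition outer :: "'a::euclidean_space set \<Rightarrow> 'a \<Rightarrow> 'a" where
  "outer W c = - (1 / norm (bgrad W c)) *\<^sub>R bgrad W c"

lemma continuous_grad_inner: "c1 f \<Longrightarrow> continuous_on UNIV (\<lambda>x. grad f x \<bullet> u)"
  by (intro continuous_intros c1_grad)

lemma lebesgue_set_integrable:
  fixes f :: "'a::euclidean_space \<Rightarrow> real"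
  assumes "compact K" "continuous_on UNIV f"
  shows "set_integrable lebesgue K f"
proof -
  have "integrable lborel (\<lambda>x. indicator K x *\<^sub>R f x)"
    using assms by (intro borel_integrable_compact) (auto intro: continuous_on_subset)
  then show ?thesis
    unfolding set_integrable_def using integrable_completion[OF borel_measurable_integrable] by blast
qed

lemma element_divergence:
  fixes V :: "(real^'n::finite) set" and f :: "real^'n \<Rightarrow> real"
  assumes d: "CARD('n) \<in> {2, 3}" and V: "full_simplex V" and f: "c1 f"
  shows "(LINT x:convex hull V|lebesgue. grad f x \<bullet> u) = (\<Sum>c\<in>V. (outer V c \<bullet> u) * (LINT x:convex hull (V - {c})|surface_measure. f x))"
proof -
  interpret full_simplex V by fact
  have K: "compact (convex hull V)" using finite by (rule finite_imp_compact_convex_hull)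
  define L where "L u = (LINT x:convex hull V|lebesgue. grad f x \<bullet> u)" for u
  define I where "I c = (LINT x:convex hull (V - {c})|surface_measure. f x) / norm (bgrad V c)" for c
  have int: "set_integrable lebesgue (convex hull V) (\<lambda>x. grad f x \<bullet> u)" for u
    by (intro lebesgue_set_integrable K continuous_grad_inner f)
  have "linear L"
    unfolding L_def by (intro linearI) (simp_all add: inner_add_right set_integral_add int set_integral_mult_right)
  moreover have "L (a - b) = I b - I a" if ab: "a \<in> V" "b \<in> V" "a \<noteq> b" for a b
  proof -
    \<comment> \<open>The constraints of the other vertices are constant along the edge direction,
      since their barycentric coordinates agree at \<open>a\<close> and \<open>b\<close>.\<close>
    let ?Z = "\<lambda>x. \<forall>c\<in>V - {a, b}. 0 \<le> bary V c x"
    have "(LINT x:convex hull V|lebesgue. grad f x \<bullet> (a - b))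
       = (LINT x:(convex hull V \<inter> {x. bgrad V b \<bullet> x + (1 - bgrad V b \<bullet> b) = 0})|surface_measure. f x) / norm (bgrad V b)
       - (LINT x:(convex hull V \<inter> {x. bgrad V a \<bullet> x + (1 - bgrad V a \<bullet> a) = 0})|surface_measure. f x) / norm (bgrad V a)"
    proof (rule element_fibre_divergence[where Z = ?Z, OF d c1_line[OF f] c1_continuous[OF f] continuous_grad_inner[OF f]])
      show "bgrad V a \<bullet> (a - b) = 1" "bgrad V b \<bullet> (a - b) = - 1"
        using bgrad_inner[OF ab(1,2)] ab(3) by auto
      show "?Z (x + t *\<^sub>R (a - b)) \<longleftrightarrow> ?Z x" for x t
      proof -
        have "bary V c (x + t *\<^sub>R (a - b)) = bary V c x" if "c \<in> V - {a, b}" for c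
          using bgrad_inner[OF ab(1,2), of c] that by (auto simp: bary_def inner_add_right)
        then show ?thesis by simp
      qed
      show "convex hull V = {x. ?Z x \<and> 0 \<le> bgrad V a \<bullet> x + (1 - bgrad V a \<bullet> a) \<and> 0 \<le> bgrad V b \<bullet> x + (1 - bgrad V b \<bullet> b)}"
        unfolding hull_bary using ab by (auto simp: bary_def)
    qed (rule K)
    then show ?thesis
      using convex_hull_facet[OF ab(1) facet_nonempty[OF ab(1)]] convex_hull_facet[OF ab(2) facet_nonempty[OF ab(2)]]
      by (simp add: L_def I_def bary_def)
  qed
  ultimately have "L u = (\<Sum>c\<in>V. - (bgrad V c \<bullet> u) * I c)"
    by (intro flux_from_edges) (auto simp: directions_UNIV)
  then show ?thesis by (simp add: L_def I_def outer_def)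
qed

lemma face_divergence:
  fixes W :: "(real^'n::finite) set" and f :: "real^'n \<Rightarrow> real"
  assumes d: "CARD('n) \<in> {2, 3}" and W: "affine_basis W" and cW: "card W = CARD('n)"
    and n: "norm n = 1" "affine hull W = {x. n \<bullet> x = k}" and nu: "n \<bullet> u = 0" and f: "c1 f"
  shows "(LINT x:convex hull W|surface_measure. grad f x \<bullet> u) = (\<Sum>c\<in>W. (outer W c \<bullet> u) * ((\<integral>x. f x \<partial>ridge_measure (convex hull (W - {c}))) / pi))"
proof -
  interpret affine_basis W by fact
  have K: "compact (convex hull W)" using finite by (rule finite_imp_compact_convex_hull)
  have sub: "convex hull W \<subseteq> {x. n \<bullet> x = k}" using convex_hull_subset_affine_hull n(2) by blast
  have ne: "W - {c} \<noteq> {}" if "c \<in> W" for c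
  proof
    assume "W - {c} = {}"
    then have "W = {c}" using that by blast
    then have "card W = 1" by simp
    then show False using cW d by auto
  qed
  have nd: "n \<bullet> z = 0 \<longleftrightarrow> z \<in> directions W" for z
  proof -
    obtain a where a: "a \<in> W" using ne cW d by fastforce
    have "n \<bullet> a = k" using n(2) hull_inc[OF a, of affine] by auto
    then show ?thesis
      using affine_hull_directions[OF a, of "z + a"] n(2) by (simp add: inner_add_right)
  qed
  define L where "L u = (LINT x:convex hull W|surface_measure. grad f x \<bullet> u)" for u
  define I where "I c = (\<integral>x. f x \<partial>ridge_measure (convex hull (W - {c}))) / (pi * norm (bgrad W c))" for c
  have int: "set_integrable surface_measure (convex hull W) (\<lambda>x. grad f x \<bullet> u)" for u
    by (rule surface_integrable[OF d K sub n(1) continuous_grad_inner[OF f]])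
  have "linear L"
    unfolding L_def by (intro linearI) (simp_all add: inner_add_right set_integral_add int set_integral_mult_right)
  moreover have "L (a - b) = I b - I a" if ab: "a \<in> W" "b \<in> W" "a \<noteq> b" for a b
  proof -
    let ?Z = "\<lambda>x. \<forall>c\<in>W - {a, b}. 0 \<le> bary W c x"
    have e: "convex hull W \<inter> {x. bgrad W c \<bullet> x + (1 - bgrad W c \<bullet> c) = 0} = convex hull (W - {c})" if "c \<in> W" for c
      using convex_hull_facet[OF that ne[OF that]] by (simp add: bary_def)
    have aff: "affine hull (convex hull (W - {c})) = {x. n \<bullet> x = k \<and> bgrad W c \<bullet> x + (1 - bgrad W c \<bullet> c) = 0}" if "c \<in> W" for c
      using affine_hull_facet[OF that ne[OF that]] n(2) by (simp add: affine_hull_convex_hull bary_def)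
    have ne': "convex hull (W - {c}) \<noteq> {}" if "c \<in> W" for c
      using ne[OF that] by simp
    have "(LINT x:convex hull W|surface_measure. grad f x \<bullet> (a - b))
       = (\<integral>x. f x \<partial>ridge_measure (convex hull W \<inter> {x. bgrad W b \<bullet> x + (1 - bgrad W b \<bullet> b) = 0})) / (pi * norm (bgrad W b))
       - (\<integral>x. f x \<partial>ridge_measure (convex hull W \<inter> {x. bgrad W a \<bullet> x + (1 - bgrad W a \<bullet> a) = 0})) / (pi * norm (bgrad W a))"
    proof (rule face_fibre_divergence[where Z = ?Z and n = n and c = k, OF d c1_line[OF f] c1_continuous[OF f] continuous_grad_inner[OF f]])
      show "bgrad W a \<bullet> (a - b) = 1" "bgrad W b \<bullet> (a - b) = - 1"
        using bgrad_inner[OF ab(1,2)] ab(3) by auto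
      show "?Z (x + t *\<^sub>R (a - b)) \<longleftrightarrow> ?Z x" for x t
      proof -
        have "bary W c (x + t *\<^sub>R (a - b)) = bary W c x" if "c \<in> W - {a, b}" for c
          using bgrad_inner[OF ab(1,2), of c] that by (auto simp: bary_def inner_add_right)
        then show ?thesis by simp
      qed
      show "convex hull W = {x. n \<bullet> x = k \<and> ?Z x \<and> 0 \<le> bgrad W a \<bullet> x + (1 - bgrad W a \<bullet> a) \<and> 0 \<le> bgrad W b \<bullet> x + (1 - bgrad W b \<bullet> b)}"
        unfolding convex_hull_bary n(2) using ab by (auto simp: bary_def)
      show "n \<bullet> (a - b) = 0" using nd directions_diff[OF ab(1,2)] by simp
      show "n \<bullet> bgrad W a = 0" "n \<bullet> bgrad W b = 0" using nd bgrad_mem by auto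
    qed (use n(1) K e[OF ab(1)] e[OF ab(2)] aff[OF ab(1)] aff[OF ab(2)] ne'[OF ab(1)] ne'[OF ab(2)] in auto)
    then show ?thesis unfolding e[OF ab(1)] e[OF ab(2)] by (simp add: L_def I_def)
  qed
  ultimately have "L u = (\<Sum>c\<in>W. - (bgrad W c \<bullet> u) * I c)"
    using nu nd by (intro flux_from_edges) auto
  then show ?thesis by (simp add: L_def I_def outer_def mult_ac)
qed

lemma polys_grad_inner:
  assumes q: "q \<in> polys p"
  shows "(\<lambda>y. grad q y \<bullet> z) \<in> polys p" "c1 (\<lambda>y. grad q y \<bullet> z)"
    "grad (\<lambda>y. grad q y \<bullet> z) x = hessian q x *v z"
proof -
  have eq: "(\<lambda>y. grad q y \<bullet> z) = (\<lambda>y. \<Sum>j\<in>UNIV. z $ j * partial_deriv j q y)"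
    by (auto simp: inner_vec_def grad_nth mult.commute)
  have c: "c1 (\<lambda>y. z $ j * partial_deriv j q y)" for j
    by (intro c1_scale polys_c1(1)[OF polys_c1(2)[OF q]])
  show "(\<lambda>y. grad q y \<bullet> z) \<in> polys p"
    unfolding eq by (intro polys_sum polys_scale polys_c1(2) q) auto
  show "c1 (\<lambda>y. grad q y \<bullet> z)"
    unfolding eq by (intro c1_sum c) auto
  show "grad (\<lambda>y. grad q y \<bullet> z) x = hessian q x *v z"
    unfolding eq c1_sum(2)[OF finite_class.finite_UNIV c] c1_scale(2)[OF polys_c1(1)[OF polys_c1(2)[OF q]]]
    by (simp add: vec_eq_iff matrix_vector_mult_def hessian_def grad_nth mult.commute)
qed

lemma hessian_nth: "hessian q x $ i $ j = partial_deriv i (partial_deriv j q) x"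
  by (simp add: hessian_def)

lemma laplacian_sum: "laplacian q x = (\<Sum>i\<in>UNIV. hessian q x $ i $ i)"
  by (simp add: laplacian_def divergence_def grad_nth hessian_nth)

lemma hessian_symmetric: "q \<in> polys p \<Longrightarrow> y \<bullet> (hessian q x *v z) = z \<bullet> (hessian q x *v y)"
proof -
  assume q: "q \<in> polys p"
  have "y \<bullet> (hessian q x *v z) = (\<Sum>i\<in>UNIV. \<Sum>j\<in>UNIV. y $ i * hessian q x $ i $ j * z $ j)"
    by (simp add: inner_vec_def matrix_vector_mult_def sum_distrib_left mult.assoc)
  also have "\<dots> = (\<Sum>j\<in>UNIV. \<Sum>i\<in>UNIV. y $ i * hessian q x $ i $ j * z $ j)" by (rule sum.swap)
  also have "\<dots> = (\<Sum>j\<in>UNIV. \<Sum>i\<in>UNIV. z $ j * hessian q x $ j $ i * y $ i)"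
    using polys_c1(3)[OF q] by (simp add: hessian_nth mult_ac)
  also have "\<dots> = z \<bullet> (hessian q x *v y)"
    by (simp add: inner_vec_def matrix_vector_mult_def sum_distrib_left mult.assoc)
  finally show ?thesis .
qed

section \<open>Integration by parts on an element\<close>

text \<open>The component along \<nu> of the field
  \<open>hessian w *v grad v - laplacian w *\<^sub>R grad v\<close>, whose divergence is the volume
  integrand of \<open>S_form\<close>.\<close>

definition parts_form :: "real^'n::finite \<Rightarrow> (real^'n \<Rightarrow> real) \<Rightarrow> (real^'n \<Rightarrow> real) \<Rightarrow> real^'n \<Rightarrow> real" where
  "parts_form \<nu> w v x = grad v x \<bullet> (hessian w x *v \<nu>) - laplacian w x * (grad v x \<bullet> \<nu>)"

text \<open>The third derivatives of \<open>w\<close> in the divergence of the field \<open>Y\<close> cancel.\<close>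

lemma element_parts:
  fixes V :: "(real^'n::finite) set"
  assumes d: "CARD('n) \<in> {2, 3}" and V: "full_simplex V" and w: "w \<in> polys p" and v: "v \<in> polys p"
  shows "(LINT x:convex hull V|lebesgue. hessian w x \<bullet> hessian v x - laplacian w x * laplacian v x)
    = (\<Sum>c\<in>V. LINT x:convex hull (V - {c})|surface_measure. parts_form (outer V c) w v x)"
proof -
  interpret full_simplex V by fact
  let ?w2 = "\<lambda>i j. partial_deriv i (partial_deriv j w)"
  define Y where "Y i x = (\<Sum>j\<in>UNIV. ?w2 i j x * partial_deriv j v x) - (\<Sum>j\<in>UNIV. ?w2 j j x) * partial_deriv i v x" for i x
  have w2: "?w2 i j \<in> polys p" for i j by (intro polys_c1(2) w)
  have v1: "partial_deriv i v \<in> polys p" for i by (intro polys_c1(2) v)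
  note C = polys_c1(1)[OF w2] polys_c1(1)[OF v1]
  have cw: "c1 (\<lambda>x. \<Sum>j\<in>UNIV. ?w2 j j x)" by (intro c1_sum C) auto
  have cY: "c1 (Y i)" for i
    unfolding Y_def[abs_def] by (intro c1_diff c1_sum c1_mult C) auto
  have dY: "grad (Y i) x $ i = (\<Sum>j\<in>UNIV. ?w2 i j x * partial_deriv i (partial_deriv j v) x + partial_deriv j v x * partial_deriv i (?w2 i j) x)
      - ((\<Sum>j\<in>UNIV. ?w2 j j x) * partial_deriv i (partial_deriv i v) x + partial_deriv i v x * (\<Sum>j\<in>UNIV. partial_deriv i (?w2 j j) x))" for i x
  proof -
    have "grad (Y i) x = grad (\<lambda>x. \<Sum>j\<in>UNIV. ?w2 i j x * partial_deriv j v x) x - grad (\<lambda>x. (\<Sum>j\<in>UNIV. ?w2 j j x) * partial_deriv i v x) x"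
      unfolding Y_def[abs_def] by (intro c1_diff(2) c1_sum c1_mult C cw) auto
    also have "grad (\<lambda>x. \<Sum>j\<in>UNIV. ?w2 i j x * partial_deriv j v x) x = (\<Sum>j\<in>UNIV. grad (\<lambda>x. ?w2 i j x * partial_deriv j v x) x)"
      by (intro c1_sum(2) c1_mult C) auto
    also have "\<dots> = (\<Sum>j\<in>UNIV. ?w2 i j x *\<^sub>R grad (partial_deriv j v) x + partial_deriv j v x *\<^sub>R grad (?w2 i j) x)"
      by (intro sum.cong refl c1_mult(2) C)
    also have "grad (\<lambda>x. (\<Sum>j\<in>UNIV. ?w2 j j x) * partial_deriv i v x) x
       = (\<Sum>j\<in>UNIV. ?w2 j j x) *\<^sub>R grad (partial_deriv i v) x + partial_deriv i v x *\<^sub>R grad (\<lambda>x. \<Sum>j\<in>UNIV. ?w2 j j x) x"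
      by (intro c1_mult(2) C cw)
    also have "grad (\<lambda>x. \<Sum>j\<in>UNIV. ?w2 j j x) x = (\<Sum>j\<in>UNIV. grad (?w2 j j) x)"
      by (intro c1_sum(2) C) auto
    finally show ?thesis by (simp add: grad_nth)
  qed
  have third: "(\<Sum>i\<in>UNIV. \<Sum>j\<in>UNIV. partial_deriv j v x * partial_deriv i (?w2 i j) x)
      = (\<Sum>i\<in>UNIV. \<Sum>j\<in>UNIV. partial_deriv i v x * partial_deriv i (?w2 j j) x)" for x
  proof -
    have "partial_deriv i (?w2 i j) = partial_deriv j (?w2 i i)" for i j
      using polys_c1(3)[OF w, of i j] polys_c1(3)[OF polys_c1(2)[OF w], of i j i] by simp
    then have "(\<Sum>i\<in>UNIV. \<Sum>j\<in>UNIV. partial_deriv j v x * partial_deriv i (?w2 i j) x)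
      = (\<Sum>i\<in>UNIV. \<Sum>j\<in>UNIV. partial_deriv j v x * partial_deriv j (?w2 i i) x)"
      by (intro sum.cong refl) metis
    also have "\<dots> = (\<Sum>j\<in>UNIV. \<Sum>i\<in>UNIV. partial_deriv j v x * partial_deriv j (?w2 i i) x)"
      by (rule sum.swap)
    finally show ?thesis .
  qed
  have div: "hessian w x \<bullet> hessian v x - laplacian w x * laplacian v x = (\<Sum>i\<in>UNIV. grad (Y i) x \<bullet> axis i 1)" for x
  proof -
    have "(\<Sum>i\<in>UNIV. grad (Y i) x \<bullet> axis i 1)
      = (\<Sum>i\<in>UNIV. \<Sum>j\<in>UNIV. ?w2 i j x * partial_deriv i (partial_deriv j v) x) + (\<Sum>i\<in>UNIV. \<Sum>j\<in>UNIV. partial_deriv j v x * partial_deriv i (?w2 i j) x)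
      - ((\<Sum>i\<in>UNIV. (\<Sum>j\<in>UNIV. ?w2 j j x) * partial_deriv i (partial_deriv i v) x) + (\<Sum>i\<in>UNIV. \<Sum>j\<in>UNIV. partial_deriv i v x * partial_deriv i (?w2 j j) x))"
      by (simp add: inner_axis dY sum.distrib sum_subtractf sum_distrib_left)
    then show ?thesis
      unfolding third by (simp add: inner_vec_def laplacian_sum hessian_nth sum_distrib_left)
  qed
  have K: "compact (convex hull V)" using finite by (rule finite_imp_compact_convex_hull)
  have F: "set_integrable surface_measure (convex hull (V - {c})) f" if "c \<in> V" "continuous_on UNIV f" for c and f :: "real^'n \<Rightarrow> real"
  proof (rule surface_integrable[OF d _ _ _ that(2)])
    show "compact (convex hull (V - {c}))" using finite by (intro finite_imp_compact_convex_hull) auto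
    show "norm (outer V c) = 1" using bgrad_nz[OF that(1)] by (simp add: outer_def)
    show "convex hull (V - {c}) \<subseteq> {x. outer V c \<bullet> x = (1 - bgrad V c \<bullet> c) / norm (bgrad V c)}"
    proof
      fix x assume "x \<in> convex hull (V - {c})"
      then have e: "bgrad V c \<bullet> x = - (1 - bgrad V c \<bullet> c)"
        using convex_hull_facet[OF that(1) facet_nonempty[OF that(1)]] by (auto simp: bary_def)
      have "outer V c \<bullet> x = - ((bgrad V c \<bullet> x) / norm (bgrad V c))" by (simp add: outer_def)
      also have "\<dots> = (1 - bgrad V c \<bullet> c) / norm (bgrad V c)"
        unfolding e by (simp only: minus_divide_left minus_minus)
      finally show "x \<in> {x. outer V c \<bullet> x = (1 - bgrad V c \<bullet> c) / norm (bgrad V c)}" by simp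
    qed
  qed
  have "(LINT x:convex hull V|lebesgue. hessian w x \<bullet> hessian v x - laplacian w x * laplacian v x)
      = (LINT x:convex hull V|lebesgue. (\<Sum>i\<in>UNIV. grad (Y i) x \<bullet> axis i 1))"
    by (simp only: div)
  also have "\<dots> = (\<Sum>i\<in>UNIV. LINT x:convex hull V|lebesgue. grad (Y i) x \<bullet> axis i 1)"
    unfolding set_lebesgue_integral_def scaleR_sum_right
    using lebesgue_set_integrable[OF K continuous_grad_inner[OF cY]]
    by (intro Bochner_Integration.integral_sum) (simp add: set_integrable_def)
  also have "\<dots> = (\<Sum>i\<in>UNIV. \<Sum>c\<in>V. outer V c $ i * (LINT x:convex hull (V - {c})|surface_measure. Y i x))"
    by (simp only: element_divergence[OF d V cY]) (simp only: inner_axis inner_real_def mult_1_right)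
  also have "\<dots> = (\<Sum>c\<in>V. \<Sum>i\<in>UNIV. outer V c $ i * (LINT x:convex hull (V - {c})|surface_measure. Y i x))"
    by (rule sum.swap)
  also have "\<dots> = (\<Sum>c\<in>V. LINT x:convex hull (V - {c})|surface_measure. parts_form (outer V c) w v x)"
  proof (intro sum.cong refl)
    fix c assume c: "c \<in> V"
    have eqx: "(\<Sum>i\<in>UNIV. outer V c $ i * Y i x) = parts_form (outer V c) w v x" for x
    proof -
      have "(\<Sum>i\<in>UNIV. outer V c $ i * Y i x) = outer V c \<bullet> (hessian w x *v grad v x) - laplacian w x * (grad v x \<bullet> outer V c)"
        by (simp add: Y_def inner_vec_def matrix_vector_mult_def hessian_nth grad_nth laplacian_sum right_diff_distrib sum_subtractf sum_distrib_left mult_ac)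
      then show ?thesis unfolding parts_form_def hessian_symmetric[OF w, of "outer V c"] .
    qed
    have "(\<Sum>i\<in>UNIV. outer V c $ i * (LINT x:convex hull (V - {c})|surface_measure. Y i x))
       = (LINT x:convex hull (V - {c})|surface_measure. (\<Sum>i\<in>UNIV. outer V c $ i * Y i x))"
      unfolding set_integral_mult_right[symmetric]
      unfolding set_lebesgue_integral_def scaleR_sum_right
      using F[OF c continuous_on_mult_left[OF c1_continuous[OF cY]]]
      by (intro Bochner_Integration.integral_sum[symmetric]) (simp add: set_integrable_def)
    also have "\<dots> = (LINT x:convex hull (V - {c})|surface_measure. parts_form (outer V c) w v x)"
      by (simp only: eqx)
    finally show "(\<Sum>i\<in>UNIV. outer V c $ i * (LINT x:convex hull (V - {c})|surface_measure. Y i x))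
       = (LINT x:convex hull (V - {c})|surface_measure. parts_form (outer V c) w v x)" .
  qed
  finally show ?thesis .
qed

lemma surf_laplacian_eq:
  assumes q: "q \<in> polys p"
  shows "surf_laplacian n q x = laplacian q x - n \<bullet> (hessian q x *v n)"
proof -
  have "partial_deriv i (\<lambda>y. surf_grad n q y $ i) x = hessian q x $ i $ i - n $ i * (hessian q x *v n) $ i" for i
  proof -
    have "(\<lambda>y. surf_grad n q y $ i) = (\<lambda>y. partial_deriv i q y - n $ i * (grad q y \<bullet> n))"
      by (auto simp: surf_grad_def grad_nth)
    then have "grad (\<lambda>y. surf_grad n q y $ i) x = grad (partial_deriv i q) x - grad (\<lambda>y. n $ i * (grad q y \<bullet> n)) x"
      using c1_diff(2)[OF polys_c1(1)[OF polys_c1(2)[OF q]] c1_scale(1)[OF polys_grad_inner(2)[OF q]]] by simp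
    also have "grad (\<lambda>y. n $ i * (grad q y \<bullet> n)) x = n $ i *\<^sub>R (hessian q x *v n)"
      by (simp add: c1_scale(2)[OF polys_grad_inner(2)[OF q]] polys_grad_inner(3)[OF q])
    finally show ?thesis by (metis grad_nth hessian_nth vector_minus_component vector_scaleR_component real_scaleR_def)
  qed
  then show ?thesis
    by (simp add: surf_laplacian_def divergence_def laplacian_sum inner_vec_def sum_subtractf)
qed

text \<open>Relates the tangential operators of \<open>S_form\<close> to the boundary terms of
  integration by parts: when the gradient of \<open>v\<close> is split into tangential and normal
  parts, the terms with \<open>n \<bullet> (hessian w x *v n)\<close> cancel.\<close>

lemma surf_form_eq_parts_form:
  assumes n: "norm n = 1" and w: "w \<in> polys p"
  shows "surf_grad n (\<lambda>y. grad w y \<bullet> n) x \<bullet> surf_grad n v x - surf_laplacian n w x * (grad v x \<bullet> n) = parts_form n w v x"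
proof -
  have nn: "n \<bullet> n = 1" using n by (simp add: dot_square_norm)
  show ?thesis
    unfolding surf_grad_def polys_grad_inner(3)[OF w] surf_laplacian_eq[OF w] parts_form_def
    by (simp add: inner_diff_left inner_diff_right nn inner_commute algebra_simps)
qed

lemma continuous_hessian_mult: "q \<in> polys p \<Longrightarrow> continuous_on UNIV (\<lambda>x. hessian q x *v z)"
  using c1_grad[OF polys_grad_inner(2), of q p z] polys_grad_inner(3)[of q p z] by simp

lemma continuous_laplacian: "q \<in> polys p \<Longrightarrow> continuous_on UNIV (laplacian q)"
  unfolding laplacian_sum[abs_def] hessian_nth by (intro continuous_intros c1_partial polys_c1)

lemma continuous_parts_form: "w \<in> polys p \<Longrightarrow> v \<in> polys p \<Longrightarrow> continuous_on UNIV (parts_form \<nu> w v)"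
  unfolding parts_form_def[abs_def]
  by (intro continuous_intros continuous_hessian_mult continuous_laplacian c1_grad polys_c1)

text \<open>The vectors \<open>e j\<close> are the coordinate axes projected to the hyperplane. They
  are too many for a basis but form a Parseval frame, which spares the choice of an orthonormal
  basis on each face.\<close>

lemma tangential_frame_sum:
  fixes n :: "real^'n::finite"
  assumes nn: "n \<bullet> n = 1"
  defines "e \<equiv> \<lambda>j. axis j 1 - (n $ j) *\<^sub>R n"
  shows "(\<Sum>j\<in>UNIV. (y \<bullet> e j) * (z \<bullet> e j)) = y \<bullet> z - (y \<bullet> n) * (z \<bullet> n)"
    and "(\<Sum>j\<in>UNIV. e j \<bullet> (A *v e j)) = (\<Sum>j\<in>UNIV. A $ j $ j) - n \<bullet> (A *v n)"
proof -
  have ye: "y \<bullet> e j = y $ j - n $ j * (y \<bullet> n)" for j y by (simp add: e_def inner_diff_right inner_axis)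
  have s: "(\<Sum>j\<in>UNIV. y $ j * z $ j) = y \<bullet> z" for y z :: "real^'n" by (simp add: inner_vec_def)
  have "(\<Sum>j\<in>UNIV. (y \<bullet> e j) * (z \<bullet> e j)) = (\<Sum>j\<in>UNIV. y $ j * z $ j) - (z \<bullet> n) * (\<Sum>j\<in>UNIV. y $ j * n $ j)
      - (y \<bullet> n) * (\<Sum>j\<in>UNIV. n $ j * z $ j) + (y \<bullet> n) * (z \<bullet> n) * (\<Sum>j\<in>UNIV. n $ j * n $ j)"
    unfolding ye by (simp add: sum_distrib_left sum.distrib[symmetric] sum_subtractf[symmetric] algebra_simps)
  then show "(\<Sum>j\<in>UNIV. (y \<bullet> e j) * (z \<bullet> e j)) = y \<bullet> z - (y \<bullet> n) * (z \<bullet> n)"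
    unfolding s nn by (simp add: inner_commute[of n])
  have Ae: "A *v e j = A *v axis j 1 - n $ j *\<^sub>R (A *v n)" for j
    by (simp add: e_def matrix_vector_mult_diff_distrib matrix_vector_mult_scaleR)
  have An: "(\<Sum>j\<in>UNIV. n $ j * (n \<bullet> (A *v axis j 1))) = n \<bullet> (A *v n)"
  proof -
    have "n \<bullet> (A *v n) = n \<bullet> (A *v (\<Sum>j\<in>UNIV. n $ j *\<^sub>R axis j 1))"
      using basis_expansion[of n] by (simp only: scalar_mult_eq_scaleR)
    also have "A *v (\<Sum>j\<in>UNIV. n $ j *\<^sub>R axis j 1) = (\<Sum>j\<in>UNIV. n $ j *\<^sub>R (A *v axis j 1))"
      using linear_sum[OF matrix_vector_mul_linear, of A "\<lambda>j. n $ j *\<^sub>R axis j 1" UNIV] by (simp add: matrix_vector_mult_scaleR)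
    finally show ?thesis by (simp add: inner_sum_right)
  qed
  have "e j \<bullet> (A *v e j) = A $ j $ j - n $ j * (A *v n) $ j - n $ j * (n \<bullet> (A *v axis j 1)) + n $ j * n $ j * (n \<bullet> (A *v n))" for j
    unfolding Ae by (simp add: e_def inner_diff_left inner_diff_right inner_axis' matrix_vector_mult_basis column_def algebra_simps)
  then have "(\<Sum>j\<in>UNIV. e j \<bullet> (A *v e j)) = (\<Sum>j\<in>UNIV. A $ j $ j) - (\<Sum>j\<in>UNIV. n $ j * (A *v n) $ j)
      - (\<Sum>j\<in>UNIV. n $ j * (n \<bullet> (A *v axis j 1))) + (\<Sum>j\<in>UNIV. n $ j * n $ j) * (n \<bullet> (A *v n))"
    by (simp add: sum.distrib sum_subtractf sum_distrib_right)
  then show "(\<Sum>j\<in>UNIV. e j \<bullet> (A *v e j)) = (\<Sum>j\<in>UNIV. A $ j $ j) - n \<bullet> (A *v n)"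
    unfolding An s nn by simp
qed

section \<open>Inverse and trace inequalities\<close>

lemma poly_interval_integrable: "integrable lborel (\<lambda>t. indicator {a..b} t * poly P t)" for P :: "real poly"
  using borel_integrable_atLeastAtMost'[of a b "poly P"]
  by (simp add: set_integrable_def continuous_intros)

lemma pderiv_sum: "pderiv (\<Sum>i\<in>I. f i) = (\<Sum>i\<in>I. pderiv (f i))"
  by (induction I rule: infinite_finite_induct) (simp_all add: pderiv_add)

lemma poly_square_eq: "(poly P t)\<^sup>2 = poly (P * P) t" for P :: "real poly"
  by (simp add: power2_eq_square)

lemma poly_square_integrable: "integrable lborel (\<lambda>t. indicator {a..b} t * (poly P t)\<^sup>2)" for P :: "real poly"
  unfolding poly_square_eq by (rule poly_interval_integrable)

lemma poly_antiderivative: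
  assumes "degree P \<le> p"
  obtains Q :: "real poly" where "pderiv Q = P" "degree Q \<le> Suc p" "poly Q 0 = 0"
proof
  let ?Q = "\<Sum>k\<le>p. monom (coeff P k / real (Suc k)) (Suc k)"
  show "pderiv ?Q = P"
  proof -
    have "pderiv ?Q = (\<Sum>k\<le>p. monom (coeff P k) k)"
      by (simp add: pderiv_sum pderiv_monom del: of_nat_Suc)
    then show ?thesis using poly_as_sum_of_monoms'[OF assms] by simp
  qed
  show "degree ?Q \<le> Suc p"
    by (intro degree_sum_le) (auto intro: order_trans[OF degree_monom_le])
  show "poly ?Q 0 = 0" by (simp add: poly_sum poly_monom)
qed

text \<open>The Cauchy-Schwarz inequality on \<open>{0..x}\<close>, obtained by expanding the
  integral of \<open>(poly (pderiv Q) t - m)\<^sup>2\<close>, where \<open>m\<close> is the mean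
  value of the derivative.\<close>

lemma antiderivative_square_le:
  fixes Q :: "real poly"
  assumes Q: "poly Q 0 = 0" and x: "0 \<le> x" "x \<le> b" "b \<le> 1"
  shows "(poly Q x)\<^sup>2 \<le> (\<integral>t. indicator {0..b} t * (poly (pderiv Q) t)\<^sup>2 \<partial>lborel)"
proof (cases "x = 0")
  case True
  then show ?thesis using Q by (auto intro!: Bochner_Integration.integral_nonneg)
next
  case False
  then have x0: "0 < x" using x by simp
  let ?P = "pderiv Q"
  define m where "m = poly Q x / x"
  have int1: "(\<integral>t. indicator {0..x} t * poly ?P t \<partial>lborel) = poly Q x"
    using integral_FTC_Icc_real[of 0 x "poly Q" "poly ?P"] x Q by (simp add: poly_DERIV mult.commute)
  have "0 \<le> (\<integral>t. indicator {0..x} t * (poly ?P t - m)\<^sup>2 \<partial>lborel)"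
    by (intro Bochner_Integration.integral_nonneg) auto
  also have "\<dots> = (\<integral>t. indicator {0..x} t * (poly ?P t)\<^sup>2 - (2 * m) * (indicator {0..x} t * poly ?P t) + m\<^sup>2 * indicator {0..x} t \<partial>lborel)"
    by (intro Bochner_Integration.integral_cong) (auto simp: power2_eq_square algebra_simps)
  also have "\<dots> = (\<integral>t. indicator {0..x} t * (poly ?P t)\<^sup>2 \<partial>lborel) - (2 * m) * poly Q x + m\<^sup>2 * x"
  proof -
    have i3: "integrable lborel (indicat_real {0..x})" using x0 by (intro integrable_real_indicator) auto
    show ?thesis
      using x poly_square_integrable[of 0 x ?P] poly_interval_integrable[of 0 x ?P] i3
      by (simp add: int1)
  qed
  finally have "(poly Q x)\<^sup>2 / x \<le> (\<integral>t. indicator {0..x} t * (poly ?P t)\<^sup>2 \<partial>lborel)"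
    using x0 by (simp add: m_def power2_eq_square)
  also have "\<dots> \<le> (\<integral>t. indicator {0..b} t * (poly ?P t)\<^sup>2 \<partial>lborel)"
    using x by (intro Bochner_Integration.integral_mono poly_square_integrable mult_right_mono) (auto simp: indicator_def)
  finally have "(poly Q x)\<^sup>2 / x \<le> (\<integral>t. indicator {0..b} t * (poly ?P t)\<^sup>2 \<partial>lborel)" .
  moreover have "(poly Q x)\<^sup>2 \<le> (poly Q x)\<^sup>2 / x"
    using x x0 by (simp add: le_divide_eq mult_left_le)
  ultimately show ?thesis by simp
qed

text \<open>The antiderivative is controlled at \<open>p + 2\<close> points by the \<open>L\<^sup>2\<close> norm, hence so is its
  Lagrange interpolation polynomial, which is the antiderivative itself.\<close>

lemma poly_L2_control:
  obtains C where "0 \<le> C" and "\<And>P :: real poly. \<And>t. degree P \<le> p \<Longrightarrow> 0 \<le> t \<Longrightarrow> t \<le> 1 \<Longrightarrow>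
      (poly P t)\<^sup>2 \<le> C * (\<integral>s. indicator {0..1/2} s * (poly P s)\<^sup>2 \<partial>lborel) \<and>
      (poly (pderiv P) t)\<^sup>2 \<le> C * (\<integral>s. indicator {0..1/2} s * (poly P s)\<^sup>2 \<partial>lborel)"
proof -
  \<comment> \<open>An antiderivative of degree \<open>Suc p\<close> takes \<open>p + 2\<close>
    nodes. They all lie in \<open>{0..1/2}\<close>, so half of the interval controls the
    whole.\<close>
  define x where "x i = real i / (2 * real (Suc p))" for i
  have x: "0 \<le> x i" "i \<le> Suc p \<Longrightarrow> x i \<le> 1/2" for i by (auto simp: x_def field_simps)
  have inj: "x i = x j \<longleftrightarrow> i = j" for i j by (auto simp: x_def)
  define L where "L i = (\<Prod>j\<in>{..Suc p} - {i}. smult (1 / (x i - x j)) [:- x j, 1:])" for i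
  have degL: "degree (L i) \<le> Suc p" if "i \<le> Suc p" for i
  proof -
    have "degree (L i) \<le> (\<Sum>j\<in>{..Suc p} - {i}. degree (smult (1 / (x i - x j)) [:- x j, 1:]))"
      unfolding L_def by (rule order_trans[OF degree_prod_sum_le]) auto
    also have "\<dots> \<le> (\<Sum>j\<in>{..Suc p} - {i}. 1)"
      by (intro sum_mono order_trans[OF degree_smult_le]) auto
    also have "\<dots> = Suc p" using that by simp
    finally show ?thesis .
  qed
  have Lx: "poly (L i) (x k) = of_bool (i = k)" if "i \<le> Suc p" "k \<le> Suc p" for i k
  proof (cases "i = k")
    case True
    have "poly (smult (1 / (x k - x j)) [:- x j, 1:]) (x k) = 1" if "j \<noteq> k" for j
      using inj[of k j] that by (simp add: diff_divide_distrib[symmetric])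
    then show ?thesis unfolding True L_def poly_prod by (intro trans[OF prod.neutral]) auto
  next
    case False
    then have "k \<in> {..Suc p} - {i}" using that by auto
    then have "\<exists>j\<in>{..Suc p} - {i}. poly (smult (1 / (x i - x j)) [:- x j, 1:]) (x k) = 0" by (intro bexI[of _ k]) auto
    then show ?thesis using False by (simp add: L_def poly_prod prod_zero_iff del: poly_smult)
  qed
  have lagrange: "Q = (\<Sum>i\<le>Suc p. smult (poly Q (x i)) (L i))" if "degree Q \<le> Suc p" for Q
  proof (rule poly_eqI_degree[of "x ` {..Suc p}"])
    have card: "card (x ` {..Suc p}) = Suc (Suc p)"
      by (subst card_image) (auto simp: inj_on_def inj)
    show "degree Q < card (x ` {..Suc p})" using that card by simp
    have "degree (\<Sum>i\<le>Suc p. smult (poly Q (x i)) (L i)) \<le> Suc p"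
      by (intro degree_sum_le) (auto intro!: order_trans[OF degree_smult_le] degL)
    then show "degree (\<Sum>i\<le>Suc p. smult (poly Q (x i)) (L i)) < card (x ` {..Suc p})" using card by simp
    fix y assume "y \<in> x ` {..Suc p}"
    then obtain k where k: "k \<le> Suc p" "y = x k" by auto
    have "poly (\<Sum>i\<le>Suc p. smult (poly Q (x i)) (L i)) y = (\<Sum>i\<le>Suc p. if i = k then poly Q (x i) else 0)"
      unfolding poly_sum k(2) using k(1) by (intro sum.cong refl) (simp add: Lx)
    also have "\<dots> = poly Q y" using k by simp
    finally show "poly Q y = poly (\<Sum>i\<le>Suc p. smult (poly Q (x i)) (L i)) y" ..
  qed
  have "\<exists>B. \<forall>t\<in>{0..1}. \<bar>poly P t\<bar> \<le> B" for P :: "real poly"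
  proof -
    have "compact (poly P ` {0..1})" by (intro compact_continuous_image continuous_intros) auto
    then show ?thesis using compact_imp_bounded by (force simp: bounded_real)
  qed
  then obtain bd where bd: "\<And>(P :: real poly) t. t \<in> {0..1} \<Longrightarrow> \<bar>poly P t\<bar> \<le> bd P" by metis
  \<comment> \<open>\<open>P\<close> and its derivative are the first and second derivatives of the
    interpolated antiderivative, hence the bounds on both derivatives of the Lagrange basis.\<close>
  define B where "B = (\<Sum>i\<le>Suc p. \<bar>bd (pderiv (L i))\<bar> + \<bar>bd (pderiv (pderiv (L i)))\<bar>)"
  have B0: "0 \<le> B" unfolding B_def by (intro sum_nonneg) simp
  have main: "(\<Sum>i\<le>Suc p. poly Q (x i) * l i)\<^sup>2 \<le> B\<^sup>2 * S"
    if l: "\<And>i. i \<le> Suc p \<Longrightarrow> \<bar>l i\<bar> \<le> \<bar>bd (pderiv (L i))\<bar> + \<bar>bd (pderiv (pderiv (L i)))\<bar>"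
      and S: "\<And>i. i \<le> Suc p \<Longrightarrow> (poly Q (x i))\<^sup>2 \<le> S" "0 \<le> S" for Q l S
  proof -
    have "\<bar>\<Sum>i\<le>Suc p. poly Q (x i) * l i\<bar> \<le> (\<Sum>i\<le>Suc p. \<bar>poly Q (x i)\<bar> * \<bar>l i\<bar>)"
      by (rule order_trans[OF sum_abs]) (simp add: abs_mult)
    also have "\<dots> \<le> (\<Sum>i\<le>Suc p. sqrt S * (\<bar>bd (pderiv (L i))\<bar> + \<bar>bd (pderiv (pderiv (L i)))\<bar>))"
    proof (intro sum_mono mult_mono)
      fix i assume "i \<in> {..Suc p}"
      then show "\<bar>poly Q (x i)\<bar> \<le> sqrt S" using S(1)[of i] real_le_rsqrt by (intro real_le_rsqrt) auto
    qed (use l S(2) in auto)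
    also have "\<dots> = sqrt S * B" by (simp only: B_def sum_distrib_left)
    finally have "\<bar>\<Sum>i\<le>Suc p. poly Q (x i) * l i\<bar>\<^sup>2 \<le> (sqrt S * B)\<^sup>2" by (intro power_mono) auto
    then show ?thesis using S(2) by (simp add: power_mult_distrib mult.commute)
  qed
  show thesis
  proof (rule that[of "B\<^sup>2"])
    fix P :: "real poly" and t :: real assume P: "degree P \<le> p" and t: "0 \<le> t" "t \<le> 1"
    define S where "S = (\<integral>s. indicator {0..1/2} s * (poly P s)\<^sup>2 \<partial>lborel)"
    have S0: "0 \<le> S" unfolding S_def by (intro Bochner_Integration.integral_nonneg) auto
    obtain Q where Q: "pderiv Q = P" "degree Q \<le> Suc p" "poly Q 0 = 0"
      by (rule poly_antiderivative[OF P])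
    have QS: "(poly Q (x i))\<^sup>2 \<le> S" if "i \<le> Suc p" for i
      unfolding S_def Q(1)[symmetric] using x that by (intro antiderivative_square_le Q) auto
    have P1: "P = (\<Sum>i\<le>Suc p. smult (poly Q (x i)) (pderiv (L i)))"
    proof -
      have "pderiv Q = pderiv (\<Sum>i\<le>Suc p. smult (poly Q (x i)) (L i))" using lagrange[OF Q(2)] by simp
      then show ?thesis by (simp only: Q(1) pderiv_sum pderiv_smult)
    qed
    have P2: "pderiv P = (\<Sum>i\<le>Suc p. smult (poly Q (x i)) (pderiv (pderiv (L i))))"
    proof -
      have "pderiv P = pderiv (\<Sum>i\<le>Suc p. smult (poly Q (x i)) (pderiv (L i)))" using P1 by simp
      then show ?thesis by (simp only: pderiv_sum pderiv_smult)
    qed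
    have "poly P t = (\<Sum>i\<le>Suc p. poly Q (x i) * poly (pderiv (L i)) t)"
      by (subst P1) (simp only: poly_sum poly_smult)
    moreover have "poly (pderiv P) t = (\<Sum>i\<le>Suc p. poly Q (x i) * poly (pderiv (pderiv (L i))) t)"
      by (subst P2) (simp only: poly_sum poly_smult)
    moreover have "(\<Sum>i\<le>Suc p. poly Q (x i) * poly (pderiv (L i)) t)\<^sup>2 \<le> B\<^sup>2 * S"
      using bd[of t] t by (intro main QS S0) (smt (verit) abs_ge_zero abs_ge_self atLeastAtMost_iff)+
    moreover have "(\<Sum>i\<le>Suc p. poly Q (x i) * poly (pderiv (pderiv (L i))) t)\<^sup>2 \<le> B\<^sup>2 * S"
      using bd[of t] t by (intro main QS S0) (smt (verit) abs_ge_zero abs_ge_self atLeastAtMost_iff)+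
    ultimately show "(poly P t)\<^sup>2 \<le> B\<^sup>2 * (\<integral>s. indicator {0..1/2} s * (poly P s)\<^sup>2 \<partial>lborel) \<and>
      (poly (pderiv P) t)\<^sup>2 \<le> B\<^sup>2 * (\<integral>s. indicator {0..1/2} s * (poly P s)\<^sup>2 \<partial>lborel)"
      unfolding S_def by simp
  qed simp
qed

lemma integral_interval_scale:
  fixes f :: "real \<Rightarrow> real"
  assumes l: "0 < l"
  shows "(\<integral>s. indicator {0..l * c} s * f s \<partial>lborel) = l * (\<integral>s. indicator {0..c} s * f (l * s) \<partial>lborel)"
proof -
  have "(\<integral>s. indicator {0..l * c} s * f s \<partial>lborel) = \<bar>l\<bar> *\<^sub>R (\<integral>s. indicator {0..l * c} (0 + l * s) * f (0 + l * s) \<partial>lborel)"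
    using l by (intro lborel_integral_real_affine) simp
  also have "(\<integral>s. indicator {0..l * c} (0 + l * s) * f (0 + l * s) \<partial>lborel) = (\<integral>s. indicator {0..c} s * f (l * s) \<partial>lborel)"
    using l by (intro Bochner_Integration.integral_cong) (auto simp: indicator_def zero_le_mult_iff)
  finally show ?thesis using l by simp
qed

text \<open>A doubling and an inverse inequality, both obtained by scaling from the unit interval.
  The length \<open>l = 0\<close> is included because fibres of a face may degenerate to
  points.\<close>

lemma poly_interval_inequalities:
  obtains C where "0 \<le> C" and "\<And>P :: real poly. \<And>l. degree P \<le> p \<Longrightarrow> 0 \<le> l \<Longrightarrow>
      (\<integral>s. indicator {0..l} s * (poly P s)\<^sup>2 \<partial>lborel) \<le> C * (\<integral>s. indicator {0..l/2} s * (poly P s)\<^sup>2 \<partial>lborel)"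
   and "\<And>P :: real poly. \<And>l. degree P \<le> p \<Longrightarrow> 0 \<le> l \<Longrightarrow>
      l\<^sup>2 * (\<integral>s. indicator {0..l} s * (poly (pderiv P) s)\<^sup>2 \<partial>lborel) \<le> C * (\<integral>s. indicator {0..l} s * (poly P s)\<^sup>2 \<partial>lborel)"
proof -
  obtain C where C: "0 \<le> C" "\<And>P :: real poly. \<And>t. degree P \<le> p \<Longrightarrow> 0 \<le> t \<Longrightarrow> t \<le> 1 \<Longrightarrow>
      (poly P t)\<^sup>2 \<le> C * (\<integral>s. indicator {0..1/2} s * (poly P s)\<^sup>2 \<partial>lborel) \<and>
      (poly (pderiv P) t)\<^sup>2 \<le> C * (\<integral>s. indicator {0..1/2} s * (poly P s)\<^sup>2 \<partial>lborel)"
    by (rule poly_L2_control[of p]) blast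
  define S where "S P = (\<integral>s. indicator {0..1/2} s * (poly P s)\<^sup>2 \<partial>lborel)" for P :: "real poly"
  have const: "(\<integral>s. indicator {0..1::real} s * k \<partial>lborel) = k" for k :: real by simp
  have unit: "(\<integral>s. indicator {0..1} s * (poly P s)\<^sup>2 \<partial>lborel) \<le> C * S P"
      "(\<integral>s. indicator {0..1} s * (poly (pderiv P) s)\<^sup>2 \<partial>lborel) \<le> C * S P" if "degree P \<le> p" for P
  proof -
    have 1: "(\<integral>s. indicator {0..1} s * (poly P' s)\<^sup>2 \<partial>lborel) \<le> (\<integral>s. indicator {0..1::real} s * (C * S P) \<partial>lborel)"
      if "\<And>t. 0 \<le> t \<Longrightarrow> t \<le> 1 \<Longrightarrow> (poly P' t)\<^sup>2 \<le> C * S P" for P' :: "real poly"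
    proof (rule Bochner_Integration.integral_mono[OF poly_square_integrable])
      have "integrable lborel (indicat_real {0..1::real})" by (rule integrable_real_indicator) auto
      then show "integrable lborel (\<lambda>s. indicat_real {0..1::real} s * (C * S P))" by simp
    qed (simp add: indicator_def that)
    show "(\<integral>s. indicator {0..1} s * (poly P s)\<^sup>2 \<partial>lborel) \<le> C * S P"
      "(\<integral>s. indicator {0..1} s * (poly (pderiv P) s)\<^sup>2 \<partial>lborel) \<le> C * S P"
      using 1[of P] 1[of "pderiv P"] C(2)[OF that] unfolding const S_def by blast+
  qed
  have half: "S P \<le> (\<integral>s. indicator {0..1} s * (poly P s)\<^sup>2 \<partial>lborel)" for P
    unfolding S_def by (intro Bochner_Integration.integral_mono poly_square_integrable mult_right_mono) (auto simp: indicator_def)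
  have degc: "degree (pcompose P [:0, l:]) \<le> p" if "degree P \<le> p" for P :: "real poly" and l
    using that degree_pcompose_le[of P "[:0, l:]"] by (auto intro: order_trans)
  have comp: "poly P (l * s) = poly (pcompose P [:0, l:]) s" for P :: "real poly" and l s
    by (simp add: poly_pcompose mult.commute)
  have dcomp: "l * poly (pderiv P) (l * s) = poly (pderiv (pcompose P [:0, l:])) s" for P :: "real poly" and l s
    by (simp add: pderiv_pcompose poly_pcompose pderiv_pCons mult.commute)
  show thesis
  proof (rule that[OF C(1)])
    fix P :: "real poly" and l :: real assume P: "degree P \<le> p" and l: "0 \<le> l"
    let ?R = "pcompose P [:0, l:]"
    have z: "(\<integral>s. indicator {0::real} s * f s \<partial>lborel) = (0::real)" for f :: "real \<Rightarrow> real"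
    proof -
      have "(\<integral>s. indicator {0::real} s * f s \<partial>lborel) = (\<integral>s. indicator {0::real} s * f 0 \<partial>lborel)"
        by (intro Bochner_Integration.integral_cong) (auto simp: indicator_def)
      then show ?thesis by simp
    qed
    show "(\<integral>s. indicator {0..l} s * (poly P s)\<^sup>2 \<partial>lborel) \<le> C * (\<integral>s. indicator {0..l/2} s * (poly P s)\<^sup>2 \<partial>lborel)"
    proof (cases "l = 0")
      case False
      then have "0 < l" using l by simp
      then show ?thesis
        using integral_interval_scale[of l 1 "\<lambda>s. (poly P s)\<^sup>2"] integral_interval_scale[of l "1/2" "\<lambda>s. (poly P s)\<^sup>2"]
          mult_left_mono[OF unit(1)[OF degc[OF P, of l]], of l]
        unfolding comp S_def by (simp add: mult_ac)
    qed (simp add: z)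
    show "l\<^sup>2 * (\<integral>s. indicator {0..l} s * (poly (pderiv P) s)\<^sup>2 \<partial>lborel) \<le> C * (\<integral>s. indicator {0..l} s * (poly P s)\<^sup>2 \<partial>lborel)"
    proof (cases "l = 0")
      case False
      then have l0: "0 < l" using l by simp
      have "l\<^sup>2 * (\<integral>s. indicator {0..l} s * (poly (pderiv P) s)\<^sup>2 \<partial>lborel)
          = l * (\<integral>s. l\<^sup>2 * (indicator {0..1} s * (poly (pderiv P) (l * s))\<^sup>2) \<partial>lborel)"
        using integral_interval_scale[OF l0, of 1 "\<lambda>s. (poly (pderiv P) s)\<^sup>2"] by simp
      also have "\<dots> = l * (\<integral>s. indicator {0..1} s * (poly (pderiv ?R) s)\<^sup>2 \<partial>lborel)"
        unfolding dcomp[symmetric] by (simp add: power_mult_distrib mult_ac)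
      also have "\<dots> \<le> l * (C * S ?R)"
        using unit(2)[OF degc[OF P, of l]] l by (rule mult_left_mono)
      also have "\<dots> \<le> l * (C * (\<integral>s. indicator {0..1} s * (poly ?R s)\<^sup>2 \<partial>lborel))"
        using half[of ?R] C(1) l by (intro mult_left_mono) auto
      also have "\<dots> = C * (\<integral>s. indicator {0..l} s * (poly P s)\<^sup>2 \<partial>lborel)"
        using integral_interval_scale[OF l0, of 1 "\<lambda>s. (poly P s)\<^sup>2"] by (simp only: comp mult_1_right mult.left_commute)
      finally show ?thesis .
    qed (use C(1) z in simp)
  qed
qed

section \<open>Inverse and trace inequalities on a face\<close>

lemma c1_bary: "c1 (bary W a)" "grad (bary W a) x = bgrad W a"
  by (rule c1I[where g = "\<lambda>_. bgrad W a"]; auto intro!: derivative_eq_intros simp: bary_def[abs_def])+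

locale face_basis = affine_basis W for W :: "(real^'n::finite) set" +
  fixes n :: "real^'n" and k :: real
  assumes dim: "CARD('n) \<in> {2, 3}" and card: "card W = CARD('n)"
    and normal: "norm n = 1" and aff: "affine hull W = {x. n \<bullet> x = k}"
begin

abbreviation "F \<equiv> convex hull W"

lemma compact_F: "compact F"
  using finite by (rule finite_imp_compact_convex_hull)

lemma F_plane: "F \<subseteq> {x. n \<bullet> x = k}"
  using convex_hull_subset_affine_hull aff by blast

lemma n_n: "n \<bullet> n = 1"
  using normal by (simp add: dot_square_norm)

lemma facet_ne: "c \<in> W \<Longrightarrow> W - {c} \<noteq> {}"
proof
  assume "c \<in> W" "W - {c} = {}"
  then have "W = {c}" by blast
  then have "card W = 1" by simp
  then show False using card dim by auto
qed

lemma W_ne: "W \<noteq> {}"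
  using card dim by auto

lemma plane_directions: "n \<bullet> z = 0 \<longleftrightarrow> z \<in> directions W"
proof -
  obtain a where a: "a \<in> W" using W_ne by auto
  have "n \<bullet> a = k" using aff hull_inc[OF a, of affine] by auto
  then show ?thesis
    using affine_hull_directions[OF a, of "z + a"] aff by (simp add: inner_add_right)
qed

lemma n_bgrad: "n \<bullet> bgrad W c = 0"
  using plane_directions bgrad_mem by blast

lemma surf_int: "continuous_on UNIV f \<Longrightarrow> set_integrable surface_measure F f" for f :: "real^'n \<Rightarrow> real"
  by (rule surface_integrable[OF dim compact_F F_plane normal])

lemma surf_mono:
  fixes f g :: "real^'n \<Rightarrow> real"
  assumes "continuous_on UNIV f" "continuous_on UNIV g" "\<And>x. x \<in> F \<Longrightarrow> f x \<le> g x"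
  shows "(LINT x:F|surface_measure. f x) \<le> (LINT x:F|surface_measure. g x)"
  by (rule set_integral_mono[OF surf_int[OF assms(1)] surf_int[OF assms(2)] assms(3)])

text \<open>Along \<open>a - b\<close> the coordinate of \<open>a\<close> grows and that of
  \<open>b\<close> falls at the same rate while the others stay fixed, so the chord starting at
  \<open>y\<close> has parameter length \<open>bary W b y\<close>.\<close>

lemma mem_F_line:
  assumes ab: "a \<in> W" "b \<in> W" "a \<noteq> b" and y: "y \<in> affine hull W" "bary W a y = 0"
  shows "y + s *\<^sub>R (a - b) \<in> F \<longleftrightarrow> y \<in> F \<and> 0 \<le> s \<and> s \<le> bary W b y"
    and "bary W a (y + s *\<^sub>R (a - b)) = s" "bary W b (y + s *\<^sub>R (a - b)) = bary W b y - s"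
proof -
  have bs: "bary W c (y + s *\<^sub>R (a - b)) = bary W c y + s * (of_bool (a = c) - of_bool (b = c))" for c
    using bgrad_inner[OF ab(1,2), of c] by (simp add: bary_def inner_add_right)
  show "bary W a (y + s *\<^sub>R (a - b)) = s" "bary W b (y + s *\<^sub>R (a - b)) = bary W b y - s"
    using bs[of a] bs[of b] ab y by auto
  have "y + s *\<^sub>R (a - b) \<in> affine hull W"
    using y(1) directions_diff[OF ab(1,2)] plane_directions aff by (simp add: inner_add_right)
  then have "y + s *\<^sub>R (a - b) \<in> F \<longleftrightarrow> (\<forall>c\<in>W. 0 \<le> bary W c y + s * (of_bool (a = c) - of_bool (b = c)))"
    unfolding convex_hull_bary by (simp add: bs)
  also have "\<dots> \<longleftrightarrow> (\<forall>c\<in>W - {a, b}. 0 \<le> bary W c y) \<and> 0 \<le> s \<and> s \<le> bary W b y"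
  proof -
    let ?R = "\<lambda>c. 0 \<le> bary W c y + s * (of_bool (a = c) - of_bool (b = c))"
    have "(\<forall>c\<in>W. ?R c) \<longleftrightarrow> (\<forall>c\<in>W - {a, b}. ?R c) \<and> ?R a \<and> ?R b" using ab by blast
    moreover have "(\<forall>c\<in>W - {a, b}. ?R c) \<longleftrightarrow> (\<forall>c\<in>W - {a, b}. 0 \<le> bary W c y)"
      by (intro ball_cong refl) auto
    moreover have "?R a \<longleftrightarrow> 0 \<le> s" "?R b \<longleftrightarrow> s \<le> bary W b y" using ab y by auto
    ultimately show ?thesis by simp
  qed
  also have "\<dots> \<longleftrightarrow> y \<in> F \<and> 0 \<le> s \<and> s \<le> bary W b y"
  proof -
    have "(\<forall>c\<in>W. 0 \<le> bary W c y) \<longleftrightarrow> (\<forall>c\<in>W - {a, b}. 0 \<le> bary W c y) \<and> 0 \<le> bary W a y \<and> 0 \<le> bary W b y" using ab by blast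
    then show ?thesis unfolding convex_hull_bary using y by auto
  qed
  finally show "y + s *\<^sub>R (a - b) \<in> F \<longleftrightarrow> y \<in> F \<and> 0 \<le> s \<and> s \<le> bary W b y" .
qed

text \<open>Every fibre of the face in the direction of an edge starts on the opposite facet of the face.\<close>

lemma face_fibre_mono:
  fixes \<phi> \<psi> :: "real^'n \<Rightarrow> real"
  assumes ab: "a \<in> W" "b \<in> W" "a \<noteq> b"
    and c: "continuous_on UNIV \<phi>" "continuous_on UNIV \<psi>"
    and le: "\<And>y. y \<in> F \<Longrightarrow> bary W a y = 0 \<Longrightarrow>
       (\<integral>s. indicator {0..bary W b y} s * \<phi> (y + s *\<^sub>R (a - b)) \<partial>lborel)
       \<le> (\<integral>s. indicator {0..bary W b y} s * \<psi> (y + s *\<^sub>R (a - b)) \<partial>lborel)"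
  shows "(LINT x:F|surface_measure. \<phi> x) \<le> (LINT x:F|surface_measure. \<psi> x)"
proof -
  let ?u = "a - b"
  define P where "P x = x - (n \<bullet> x - k) *\<^sub>R n" for x
  have nu: "n \<bullet> ?u = 0" using plane_directions directions_diff[OF ab(1,2)] by blast
  have Pu: "P (x + t *\<^sub>R ?u) = P x + t *\<^sub>R ?u" for x t by (simp add: P_def inner_add_right nu)
  have PA: "P x \<in> affine hull W" for x by (simp add: aff P_def inner_diff_right n_n)
  have cP: "continuous_on UNIV P" unfolding P_def by (intro continuous_intros)
  have [measurable]: "P \<in> borel_measurable borel" using cP by (rule borel_measurable_continuous_onI)
  have Fb [measurable]: "F \<in> sets borel" using compact_F by (rule borel_compact)
  define Q where "Q = {x. 0 \<le> n \<bullet> x - k \<and> n \<bullet> x - k \<le> 1 \<and> P x \<in> F}"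
  have Qb: "Q \<in> sets borel" unfolding Q_def by measurable
  have bQ: "bounded Q"
  proof -
    obtain R where R: "\<And>x. x \<in> F \<Longrightarrow> norm x \<le> R" using compact_imp_bounded[OF compact_F] by (auto simp: bounded_iff)
    show ?thesis
    proof (rule bounded_subset[of "cball 0 (R + 1)"], simp, rule subsetI)
      fix x assume x: "x \<in> Q"
      have "norm x \<le> norm (P x) + norm ((n \<bullet> x - k) *\<^sub>R n)"
        by (metis P_def diff_add_cancel norm_triangle_ineq)
      also have "\<dots> \<le> R + 1" using x R normal by (intro add_mono) (auto simp: Q_def)
      finally show "x \<in> cball 0 (R + 1)" by simp
    qed
  qed
  \<comment> \<open>The starting point of the fibre through \<open>P x\<close>, where the coordinate
    of \<open>a\<close> vanishes.\<close>
  define st where "st x = P x + (- bary W a (P x)) *\<^sub>R ?u" for x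
  have uA: "z \<in> affine hull W \<Longrightarrow> z + s *\<^sub>R ?u \<in> affine hull W" for z s using nu by (simp add: aff inner_add_right)
  have stA: "st x \<in> affine hull W" for x unfolding st_def by (intro uA PA)
  have sta: "bary W a (st x) = 0" for x
    using bgrad_inner[OF ab(1,2), of a] ab(3) by (simp add: st_def bary_def inner_add_right algebra_simps)
  define I where "I f x = slab (bgrad W a \<bullet> x) *
        (slab (n \<bullet> x - k) * (if st x \<in> F then \<integral>s. indicator {0..bary W b (st x)} s * f (st x + s *\<^sub>R ?u) \<partial>lborel else 0))"
    for f :: "real^'n \<Rightarrow> real" and x
  have rep: "(LINT x:F|surface_measure. f x) = (\<integral>x. I f x \<partial>lborel)" and repint: "integrable lborel (I f)"
    if f: "continuous_on UNIV f" for f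
  proof -
    have fm [measurable]: "f \<in> borel_measurable borel" using f by (rule borel_measurable_continuous_onI)
    have fP: "continuous_on UNIV (\<lambda>x. f (P x))" by (rule continuous_on_compose2[OF f cP]) auto
    have "(LINT x:F|surface_measure. f x) = (\<integral>x. slab (n \<bullet> x - k) * (indicator F (P x) * f (P x)) \<partial>lborel)"
      unfolding P_def by (intro surface_integral_slab dim normal Fb F_plane fm)
    also have "\<dots> = (\<integral>x. indicator Q x * f (P x) \<partial>lborel)"
      by (intro Bochner_Integration.integral_cong) (auto simp: Q_def indicator_def)
    finally have 1: "(LINT x:F|surface_measure. f x) = (\<integral>x. indicator Q x * f (P x) \<partial>lborel)" .
    have int: "integrable lborel (\<lambda>x. indicator Q x * f (P x))"
      by (intro bounded_support_integrable bounded_support_indicator_continuous bQ Qb fP)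
    have gu: "bgrad W a \<bullet> ?u = 1" using bgrad_inner[OF ab(1,2), of a] ab(3) by simp
    have inner: "(\<integral>t. indicator Q (x + t *\<^sub>R ?u) * f (P (x + t *\<^sub>R ?u)) \<partial>lborel)
      = slab (n \<bullet> x - k) * (if st x \<in> F then \<integral>s. indicator {0..bary W b (st x)} s * f (st x + s *\<^sub>R ?u) \<partial>lborel else 0)" for x
    proof -
      define G where "G s = slab (n \<bullet> x - k) * (indicator F (st x + s *\<^sub>R ?u) * f (st x + s *\<^sub>R ?u))" for s
      have [measurable]: "G \<in> borel_measurable borel" unfolding G_def by measurable
      have "indicator Q (x + t *\<^sub>R ?u) * f (P (x + t *\<^sub>R ?u)) = G (t + bary W a (P x))" for t
      proof -
        have "st x + (t + bary W a (P x)) *\<^sub>R ?u = P (x + t *\<^sub>R ?u)"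
          unfolding Pu st_def by (simp only: add.assoc scaleR_left.add[symmetric]) simp
        then show ?thesis by (simp add: G_def Q_def indicator_def inner_add_right nu)
      qed
      then have "(\<integral>t. indicator Q (x + t *\<^sub>R ?u) * f (P (x + t *\<^sub>R ?u)) \<partial>lborel) = (\<integral>t. G t \<partial>lborel)"
        using lborel_integral_translate[of G "bary W a (P x)"] by simp
      also have "\<dots> = (\<integral>s. slab (n \<bullet> x - k) * ((if st x \<in> F then indicator {0..bary W b (st x)} s else 0) * f (st x + s *\<^sub>R ?u)) \<partial>lborel)"
        unfolding G_def using mem_F_line(1)[OF ab stA sta]
        by (intro Bochner_Integration.integral_cong refl) (simp add: indicator_def)
      finally show ?thesis by simp
    qed
    show "(LINT x:F|surface_measure. f x) = (\<integral>x. I f x \<partial>lborel)" "integrable lborel (I f)"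
      using integral_fibre[OF int gu] unfolding inner 1 I_def[abs_def] by simp_all
  qed
  show ?thesis
    unfolding rep[OF c(1)] rep[OF c(2)]
  proof (rule Bochner_Integration.integral_mono[OF repint[OF c(1)] repint[OF c(2)]])
    fix x
    show "I \<phi> x \<le> I \<psi> x"
      unfolding I_def using le[of "st x"] sta by (intro mult_left_mono) auto
  qed
qed

end

text \<open>One constant for both one-dimensional estimates. It is fixed by the degree alone, before
  any mesh appears, so later bounds are uniform in the mesh.\<close>

definition interval_constant :: "nat \<Rightarrow> real \<Rightarrow> bool" where
  "interval_constant p C \<longleftrightarrow> 0 \<le> C \<and> (\<forall>P :: real poly. \<forall>l. degree P \<le> p \<longrightarrow> 0 \<le> l \<longrightarrow>
      (\<integral>s. indicator {0..l} s * (poly P s)\<^sup>2 \<partial>lborel) \<le> C * (\<integral>s. indicator {0..l/2} s * (poly P s)\<^sup>2 \<partial>lborel) \<and>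
      l\<^sup>2 * (\<integral>s. indicator {0..l} s * (poly (pderiv P) s)\<^sup>2 \<partial>lborel) \<le> C * (\<integral>s. indicator {0..l} s * (poly P s)\<^sup>2 \<partial>lborel))"

lemma interval_constant_exists: "\<exists>C. interval_constant p C"
  unfolding interval_constant_def by (rule poly_interval_inequalities[of p]) blast

context face_basis
begin

text \<open>On a fibre in direction \<open>a - b\<close> the sum of the two coordinates is constant
  and equals the parameter length; the weight is therefore exactly the factor
  \<open>l\<^sup>2\<close> of the one-dimensional inverse inequality.\<close>

lemma inverse_weighted:
  assumes C: "interval_constant p C" and q: "q \<in> polys p" and ab: "a \<in> W" "b \<in> W" "a \<noteq> b"
  shows "(LINT x:F|surface_measure. (bary W a x + bary W b x)\<^sup>2 * (grad q x \<bullet> (a - b))\<^sup>2) \<le> C * (LINT x:F|surface_measure. (q x)\<^sup>2)"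
proof -
  note cq = polys_c1(1)[OF q]
  have "(LINT x:F|surface_measure. (bary W a x + bary W b x)\<^sup>2 * (grad q x \<bullet> (a - b))\<^sup>2) \<le> (LINT x:F|surface_measure. C * (q x)\<^sup>2)"
  proof (rule face_fibre_mono[OF ab])
    show "continuous_on UNIV (\<lambda>x. (bary W a x + bary W b x)\<^sup>2 * (grad q x \<bullet> (a - b))\<^sup>2)"
      by (intro continuous_intros continuous_grad_inner cq c1_continuous c1_bary)
    show "continuous_on UNIV (\<lambda>x. C * (q x)\<^sup>2)" by (intro continuous_intros c1_continuous cq)
    fix y assume y: "y \<in> F" "bary W a y = 0"
    then have yA: "y \<in> affine hull W" and l: "0 \<le> bary W b y" using ab by (auto simp: convex_hull_bary)
    obtain P where P: "degree P \<le> p" "\<And>s. q (y + s *\<^sub>R (a - b)) = poly P s"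
      using polys_line[OF q, of y "a - b"] by metis
    have D: "grad q (y + s *\<^sub>R (a - b)) \<bullet> (a - b) = poly (pderiv P) s" for s
    proof (rule DERIV_unique)
      show "((\<lambda>s. q (y + s *\<^sub>R (a - b))) has_real_derivative grad q (y + s *\<^sub>R (a - b)) \<bullet> (a - b)) (at s)"
        by (rule c1_line[OF cq])
      show "((\<lambda>s. q (y + s *\<^sub>R (a - b))) has_real_derivative poly (pderiv P) s) (at s)"
        unfolding P(2) by (rule poly_DERIV)
    qed
    let ?l = "bary W b y"
    have "(\<integral>s. indicator {0..?l} s * ((bary W a (y + s *\<^sub>R (a - b)) + bary W b (y + s *\<^sub>R (a - b)))\<^sup>2 * (grad q (y + s *\<^sub>R (a - b)) \<bullet> (a - b))\<^sup>2) \<partial>lborel)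
      = ?l\<^sup>2 * (\<integral>s. indicator {0..?l} s * (poly (pderiv P) s)\<^sup>2 \<partial>lborel)"
      unfolding mem_F_line(2,3)[OF ab yA y(2)] D integral_mult_right_zero[symmetric] by (simp add: mult_ac)
    also have "\<dots> \<le> C * (\<integral>s. indicator {0..?l} s * (poly P s)\<^sup>2 \<partial>lborel)"
      using C P(1) l by (simp add: interval_constant_def)
    also have "\<dots> = (\<integral>s. indicator {0..?l} s * (C * (q (y + s *\<^sub>R (a - b)))\<^sup>2) \<partial>lborel)"
      unfolding P(2) integral_mult_right_zero[symmetric] by (simp add: mult_ac)
    finally show "(\<integral>s. indicator {0..?l} s * ((bary W a (y + s *\<^sub>R (a - b)) + bary W b (y + s *\<^sub>R (a - b)))\<^sup>2 * (grad q (y + s *\<^sub>R (a - b)) \<bullet> (a - b))\<^sup>2) \<partial>lborel)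
       \<le> (\<integral>s. indicator {0..?l} s * (C * (q (y + s *\<^sub>R (a - b)))\<^sup>2) \<partial>lborel)" .
  qed
  then show ?thesis by simp
qed

text \<open>The weight degenerates only at the vertex \<open>c\<close>. On fibres in direction
  \<open>c - a\<close> it is at least 1/4 on the half away from \<open>c\<close>, because the
  parameter length is at most 1, and doubling recovers the other half.\<close>

lemma weight_removal:
  assumes C: "interval_constant p C" and r: "r \<in> polys p" and ca: "c \<in> W" "a \<in> W" "c \<noteq> a"
  shows "(LINT x:F|surface_measure. (r x)\<^sup>2) \<le> 4 * C * (LINT x:F|surface_measure. (1 - bary W c x)\<^sup>2 * (r x)\<^sup>2)"
proof -
  note cr = polys_c1(1)[OF r]
  have C0: "0 \<le> C" using C by (simp add: interval_constant_def)
  have "(LINT x:F|surface_measure. (r x)\<^sup>2) \<le> (LINT x:F|surface_measure. 4 * C * ((1 - bary W c x)\<^sup>2 * (r x)\<^sup>2))"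
  proof (rule face_fibre_mono[OF ca])
    show "continuous_on UNIV (\<lambda>x. (r x)\<^sup>2)" by (intro continuous_intros c1_continuous cr)
    show "continuous_on UNIV (\<lambda>x. 4 * C * ((1 - bary W c x)\<^sup>2 * (r x)\<^sup>2))"
      by (intro continuous_intros c1_continuous cr c1_bary)
    fix y assume y: "y \<in> F" "bary W c y = 0"
    let ?l = "bary W a y"
    have yA: "y \<in> affine hull W" and l0: "0 \<le> ?l" using y ca by (auto simp: convex_hull_bary)
    have "?l \<le> (\<Sum>b\<in>W. bary W b y)"
      using y ca finite by (intro member_le_sum) (auto simp: convex_hull_bary)
    then have l1: "?l \<le> 1" using affine_hull_bary(2)[OF yA] by simp
    obtain P where P: "degree P \<le> p" "\<And>s. r (y + s *\<^sub>R (c - a)) = poly P s"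
      using polys_line[OF r, of y "c - a"] by metis
    have "(\<integral>s. indicator {0..?l} s * (r (y + s *\<^sub>R (c - a)))\<^sup>2 \<partial>lborel) \<le> C * (\<integral>s. indicator {0..?l/2} s * (poly P s)\<^sup>2 \<partial>lborel)"
      unfolding P(2) using C P(1) l0 by (simp add: interval_constant_def)
    also have "\<dots> \<le> C * (\<integral>s. indicator {0..?l} s * (4 * ((1 - s)\<^sup>2 * (poly P s)\<^sup>2)) \<partial>lborel)"
    proof (intro mult_left_mono C0 Bochner_Integration.integral_mono poly_square_integrable)
      have eq: "4 * ((1 - s)\<^sup>2 * (poly P s)\<^sup>2) = poly ([:4:] * [:1, -1:] * [:1, -1:] * P * P) s" for s
        by (simp add: power2_eq_square algebra_simps)
      show "integrable lborel (\<lambda>s. indicator {0..?l} s * (4 * ((1 - s)\<^sup>2 * (poly P s)\<^sup>2)))"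
        unfolding eq by (rule poly_interval_integrable)
      fix s :: real
      show "indicator {0..?l/2} s * (poly P s)\<^sup>2 \<le> indicator {0..?l} s * (4 * ((1 - s)\<^sup>2 * (poly P s)\<^sup>2))"
      proof (cases "s \<in> {0..?l/2}")
        case True
        then have "1/2 \<le> 1 - s" using l1 by auto
        then have "(1/2)\<^sup>2 \<le> (1 - s)\<^sup>2" by (intro power_mono) auto
        then have "1 \<le> 4 * (1 - s)\<^sup>2" by (simp add: power2_eq_square)
        then have "1 * (poly P s)\<^sup>2 \<le> (4 * (1 - s)\<^sup>2) * (poly P s)\<^sup>2" by (intro mult_right_mono) auto
        then show ?thesis using True l0 by (auto simp: indicator_def)
      qed (auto simp: indicator_def)
    qed
    also have "\<dots> = (\<integral>s. indicator {0..?l} s * (4 * C * ((1 - bary W c (y + s *\<^sub>R (c - a)))\<^sup>2 * (r (y + s *\<^sub>R (c - a)))\<^sup>2)) \<partial>lborel)"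
      unfolding P(2) mem_F_line(2)[OF ca yA y(2)] integral_mult_right_zero[symmetric] by (simp add: mult_ac)
    finally show "(\<integral>s. indicator {0..?l} s * (r (y + s *\<^sub>R (c - a)))\<^sup>2 \<partial>lborel)
       \<le> (\<integral>s. indicator {0..?l} s * (4 * C * ((1 - bary W c (y + s *\<^sub>R (c - a)))\<^sup>2 * (r (y + s *\<^sub>R (c - a)))\<^sup>2)) \<partial>lborel)" .
  qed
  then show ?thesis by simp
qed

text \<open>For \<open>d = 2\<close> the weight in \<open>inverse_weighted\<close> is 1. For
  \<open>d = 3\<close> it is \<open>(1 - bary W c x)\<^sup>2\<close> with \<open>c\<close> the third
  vertex, and \<open>weight_removal\<close> applies to the edge derivative, itself a polynomial. The
  constant covers both cases.\<close>

lemma inverse_inequality: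
  assumes C: "interval_constant p C" and q: "q \<in> polys p" and ab: "a \<in> W" "b \<in> W"
  shows "(LINT x:F|surface_measure. (grad q x \<bullet> (a - b))\<^sup>2) \<le> (C + 4 * C * C) * (LINT x:F|surface_measure. (q x)\<^sup>2)"
proof -
  have C0: "0 \<le> C" using C by (simp add: interval_constant_def)
  have S0: "0 \<le> (LINT x:F|surface_measure. (q x)\<^sup>2)"
    unfolding set_lebesgue_integral_def by (intro Bochner_Integration.integral_nonneg) auto
  show ?thesis
  proof (cases "a = b")
    case True
    then show ?thesis using C0 S0 by simp
  next
    case False
    have weighted: "(LINT x:F|surface_measure. (bary W a x + bary W b x)\<^sup>2 * (grad q x \<bullet> (a - b))\<^sup>2) \<le> C * (LINT x:F|surface_measure. (q x)\<^sup>2)"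
      by (rule inverse_weighted[OF C q ab False])
    have Fb: "F \<in> sets surface_measure" using compact_F by (simp add: borel_compact)
    have sum1: "(\<Sum>c\<in>W. bary W c x) = 1" if "x \<in> F" for x
      using that affine_hull_bary(2) by (auto simp: convex_hull_bary)
    show ?thesis
    proof (cases "W = {a, b}")
      case True
      have "(LINT x:F|surface_measure. (bary W a x + bary W b x)\<^sup>2 * (grad q x \<bullet> (a - b))\<^sup>2) = (LINT x:F|surface_measure. (grad q x \<bullet> (a - b))\<^sup>2)"
      proof (rule set_lebesgue_integral_cong[OF Fb], safe)
        fix x assume "x \<in> F"
        then have "bary W a x + bary W b x = 1"
          using sum1[of x] sum.insert[of "{b}" a "\<lambda>c. bary W c x"] True False by auto
        then show "(bary W a x + bary W b x)\<^sup>2 * (grad q x \<bullet> (a - b))\<^sup>2 = (grad q x \<bullet> (a - b))\<^sup>2" by simp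
      qed
      then show ?thesis using weighted C0 S0
        by (simp add: distrib_right add_increasing2)
    next
      case False': False
      then obtain c where c: "c \<in> W" "c \<noteq> a" "c \<noteq> b" using ab by blast
      have "card {a, b, c} = 3" using c False by simp
      moreover have "card {a, b, c} \<le> card W" using ab c by (intro card_mono finite) auto
      ultimately have "card {a, b, c} = card W" using card dim by auto
      then have "{a, b, c} = W" using ab c finite by (intro card_subset_eq) auto
      then have W: "W = {a, b, c}" by simp
      have "(LINT x:F|surface_measure. (grad q x \<bullet> (a - b))\<^sup>2) \<le> 4 * C * (LINT x:F|surface_measure. (1 - bary W c x)\<^sup>2 * (grad q x \<bullet> (a - b))\<^sup>2)"
        by (rule weight_removal[OF C polys_grad_inner(1)[OF q] c(1) ab(1) c(2)])
      also have "(LINT x:F|surface_measure. (1 - bary W c x)\<^sup>2 * (grad q x \<bullet> (a - b))\<^sup>2) = (LINT x:F|surface_measure. (bary W a x + bary W b x)\<^sup>2 * (grad q x \<bullet> (a - b))\<^sup>2)"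
      proof (rule set_lebesgue_integral_cong[OF Fb], safe)
        fix x assume "x \<in> F"
        then have "(\<Sum>d\<in>{a, b, c}. bary W d x) = 1" using sum1[of x] W by simp
        then have "bary W a x + bary W b x = 1 - bary W c x" using c False by (simp add: algebra_simps)
        then show "(1 - bary W c x)\<^sup>2 * (grad q x \<bullet> (a - b))\<^sup>2 = (bary W a x + bary W b x)\<^sup>2 * (grad q x \<bullet> (a - b))\<^sup>2" by simp
      qed
      also have "4 * C * \<dots> \<le> 4 * C * (C * (LINT x:F|surface_measure. (q x)\<^sup>2))"
        using weighted C0 by (intro mult_left_mono) auto
      also have "\<dots> \<le> (C + 4 * C * C) * (LINT x:F|surface_measure. (q x)\<^sup>2)"
        using C0 S0 by (simp add: distrib_right mult.assoc)
      finally show ?thesis .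
    qed
  qed
qed

lemma ridge_compact: "compact (convex hull (W - {c}))"
  using finite by (intro finite_imp_compact_convex_hull) auto

lemma ridge_ne: "c \<in> W \<Longrightarrow> convex hull (W - {c}) \<noteq> {}"
  using facet_ne by simp

lemma ridge_AE: "c \<in> W \<Longrightarrow> AE x in ridge_measure (convex hull (W - {c})). x \<in> F \<and> bary W c x = 0"
proof -
  assume c: "c \<in> W"
  show ?thesis
    using AE_ridge_measure[OF ridge_compact ridge_ne[OF c]] unfolding convex_hull_facet[OF c facet_ne[OF c]] by simp
qed

text \<open>The divergence theorem for the field \<open>(x - c) f\<close>, written in barycentric coordinates: its only
  flux is through the ridge opposite \<open>c\<close>.\<close>

lemma trace_identity:
  assumes f: "c1 f" and c: "c \<in> W"
  shows "(\<integral>x. f x \<partial>ridge_measure (convex hull (W - {c}))) / (pi * norm (bgrad W c))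
    = (\<Sum>a\<in>W - {c}. LINT x:F|surface_measure. bary W a x * (grad f x \<bullet> (a - c)) + f x)"
proof -
  let ?E = "\<lambda>c f. \<integral>x. f x \<partial>ridge_measure (convex hull (W - {c}))"
  have cf: "c1 (\<lambda>x. bary W a x * f x)" for a by (intro c1_mult c1_bary f)
  have 1: "(LINT x:F|surface_measure. bary W a x * (grad f x \<bullet> (a - c)) + f x) = ?E c (\<lambda>x. bary W a x * f x) / (pi * norm (bgrad W c))"
    if a: "a \<in> W - {c}" for a
  proof -
    have aW: "a \<in> W" "a \<noteq> c" using a by auto
    have "grad (\<lambda>x. bary W a x * f x) x \<bullet> (a - c) = bary W a x * (grad f x \<bullet> (a - c)) + f x" for x
      using bgrad_inner[OF aW(1) c, of a] aW
      by (simp add: c1_mult(2)[OF c1_bary(1) f] c1_bary(2) inner_add_left)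
    then have "(LINT x:F|surface_measure. bary W a x * (grad f x \<bullet> (a - c)) + f x)
       = (\<Sum>c'\<in>W. (outer W c' \<bullet> (a - c)) * (?E c' (\<lambda>x. bary W a x * f x) / pi))"
      using face_divergence[OF dim affine_basis_axioms card normal aff _ cf, of "a - c" a] plane_directions directions_diff[OF aW(1) c] by simp
    also have "\<dots> = (\<Sum>c'\<in>W. if c' = c then ?E c (\<lambda>x. bary W a x * f x) / (pi * norm (bgrad W c)) else 0)"
    proof (rule sum.cong[OF refl])
      fix c' assume c': "c' \<in> W"
      have o: "outer W c' \<bullet> (a - c) = - (of_bool (a = c') - of_bool (c = c')) / norm (bgrad W c')"
        using bgrad_inner[OF aW(1) c, of c'] by (simp add: outer_def)
      \<comment> \<open>On the ridge opposite \<open>a\<close> the factor \<open>bary W a\<close>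
        vanishes; for any other ridge than the one opposite \<open>c\<close> the direction
        \<open>a - c\<close> is tangential.\<close>
      have "?E a (\<lambda>x. bary W a x * f x) = (\<integral>x. 0 \<partial>ridge_measure (convex hull (W - {a})))"
      proof (rule integral_cong_AE)
        show "AE x in ridge_measure (convex hull (W - {a})). bary W a x * f x = 0"
          using ridge_AE[OF aW(1)] by eventually_elim simp
        show "(\<lambda>x. bary W a x * f x) \<in> borel_measurable (ridge_measure (convex hull (W - {a})))"
          using borel_measurable_continuous_onI[OF c1_continuous[OF cf]] by (simp cong: measurable_cong_sets)
      qed simp
      then show "(outer W c' \<bullet> (a - c)) * (?E c' (\<lambda>x. bary W a x * f x) / pi) = (if c' = c then ?E c (\<lambda>x. bary W a x * f x) / (pi * norm (bgrad W c)) else 0)"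
        unfolding o using aW by auto
    qed
    also have "\<dots> = ?E c (\<lambda>x. bary W a x * f x) / (pi * norm (bgrad W c))"
      using c finite by simp
    finally show ?thesis .
  qed
  \<comment> \<open>On the ridge opposite \<open>c\<close> the coordinates of the remaining vertices
    sum to 1, so the weights disappear.\<close>
  have "(\<Sum>a\<in>W - {c}. ?E c (\<lambda>x. bary W a x * f x)) = ?E c (\<lambda>x. \<Sum>a\<in>W - {c}. bary W a x * f x)"
    by (rule Bochner_Integration.integral_sum[symmetric]) (intro integrable_ridge_measure ridge_compact ridge_ne c c1_continuous cf)
  also have "\<dots> = ?E c f"
  proof (rule integral_cong_AE)
    show "AE x in ridge_measure (convex hull (W - {c})). (\<Sum>a\<in>W - {c}. bary W a x * f x) = f x"
      using ridge_AE[OF c]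
    proof eventually_elim
      case (elim x)
      then have "(\<Sum>a\<in>W - {c}. bary W a x) = 1"
        using affine_hull_bary(2)[of x] sum.remove[OF finite c, of "\<lambda>a. bary W a x"] by (auto simp: convex_hull_bary)
      then show ?case by (simp add: sum_distrib_right[symmetric])
    qed
    have "continuous_on UNIV (\<lambda>x. \<Sum>a\<in>W - {c}. bary W a x * f x)" by (intro continuous_intros c1_continuous f c1_bary)
    from borel_measurable_continuous_onI[OF this]
    show "(\<lambda>x. \<Sum>a\<in>W - {c}. bary W a x * f x) \<in> borel_measurable (ridge_measure (convex hull (W - {c})))"
      by (simp cong: measurable_cong_sets)
    show "f \<in> borel_measurable (ridge_measure (convex hull (W - {c})))"
      using borel_measurable_continuous_onI[OF c1_continuous[OF f]] by (simp cong: measurable_cong_sets)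
  qed
  finally have "?E c f / (pi * norm (bgrad W c)) = (\<Sum>a\<in>W - {c}. ?E c (\<lambda>x. bary W a x * f x) / (pi * norm (bgrad W c)))"
    unfolding sum_divide_distrib[symmetric] by simp
  also have "\<dots> = (\<Sum>a\<in>W - {c}. LINT x:F|surface_measure. bary W a x * (grad f x \<bullet> (a - c)) + f x)"
    using 1 by (intro sum.cong) auto
  finally show ?thesis .
qed

lemma bary_le_1: "x \<in> F \<Longrightarrow> a \<in> W \<Longrightarrow> 0 \<le> bary W a x \<and> bary W a x \<le> 1"
  using member_le_sum[of a W "\<lambda>a. bary W a x"] affine_hull_bary(2)[of x] finite by (auto simp: convex_hull_bary)

text \<open>The identity is applied to the square of \<open>q\<close>. The mixed term
  \<open>2 * q * dq\<close> is at most \<open>q\<^sup>2 + dq\<^sup>2\<close>, and the inverse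
  inequality absorbs the derivative; the leading 2 bounds the number of vertices other than
  \<open>c\<close>.\<close>

lemma trace_inequality:
  assumes C: "interval_constant p C" and q: "q \<in> polys p" and c: "c \<in> W"
  shows "(\<integral>x. (q x)\<^sup>2 \<partial>ridge_measure (convex hull (W - {c})))
    \<le> pi * norm (bgrad W c) * (2 * (2 + (C + 4 * C * C)) * (LINT x:F|surface_measure. (q x)\<^sup>2))"
proof -
  note cq = polys_c1(1)[OF q]
  have C0: "0 \<le> C" using C by (simp add: interval_constant_def)
  let ?S = "LINT x:F|surface_measure. (q x)\<^sup>2"
  let ?k = "2 + (C + 4 * C * C)"
  have S0: "0 \<le> ?S" unfolding set_lebesgue_integral_def by (intro Bochner_Integration.integral_nonneg) auto
  have cq2: "c1 (\<lambda>x. (q x)\<^sup>2)" and gq2: "grad (\<lambda>x. (q x)\<^sup>2) x = (2 * q x) *\<^sub>R grad q x" for x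
    using c1_mult[OF cq cq] by (simp_all add: power2_eq_square scaleR_add_left[symmetric])
  have bound: "(LINT x:F|surface_measure. bary W a x * (grad (\<lambda>x. (q x)\<^sup>2) x \<bullet> (a - c)) + (q x)\<^sup>2) \<le> ?k * ?S" if a: "a \<in> W" for a
  proof -
    have "(LINT x:F|surface_measure. bary W a x * (grad (\<lambda>x. (q x)\<^sup>2) x \<bullet> (a - c)) + (q x)\<^sup>2)
       \<le> (LINT x:F|surface_measure. 2 * (q x)\<^sup>2 + (grad q x \<bullet> (a - c))\<^sup>2)"
    proof (rule surf_mono)
      show "continuous_on UNIV (\<lambda>x. bary W a x * (grad (\<lambda>x. (q x)\<^sup>2) x \<bullet> (a - c)) + (q x)\<^sup>2)"
        by (intro continuous_intros continuous_grad_inner c1_continuous cq2 cq c1_bary)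
      show "continuous_on UNIV (\<lambda>x. 2 * (q x)\<^sup>2 + (grad q x \<bullet> (a - c))\<^sup>2)"
        by (intro continuous_intros continuous_grad_inner c1_continuous cq)
      fix x assume "x \<in> F"
      then have b: "0 \<le> bary W a x" "bary W a x \<le> 1" using bary_le_1 a by auto
      let ?d = "grad q x \<bullet> (a - c)"
      have "bary W a x * (2 * q x * ?d) \<le> bary W a x * ((q x)\<^sup>2 + ?d\<^sup>2)"
        using b sum_squares_bound[of "q x" ?d] by (intro mult_left_mono) auto
      also have "\<dots> \<le> 1 * ((q x)\<^sup>2 + ?d\<^sup>2)" using b by (intro mult_right_mono) auto
      finally show "bary W a x * (grad (\<lambda>x. (q x)\<^sup>2) x \<bullet> (a - c)) + (q x)\<^sup>2 \<le> 2 * (q x)\<^sup>2 + ?d\<^sup>2"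
        by (simp add: gq2)
    qed
    also have "\<dots> = 2 * ?S + (LINT x:F|surface_measure. (grad q x \<bullet> (a - c))\<^sup>2)"
    proof -
      have i: "set_integrable surface_measure F (\<lambda>x. 2 * (q x)\<^sup>2)" "set_integrable surface_measure F (\<lambda>x. (grad q x \<bullet> (a - c))\<^sup>2)"
        by (intro surf_int continuous_intros continuous_grad_inner c1_continuous cq)+
      show ?thesis using set_integral_add(2)[OF i] by simp
    qed
    also have "\<dots> \<le> ?k * ?S"
      using inverse_inequality[OF C q a c] by (simp add: algebra_simps)
    finally show ?thesis .
  qed
  have nz: "norm (bgrad W c) \<noteq> 0"
  proof -
    obtain b where "b \<in> W" "b \<noteq> c" using facet_ne[OF c] by blast
    then show ?thesis using bgrad_nonzero[OF c, of b] by simp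
  qed
  have "(\<integral>x. (q x)\<^sup>2 \<partial>ridge_measure (convex hull (W - {c}))) / (pi * norm (bgrad W c)) \<le> (\<Sum>a\<in>W - {c}. ?k * ?S)"
    unfolding trace_identity[OF cq2 c] by (intro sum_mono bound) auto
  also have "\<dots> = real (card (W - {c})) * (?k * ?S)" by simp
  also have "\<dots> \<le> 2 * (?k * ?S)"
    using card dim finite c C0 S0 by (intro mult_right_mono mult_nonneg_nonneg) (auto simp: card_Diff_singleton)
  finally have "(\<integral>x. (q x)\<^sup>2 \<partial>ridge_measure (convex hull (W - {c}))) / (pi * norm (bgrad W c)) \<le> 2 * ?k * ?S" by (simp only: mult.assoc)
  then have "(\<integral>x. (q x)\<^sup>2 \<partial>ridge_measure (convex hull (W - {c}))) \<le> (2 * ?k * ?S) * (pi * norm (bgrad W c))"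
    using nz by (subst (asm) pos_divide_le_eq) auto
  then show ?thesis by (simp only: mult.commute[of "pi * norm (bgrad W c)"])
qed

text \<open>Serves the boundary faces, where only \<open>q\<close> itself is penalised. The conormal
  derivative is a combination of edge derivatives with coefficients at most \<open>G\<close>. The 9
  is a 3 from Cauchy-Schwarz over at most three vertices times a 3 from summing the inverse
  inequalities. Each power of \<open>G\<close> later becomes an inverse face size.\<close>

lemma conormal_trace_inequality:
  assumes C: "interval_constant p C" and q: "q \<in> polys p" and c: "c \<in> W"
    and G: "\<And>a. a \<in> W \<Longrightarrow> norm (bgrad W a) \<le> G"
  shows "(\<integral>x. (grad q x \<bullet> outer W c)\<^sup>2 \<partial>ridge_measure (convex hull (W - {c})))
    \<le> pi * G * (2 * (2 + (C + 4 * C * C)) * (9 * G\<^sup>2 * (C + 4 * C * C) * (LINT x:F|surface_measure. (q x)\<^sup>2)))"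
proof -
  note cq = polys_c1(1)[OF q]
  have C0: "0 \<le> C" using C by (simp add: interval_constant_def)
  let ?S = "LINT x:F|surface_measure. (q x)\<^sup>2"
  let ?c = "C + 4 * C * C"
  have S0: "0 \<le> ?S" unfolding set_lebesgue_integral_def by (intro Bochner_Integration.integral_nonneg) auto
  have G0: "0 \<le> G" using G[OF c] norm_ge_zero order_trans by blast
  have W3: "real (card W) \<le> 3" using card dim by auto
  let ?\<mu> = "outer W c"
  have \<mu>d: "?\<mu> \<in> directions W" unfolding outer_def by (intro subspace_scale subspace_directions bgrad_mem)
  have \<mu>1: "norm ?\<mu> \<le> 1" by (simp add: outer_def)
  have exp: "grad q x \<bullet> ?\<mu> = (\<Sum>a\<in>W. (bgrad W a \<bullet> ?\<mu>) * (grad q x \<bullet> (a - c)))" for x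
  proof -
    have "?\<mu> = (\<Sum>a\<in>W. (bgrad W a \<bullet> ?\<mu>) *\<^sub>R (a - c))"
      using directions_expansion[OF \<mu>d] by (simp add: scaleR_diff_right sum_subtractf scaleR_sum_left[symmetric])
    then have "grad q x \<bullet> ?\<mu> = grad q x \<bullet> (\<Sum>a\<in>W. (bgrad W a \<bullet> ?\<mu>) *\<^sub>R (a - c))" by simp
    then show ?thesis by (simp add: inner_sum_right)
  qed
  have sq: "(grad q x \<bullet> ?\<mu>)\<^sup>2 \<le> 3 * G\<^sup>2 * (\<Sum>a\<in>W. (grad q x \<bullet> (a - c))\<^sup>2)" for x
  proof -
    have "(grad q x \<bullet> ?\<mu>)\<^sup>2 \<le> (\<Sum>a\<in>W. ((bgrad W a \<bullet> ?\<mu>) * (grad q x \<bullet> (a - c)))\<^sup>2) * real (card W)"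
      unfolding exp by (rule sum_squared_le_sum_of_squares)
    also have "\<dots> \<le> (\<Sum>a\<in>W. G\<^sup>2 * (grad q x \<bullet> (a - c))\<^sup>2) * 3"
    proof (intro mult_mono sum_mono W3)
      fix a assume a: "a \<in> W"
      have "\<bar>bgrad W a \<bullet> ?\<mu>\<bar> \<le> norm (bgrad W a) * norm ?\<mu>" by (rule Cauchy_Schwarz_ineq2)
      also have "\<dots> \<le> G * 1" using G[OF a] \<mu>1 G0 by (intro mult_mono) auto
      finally have "\<bar>bgrad W a \<bullet> ?\<mu>\<bar>\<^sup>2 \<le> G\<^sup>2" by (intro power_mono) auto
      then show "((bgrad W a \<bullet> ?\<mu>) * (grad q x \<bullet> (a - c)))\<^sup>2 \<le> G\<^sup>2 * (grad q x \<bullet> (a - c))\<^sup>2"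
        by (simp add: power_mult_distrib mult_right_mono)
    qed (auto intro: sum_nonneg)
    finally show ?thesis by (simp add: sum_distrib_left mult_ac)
  qed
  have "(LINT x:F|surface_measure. (grad q x \<bullet> ?\<mu>)\<^sup>2) \<le> (LINT x:F|surface_measure. 3 * G\<^sup>2 * (\<Sum>a\<in>W. (grad q x \<bullet> (a - c))\<^sup>2))"
    by (intro surf_mono sq continuous_intros continuous_grad_inner cq)
  also have "\<dots> = 3 * G\<^sup>2 * (\<Sum>a\<in>W. LINT x:F|surface_measure. (grad q x \<bullet> (a - c))\<^sup>2)"
  proof -
    have "(LINT x:F|surface_measure. (\<Sum>a\<in>W. (grad q x \<bullet> (a - c))\<^sup>2)) = (\<Sum>a\<in>W. LINT x:F|surface_measure. (grad q x \<bullet> (a - c))\<^sup>2)"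
      unfolding set_lebesgue_integral_def scaleR_sum_right
      by (rule Bochner_Integration.integral_sum)
         (use surf_int[OF continuous_on_power[OF continuous_grad_inner[OF cq]]] in \<open>simp add: set_integrable_def\<close>)
    then show ?thesis by simp
  qed
  also have "\<dots> \<le> 3 * G\<^sup>2 * (\<Sum>a\<in>W. ?c * ?S)"
    by (intro mult_left_mono sum_mono inverse_inequality[OF C q _ c]) auto
  also have "\<dots> = 3 * G\<^sup>2 * (real (card W) * (?c * ?S))" by simp
  also have "\<dots> \<le> 3 * G\<^sup>2 * (3 * (?c * ?S))"
    using W3 C0 S0 by (intro mult_left_mono mult_right_mono) auto
  finally have 1: "(LINT x:F|surface_measure. (grad q x \<bullet> ?\<mu>)\<^sup>2) \<le> 9 * G\<^sup>2 * ?c * ?S" by (simp add: mult_ac)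
  have "(\<integral>x. (grad q x \<bullet> ?\<mu>)\<^sup>2 \<partial>ridge_measure (convex hull (W - {c})))
     \<le> pi * norm (bgrad W c) * (2 * (2 + ?c) * (LINT x:F|surface_measure. (grad q x \<bullet> ?\<mu>)\<^sup>2))"
    by (rule trace_inequality[OF C polys_grad_inner(1)[OF q] c])
  also have "\<dots> \<le> pi * G * (2 * (2 + ?c) * (9 * G\<^sup>2 * ?c * ?S))"
    using C0 S0 G0 G[OF c] 1
    by (intro mult_mono) (auto intro!: mult_nonneg_nonneg Bochner_Integration.integral_nonneg simp: set_lebesgue_integral_def)
  finally show ?thesis .
qed

end

section \<open>Combinatorics of the mesh\<close>

text \<open>Elements and faces of a mesh are bare sets; their vertices are recovered as extreme
  points.\<close>

definition verts :: "'a::euclidean_space set \<Rightarrow> 'a set" where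
  "verts K = {x. x extreme_point_of K}"

lemma verts_hull: "\<not> affine_dependent W \<Longrightarrow> verts (convex hull W) = W"
  by (auto simp: verts_def extreme_point_of_convex_hull_affine_independent)

context affine_basis
begin

lemma positive_combination_rel_interior:
  assumes D: "D \<subseteq> W" and y: "y \<in> affine hull W" "\<And>c. c \<in> D \<Longrightarrow> 0 < bary W c y" "\<And>c. c \<in> W - D \<Longrightarrow> bary W c y = 0"
  shows "y \<in> rel_interior (convex hull D)"
proof -
  have fD: "Finite_Set.finite D" using D finite finite_subset by blast
  have "(\<Sum>c\<in>D. bary W c y) = 1" "(\<Sum>c\<in>D. bary W c y *\<^sub>R c) = y"
  proof -
    have "(\<Sum>c\<in>D. bary W c y) = (\<Sum>c\<in>W. bary W c y)" "(\<Sum>c\<in>D. bary W c y *\<^sub>R c) = (\<Sum>c\<in>W. bary W c y *\<^sub>R c)"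
      using y(3) by (intro sum.mono_neutral_left finite D; auto)+
    then show "(\<Sum>c\<in>D. bary W c y) = 1" "(\<Sum>c\<in>D. bary W c y *\<^sub>R c) = y"
      using affine_hull_bary[OF y(1)] by simp_all
  qed
  then have "y \<in> {y. \<exists>u. (\<forall>x\<in>D. 0 < u x) \<and> sum u D = 1 \<and> (\<Sum>i\<in>D. u i *\<^sub>R i) = y}"
    using y(2) by (intro CollectI exI[of _ "\<lambda>c. bary W c y"]) simp
  then show ?thesis
    by (rule subsetD[OF explicit_subset_rel_interior_convex_hull_minimal[OF fD]])
qed

end

text \<open>A canonical relative interior point; it tests which elements contain a given subsimplex
  and on which side of a face they lie.\<close>

definition centroid :: "'a::euclidean_space set \<Rightarrow> 'a" where
  "centroid D = (\<Sum>c\<in>D. (1 / real (card D)) *\<^sub>R c)"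

context affine_basis
begin

lemma centroid_bary:
  assumes D: "D \<subseteq> W" "D \<noteq> {}"
  shows "c \<in> W \<Longrightarrow> bary W c (centroid D) = of_bool (c \<in> D) / real (card D)" "centroid D \<in> affine hull W"
    "centroid D \<in> convex hull D"
proof -
  have fD: "Finite_Set.finite D" using D finite finite_subset by blast
  have n0: "card D \<noteq> 0" using fD D by simp
  have e: "centroid D = (\<Sum>c\<in>W. (of_bool (c \<in> D) / real (card D)) *\<^sub>R c)"
  proof -
    have "(\<Sum>c\<in>D. (1 / real (card D)) *\<^sub>R c) = (\<Sum>c\<in>D. (of_bool (c \<in> D) / real (card D)) *\<^sub>R c)" by (intro sum.cong) auto
    also have "\<dots> = (\<Sum>c\<in>W. (of_bool (c \<in> D) / real (card D)) *\<^sub>R c)"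
      by (intro sum.mono_neutral_left finite D) auto
    finally show ?thesis by (simp add: centroid_def)
  qed
  have s: "(\<Sum>c\<in>W. of_bool (c \<in> D) / real (card D)) = 1"
  proof -
    have "(\<Sum>c\<in>W. of_bool (c \<in> D) / real (card D)) = (\<Sum>c\<in>D. of_bool (c \<in> D) / real (card D))"
      by (intro sum.mono_neutral_right finite D) auto
    also have "\<dots> = 1" using n0 by simp
    finally show ?thesis .
  qed
  show "c \<in> W \<Longrightarrow> bary W c (centroid D) = of_bool (c \<in> D) / real (card D)"
    unfolding e using bary_affine_combination[OF _ s] by simp
  show "centroid D \<in> convex hull D"
    unfolding convex_hull_finite[OF fD] centroid_def using n0
    by (intro CollectI exI[of _ "\<lambda>_. 1 / real (card D)"]) auto
  then show "centroid D \<in> affine hull W"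
    using convex_hull_subset_affine_hull[of D] hull_mono[OF D(1), of affine] by blast
qed

lemma centroid_rel_interior:
  assumes D: "D \<subseteq> W" "D \<noteq> {}" shows "centroid D \<in> rel_interior (convex hull D)"
proof (rule positive_combination_rel_interior[OF D(1) centroid_bary(2)[OF D]])
  have "0 < card D" using D finite finite_subset by (simp add: card_gt_0_iff)
  then show "0 < bary W c (centroid D)" if "c \<in> D" for c
    using centroid_bary(1)[OF D, of c] that D by auto
  show "bary W c (centroid D) = 0" if "c \<in> W - D" for c
    using centroid_bary(1)[OF D, of c] that by auto
qed

end

lemma continuous_bary: "continuous_on S (bary V c)"
  unfolding bary_def[abs_def] by (intro continuous_intros)

locale element = full_simplex V for V :: "(real^'n::finite) set" +
  assumes dim: "CARD('n) \<in> {2, 3}"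
begin

abbreviation "K \<equiv> convex hull V"

lemma compact_K: "compact K"
  using finite by (rule finite_imp_compact_convex_hull)

lemma positive_interior: "(\<And>c. c \<in> V \<Longrightarrow> 0 < bary V c y) \<Longrightarrow> y \<in> interior K"
proof (rule interiorI)
  show "open {x. \<forall>c\<in>V. 0 < bary V c x}"
  proof -
    have "{x. \<forall>c\<in>V. 0 < bary V c x} = (\<Inter>c\<in>V. {x. 0 < bary V c x})" by auto
    then show ?thesis
      using finite by (auto intro!: open_INT open_Collect_less continuous_bary continuous_on_const)
  qed
  show "{x. \<forall>c\<in>V. 0 < bary V c x} \<subseteq> K" by (auto simp: hull_bary less_imp_le)
qed auto

lemma outer_norm: "c \<in> V \<Longrightarrow> norm (outer V c) = 1"
  using bgrad_nz by (simp add: outer_def)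

lemma facet_hull: "c \<in> V \<Longrightarrow> convex hull (V - {c}) = K \<inter> {x. bary V c x = 0}"
  using convex_hull_facet facet_nonempty by blast

lemma outer_diff:
  assumes "c \<in> V" "bary V c x = 0" shows "outer V c \<bullet> (y - x) = - bary V c y / norm (bgrad V c)"
  using bary_diff[of c y x] assms by (simp add: outer_def)

lemma outer_outward: "c \<in> V \<Longrightarrow> outward_on (outer V c) (convex hull (V - {c})) K"
  by (auto simp: outward_on_def facet_hull outer_diff hull_bary divide_nonneg_nonneg)

lemma not_inward: "c \<in> V \<Longrightarrow> \<not> outward_on (- outer V c) (convex hull (V - {c})) K"
proof
  assume c: "c \<in> V" and o: "outward_on (- outer V c) (convex hull (V - {c})) K"
  obtain b where "b \<in> V - {c}" using facet_nonempty[OF c] by auto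
  then obtain x where x: "x \<in> convex hull (V - {c})" using hull_inc by metis
  have "c \<in> K" using c by (rule hull_inc)
  then have "- outer V c \<bullet> (c - x) \<le> 0" using o x by (auto simp: outward_on_def)
  moreover have "bary V c x = 0" using x facet_hull[OF c] by auto
  ultimately have "1 / norm (bgrad V c) \<le> 0"
    using outer_diff[OF c, of x c] bary_vertex[OF c c] by simp
  then show False using bgrad_nz[OF c] by simp
qed

lemma normal_cases:
  assumes c: "c \<in> V" and \<nu>: "unit_normal_to \<nu> (convex hull (V - {c}))"
  shows "\<nu> = outer V c \<or> \<nu> = - outer V c"
proof -
  let ?g = "bgrad V c"
  have gg: "?g \<bullet> ?g \<noteq> 0" using bgrad_nz[OF c] by simp
  have perp: "\<nu> \<bullet> z = 0" if "z \<in> directions (V - {c})" for z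
    using that unfolding directions_def
  proof (induction rule: span_induct_alt)
    case (step r d z)
    then obtain x y where "d = x - y" "x \<in> V - {c}" "y \<in> V - {c}" by auto
    then have "\<nu> \<bullet> d = 0" using \<nu> hull_inc[of _ "V - {c}" convex] unfolding unit_normal_to_def by auto
    then show ?case using step by (simp add: inner_add_right)
  qed simp
  define z where "z = \<nu> - ((\<nu> \<bullet> ?g) / (?g \<bullet> ?g)) *\<^sub>R ?g"
  have gz: "?g \<bullet> z = 0" using gg by (simp add: z_def inner_diff_right inner_commute)
  then have "z \<in> directions (V - {c})" unfolding directions_facet[OF c] by (simp add: directions_UNIV)
  then have "\<nu> \<bullet> z = 0" by (rule perp)
  then have "z \<bullet> z = 0" using gz by (simp add: z_def inner_diff_left)
  then have "\<nu> = ((\<nu> \<bullet> ?g) / (?g \<bullet> ?g)) *\<^sub>R ?g" by (simp add: z_def)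
  moreover obtain s where "s = - ((\<nu> \<bullet> ?g) / (?g \<bullet> ?g)) * norm ?g" by simp
  ultimately have \<nu>s: "\<nu> = s *\<^sub>R outer V c" using bgrad_nz[OF c] by (simp add: outer_def)
  moreover have "norm \<nu> = 1" using \<nu> by (simp add: unit_normal_to_def)
  ultimately have "\<bar>s\<bar> = 1" using outer_norm[OF c] by simp
  then have "s = 1 \<or> s = -1" by linarith
  then show ?thesis using \<nu>s by auto
qed

lemma outward_iff:
  assumes c: "c \<in> V" and \<nu>: "unit_normal_to \<nu> (convex hull (V - {c}))"
  shows "outward_on \<nu> (convex hull (V - {c})) K \<longleftrightarrow> \<nu> = outer V c"
  using normal_cases[OF assms] outer_outward[OF c] not_inward[OF c] by metis

lemma facet_basis:
  assumes c: "c \<in> V"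
  shows "face_basis (V - {c}) (outer V c) ((1 - bgrad V c \<bullet> c) / norm (bgrad V c))"
proof -
  interpret F: affine_basis "V - {c}" by (rule subset_basis) auto
  show ?thesis
  proof
    show "card (V - {c}) = CARD('n)" using card c finite by simp
    show "affine hull (V - {c}) = {x. outer V c \<bullet> x = (1 - bgrad V c \<bullet> c) / norm (bgrad V c)}"
    proof -
      have "bary V c x = 0 \<longleftrightarrow> outer V c \<bullet> x = (1 - bgrad V c \<bullet> c) / norm (bgrad V c)" for x
      proof -
        have "outer V c \<bullet> x = (1 - bgrad V c \<bullet> c) / norm (bgrad V c) - bary V c x / norm (bgrad V c)"
          by (simp add: outer_def bary_def diff_divide_distrib add_divide_distrib)
        then show ?thesis using bgrad_nz[OF c] by simp
      qed
      then show ?thesis using affine_hull_facet[OF c facet_nonempty[OF c]] by (simp add: affine_hull_UNIV)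
    qed
  qed (use dim outer_norm[OF c] in auto)
qed

lemma facet_of_iff: "F facet_of K \<longleftrightarrow> (\<exists>c\<in>V. F = convex hull (V - {c}))"
  unfolding facet_of_convex_hull_affine_independent[OF independent] using facet_nonempty by auto

text \<open>Over the element the coordinate of \<open>c\<close> stays between 0 and 1, while across
  the ball in the direction of its gradient it changes by \<open>2 * r\<close> times the norm of the
  gradient.\<close>

lemma bgrad_inball:
  assumes c: "c \<in> V" and r: "0 < r" "cball x r \<subseteq> K"
  shows "norm (bgrad V c) * (2 * r) \<le> 1"
proof -
  let ?e = "(1 / norm (bgrad V c)) *\<^sub>R bgrad V c"
  have e: "norm ?e = 1" "bgrad V c \<bullet> ?e = norm (bgrad V c)"
    using bgrad_nz[OF c] by (auto simp: dot_square_norm power2_eq_square)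
  have "x + r *\<^sub>R ?e \<in> K" "x - r *\<^sub>R ?e \<in> K"
    using r e by (auto intro!: subsetD[OF r(2)] simp: dist_norm)
  moreover have "bary V c y \<le> 1" if "y \<in> K" for y
    using that member_le_sum[of c V "\<lambda>c. bary V c y"] affine_hull_bary(2)[of y] finite c by (auto simp: affine_hull_UNIV hull_bary)
  ultimately have "bary V c (x + r *\<^sub>R ?e) - bary V c (x - r *\<^sub>R ?e) \<le> 1"
    using c by (force simp: hull_bary)
  moreover have "bary V c (x + r *\<^sub>R ?e) - bary V c (x - r *\<^sub>R ?e) = (2 * r) * (bgrad V c \<bullet> ?e)"
    unfolding bary_diff inner_scaleR_right[symmetric] by (rule arg_cong) (simp add: scaleR_2 flip: scaleR_scaleR)
  ultimately show ?thesis unfolding e(2) by (simp add: mult_ac)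
qed

end

section \<open>Elements on the two sides of a face\<close>

locale mesh =
  fixes \<Omega> :: "(real^'n::finite) set" and \<T> and n
  assumes dim: "CARD('n) \<in> {2, 3}" and open_\<Omega>: "open \<Omega>" and convex_\<Omega>: "convex \<Omega>"
    and conforming: "conforming_mesh \<Omega> \<T>" and normals: "face_normals \<Omega> \<T> n"
begin

abbreviation "\<I> \<equiv> interior_faces \<Omega> \<T>"
abbreviation "\<B> \<equiv> boundary_faces \<Omega> \<T>"
abbreviation "left F \<equiv> elem_in \<T> n F"
abbreviation "right F \<equiv> elem_out \<T> n F"

lemma finite_mesh: "finite \<T>" and mesh_face: "K \<in> \<T> \<Longrightarrow> K' \<in> \<T> \<Longrightarrow> K \<inter> K' face_of K"
  and mesh_union: "\<Union>\<T> = closure \<Omega>"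
  using conforming by (auto simp: conforming_mesh_def triangulation_def)

lemma mesh_element: assumes "K \<in> \<T>" shows "element (verts K)" "K = convex hull (verts K)"
proof -
  obtain C where C: "\<not> affine_dependent C" "int (card C) = int CARD('n) + 1" "K = convex hull C"
    using conforming assms by (auto simp: conforming_mesh_def simplex_def)
  have "verts K = C" using verts_hull[OF C(1)] C(3) by simp
  then show "element (verts K)" "K = convex hull (verts K)"
    using C dim by (auto simp: element_def element_axioms_def full_simplex_def full_simplex_axioms_def affine_basis_def)
qed

lemma finite_verts: "K \<in> \<T> \<Longrightarrow> finite (verts K)"
proof -
  assume "K \<in> \<T>"
  then interpret element "verts K" by (rule mesh_element)
  show ?thesis by (rule finite)
qed

lemma card_verts: "K \<in> \<T> \<Longrightarrow> card (verts K) = CARD('n) + 1"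
proof -
  assume "K \<in> \<T>"
  then interpret element "verts K" by (rule mesh_element)
  show ?thesis using card by simp
qed

lemma facet_mesh: "K \<in> \<T> \<Longrightarrow> F facet_of K \<longleftrightarrow> (\<exists>c\<in>verts K. F = convex hull (verts K - {c}))"
proof -
  assume K: "K \<in> \<T>"
  interpret element "verts K" using K by (rule mesh_element)
  show ?thesis using facet_of_iff mesh_element(2)[OF K] by simp
qed

lemma verts_facet:
  assumes "K \<in> \<T>" "c \<in> verts K" shows "verts (convex hull (verts K - {c})) = verts K - {c}"
proof -
  interpret element "verts K" using assms(1) by (rule mesh_element)
  interpret F: affine_basis "verts K - {c}" by (rule subset_basis) auto
  show ?thesis using verts_hull[OF F.independent] .
qed

lemma element_subset: "K \<in> \<T> \<Longrightarrow> K \<subseteq> closure \<Omega>"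
  using mesh_union by blast

text \<open>The intersection is a face of \<open>K\<close>, hence spanned by some vertices of
  \<open>K\<close>. These are extreme in the intersection, which is also a face of
  \<open>K'\<close>, so they are vertices of \<open>K'\<close> too.\<close>

lemma intersection_hull:
  assumes K: "K \<in> \<T>" "K' \<in> \<T>" shows "K \<inter> K' = convex hull (verts K \<inter> verts K')"
proof -
  interpret element "verts K" using K(1) by (rule mesh_element)
  have f: "K \<inter> K' face_of K" "K \<inter> K' face_of K'"
    using mesh_face[OF K] mesh_face[OF K(2,1)] by (simp_all add: Int_commute)
  have "K \<inter> K' face_of convex hull (verts K)" using f(1) mesh_element(2)[OF K(1)] by simp
  then obtain c where c: "c \<subseteq> verts K" "K \<inter> K' = convex hull c"
    using face_of_convex_hull_affine_independent[OF independent] by auto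
  have "c \<subseteq> verts K'"
  proof
    fix x assume x: "x \<in> c"
    then have "x extreme_point_of K" "x \<in> K \<inter> K'" using c hull_inc[OF x, of convex] by (auto simp: verts_def)
    then have "x extreme_point_of (K \<inter> K')" using extreme_point_of_face[OF f(1)] by simp
    then show "x \<in> verts K'" using extreme_point_of_face[OF f(2)] by (simp add: verts_def)
  qed
  then have 1: "K \<inter> K' \<subseteq> convex hull (verts K \<inter> verts K')" using c hull_mono by (metis le_inf_iff)
  have "convex hull (verts K \<inter> verts K') \<subseteq> K" "convex hull (verts K \<inter> verts K') \<subseteq> K'"
    using hull_mono[of "verts K \<inter> verts K'" "verts K" convex] hull_mono[of "verts K \<inter> verts K'" "verts K'" convex] mesh_element(2)[OF K(1)] mesh_element(2)[OF K(2)] by auto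
  then show ?thesis using 1 by blast
qed

lemma interior_unique:
  assumes "K \<in> \<T>" "K' \<in> \<T>" "y \<in> interior K" "y \<in> interior K'" shows "K = K'"
proof -
  have "K \<inter> K' = K" "K' \<inter> K = K'"
    using face_of_disjoint_interior[OF mesh_face, of K K'] face_of_disjoint_interior[OF mesh_face, of K' K] assms interior_subset by blast+
  then show ?thesis by blast
qed

text \<open>A face of \<open>K\<close> that contains a relative interior point of
  \<open>convex hull D\<close> contains all of it. Whether an element contains a subsimplex can thus
  be tested at a single point.\<close>

lemma positive_point_vertices:
  assumes K: "K \<in> \<T>" "K' \<in> \<T>" and D: "D \<subseteq> verts K" and y: "y \<in> rel_interior (convex hull D)" "y \<in> K'"
  shows "D \<subseteq> verts K'"
proof -
  have DK: "convex hull D \<subseteq> K" using hull_mono[OF D, of convex] mesh_element(2)[OF K(1)] by simp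
  have yD: "y \<in> convex hull D" using y(1) rel_interior_subset by blast
  have f: "K \<inter> K' face_of K" "K \<inter> K' face_of K'"
    using mesh_face[OF K] mesh_face[OF K(2,1)] by (simp_all add: Int_commute)
  have "convex hull D \<subseteq> K \<inter> K'"
    by (rule subset_of_face_of[OF f(1) DK]) (use y yD DK in blast)
  show ?thesis
  proof
    fix x assume x: "x \<in> D"
    then have "x extreme_point_of K" "x \<in> K \<inter> K'"
      using D hull_inc[OF x, of convex] \<open>convex hull D \<subseteq> K \<inter> K'\<close> by (auto simp: verts_def)
    then have "x extreme_point_of (K \<inter> K')" using extreme_point_of_face[OF f(1)] by simp
    then show "x \<in> verts K'" using extreme_point_of_face[OF f(2)] by (simp add: verts_def)
  qed
qed

lemma opposite_vertex:
  assumes K: "K \<in> \<T>" and W: "W \<subseteq> verts K" "card W = CARD('n)"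
  obtains a where "a \<in> verts K" "W = verts K - {a}"
proof -
  have "card (verts K - W) = 1"
    using card_Diff_subset[of W "verts K"] W card_verts[OF K] finite_subset[OF W(1) finite_verts[OF K]] by simp
  then obtain a where "verts K - W = {a}" by (auto simp: card_1_singleton_iff)
  then show thesis using that[of a] W(1) by blast
qed

lemma faces_verts:
  assumes "F \<in> faces \<T>" shows "F = convex hull (verts F)" "card (verts F) = CARD('n)" "\<exists>K\<in>\<T>. verts F \<subseteq> verts K"
proof -
  obtain K c where "K \<in> \<T>" "c \<in> verts K" "F = convex hull (verts K - {c})"
    using assms facet_mesh by (auto simp: faces_def)
  then show "F = convex hull (verts F)" "card (verts F) = CARD('n)" "\<exists>K\<in>\<T>. verts F \<subseteq> verts K"
    using verts_facet[of K c] card_verts[of K] finite_verts[of K] by auto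
qed

lemma facet_of_verts:
  assumes K: "K \<in> \<T>" and F: "F \<in> faces \<T>" shows "F facet_of K \<longleftrightarrow> verts F \<subseteq> verts K"
proof
  assume "F facet_of K"
  then obtain c where "c \<in> verts K" "F = convex hull (verts K - {c})" using facet_mesh[OF K] by auto
  then show "verts F \<subseteq> verts K" using verts_facet[OF K] by auto
next
  assume W: "verts F \<subseteq> verts K"
  obtain a where "a \<in> verts K" "verts F = verts K - {a}"
    by (rule opposite_vertex[OF K W faces_verts(2)[OF F]])
  then show "F facet_of K" using facet_mesh[OF K] faces_verts(1)[OF F] by auto
qed

lemma finite_faces: "finite (faces \<T>)"
proof -
  have "faces \<T> \<subseteq> (\<Union>K\<in>\<T>. (\<lambda>c. convex hull (verts K - {c})) ` verts K)"
    using facet_mesh by (auto simp: faces_def)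
  then show ?thesis by (rule finite_subset) (use finite_mesh finite_verts in blast)
qed

lemma normal_unit: "F \<in> faces \<T> \<Longrightarrow> unit_normal_to (n F) F"
  and normal_boundary: "F \<in> \<B> \<Longrightarrow> outward_on (n F) F \<Omega>"
  using normals by (auto simp: face_normals_def)

text \<open>Two elements on the same side of a common facet have a common interior point next to its centroid.\<close>

lemma same_side_unique:
  assumes K: "K \<in> \<T>" "K' \<in> \<T>" and F: "F facet_of K" "F facet_of K'"
    and \<nu>: "unit_normal_to \<nu> F" "outward_on \<nu> F K" "outward_on \<nu> F K'"
  shows "K = K'"
proof -
  let ?y = "\<lambda>\<epsilon>. centroid (verts F) - \<epsilon> *\<^sub>R \<nu>"
  have ev: "eventually (\<lambda>\<epsilon>. ?y \<epsilon> \<in> interior K) (at_right 0)"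
    if K: "K \<in> \<T>" and F: "F facet_of K" and o: "outward_on \<nu> F K" for K
  proof -
    interpret element "verts K" using K by (rule mesh_element)
    obtain a where a: "a \<in> verts K" "F = convex hull (verts K - {a})" using F facet_mesh[OF K] by auto
    have W: "verts F = verts K - {a}" using verts_facet[OF K a(1)] a(2) by simp
    have \<nu>a: "\<nu> = outer (verts K) a"
      using outward_iff[OF a(1)] \<nu>(1) o a(2) mesh_element(2)[OF K] by simp
    have W': "verts K - {a} \<subseteq> verts K" "verts K - {a} \<noteq> {}" using facet_nonempty[OF a(1)] by auto
    have "eventually (\<lambda>\<epsilon>. 0 < bary (verts K) c (?y \<epsilon>)) (at_right 0)" if c: "c \<in> verts K" for c
    proof (cases "c = a")
      case True
      have "bary (verts K) a (?y \<epsilon>) = \<epsilon> * norm (bgrad (verts K) a)" for \<epsilon>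
      proof -
        have "bary (verts K) a (?y \<epsilon>) = bary (verts K) a (centroid (verts F)) - \<epsilon> * (bgrad (verts K) a \<bullet> \<nu>)"
          using bary_diff[of a "?y \<epsilon>" "centroid (verts F)"] by simp
        moreover have "bary (verts K) a (centroid (verts F)) = 0" using centroid_bary(1)[OF W' a(1)] W by simp
        moreover have "bgrad (verts K) a \<bullet> \<nu> = - norm (bgrad (verts K) a)"
          unfolding \<nu>a outer_def using bgrad_nz[OF a(1)] by (simp add: dot_square_norm power2_eq_square)
        ultimately show ?thesis by simp
      qed
      then have "eventually (\<lambda>\<epsilon>. 0 < bary (verts K) a (?y \<epsilon>)) (at_right 0)"
        using eventually_at_right_less[of "0::real"] bgrad_nz[OF a(1)] by (auto elim!: eventually_mono)
      then show ?thesis using True by simp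
    next
      case False
      have "((\<lambda>\<epsilon>. bary (verts K) c (?y \<epsilon>)) \<longlongrightarrow> bary (verts K) c (?y 0)) (at_right 0)"
        unfolding bary_def by (intro tendsto_intros)
      moreover have "0 < bary (verts K) c (?y 0)"
        using centroid_bary(1)[OF W' c] W False c card_gt_0_iff[of "verts K - {a}"] finite W' by auto
      ultimately show ?thesis by (rule order_tendstoD(1))
    qed
    then have "eventually (\<lambda>\<epsilon>. \<forall>c\<in>verts K. 0 < bary (verts K) c (?y \<epsilon>)) (at_right 0)"
      using finite by (simp add: eventually_ball_finite)
    then show ?thesis
    proof eventually_elim
      case (elim \<epsilon>)
      then have "?y \<epsilon> \<in> interior (convex hull (verts K))" by (intro positive_interior) auto
      then show ?case using mesh_element(2)[OF K] by simp
    qed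
  qed
  have "eventually (\<lambda>\<epsilon>. ?y \<epsilon> \<in> interior K \<and> ?y \<epsilon> \<in> interior K') (at_right 0)"
    by (intro eventually_conj ev K F \<nu>)
  then obtain \<epsilon> where "?y \<epsilon> \<in> interior K" "?y \<epsilon> \<in> interior K'"
    using eventually_happens'[of "at_right (0::real)"] by force
  then show ?thesis using interior_unique K by blast
qed

lemma outward_cases:
  assumes K: "K \<in> \<T>" and F: "F facet_of K" and \<nu>: "unit_normal_to \<nu> F"
  shows "outward_on \<nu> F K \<or> outward_on (- \<nu>) F K"
proof -
  interpret element "verts K" using K by (rule mesh_element)
  obtain a where a: "a \<in> verts K" "F = convex hull (verts K - {a})" using F facet_mesh[OF K] by auto
  show ?thesis
    using normal_cases[OF a(1)] \<nu> outer_outward[OF a(1)] a(2) mesh_element(2)[OF K] by (metis minus_minus)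
qed

lemma not_both_outward:
  assumes K: "K \<in> \<T>" and F: "F facet_of K" and \<nu>: "unit_normal_to \<nu> F" "outward_on \<nu> F K"
  shows "\<not> outward_on (- \<nu>) F K"
proof -
  interpret element "verts K" using K by (rule mesh_element)
  obtain a where a: "a \<in> verts K" "F = convex hull (verts K - {a})" using F facet_mesh[OF K] by auto
  show ?thesis
    using outward_iff[OF a(1)] \<nu> not_inward[OF a(1)] a(2) mesh_element(2)[OF K] by metis
qed

lemma boundary_outward:
  assumes F: "F \<in> \<B>" and K: "K \<in> \<T>"
  shows "outward_on (n F) F K"
  unfolding outward_on_def
proof (intro ballI)
  fix x y assume x: "x \<in> F" and y: "y \<in> K"
  have "y \<in> closure \<Omega>" using y element_subset[OF K] by blast
  moreover have "\<Omega> \<subseteq> {y. n F \<bullet> (y - x) \<le> 0}" using normal_boundary[OF F] x by (auto simp: outward_on_def)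
  moreover have "closed {y. n F \<bullet> (y - x) \<le> 0}" by (intro closed_Collect_le continuous_intros)
  ultimately show "n F \<bullet> (y - x) \<le> 0" using closure_minimal by blast
qed

lemma boundary_face_elements:
  assumes F: "F \<in> \<B>"
  shows "left F \<in> \<T>" "{K \<in> \<T>. F facet_of K} = {left F}" "outward_on (n F) F (left F)"
proof -
  have Ff: "F \<in> faces \<T>" using F by (auto simp: boundary_faces_def)
  then obtain K where K: "K \<in> \<T>" "F facet_of K" by (auto simp: faces_def)
  have u: "K' = K" if "K' \<in> \<T>" "F facet_of K'" for K'
    using same_side_unique[OF that(1) K(1) that(2) K(2) normal_unit[OF Ff]] boundary_outward[OF F] that K by blast
  have e: "left F = K"
    unfolding elem_in_def by (rule the_equality) (use K boundary_outward[OF F K(1)] u in blast)+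
  show "left F \<in> \<T>" "outward_on (n F) F (left F)"
    unfolding e by (rule K(1), rule boundary_outward[OF F K(1)])
  show "{K \<in> \<T>. F facet_of K} = {left F}" unfolding e using K u by blast
qed

text \<open>Points of \<Omega> that approach a relative interior point of \<open>F\<close> from the
  side of \<nu> are covered by finitely many elements. One of these contains infinitely many of the
  points, hence their limit, hence all vertices of \<open>F\<close>, and it cannot lie on the side
  of \<open>K\<close>.\<close>

lemma interior_face_other_side:
  assumes F: "F \<in> \<I>" and K: "K \<in> \<T>" "F facet_of K" and \<nu>: "unit_normal_to \<nu> F" "outward_on \<nu> F K"
  shows "\<exists>K'\<in>\<T>. F facet_of K' \<and> outward_on (- \<nu>) F K'"
proof -
  have Ff: "F \<in> faces \<T>" and nb: "\<not> F \<subseteq> frontier \<Omega>" using F by (auto simp: interior_faces_def boundary_faces_def)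
  interpret element "verts K" using K(1) by (rule mesh_element)
  obtain a where a: "a \<in> verts K" "F = convex hull (verts K - {a})" using K facet_mesh by auto
  have W: "verts F = verts K - {a}" using verts_facet[OF K(1) a(1)] a(2) by simp
  have W': "verts K - {a} \<subseteq> verts K" "verts K - {a} \<noteq> {}" using facet_nonempty[OF a(1)] by auto
  obtain x0 where x0: "x0 \<in> F" "x0 \<notin> frontier \<Omega>" using nb by auto
  have "F \<subseteq> K" using K(2) facet_of_imp_subset by blast
  then have "x0 \<in> \<Omega>" using x0 element_subset[OF K(1)] interior_open[OF open_\<Omega>] by (auto simp: frontier_def)
  let ?m = "centroid (verts F)"
  \<comment> \<open>\<open>x0\<close> may lie on the relative boundary of \<open>F\<close>. A small
    step towards the centroid makes all coordinates of the vertices of \<open>F\<close> positive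
    without leaving \<Omega>.\<close>
  define y where "y t = x0 + t *\<^sub>R (?m - x0)" for t
  have "((\<lambda>t. y t) \<longlongrightarrow> y 0) (at_right 0)" unfolding y_def by (intro tendsto_intros)
  then have "eventually (\<lambda>t. y t \<in> \<Omega>) (at_right 0)"
    using open_\<Omega> \<open>x0 \<in> \<Omega>\<close> by (intro topological_tendstoD) (auto simp: y_def)
  moreover have "eventually (\<lambda>t::real. 0 < t \<and> t < 1) (at_right 0)"
    by (auto simp: eventually_at_right_less intro!: eventually_conj eventually_at_right_real[of 0 1, THEN eventually_mono])
  ultimately have "eventually (\<lambda>t. y t \<in> \<Omega> \<and> 0 < t \<and> t < 1) (at_right 0)" by eventually_elim auto
  then obtain t where t: "y t \<in> \<Omega>" "0 < t" "t < 1"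
    using eventually_happens'[of "at_right (0::real)"] by force
  have bx0: "bary (verts K) a x0 = 0" "\<And>c. c \<in> verts K \<Longrightarrow> 0 \<le> bary (verts K) c x0"
    using x0(1) a(2) facet_hull[OF a(1)] by (auto simp: hull_bary)
  have by': "bary (verts K) c (y t) = (1 - t) * bary (verts K) c x0 + t * bary (verts K) c ?m" for c
    by (simp add: y_def bary_def inner_add_right inner_diff_right algebra_simps)
  have yr: "y t \<in> rel_interior (convex hull (verts K - {a}))"
  proof (rule positive_combination_rel_interior[OF W'(1)])
    show "y t \<in> affine hull verts K" by (simp add: affine_hull_UNIV)
    show "0 < bary (verts K) c (y t)" if "c \<in> verts K - {a}" for c
      unfolding by' using that t bx0(2)[of c] centroid_bary(1)[OF W', of c] W card_gt_0_iff[of "verts K - {a}"] finite W'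
      by (intro add_nonneg_pos) auto
    show "bary (verts K) c (y t) = 0" if "c \<in> verts K - (verts K - {a})" for c
      unfolding by' using that bx0(1) centroid_bary(1)[OF W' a(1)] W by auto
  qed
  have ya: "bary (verts K) a (y t) = 0" unfolding by' using bx0(1) centroid_bary(1)[OF W' a(1)] W by auto
  have yF: "y t \<in> F" using yr rel_interior_subset a(2) by blast
  \<comment> \<open>The normal \<nu> points out of \<open>K\<close>, so this sequence reaches the
    face from the other side.\<close>
  define z where "z k = y t + (1 / real (Suc k)) *\<^sub>R \<nu>" for k
  have z_lim: "z \<longlonglongrightarrow> y t"
  proof -
    have "(\<lambda>k. y t + (1 / real (Suc k)) *\<^sub>R \<nu>) \<longlonglongrightarrow> y t + 0 *\<^sub>R \<nu>"
      by (intro tendsto_intros LIMSEQ_Suc[OF lim_1_over_n])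
    then show ?thesis by (simp add: z_def[abs_def])
  qed
  then have "eventually (\<lambda>k. z k \<in> \<Omega>) sequentially" using open_\<Omega> t(1) by (rule topological_tendstoD)
  then obtain N where N: "\<And>k. N \<le> k \<Longrightarrow> z k \<in> \<Omega>" by (auto simp: eventually_sequentially)
  have "\<exists>K'\<in>\<T>. z (k + N) \<in> K'" for k
    using N[of "k + N"] mesh_union closure_subset[of \<Omega>] by auto
  then obtain c where c: "\<And>k. c k \<in> \<T>" "\<And>k. z (k + N) \<in> c k" by metis
  have "finite (range c)" using c(1) finite_mesh finite_subset[of "range c" \<T>] by blast
  then obtain K' where inf: "infinite {k. c k = K'}"
    using inf_img_fin_domE'[of c UNIV] by (auto simp: vimage_def)
  have K': "K' \<in> \<T>" using c(1) not_finite_existsD[OF inf] by auto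
  have "y t \<in> K'"
  proof -
    obtain r :: "nat \<Rightarrow> nat" where r: "strict_mono r" "\<And>k. c (r k) = K'"
      using infinite_enumerate[OF inf] by auto
    have "(\<lambda>k. z (r k + N)) \<longlonglongrightarrow> y t"
      using LIMSEQ_subseq_LIMSEQ[OF LIMSEQ_ignore_initial_segment[OF z_lim, of N] r(1)] by (simp add: o_def)
    moreover have "z (r k + N) \<in> K'" for k using c(2)[of "r k"] r(2)[of k] by simp
    moreover have "closed K'"
    proof -
      interpret E: element "verts K'" using K' by (rule mesh_element)
      show ?thesis using E.compact_K mesh_element(2)[OF K'] compact_imp_closed by simp
    qed
    ultimately show ?thesis using closed_sequentially[of K' "\<lambda>k. z (r k + N)" "y t"] by simp
  qed
  have "verts K - {a} \<subseteq> verts K'"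
    by (rule positive_point_vertices[OF K(1) K' W'(1) yr \<open>y t \<in> K'\<close>])
  then have F': "F facet_of K'" using facet_of_verts[OF K' Ff] W by simp
  obtain k where k: "c k = K'" using not_finite_existsD[OF inf] by auto
  have "\<not> outward_on \<nu> F K'"
  proof
    assume "outward_on \<nu> F K'"
    then have "\<nu> \<bullet> (z (k + N) - y t) \<le> 0" using yF c(2)[of k] k by (auto simp: outward_on_def)
    moreover have "\<nu> \<bullet> \<nu> = 1" using \<nu>(1) by (simp add: unit_normal_to_def dot_square_norm)
    ultimately show False by (simp add: z_def)
  qed
  then show ?thesis using outward_cases[OF K' F' \<nu>(1)] K' F' by blast
qed

lemma interior_face_elements:
  assumes F: "F \<in> \<I>"
  shows "left F \<in> \<T>" "right F \<in> \<T>" "left F \<noteq> right F"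
    "{K \<in> \<T>. F facet_of K} = {left F, right F}"
    "outward_on (n F) F (left F)" "outward_on (- n F) F (right F)"
proof -
  have Ff: "F \<in> faces \<T>" using F by (auto simp: interior_faces_def)
  have nu: "unit_normal_to (n F) F" "unit_normal_to (- n F) F"
    using normal_unit[OF Ff] by (auto simp: unit_normal_to_def)
  obtain K0 where K0: "K0 \<in> \<T>" "F facet_of K0" using Ff by (auto simp: faces_def)
  have "\<exists>K1 K2. K1 \<in> \<T> \<and> K2 \<in> \<T> \<and> F facet_of K1 \<and> F facet_of K2 \<and> outward_on (n F) F K1 \<and> outward_on (- n F) F K2"
    using outward_cases[OF K0 nu(1)]
  proof
    assume o: "outward_on (n F) F K0"
    then show ?thesis using interior_face_other_side[OF F K0 nu(1) o] K0 by blast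
  next
    assume o: "outward_on (- n F) F K0"
    then show ?thesis using interior_face_other_side[OF F K0 nu(2) o] K0 by auto
  qed
  then obtain K1 K2 where K: "K1 \<in> \<T>" "K2 \<in> \<T>" "F facet_of K1" "F facet_of K2" "outward_on (n F) F K1" "outward_on (- n F) F K2"
    by blast
  have 1: "left F = K1"
    unfolding elem_in_def by (rule the_equality) (use K same_side_unique[OF _ K(1) _ K(3) nu(1) _ K(5)] in blast)+
  have 2: "right F = K2"
    unfolding elem_out_def by (rule the_equality) (use K same_side_unique[OF _ K(2) _ K(4) nu(2) _ K(6)] in blast)+
  have "K \<in> {K1, K2}" if "K \<in> \<T>" "F facet_of K" for K
    using outward_cases[OF that nu(1)] same_side_unique[OF that(1) K(1) that(2) K(3) nu(1) _ K(5)]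
      same_side_unique[OF that(1) K(2) that(2) K(4) nu(2) _ K(6)] by blast
  moreover have "K1 \<noteq> K2" using not_both_outward[OF K(1,3) nu(1) K(5)] K(6) by auto
  ultimately show "left F \<in> \<T>" "right F \<in> \<T>" "left F \<noteq> right F"
    "{K \<in> \<T>. F facet_of K} = {left F, right F}"
    "outward_on (n F) F (left F)" "outward_on (- n F) F (right F)"
    unfolding 1 2 using K by auto
qed

end

lemma (in element) interior_nonempty: "interior K \<noteq> {}"
proof -
  have "V \<noteq> {}" "0 < card V" using card by auto
  then have "centroid V \<in> interior K" by (intro positive_interior) (simp add: centroid_bary)
  then show ?thesis by blast
qed

section \<open>The patch of elements around a ridge\<close>

context mesh
begin

definition patch :: "(real^'n) set \<Rightarrow> (real^'n) set set" where
  "patch D = {K \<in> \<T>. D \<subseteq> verts K}"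

lemma finite_patch: "finite (patch D)"
  using finite_mesh by (simp add: patch_def)

lemma element_compact: "K \<in> \<T> \<Longrightarrow> compact K" and element_convex: "K \<in> \<T> \<Longrightarrow> convex K"
  and element_interior: "K \<in> \<T> \<Longrightarrow> interior K \<noteq> {}"
proof -
  assume K: "K \<in> \<T>"
  interpret element "verts K" using K by (rule mesh_element)
  show "compact K" "convex K" "interior K \<noteq> {}"
    using compact_K convex_convex_hull[of "verts K"] interior_nonempty mesh_element(2)[OF K] by simp_all
qed

lemma centroid_mem_iff:
  assumes K0: "K0 \<in> patch D" and D: "D \<noteq> {}" and K: "K \<in> \<T>"
  shows "centroid D \<in> K \<longleftrightarrow> K \<in> patch D"
proof
  have K0': "K0 \<in> \<T>" "D \<subseteq> verts K0" using K0 by (auto simp: patch_def)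
  interpret element "verts K0" using K0'(1) by (rule mesh_element)
  assume "centroid D \<in> K"
  then show "K \<in> patch D"
    using positive_point_vertices[OF K0'(1) K K0'(2) centroid_rel_interior[OF K0'(2) D]] K by (simp add: patch_def)
next
  assume "K \<in> patch D"
  then have D': "D \<subseteq> verts K" by (simp add: patch_def)
  interpret element "verts K" using K by (rule mesh_element)
  show "centroid D \<in> K"
    using centroid_bary(3)[OF D' D] hull_mono[OF D', of convex] mesh_element(2)[OF K] by auto
qed

text \<open>A count of common vertices: there are at least \<open>d - 1\<close>, those of
  \<open>D\<close>, and \<open>d + 1\<close> would make the elements equal. With
  \<open>d - 1\<close> they meet in the ridge only, with \<open>d\<close> in a facet.\<close>

lemma shared_facet:
  assumes K: "K1 \<in> \<T>" "K2 \<in> \<T>" "K1 \<noteq> K2" and D: "D \<subseteq> verts K1 \<inter> verts K2" "Suc (card D) = CARD('n)"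
  shows "K1 \<inter> K2 = convex hull D \<or>
    (\<exists>F\<in>\<I>. D \<subseteq> verts F \<and> F facet_of K1 \<and> F facet_of K2)"
proof -
  define I where "I = verts K1 \<inter> verts K2"
  have fI: "finite I" using finite_verts[OF K(1)] by (simp add: I_def)
  have KI: "K1 \<inter> K2 = convex hull I" unfolding I_def by (rule intersection_hull[OF K(1,2)])
  have cI: "card I \<le> CARD('n)"
  proof (rule ccontr)
    assume "\<not> card I \<le> CARD('n)"
    then have "card (verts K1) \<le> card I" "card (verts K2) \<le> card I" using card_verts[OF K(1)] card_verts[OF K(2)] by auto
    then have "I = verts K1" "I = verts K2"
      using card_seteq[of "verts K1" I] card_seteq[of "verts K2" I] finite_verts[OF K(1)] finite_verts[OF K(2)] by (auto simp: I_def)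
    then show False using mesh_element(2)[OF K(1)] mesh_element(2)[OF K(2)] K(3) by simp
  qed
  have "card D \<le> card I" using card_mono[OF fI] D(1) by (simp add: I_def)
  then consider "card I = card D" | "card I = CARD('n)" using cI D(2) by linarith
  then show ?thesis
  proof cases
    case 1
    then have "D = I" using card_subset_eq[OF fI] D(1) by (simp add: I_def)
    then show ?thesis using KI by simp
  next
    case 2
    obtain a where a: "a \<in> verts K1" "I = verts K1 - {a}" using opposite_vertex[OF K(1) _ 2] by (auto simp: I_def)
    obtain b where b: "b \<in> verts K2" "I = verts K2 - {b}" using opposite_vertex[OF K(2) _ 2] by (auto simp: I_def)
    let ?F = "convex hull I"
    have v: "verts ?F = I" using verts_facet[OF K(1) a(1)] a(2) by simp
    have f: "?F facet_of K1" "?F facet_of K2" unfolding facet_mesh[OF K(1)] facet_mesh[OF K(2)] using a b by metis+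
    have "?F \<notin> \<B>"
    proof
      assume "?F \<in> \<B>"
      from boundary_face_elements(2)[OF this] show False using f K by blast
    qed
    then have "?F \<in> \<I>" using f(1) K(1) by (auto simp: interior_faces_def faces_def)
    then show ?thesis using f v D(1) by (intro disjI2 bexI[of _ ?F]) (auto simp: I_def)
  qed
qed

text \<open>Near the centroid of a ridge, a segment in general position joining two elements of the patch avoids the ridge.\<close>

lemma patch_connected:
  assumes D: "Suc (card D) = CARD('n)" "finite D"
    and S: "S \<subseteq> patch D" "K \<in> S" "K' \<in> patch D"
    and closed: "\<And>F K1 K2. F \<in> \<I> \<Longrightarrow> D \<subseteq> verts F \<Longrightarrow> K1 \<in> S \<Longrightarrow> K2 \<in> patch D \<Longrightarrow>
      F facet_of K1 \<Longrightarrow> F facet_of K2 \<Longrightarrow> K2 \<in> S"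
  shows "K' \<in> S"
proof (rule ccontr)
  assume nS: "K' \<notin> S"
  have D0: "D \<noteq> {}" using D dim by auto
  define m where "m = centroid D"
  have Kp: "K \<in> patch D" using S by blast
  have KT: "K \<in> \<T>" "K' \<in> \<T>" using Kp S(3) by (auto simp: patch_def)
  have mK: "m \<in> K''\<longleftrightarrow> K'' \<in> patch D" if "K'' \<in> \<T>" for K''
    unfolding m_def using centroid_mem_iff[OF Kp D0 that] .
  have "open (- \<Union>(\<T> - patch D))"
    using finite_mesh element_compact compact_imp_closed by (intro open_Compl closed_Union) auto
  moreover have "m \<in> - \<Union>(\<T> - patch D)" using mK by blast
  ultimately obtain e where e: "0 < e" "ball m e \<subseteq> - \<Union>(\<T> - patch D)"
    using openE by metis
  have near: "\<exists>y. y \<in> interior K'' \<and> y \<in> ball m e \<and> y \<notin> affine hull W"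
    if K'': "K'' \<in> patch D" and W: "finite W" "card W \<le> CARD('n)" for K'' W
  proof (rule ccontr)
    assume n: "\<not> ?thesis"
    have "K'' \<in> \<T>" using K'' by (simp add: patch_def)
    then have "closure (interior K'') = closure K''"
      using convex_closure_interior element_convex element_interior by blast
    moreover have "m \<in> closure K''" using mK[OF \<open>K'' \<in> \<T>\<close>] K'' closure_subset by blast
    ultimately have "ball m e \<inter> interior K'' \<noteq> {}"
      using open_Int_closure_eq_empty[OF open_ball[of m e], of "interior K''"] e(1) centre_in_ball[of m e] by blast
    moreover have "ball m e \<inter> interior K'' \<subseteq> interior (affine hull W)"
      using n by (intro interior_maximal) auto
    moreover have "interior (affine hull W) = {}" using empty_interior_affine_hull[OF W(1)] W(2) by simp
    ultimately show False by blast
  qed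
  obtain x where x: "x \<in> interior K" "x \<in> ball m e" "x \<notin> affine hull D" using near[OF Kp D(2)] D(1) by auto
  \<comment> \<open>At most \<open>d\<close> points span an affine subspace without interior, so
    \<open>x'\<close> can be chosen off it; then no point of the segment lies in
    \<open>affine hull D\<close>.\<close>
  have "card (insert x D) \<le> CARD('n)" using D by (simp add: card_insert_if)
  then obtain x' where x': "x' \<in> interior K'" "x' \<in> ball m e" "x' \<notin> affine hull (insert x D)"
    using near[OF S(3), of "insert x D"] D(2) by auto
  let ?s = "closed_segment x x'"
  have xK: "x \<in> K" "x' \<in> K'" using x(1) x'(1) interior_subset by blast+
  have s: "?s \<subseteq> ball m e" using x x' by (intro closed_segment_subset) auto
  have "?s \<subseteq> closure \<Omega>"
    using xK element_subset KT convex_\<Omega> by (intro closed_segment_subset convex_closure) auto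
  then have cov: "?s \<subseteq> \<Union>S \<union> \<Union>(patch D - S)"
  proof -
    have "y \<in> \<Union>S \<union> \<Union>(patch D - S)" if y: "y \<in> ?s" for y
    proof -
      obtain K'' where K'': "K'' \<in> \<T>" "y \<in> K''" using y \<open>?s \<subseteq> closure \<Omega>\<close> mesh_union by blast
      then have "K'' \<in> patch D" using y s e(2) by blast
      then show ?thesis using K'' by blast
    qed
    then show ?thesis by blast
  qed
  have avoid: "y \<notin> affine hull D" if ys: "y \<in> ?s" for y
  proof
    assume y: "y \<in> affine hull D"
    obtain t where t: "y = (1 - t) *\<^sub>R x + t *\<^sub>R x'" using ys by (auto simp: in_segment)
    show False
    proof (cases "t = 0")
      case True then show ?thesis using y t x(3) by simp
    next
      case False
      have "y \<in> affine hull (insert x D)" "x \<in> affine hull (insert x D)"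
        using y hull_mono[of D "insert x D" affine] hull_inc[of x "insert x D" affine] by auto
      then have "(1 / t) *\<^sub>R y + (1 - 1 / t) *\<^sub>R x \<in> affine hull (insert x D)"
        by (intro mem_affine affine_affine_hull) auto
      moreover have "(1 / t) *\<^sub>R y + (1 - 1 / t) *\<^sub>R x = x'"
      proof -
        have "(1 / t) *\<^sub>R ((1 - t) *\<^sub>R x + t *\<^sub>R x') + (1 - 1 / t) *\<^sub>R x = ((1 / t) * (1 - t) + (1 - 1 / t)) *\<^sub>R x + x'"
          using False by (simp add: scaleR_add_right scaleR_left_distrib)
        moreover have "(1 / t) * (1 - t) + (1 - 1 / t) = 0" using False by (simp add: field_simps)
        ultimately show ?thesis unfolding t by simp
      qed
      ultimately show ?thesis using x'(3) by simp
    qed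
  qed
  \<comment> \<open>A common point of an element of \<open>S\<close> and one outside
    \<open>S\<close> would lie on the ridge, which the segment avoids, or on a shared facet, across
    which \<open>S\<close> is closed. The segment is thus covered by two disjoint closed
    sets.\<close>
  have "\<Union>S \<inter> \<Union>(patch D - S) \<inter> ?s = {}"
  proof (rule ccontr)
    assume "\<Union>S \<inter> \<Union>(patch D - S) \<inter> ?s \<noteq> {}"
    then obtain y K1 K2 where y: "y \<in> ?s" "y \<in> K1" "y \<in> K2" "K1 \<in> S" "K2 \<in> patch D" "K2 \<notin> S" by blast
    have "K1 \<in> \<T>" "K2 \<in> \<T>" "K1 \<noteq> K2" "D \<subseteq> verts K1 \<inter> verts K2"
      using y S(1) by (auto simp: patch_def)
    from shared_facet[OF this D(1)] show False
    proof
      assume "K1 \<inter> K2 = convex hull D"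
      then show False using y avoid[OF y(1)] convex_hull_subset_affine_hull[of D] by blast
    next
      assume "\<exists>F\<in>\<I>. D \<subseteq> verts F \<and> F facet_of K1 \<and> F facet_of K2"
      then show False using closed y(4-6) by blast
    qed
  qed
  moreover have "closed (\<Union>S)" "closed (\<Union>(patch D - S))"
    using finite_patch[of D] S(1) element_compact compact_imp_closed
    by (intro closed_Union; auto simp: patch_def dest: finite_subset)+
  ultimately have "\<Union>S \<inter> ?s = {} \<or> \<Union>(patch D - S) \<inter> ?s = {}"
    using connected_closedD[OF connected_segment(1)[of x x'] _ cov] by blast
  then show False using xK S(2,3) nS by auto
qed

text \<open>By connectedness every element of the patch can be reached through pairs whose values
  differ by at most \<open>J\<close>. A shortest path is no longer than the number of such pairs,
  which is at most the square of the patch size.\<close>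

lemma patch_chain:
  fixes f :: "(real^'n) set \<Rightarrow> 'b::real_normed_vector"
  assumes D: "Suc (card D) = CARD('n)" "finite D" and K: "K \<in> patch D" "K' \<in> patch D"
    and J: "0 \<le> J" "\<And>F. F \<in> \<I> \<Longrightarrow> D \<subseteq> verts F \<Longrightarrow>
      norm (f (left F) - f (right F)) \<le> J"
  shows "norm (f K - f K') \<le> real ((card (patch D))\<^sup>2) * J"
proof -
  define R where "R = {(K1, K2). K1 \<in> patch D \<and> K2 \<in> patch D \<and> norm (f K1 - f K2) \<le> J}"
  have Rs: "R \<subseteq> patch D \<times> patch D" by (auto simp: R_def)
  then have fR: "finite R" using finite_patch finite_subset by blast
  have cR: "card R \<le> (card (patch D))\<^sup>2"
    using card_mono[OF _ Rs] finite_patch by (simp add: card_cartesian_product power2_eq_square)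
  have "K' \<in> {K' \<in> patch D. (K, K') \<in> R\<^sup>*}"
  proof (rule patch_connected[OF D _ _ K(2), where K = K])
    fix F K1 K2
    assume F: "F \<in> \<I>" "D \<subseteq> verts F" and K1: "K1 \<in> {K' \<in> patch D. (K, K') \<in> R\<^sup>*}"
      and K2: "K2 \<in> patch D" and fc: "F facet_of K1" "F facet_of K2"
    have "K1 \<in> {left F, right F}" "K2 \<in> {left F, right F}"
      using interior_face_elements(4)[OF F(1)] fc K1 K2 by (auto simp: patch_def)
    then have "norm (f K1 - f K2) \<le> J"
      using J(2)[OF F] J(1) by (auto simp: norm_minus_commute)
    then have "(K1, K2) \<in> R" using K1 K2 by (auto simp: R_def)
    then show "K2 \<in> {K' \<in> patch D. (K, K') \<in> R\<^sup>*}" using K1 K2 by auto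
  qed (use K in auto)
  then obtain k where k: "k \<le> card R" "(K, K') \<in> R ^^ k"
    using rtrancl_finite_eq_relpow[OF fR] by auto
  have "norm (f K - f K') \<le> real k * J" if "(K, K') \<in> R ^^ k" for k K K'
    using that
  proof (induction k arbitrary: K')
    case (Suc k)
    then obtain K'' where "(K, K'') \<in> R ^^ k" "(K'', K') \<in> R" by auto
    then have "norm (f K - f K'') \<le> real k * J" "norm (f K'' - f K') \<le> J" using Suc.IH by (auto simp: R_def)
    then show ?case using norm_triangle_ineq[of "f K - f K''" "f K'' - f K'"] by (simp add: algebra_simps)
  qed simp
  from this[OF k(2)] have "norm (f K - f K') \<le> real k * J" .
  also have "\<dots> \<le> real ((card (patch D))\<^sup>2) * J"
    using J(1) k(1) cR by (intro mult_right_mono) auto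
  finally show ?thesis .
qed

section \<open>Consequences of shape regularity\<close>

lemma inscribed_ball:
  assumes K: "K \<in> \<T>"
  obtains x r where "0 < r" "cball x r \<subseteq> K" "diameter K \<le> 4 * shape_regularity \<T> * r"
proof -
  let ?X = "{2 * r |r x. 0 < r \<and> cball x r \<subseteq> K}"
  obtain x0 where "x0 \<in> interior K" using element_interior[OF K] by blast
  then obtain r0 where r0: "0 < r0" "cball x0 r0 \<subseteq> K"
    using open_contains_cball[of "interior K"] interior_subset[of K] by blast
  have bK: "bounded K" using element_compact[OF K] compact_imp_bounded by blast
  have up: "y \<le> diameter K" if "y \<in> ?X" for y
    using that diameter_subset[OF _ bK] by (auto simp: diameter_cball dest!: diameter_subset[OF _ bK])
  then have bdd: "bdd_above ?X" by (rule bdd_aboveI)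
  have X0: "2 * r0 \<in> ?X" using r0 by blast
  then have "2 * r0 \<le> Sup ?X" using cSup_upper[OF _ bdd] by blast
  then have pos: "0 < inball_diameter K" using r0(1) by (simp add: inball_diameter_def)
  \<comment> \<open>A ball of more than half the supremal diameter avoids the question of
    attainment; this loss and the passage from diameter to radius give the factor 4.\<close>
  then have "inball_diameter K / 2 < Sup ?X" by (simp add: inball_diameter_def)
  then obtain y where y: "y \<in> ?X" "inball_diameter K / 2 < y" using less_cSupD[of ?X] X0 by blast
  then obtain r x where r: "y = 2 * r" "0 < r" "cball x r \<subseteq> K" by blast
  have \<theta>: "diameter K / inball_diameter K \<le> shape_regularity \<T>"
    unfolding shape_regularity_def using K finite_mesh by (intro Max_ge) auto
  have "0 \<le> diameter K" by (rule diameter_ge_0[OF bK])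
  then have \<theta>0: "0 \<le> shape_regularity \<T>" using \<theta> pos by (meson divide_nonneg_pos order_trans)
  have "diameter K \<le> shape_regularity \<T> * inball_diameter K" using \<theta> pos by (simp add: divide_le_eq)
  also have "\<dots> \<le> shape_regularity \<T> * (4 * r)" using y(2) r(1) \<theta>0 by (intro mult_left_mono) auto
  finally show thesis using that[OF r(2,3)] by (simp add: mult_ac)
qed

text \<open>Scaled towards the common centroid to equal diameters, the elements of a patch contain disjoint balls of comparable radius.\<close>

lemma card_patch:
  assumes D: "D \<noteq> {}" shows "real (card (patch D)) \<le> (4 * \<bar>shape_regularity \<T>\<bar>) ^ CARD('n)"
proof (cases "patch D = {}")
  case False
  let ?T = "patch D" and ?\<theta> = "shape_regularity \<T>" and ?m = "centroid D"
  obtain K0 where K0: "K0 \<in> ?T" using False by blast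
  have TT: "K \<in> \<T>" if "K \<in> ?T" for K using that by (simp add: patch_def)
  have "\<exists>x r. 0 < r \<and> cball x r \<subseteq> K \<and> diameter K \<le> 4 * ?\<theta> * r" if "K \<in> ?T" for K
    using inscribed_ball[OF TT[OF that]] by metis
  then obtain x r where xr: "\<And>K. K \<in> ?T \<Longrightarrow> 0 < r K" "\<And>K. K \<in> ?T \<Longrightarrow> cball (x K) (r K) \<subseteq> K"
    "\<And>K. K \<in> ?T \<Longrightarrow> diameter K \<le> 4 * ?\<theta> * r K" by metis
  have bK: "bounded K" if "K \<in> ?T" for K using element_compact[OF TT[OF that]] compact_imp_bounded by blast
  have dpos: "0 < diameter K" if "K \<in> ?T" for K
    using diameter_subset[OF xr(2)[OF that] bK[OF that]] xr(1)[OF that] by (simp add: diameter_cball)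
  define s where "s = Min (diameter ` ?T)"
  have s_le: "s \<le> diameter K" if "K \<in> ?T" for K unfolding s_def using finite_patch that by (intro Min_le) auto
  have s0: "0 < s" unfolding s_def using finite_patch False dpos by (subst Min_gr_iff) auto
  have "0 < ?\<theta>"
  proof -
    have "0 < 4 * ?\<theta> * r K0" using xr(3)[OF K0] dpos[OF K0] by linarith
    then show ?thesis using xr(1)[OF K0] by (simp add: zero_less_mult_iff)
  qed
  \<comment> \<open>Scaled by \<open>s / diameter K\<close>, the inscribed ball has radius at least
    \<rho>. The scaling centre lies in \<open>K\<close> and the factor is at most 1, so by convexity
    the scaled ball stays in \<open>K\<close>, and disjointness of interiors is inherited.\<close>
  define \<rho> where "\<rho> = s / (4 * ?\<theta>)"
  have \<rho>0: "0 < \<rho>" using s0 \<open>0 < ?\<theta>\<close> by (simp add: \<rho>_def)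
  define c where "c K = ?m + (s / diameter K) *\<^sub>R (x K - ?m)" for K
  have key: "y \<in> K \<and> y \<in> cball ?m s" if K: "K \<in> ?T" and y: "y \<in> ball (c K) \<rho>" for K y
  proof -
    define l where "l = s / diameter K"
    have l: "0 < l" "l \<le> 1" using s0 s_le[OF K] dpos[OF K] by (auto simp: l_def divide_simps)
    define z where "z = ?m + (1 / l) *\<^sub>R (y - ?m)"
    have "\<rho> \<le> l * r K"
    proof -
      have "\<rho> * diameter K \<le> \<rho> * (4 * ?\<theta> * r K)" using xr(3)[OF K] \<rho>0 by (intro mult_left_mono) auto
      also have "\<dots> = s * r K" using \<open>0 < ?\<theta>\<close> by (simp add: \<rho>_def)
      finally show ?thesis using dpos[OF K] by (simp add: l_def field_simps)
    qed
    have "z - x K = (1 / l) *\<^sub>R (y - c K)"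
      using l by (simp add: z_def c_def l_def[symmetric] algebra_simps scaleR_diff_right)
    then have "norm (z - x K) = norm (y - c K) / l" using l by simp
    also have "\<dots> \<le> \<rho> / l" using y l by (intro divide_right_mono) (auto simp: dist_norm norm_minus_commute)
    also have "\<dots> \<le> r K" using \<open>\<rho> \<le> l * r K\<close> l by (simp add: divide_le_eq mult.commute)
    finally have "z \<in> K" using xr(2)[OF K] by (auto simp: dist_norm norm_minus_commute)
    moreover have mK: "?m \<in> K" using centroid_mem_iff[OF K0 D TT[OF K]] K by simp
    ultimately have "(1 - l) *\<^sub>R ?m + l *\<^sub>R z \<in> K"
      using convexD[OF element_convex[OF TT[OF K]], of ?m z "1 - l" l] l by simp
    moreover have yz: "y - ?m = l *\<^sub>R (z - ?m)" using l by (simp add: z_def)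
    then have "y = (1 - l) *\<^sub>R ?m + l *\<^sub>R z" by (simp add: algebra_simps)
    moreover have "norm (y - ?m) \<le> l * diameter K"
      unfolding yz using l diameter_bounded_bound[OF bK[OF K] \<open>z \<in> K\<close> mK] by (simp add: dist_norm)
    then have "norm (y - ?m) \<le> s" using dpos[OF K] by (simp add: l_def)
    ultimately show ?thesis by (simp add: dist_norm norm_minus_commute)
  qed
  have disj: "disjoint_family_on (\<lambda>K. ball (c K) \<rho>) ?T"
  proof (unfold disjoint_family_on_def, intro ballI impI)
    fix K K' assume K: "K \<in> ?T" "K' \<in> ?T" "K \<noteq> K'"
    have "ball (c K) \<rho> \<subseteq> interior K" "ball (c K') \<rho> \<subseteq> interior K'"
      using key K by (intro interior_maximal; auto)+
    then show "ball (c K) \<rho> \<inter> ball (c K') \<rho> = {}" using interior_unique TT K by blast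
  qed
  let ?\<omega> = "unit_ball_vol (real CARD('n))"
  have "real (card ?T) * (?\<omega> * \<rho> ^ CARD('n)) = (\<Sum>K\<in>?T. measure lborel (ball (c K) \<rho>))"
    using \<rho>0 by (simp add: content_ball)
  also have "\<dots> = measure lborel (\<Union>K\<in>?T. ball (c K) \<rho>)"
    using finite_patch disj emeasure_lborel_ball_finite
    by (intro measure_finite_Union[symmetric]) (auto simp: less_top[symmetric])
  also have "\<dots> \<le> measure lborel (cball ?m s)"
    using key emeasure_lborel_cball_finite[of ?m s]
    by (intro measure_mono_fmeasurable sets.finite_UN finite_patch) (auto simp: fmeasurable_def)
  also have "\<dots> = ?\<omega> * s ^ CARD('n)" using s0 by (simp add: content_cball)
  finally have "?\<omega> * (real (card ?T) * \<rho> ^ CARD('n)) \<le> ?\<omega> * s ^ CARD('n)" by (simp add: mult_ac)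
  moreover have "0 < ?\<omega>" by simp
  ultimately have "real (card ?T) * \<rho> ^ CARD('n) \<le> s ^ CARD('n)" by (rule mult_left_le_imp_le)
  then have "real (card ?T) \<le> s ^ CARD('n) / \<rho> ^ CARD('n)" using \<rho>0 by (simp add: pos_le_divide_eq)
  also have "\<dots> = (s / \<rho>) ^ CARD('n)" by (simp add: power_divide)
  also have "s / \<rho> = 4 * \<bar>?\<theta>\<bar>" using s0 \<open>0 < ?\<theta>\<close> by (simp add: \<rho>_def)
  finally show ?thesis .
qed simp

lemma facet_bgrad_norm:
  assumes K: "K \<in> \<T>" and a: "a \<in> verts K" and c: "c \<in> verts K - {a}"
  shows "norm (bgrad (verts K - {a}) c) \<le> norm (bgrad (verts K) c)"
proof -
  interpret element "verts K" using K by (rule mesh_element)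
  let ?x = "bgrad (verts K) c" and ?g = "bgrad (verts K) a"
  let ?y = "?x - ((?x \<bullet> ?g) / (?g \<bullet> ?g)) *\<^sub>R ?g"
  have "?g \<bullet> ?y = 0" using bgrad_nz[OF a] by (simp add: inner_diff_right inner_commute)
  then have "?y \<bullet> ?y = ?x \<bullet> ?y" by (simp add: inner_diff_left)
  then have "(norm ?y)\<^sup>2 \<le> norm ?x * norm ?y" using norm_cauchy_schwarz[of ?x ?y] by (simp add: dot_square_norm)
  then have "norm ?y \<le> norm ?x"
    by (cases "norm ?y = 0") (auto simp: power2_eq_square)
  then show ?thesis using bgrad_facet[OF a, of c] c by simp
qed

text \<open>The isodiametric bound: in dimension 1 or 2 the volume of the unit ball is at most
  \<open>2 ^ (CARD('n) - 1)\<close>, which absorbs the halving of the diameter.\<close>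

lemma face_size_le:
  assumes K: "K \<in> \<T>" and F: "F facet_of K" shows "face_size F \<le> diameter K"
proof -
  interpret element "verts K" using K by (rule mesh_element)
  obtain a where a: "a \<in> verts K" "F = convex hull (verts K - {a})" using F facet_mesh[OF K] by auto
  interpret fb: face_basis "verts K - {a}" "outer (verts K) a" "(1 - bgrad (verts K) a \<bullet> a) / norm (bgrad (verts K) a)"
    by (rule facet_basis[OF a(1)])
  let ?k = "CARD('n) - 1"
  have cF: "compact F" using fb.compact_F a(2) by simp
  have bF: "bounded F" "F \<noteq> {}" "F \<in> sets borel"
    using cF compact_imp_bounded compact_imp_closed borel_closed a(2) facet_nonempty[OF a(1)] by auto
  have bK: "bounded K" using element_compact[OF K] compact_imp_bounded by blast
  have "emeasure surface_measure F \<le> ennreal (unit_ball_vol (real ?k) * (diameter F / 2) ^ ?k)"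
    using surface_measure_hyperplane(2)[OF dim outer_norm[OF a(1)] bF(3) _ bF(1,2)] fb.F_plane a(2) by simp
  then have "measure surface_measure F \<le> unit_ball_vol (real ?k) * (diameter F / 2) ^ ?k"
    unfolding measure_def using diameter_ge_0[OF bF(1)] by (intro enn2real_leI) (auto intro!: mult_nonneg_nonneg)
  also have "\<dots> \<le> diameter F ^ ?k"
  proof -
    have "unit_ball_vol (real ?k) \<le> 2 ^ ?k"
      using dim pi_less_4 by (auto simp: unit_ball_vol_1 unit_ball_vol_2)
    then have "unit_ball_vol (real ?k) * (diameter F / 2) ^ ?k \<le> 2 ^ ?k * (diameter F / 2) ^ ?k"
      using diameter_ge_0[OF bF(1)] by (intro mult_right_mono) auto
    then show ?thesis by (simp add: power_divide)
  qed
  finally have "face_size F \<le> root ?k (diameter F ^ ?k)"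
    unfolding face_size_def using dim by (subst real_root_le_iff) auto
  also have "\<dots> = diameter F" using dim diameter_ge_0[OF bF(1)] by (intro real_root_power_cancel) auto
  also have "\<dots> \<le> diameter K" using bK facet_of_imp_subset[OF F] by (intro diameter_subset)
  finally show ?thesis .
qed

lemma face_size_nonneg: "0 \<le> face_size F"
  unfolding face_size_def using dim by (intro real_root_ge_zero) auto

text \<open>With an inscribed ball of radius \<open>r\<close>, the gradient is at most
  \<open>1 / (2 * r)\<close> and the face size at most
  \<open>4 * \<bar>shape_regularity \<T>\<bar> * r\<close>. The gradient norm is an inverse height,
  so the heights of a face are not small against its size.\<close>

lemma bgrad_face_size:
  assumes F: "F \<in> faces \<T>" and c: "c \<in> verts F"
  shows "norm (bgrad (verts F) c) * face_size F \<le> 2 * \<bar>shape_regularity \<T>\<bar>"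
proof -
  obtain K where K: "K \<in> \<T>" "F facet_of K" using F by (auto simp: faces_def)
  interpret element "verts K" using K(1) by (rule mesh_element)
  obtain a where a: "a \<in> verts K" "F = convex hull (verts K - {a})" using K facet_mesh by auto
  have v: "verts F = verts K - {a}" using verts_facet[OF K(1) a(1)] a(2) by simp
  obtain x r where r: "0 < r" "cball x r \<subseteq> K" "diameter K \<le> 4 * shape_regularity \<T> * r" using inscribed_ball[OF K(1)] .
  have "norm (bgrad (verts F) c) \<le> norm (bgrad (verts K) c)"
    using facet_bgrad_norm[OF K(1) a(1)] c v by simp
  moreover have "norm (bgrad (verts K) c) * (2 * r) \<le> 1"
    using bgrad_inball[of c r x] r mesh_element(2)[OF K(1)] c v by simp
  ultimately have 1: "norm (bgrad (verts F) c) * (2 * r) \<le> 1"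
    using r(1) by (meson mult_right_mono order_trans less_imp_le mult_pos_pos zero_less_numeral)
  have "face_size F \<le> 4 * \<bar>shape_regularity \<T>\<bar> * r"
    using face_size_le[OF K] r(3) mult_right_mono[of "shape_regularity \<T>" "\<bar>shape_regularity \<T>\<bar>" r] r(1) by linarith
  then have "norm (bgrad (verts F) c) * face_size F \<le> norm (bgrad (verts F) c) * (4 * \<bar>shape_regularity \<T>\<bar> * r)"
    by (intro mult_left_mono) auto
  also have "\<dots> = (norm (bgrad (verts F) c) * (2 * r)) * (2 * \<bar>shape_regularity \<T>\<bar>)" by simp
  also have "\<dots> \<le> 1 * (2 * \<bar>shape_regularity \<T>\<bar>)" using 1 by (intro mult_right_mono) auto
  finally show ?thesis by simp
qed

end

section \<open>Normals of the boundary faces\<close>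

lemma parallel_of_hyperplane_subset:
  fixes a \<nu> :: "'a::euclidean_space"
  assumes a: "a \<noteq> 0" "norm \<nu> = 1" and x: "a \<bullet> x = b" and sub: "{y. a \<bullet> y = b} \<subseteq> {y. \<nu> \<bullet> y = k}"
  shows "\<nu> = (1 / norm a) *\<^sub>R a \<or> \<nu> = - (1 / norm a) *\<^sub>R a"
proof -
  define s where "s = (\<nu> \<bullet> a) / (a \<bullet> a)"
  define z where "z = \<nu> - s *\<^sub>R a"
  have az: "a \<bullet> z = 0" using a by (simp add: z_def s_def inner_diff_right inner_commute)
  then have "x + z \<in> {y. a \<bullet> y = b}" "x \<in> {y. a \<bullet> y = b}" using x by (auto simp: inner_add_right)
  then have "x + z \<in> {y. \<nu> \<bullet> y = k}" "x \<in> {y. \<nu> \<bullet> y = k}" using sub by blast+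
  then have "\<nu> \<bullet> z = 0" by (simp add: inner_add_right)
  then have "z \<bullet> z = 0" using az by (simp add: z_def inner_diff_left)
  then have \<nu>: "\<nu> = s *\<^sub>R a" by (simp add: z_def)
  then have "\<bar>s\<bar> = 1 / norm a" using a by (simp add: field_simps)
  then have "s = 1 / norm a \<or> s = - (1 / norm a)" by linarith
  then show ?thesis using \<nu> by auto
qed

text \<open>A boundary face of any mesh lies in a facet of the polytope, whose hyperplane determines
  the normal up to sign. The set \<open>N\<close> is therefore fixed before the mesh.\<close>

lemma finite_boundary_normals:
  fixes \<Omega> :: "(real^'n::finite) set"
  assumes poly: "polytope (closure \<Omega>)"
  obtains N where "finite N" "\<And>\<T> n F. mesh \<Omega> \<T> n \<Longrightarrow> F \<in> boundary_faces \<Omega> \<T> \<Longrightarrow> n F \<in> N"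
proof -
  let ?S = "closure \<Omega>"
  define a where "a G = (SOME a. a \<noteq> 0 \<and> (\<exists>b. affine hull G = {x. a \<bullet> x = b}))" for G :: "(real^'n) set"
  define N where "N = (\<Union>G\<in>{G. G facet_of ?S}. {(1 / norm (a G)) *\<^sub>R a G, - (1 / norm (a G)) *\<^sub>R a G})"
  have "finite N" unfolding N_def using finite_polyhedron_facets[OF polytope_imp_polyhedron[OF poly]] by simp
  moreover have "n F \<in> N" if m: "mesh \<Omega> \<T> n" and F: "F \<in> boundary_faces \<Omega> \<T>" for \<T> n F
  proof -
    interpret mesh \<Omega> \<T> n by (rule m)
    have Ff: "F \<in> faces \<T>" using F by (simp add: boundary_faces_def)
    then obtain K where K: "K \<in> \<T>" "F facet_of K" by (auto simp: faces_def)
    have FK: "F \<subseteq> K" "F \<noteq> {}" using K(2) facet_of_imp_subset by (auto simp: facet_of_def)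
    then obtain x0 where x0: "x0 \<in> F" by blast
    have n0: "n F \<bullet> (x - x0) = 0" if "x \<in> F" for x
      using conjunct2[OF normal_unit[OF Ff, unfolded unit_normal_to_def]] x0 that by simp
    have nF1: "norm (n F) = 1" by (rule conjunct1[OF normal_unit[OF Ff, unfolded unit_normal_to_def]])
    have nF2: "n F \<bullet> x = n F \<bullet> x0" if "x \<in> F" for x
      using n0[OF that] unfolding inner_diff_right by (rule eq_iff_diff_eq_0[THEN iffD2])
    note nF = nF1 nF2
    have FS: "F \<subseteq> ?S" by (rule subset_trans[OF FK(1) element_subset[OF K(1)]])
    have le: "n F \<bullet> x \<le> n F \<bullet> x0" if xS: "x \<in> ?S" for x
    proof -
      obtain K' where "K' \<in> \<T>" "x \<in> K'" using xS mesh_union by blast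
      then show ?thesis using boundary_outward[OF F, of K'] x0 by (auto simp: outward_on_def inner_diff_right)
    qed
    \<comment> \<open>The supporting hyperplane at \<open>F\<close> cuts out a proper face of the
      polytope; since it contains \<open>F\<close>, its dimension is \<open>d - 1\<close>.\<close>
    define G where "G = ?S \<inter> {x. n F \<bullet> x = n F \<bullet> x0}"
    have cS: "convex ?S" using convex_\<Omega> convex_closure by blast
    have Gf: "G face_of ?S" unfolding G_def using cS le by (rule face_of_Int_supporting_hyperplane_le)
    have FG: "F \<subseteq> G" unfolding G_def by (intro subsetI IntI CollectI nF(2) subsetD[OF FS])
    have dK: "aff_dim K = int CARD('n)"
      using conforming K(1) aff_dim_simplex by (auto simp: conforming_mesh_def)
    have dF: "aff_dim F = int CARD('n) - 1" using K(2) dK by (simp add: facet_of_def)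
    have GS: "G \<noteq> ?S"
    proof
      assume e: "G = ?S"
      then have "K \<subseteq> {x. n F \<bullet> x = n F \<bullet> x0}" using element_subset[OF K(1)] by (auto simp: G_def)
      then have "aff_dim K \<le> aff_dim {x. n F \<bullet> x = n F \<bullet> x0}" by (rule aff_dim_subset)
      also have "\<dots> = int CARD('n) - 1" using nF(1) aff_dim_hyperplane[of "n F"] by fastforce
      finally show False using dK by simp
    qed
    have "aff_dim G < aff_dim ?S" by (rule face_of_aff_dim_lt[OF cS Gf GS])
    moreover have "aff_dim ?S \<le> int CARD('n)" using aff_dim_le_DIM[of ?S] by simp
    moreover have "int CARD('n) - 1 \<le> aff_dim G" using aff_dim_subset[OF FG] dF by simp
    ultimately have dG: "aff_dim G = int CARD('n) - 1" "aff_dim ?S = int CARD('n)" by auto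
    have Gfac: "G facet_of ?S" using Gf dG FG x0 by (auto simp: facet_of_def)
    have "\<exists>a. a \<noteq> 0 \<and> (\<exists>b. affine hull G = {x. a \<bullet> x = b})"
      using dG(1) aff_dim_eq_hyperplane[of G] by simp
    then have "a G \<noteq> 0 \<and> (\<exists>b. affine hull G = {x. a G \<bullet> x = b})"
      unfolding a_def by (rule someI_ex)
    then obtain b where b: "a G \<noteq> 0" "affine hull G = {x. a G \<bullet> x = b}" by blast
    have "affine hull G \<subseteq> {x. n F \<bullet> x = n F \<bullet> x0}"
      using affine_hyperplane by (intro hull_minimal) (auto simp: G_def)
    moreover have "a G \<bullet> x0 = b" using hull_inc[of x0 G affine] FG x0 b(2) by auto
    ultimately have "n F = (1 / norm (a G)) *\<^sub>R a G \<or> n F = - (1 / norm (a G)) *\<^sub>R a G"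
      using parallel_of_hyperplane_subset[OF b(1) nF(1)] b(2) by metis
    then show ?thesis using Gfac by (auto simp: N_def)
  qed
  ultimately show thesis by (rule that)
qed

text \<open>The quantity \<open>1 - (n F \<bullet> n F')\<^sup>2\<close> is the squared sine of the
  angle between two faces and takes finitely many values. Adjoining 1 keeps the minimum defined when
  none is positive and ensures \<open>\<delta> \<le> 1\<close>.\<close>

lemma boundary_angle_bound:
  fixes \<Omega> :: "(real^'n::finite) set"
  assumes poly: "polytope (closure \<Omega>)"
  obtains \<delta> where "0 < \<delta>" "\<delta> \<le> 1"
    "\<And>\<T> n F F'. mesh \<Omega> \<T> n \<Longrightarrow> F \<in> boundary_faces \<Omega> \<T> \<Longrightarrow> F' \<in> boundary_faces \<Omega> \<T> \<Longrightarrow>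
      (n F \<bullet> n F')\<^sup>2 \<noteq> 1 \<Longrightarrow> \<delta> \<le> 1 - (n F \<bullet> n F')\<^sup>2"
proof -
  obtain N where N: "finite N" "\<And>\<T> n F. mesh \<Omega> \<T> n \<Longrightarrow> F \<in> boundary_faces \<Omega> \<T> \<Longrightarrow> n F \<in> N"
    using finite_boundary_normals[OF poly] by metis
  define P where "P = {t \<in> (\<lambda>(a, b). 1 - (a \<bullet> b)\<^sup>2) ` (N \<times> N). 0 < t}"
  have fP: "finite (insert 1 P)" using N(1) by (simp add: P_def)
  let ?d = "Min (insert 1 P)"
  show thesis
  proof (rule that[of ?d])
    show "0 < ?d" using fP by (subst Min_gr_iff) (auto simp: P_def)
    show "?d \<le> 1" using fP by (intro Min_le) auto
    fix \<T> n F F'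
    assume m: "mesh \<Omega> \<T> n" and F: "F \<in> boundary_faces \<Omega> \<T>" "F' \<in> boundary_faces \<Omega> \<T>" and ne: "(n F \<bullet> n F')\<^sup>2 \<noteq> 1"
    interpret mesh \<Omega> \<T> n by (rule m)
    have "norm (n F) = 1" "norm (n F') = 1"
      using normal_unit F by (auto simp: unit_normal_to_def boundary_faces_def)
    then have "\<bar>n F \<bullet> n F'\<bar> \<le> 1" using Cauchy_Schwarz_ineq2[of "n F" "n F'"] by simp
    then have "(n F \<bullet> n F')\<^sup>2 \<le> 1" using abs_square_le_1 by blast
    then have "1 - (n F \<bullet> n F')\<^sup>2 \<in> P" using ne N(2)[OF m] F by (auto simp: P_def intro!: image_eqI[of _ _ "(n F, n F')"])
    then show "?d \<le> 1 - (n F \<bullet> n F')\<^sup>2" using fP by (intro Min_le) auto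
  qed
qed

section \<open>Reduction to the ridges\<close>

lemma polys_combination:
  fixes r s :: real
  assumes f: "f \<in> polys p" and g: "g \<in> polys p"
  defines "q \<equiv> \<lambda>x. r * f x + s * g x"
  shows "q \<in> polys p" "grad q x = r *\<^sub>R grad f x + s *\<^sub>R grad g x"
    "hessian q x *v z = r *\<^sub>R (hessian f x *v z) + s *\<^sub>R (hessian g x *v z)"
    "laplacian q x = r * laplacian f x + s * laplacian g x"
proof -
  show q: "q \<in> polys p" unfolding q_def by (intro polys_add polys_scale f g)
  have comb: "grad (\<lambda>x. r * h x + s * k x) x = r *\<^sub>R grad h x + s *\<^sub>R grad k x"
    if "h \<in> polys p" "k \<in> polys p" for h k x
    using c1_add(2)[OF c1_scale(1)[OF polys_c1(1)[OF that(1)]] c1_scale(1)[OF polys_c1(1)[OF that(2)]]]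
    by (simp add: c1_scale(2)[OF polys_c1(1)[OF that(1)]] c1_scale(2)[OF polys_c1(1)[OF that(2)]])
  show gq: "grad q x = r *\<^sub>R grad f x + s *\<^sub>R grad g x" for x unfolding q_def by (rule comb[OF f g])
  have "(\<lambda>y. grad q y \<bullet> z) = (\<lambda>y. r * (grad f y \<bullet> z) + s * (grad g y \<bullet> z))"
    by (simp add: gq inner_add_left)
  then show "hessian q x *v z = r *\<^sub>R (hessian f x *v z) + s *\<^sub>R (hessian g x *v z)"
    using comb[OF polys_grad_inner(1)[OF f] polys_grad_inner(1)[OF g], of z z x]
    by (simp add: polys_grad_inner(3)[OF f] polys_grad_inner(3)[OF g] polys_grad_inner(3)[OF q, symmetric])
  have "partial_deriv i (partial_deriv i q) x = r * partial_deriv i (partial_deriv i f) x + s * partial_deriv i (partial_deriv i g) x" for i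
  proof -
    have "partial_deriv i q = (\<lambda>y. r * partial_deriv i f y + s * partial_deriv i g y)"
      by (rule ext) (simp add: gq flip: grad_nth)
    then show ?thesis
      using arg_cong[OF comb[OF polys_c1(2)[OF f, of i] polys_c1(2)[OF g, of i], of x], of "\<lambda>u. u $ i"] by (simp add: grad_nth)
  qed
  then show "laplacian q x = r * laplacian f x + s * laplacian g x"
    by (simp add: laplacian_sum hessian_nth sum.distrib sum_distrib_left)
qed

text \<open>Makes \<open>piece\<close> well defined. The nonzero set within \<open>S\<close> is open
  and negligible, hence empty; along a line from a point of \<open>S\<close> the polynomial then has
  infinitely many roots.\<close>

lemma polys_eq_0:
  assumes d: "d \<in> polys p" and S: "open S" "S \<noteq> {}" and z: "AE x in lebesgue. x \<in> S \<longrightarrow> d x = 0"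
  shows "d x = 0"
proof -
  have cd: "continuous_on UNIV d" using c1_continuous polys_c1(1)[OF d] by blast
  have "open {x. d x \<noteq> 0}" using open_Collect_neq[OF cd continuous_on_const] .
  then have "open (S \<inter> {x. d x \<noteq> 0})" using S(1) by (rule open_Int[rotated])
  moreover have "negligible (S \<inter> {x. d x \<noteq> 0})"
  proof -
    obtain N where N: "{x \<in> space lebesgue. \<not> (x \<in> S \<longrightarrow> d x = 0)} \<subseteq> N" "emeasure lebesgue N = 0" "N \<in> sets lebesgue"
      by (rule AE_E[OF z])
    then have "S \<inter> {x. d x \<noteq> 0} \<subseteq> N" by auto
    then show ?thesis using null_setsI[OF N(2,3)] negligible_subset negligible_iff_null_sets by blast
  qed
  ultimately have 0: "d x = 0" if "x \<in> S" for x using open_not_negligible that by blast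
  obtain x0 where x0: "x0 \<in> S" using S by blast
  obtain P where P: "\<And>t. d (x0 + t *\<^sub>R (x - x0)) = poly P t" using polys_line[OF d] by metis
  have "((\<lambda>t. x0 + t *\<^sub>R (x - x0)) \<longlongrightarrow> x0 + 0 *\<^sub>R (x - x0)) (at_right 0)" by (intro tendsto_intros)
  then have "eventually (\<lambda>t. x0 + t *\<^sub>R (x - x0) \<in> S) (at_right 0)"
    using S(1) x0 by (intro topological_tendstoD) auto
  then obtain b :: real where b: "0 < b" "\<And>t. 0 < t \<Longrightarrow> t < b \<Longrightarrow> x0 + t *\<^sub>R (x - x0) \<in> S"
    by (auto simp: eventually_at_right_field)
  then have "{0<..<b} \<subseteq> {t. poly P t = 0}" using 0 by (auto simp: P[symmetric])
  then have "infinite {t. poly P t = 0}" using infinite_Ioo[OF b(1)] infinite_super by blast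
  then have "P = 0" using poly_roots_finite by blast
  then show ?thesis using P[of 1] by simp
qed

text \<open>The surface divergence of the tangential part of \<open>(\<partial>\<^sub>n v) \<nabla>w\<close>.\<close>

definition flux_form :: "real^'n::finite \<Rightarrow> (real^'n \<Rightarrow> real) \<Rightarrow> (real^'n \<Rightarrow> real) \<Rightarrow> real^'n \<Rightarrow> real" where
  "flux_form n v w x = (hessian v x *v n) \<bullet> grad w x - (grad w x \<bullet> n) * (n \<bullet> (hessian v x *v n))
     + (grad v x \<bullet> n) * (laplacian w x - n \<bullet> (hessian w x *v n))"

text \<open>Here the second-order terms left on a face become a surface divergence: antisymmetrising
  in \<open>w\<close> and \<open>v\<close> cancels the terms with two normal directions.\<close>

lemma parts_form_commutator: "parts_form n w v x - parts_form n v w x = flux_form n w v x - flux_form n v w x"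
  by (simp add: parts_form_def flux_form_def inner_commute algebra_simps)

text \<open>For boundary faces, where \<open>S_form\<close> has no tangential Laplacians: its
  gradient terms exceed the boundary term of integration by parts by exactly a surface
  divergence.\<close>

lemma flux_form_surface:
  assumes n: "norm n = 1" and w: "w \<in> polys p" and v: "v \<in> polys p"
  shows "flux_form n v w x = parts_form n w v x * -1 + (surf_grad n (\<lambda>y. grad w y \<bullet> n) x \<bullet> surf_grad n v x
      + surf_grad n (\<lambda>y. grad v y \<bullet> n) x \<bullet> surf_grad n w x)"
proof -
  have nn: "n \<bullet> n = 1" using n by (simp add: dot_square_norm)
  show ?thesis
    unfolding surf_grad_def polys_grad_inner(3)[OF w] polys_grad_inner(3)[OF v] parts_form_def flux_form_def
    by (simp add: inner_diff_left inner_diff_right nn inner_commute algebra_simps)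
qed

lemma continuous_flux_form: "w \<in> polys p \<Longrightarrow> v \<in> polys p \<Longrightarrow> continuous_on UNIV (flux_form \<nu> v w)"
  unfolding flux_form_def[abs_def]
  by (intro continuous_intros continuous_hessian_mult continuous_laplacian c1_grad polys_c1)

text \<open>The divergence theorem on the face, applied to the components of the tangential field in
  the frame \<open>e j\<close>. On a ridge only the conormal component survives, and the conormal is
  itself tangential to the face.\<close>

lemma (in face_basis) face_flux:
  assumes w: "w \<in> polys p" and v: "v \<in> polys p"
  shows "(LINT x:F|surface_measure. flux_form n v w x)
    = (\<Sum>c\<in>W. \<integral>x. (grad v x \<bullet> n) * (grad w x \<bullet> outer W c) \<partial>ridge_measure (convex hull (W - {c}))) / pi"
proof -
  define e where "e j = axis j 1 - (n $ j) *\<^sub>R n" for j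
  have ne: "n \<bullet> e j = 0" for j by (simp add: e_def inner_diff_right inner_axis n_n)
  define Y where "Y j x = (grad v x \<bullet> n) * (grad w x \<bullet> e j)" for j x
  note cg = polys_grad_inner(2)[OF v] polys_grad_inner(2)[OF w]
  have cY: "c1 (Y j)" for j unfolding Y_def[abs_def] by (intro c1_mult cg)
  have gY: "grad (Y j) x \<bullet> e j = (grad v x \<bullet> n) * (e j \<bullet> (hessian w x *v e j)) + ((hessian v x *v n) \<bullet> e j) * (grad w x \<bullet> e j)" for j x
    unfolding Y_def[abs_def] c1_mult(2)[OF cg] polys_grad_inner(3)[OF v] polys_grad_inner(3)[OF w]
    by (simp add: inner_add_left inner_commute[of "e j"] mult.commute)
  have pt: "flux_form n v w x = (\<Sum>j\<in>UNIV. grad (Y j) x \<bullet> e j)" for x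
    unfolding gY sum.distrib sum_distrib_left[symmetric]
      tangential_frame_sum[OF n_n, folded e_def] flux_form_def laplacian_sum
    by (simp add: inner_commute[of "_ *v n"] inner_commute[of _ n] algebra_simps)
  have tang: "outer W c \<bullet> n = 0" for c using n_bgrad[of c] by (simp add: outer_def inner_commute)
  have "(LINT x:F|surface_measure. flux_form n v w x)
     = (LINT x:F|surface_measure. (\<Sum>j\<in>UNIV. grad (Y j) x \<bullet> e j))"
    by (simp only: pt)
  also have "\<dots> = (\<Sum>j\<in>UNIV. LINT x:F|surface_measure. grad (Y j) x \<bullet> e j)"
    unfolding set_lebesgue_integral_def scaleR_sum_right
    using surf_int[OF continuous_grad_inner[OF cY]]
    by (intro Bochner_Integration.integral_sum) (simp add: set_integrable_def)
  also have "\<dots> = (\<Sum>j\<in>UNIV. \<Sum>c\<in>W. (outer W c \<bullet> e j) * ((\<integral>x. Y j x \<partial>ridge_measure (convex hull (W - {c}))) / pi))"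
    by (simp only: face_divergence[OF dim affine_basis_axioms card normal aff ne cY])
  also have "\<dots> = (\<Sum>c\<in>W. (\<Sum>j\<in>UNIV. (outer W c \<bullet> e j) * (\<integral>x. Y j x \<partial>ridge_measure (convex hull (W - {c})))) / pi)"
    by (subst sum.swap) (simp add: sum_divide_distrib)
  also have "\<dots> = (\<Sum>c\<in>W. (\<integral>x. (grad v x \<bullet> n) * (grad w x \<bullet> outer W c) \<partial>ridge_measure (convex hull (W - {c}))) / pi)"
  proof (intro sum.cong refl arg_cong2[where f = "(/)"])
    fix c assume c: "c \<in> W"
    let ?e = "convex hull (W - {c})"
    have eqx: "(\<Sum>j\<in>UNIV. (outer W c \<bullet> e j) * Y j x) = (grad v x \<bullet> n) * (grad w x \<bullet> outer W c)" for x
    proof -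
      have "(\<Sum>j\<in>UNIV. (outer W c \<bullet> e j) * Y j x) = (grad v x \<bullet> n) * (\<Sum>j\<in>UNIV. (outer W c \<bullet> e j) * (grad w x \<bullet> e j))"
        by (simp add: Y_def sum_distrib_left mult_ac)
      then show ?thesis
        unfolding tangential_frame_sum(1)[OF n_n, folded e_def] by (simp add: tang inner_commute[of _ "outer W c"])
    qed
    have "(\<Sum>j\<in>UNIV. (outer W c \<bullet> e j) * (\<integral>x. Y j x \<partial>ridge_measure ?e)) = (\<integral>x. (\<Sum>j\<in>UNIV. (outer W c \<bullet> e j) * Y j x) \<partial>ridge_measure ?e)"
      using integrable_ridge_measure[OF ridge_compact ridge_ne[OF c] c1_continuous[OF cY]]
      by (subst Bochner_Integration.integral_sum) auto
    also have "\<dots> = (\<integral>x. (grad v x \<bullet> n) * (grad w x \<bullet> outer W c) \<partial>ridge_measure ?e)"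
      by (simp only: eqx)
    finally show "(\<Sum>j\<in>UNIV. (outer W c \<bullet> e j) * (\<integral>x. Y j x \<partial>ridge_measure ?e)) = (\<integral>x. (grad v x \<bullet> n) * (grad w x \<bullet> outer W c) \<partial>ridge_measure ?e)" .
  qed
  finally show ?thesis by (simp add: sum_divide_distrib)
qed

lemma parts_form_minus: "parts_form (- n) w v x = - parts_form n w v x"
proof -
  have "hessian w x *v (- n) = - (hessian w x *v n)"
    using matrix_vector_mult_diff_distrib[of "hessian w x" 0 n] by simp
  then show ?thesis by (simp add: parts_form_def)
qed

text \<open>Writing the traces as average plus or minus half the jump, the terms of \<open>S_form\<close> on an interior face
  leave only the commutator of the jump of \<open>w\<close> and the average of \<open>v\<close>.\<close>

lemma interior_face_identity:
  assumes n: "norm n = 1" and f: "f \<in> polys p" "f' \<in> polys p" and g: "g \<in> polys p" "g' \<in> polys p"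
  defines "fj \<equiv> \<lambda>x. 1 * f x + (-1) * f' x" and "ga \<equiv> \<lambda>x. (1/2) * g x + (1/2) * g' x"
  shows "(surf_grad n (\<lambda>y. (1/2) *\<^sub>R (grad f y \<bullet> n + grad f' y \<bullet> n)) x \<bullet> (surf_grad n g x - surf_grad n g' x)
      + surf_grad n (\<lambda>y. (1/2) *\<^sub>R (grad g y \<bullet> n + grad g' y \<bullet> n)) x \<bullet> (surf_grad n f x - surf_grad n f' x))
    - ((1/2) *\<^sub>R (surf_laplacian n f x + surf_laplacian n f' x) * (grad g x \<bullet> n - grad g' x \<bullet> n)
      + (1/2) *\<^sub>R (surf_laplacian n g x + surf_laplacian n g' x) * (grad f x \<bullet> n - grad f' x \<bullet> n))
    = parts_form n f g x + parts_form (- n) f' g' x - (flux_form n fj ga x - flux_form n ga fj x)" (is "?L = _")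
proof -
  let ?fa = "\<lambda>x. (1/2) * f x + (1/2) * f' x" and ?gj = "\<lambda>x. 1 * g x + (-1) * g' x"
  note P = polys_combination[OF f] polys_combination[OF g]
  have avg: "(\<lambda>y. (1/2) *\<^sub>R (grad f y \<bullet> n + grad f' y \<bullet> n)) = (\<lambda>y. grad ?fa y \<bullet> n)"
     "(\<lambda>y. (1/2) *\<^sub>R (grad g y \<bullet> n + grad g' y \<bullet> n)) = (\<lambda>y. grad ga y \<bullet> n)"
    unfolding P(2,6) ga_def by (simp_all add: inner_add_left fun_eq_iff)
  have sg: "surf_grad n g x - surf_grad n g' x = surf_grad n ?gj x" "surf_grad n f x - surf_grad n f' x = surf_grad n fj x"
    unfolding surf_grad_def fj_def P(2,6) by (simp_all add: inner_add_left inner_diff_left algebra_simps)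
  have sl: "(1/2) *\<^sub>R (surf_laplacian n f x + surf_laplacian n f' x) = surf_laplacian n ?fa x"
    "(1/2) *\<^sub>R (surf_laplacian n g x + surf_laplacian n g' x) = surf_laplacian n ga x"
    unfolding ga_def surf_laplacian_eq[OF P(1)] surf_laplacian_eq[OF P(5)] surf_laplacian_eq[OF f(1)] surf_laplacian_eq[OF f(2)]
      surf_laplacian_eq[OF g(1)] surf_laplacian_eq[OF g(2)] P(3,4) P(7,8)
    by (simp_all add: inner_add_right algebra_simps)
  have gn: "grad g x \<bullet> n - grad g' x \<bullet> n = grad ?gj x \<bullet> n" "grad f x \<bullet> n - grad f' x \<bullet> n = grad fj x \<bullet> n"
    unfolding fj_def P(2,6) by (simp_all add: inner_diff_left)
  have "?L = parts_form n ?fa ?gj x + parts_form n ga fj x"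
    unfolding avg sg sl gn
    using surf_form_eq_parts_form[OF n P(1), of "1/2" "1/2" x ?gj] surf_form_eq_parts_form[OF n P(5)[of "1/2" "1/2"], folded ga_def, of x fj]
    by linarith
  also have "parts_form n ?fa ?gj x = parts_form n f g x + parts_form (- n) f' g' x - parts_form n fj ga x"
    unfolding parts_form_minus unfolding parts_form_def fj_def ga_def P(2-4) P(6-8)
    by (simp add: inner_add_left inner_add_right inner_diff_left inner_diff_right field_simps)
  finally show ?thesis using parts_form_commutator[of n fj ga x] by simp
qed

text \<open>The determinant of the components of \<open>y\<close> and \<open>z\<close> along
  \<open>n\<close> and \<mu>. For an orthonormal pair it depends only on the oriented plane spanned,
  which lets different faces at one ridge be compared.\<close>

definition wedge :: "'a::real_inner \<Rightarrow> 'a \<Rightarrow> 'a \<Rightarrow> 'a \<Rightarrow> real" where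
  "wedge n \<mu> y z = (y \<bullet> n) * (z \<bullet> \<mu>) - (z \<bullet> n) * (y \<bullet> \<mu>)"

lemma wedge_scale: "wedge (r *\<^sub>R n) (s *\<^sub>R \<mu>) y z = r * s * wedge n \<mu> y z"
  by (simp add: wedge_def algebra_simps)

lemma wedge_minus: "wedge (- n) \<mu> y z = - wedge n \<mu> y z"
  by (simp add: wedge_def)

lemma wedge_diff: "wedge n \<mu> (y - y') z = wedge n \<mu> y z - wedge n \<mu> y' z" "wedge n \<mu> y (z - z') = wedge n \<mu> y z - wedge n \<mu> y z'"
  by (simp_all add: wedge_def inner_diff_left algebra_simps)

section \<open>From faces to ridge integrals\<close>

context mesh
begin

lemma piece_polys:
  assumes v: "v \<in> V0 p \<Omega> \<T>" and K: "K \<in> \<T>"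
  shows "piece v K \<in> polys p"
proof -
  obtain q where q: "q \<in> polys p" "AE x in lebesgue. x \<in> K \<longrightarrow> v x = q x" using v K by (auto simp: V0_def)
  have "piece v K = q"
    unfolding piece_def
  proof (rule the_equality)
    show "(\<exists>p. q \<in> polys p) \<and> (AE x in lebesgue. x \<in> K \<longrightarrow> v x = q x)" using q by blast
    fix q' assume "(\<exists>p. q' \<in> polys p) \<and> (AE x in lebesgue. x \<in> K \<longrightarrow> v x = q' x)"
    then obtain p' where q': "q' \<in> polys p'" "AE x in lebesgue. x \<in> K \<longrightarrow> v x = q' x" by blast
    \<comment> \<open>\<open>piece\<close> admits competitors of any degree, hence the
      maximum.\<close>
    have "(\<lambda>x. q' x - q x) \<in> polys (max p p')"
      by (intro polys_diff polys_mono[OF _ q(1)] polys_mono[OF _ q'(1)]) auto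
    moreover have "AE x in lebesgue. x \<in> interior K \<longrightarrow> q' x - q x = 0"
      using q(2) q'(2) by eventually_elim (auto dest: subsetD[OF interior_subset])
    ultimately have "q' x - q x = 0" for x using polys_eq_0[OF _ open_interior element_interior[OF K]] by blast
    then show "q' = q" by (intro ext) simp
  qed
  then show ?thesis using q by simp
qed

lemma face_basis_face:
  assumes F: "F \<in> faces \<T>" obtains k where "face_basis (verts F) (n F) k"
proof -
  obtain K where K: "K \<in> \<T>" "F facet_of K" using F by (auto simp: faces_def)
  interpret element "verts K" using K(1) by (rule mesh_element)
  obtain a where a: "a \<in> verts K" "F = convex hull (verts K - {a})" using K facet_mesh by auto
  have v: "verts F = verts K - {a}" using verts_facet[OF K(1) a(1)] a(2) by simp
  obtain k where k: "face_basis (verts F) (outer (verts K) a) k" using facet_basis[OF a(1)] v by metis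
  interpret fb: face_basis "verts F" "outer (verts K) a" k by (rule k)
  have "n F = outer (verts K) a \<or> n F = - outer (verts K) a"
    using normal_cases[OF a(1)] normal_unit[OF F] a(2) by simp
  moreover have "face_basis (verts F) (- outer (verts K) a) (- k)"
    by unfold_locales (use fb.dim fb.card fb.normal fb.aff in auto)
  ultimately show thesis using that k by metis
qed

definition side_normal :: "(real^'n) set \<Rightarrow> (real^'n) set \<Rightarrow> real^'n" where
  "side_normal K F = (if outward_on (n F) F K then n F else - n F)"

lemma side_normal_outer:
  assumes K: "K \<in> \<T>" and c: "c \<in> verts K"
  shows "outer (verts K) c = side_normal K (convex hull (verts K - {c}))"
proof -
  interpret element "verts K" using K by (rule mesh_element)
  let ?F = "convex hull (verts K - {c})"
  have F: "?F \<in> faces \<T>" using facet_mesh[OF K] c K by (auto simp: faces_def)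
  show ?thesis
    using normal_cases[OF c normal_unit[OF F]] outward_iff[OF c normal_unit[OF F]] mesh_element(2)[OF K]
    by (auto simp: side_normal_def)
qed

lemma side_normal_cases:
  shows "F \<in> \<B> \<Longrightarrow> side_normal (left F) F = n F"
    and "F \<in> \<I> \<Longrightarrow> side_normal (left F) F = n F"
    and "F \<in> \<I> \<Longrightarrow> side_normal (right F) F = - n F"
proof -
  show "F \<in> \<B> \<Longrightarrow> side_normal (left F) F = n F"
    using boundary_face_elements(3) by (simp add: side_normal_def)
  assume F: "F \<in> \<I>"
  then show "side_normal (left F) F = n F"
    using interior_face_elements(5) by (simp add: side_normal_def)
  have Ff: "F \<in> faces \<T>" using F by (simp add: interior_faces_def)
  have "F facet_of right F" using interior_face_elements(4)[OF F] by blast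
  then have "\<not> outward_on (n F) F (right F)"
    using not_both_outward[OF interior_face_elements(2)[OF F] _ normal_unit[OF Ff]] interior_face_elements(6)[OF F] by blast
  then show "side_normal (right F) F = - n F" by (simp add: side_normal_def)
qed

text \<open>Double counting of pairs of an element and a facet: an interior face is met twice, with
  opposite outward normals, and a boundary face once. The summand is arbitrary because this serves
  both the integration by parts and the cancellation around a ridge.\<close>

lemma sum_elements_faces:
  fixes I :: "(real^'n) set \<Rightarrow> (real^'n) set \<Rightarrow> real^'n \<Rightarrow> real"
  shows "(\<Sum>K\<in>\<T>. \<Sum>c\<in>verts K. I K (convex hull (verts K - {c})) (outer (verts K) c))
    = (\<Sum>F\<in>\<I>. I (left F) F (n F) + I (right F) F (- n F))
    + (\<Sum>F\<in>\<B>. I (left F) F (n F))"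
proof -
  have "(\<Sum>K\<in>\<T>. \<Sum>c\<in>verts K. I K (convex hull (verts K - {c})) (outer (verts K) c))
    = (\<Sum>K\<in>\<T>. \<Sum>F | F \<in> faces \<T> \<and> F facet_of K. I K F (side_normal K F))"
  proof (intro sum.cong refl)
    fix K assume K: "K \<in> \<T>"
    have inj: "inj_on (\<lambda>c. convex hull (verts K - {c})) (verts K)"
      using verts_facet[OF K] by (intro inj_onI) (metis Diff_insert_absorb insert_Diff insert_Diff_single singletonD DiffE DiffI insertI1)
    have im: "{F. F \<in> faces \<T> \<and> F facet_of K} = (\<lambda>c. convex hull (verts K - {c})) ` verts K"
      using facet_mesh[OF K] K by (auto simp: faces_def)
    show "(\<Sum>c\<in>verts K. I K (convex hull (verts K - {c})) (outer (verts K) c))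
      = (\<Sum>F | F \<in> faces \<T> \<and> F facet_of K. I K F (side_normal K F))"
      unfolding im sum.reindex[OF inj] by (intro sum.cong refl) (simp add: side_normal_outer[OF K])
  qed
  also have "\<dots> = (\<Sum>F\<in>faces \<T>. \<Sum>K | K \<in> \<T> \<and> F facet_of K. I K F (side_normal K F))"
    by (rule sum.swap_restrict[OF finite_mesh finite_faces])
  also have "\<dots> = (\<Sum>F\<in>\<I>. \<Sum>K | K \<in> \<T> \<and> F facet_of K. I K F (side_normal K F))
    + (\<Sum>F\<in>\<B>. \<Sum>K | K \<in> \<T> \<and> F facet_of K. I K F (side_normal K F))"
  proof -
    have "\<B> \<subseteq> faces \<T>" by (auto simp: boundary_faces_def)
    then show ?thesis unfolding interior_faces_def using finite_faces by (rule sum.subset_diff)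
  qed
  also have "\<dots> = (\<Sum>F\<in>\<I>. I (left F) F (n F) + I (right F) F (- n F))
    + (\<Sum>F\<in>\<B>. I (left F) F (n F))"
    by (intro arg_cong2[where f = "(+)"] sum.cong refl)
      (simp_all add: interior_face_elements(3,4) boundary_face_elements(2) side_normal_cases)
  finally show ?thesis .
qed

definition "jump_poly w F = (\<lambda>x. 1 * piece w (left F) x + (-1) * piece w (right F) x)"
definition "avg_poly w F = (\<lambda>x. (1/2) * piece w (left F) x + (1/2) * piece w (right F) x)"

definition "interior_flux w v F c =
  (\<integral>x. wedge (n F) (outer (verts F) c) (grad (jump_poly w F) x) (grad (avg_poly v F) x) \<partial>ridge_measure (convex hull (verts F - {c})))"
definition "boundary_flux w v F c =
  (\<integral>x. (grad (piece v (left F)) x \<bullet> n F) * (grad (piece w (left F)) x \<bullet> outer (verts F) c) \<partial>ridge_measure (convex hull (verts F - {c})))"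

text \<open>On every face the boundary terms of the elements cancel against the face terms of
  \<open>S_form\<close> up to surface divergences, and \<open>face_flux\<close> moves these to the
  ridges. The division by \<open>pi\<close> undoes the normalisation of
  \<open>ridge_measure\<close>.\<close>

lemma S_form_ridges:
  assumes w: "w \<in> V0 p \<Omega> \<T>" and v: "v \<in> V0 p \<Omega> \<T>"
  shows "S_form \<Omega> \<T> n w v =
    (\<Sum>F\<in>\<I>. \<Sum>c\<in>verts F. interior_flux w v F c) / pi
    - (\<Sum>F\<in>\<B>. \<Sum>c\<in>verts F. boundary_flux w v F c) / pi"
proof -
  define W where "W = piece w"
  define V where "V = piece v"
  have WV: "W K \<in> polys p" "V K \<in> polys p" if "K \<in> \<T>" for K
    using piece_polys that w v by (simp_all add: W_def V_def)
  define A where "A F x = surf_grad (n F) (avg \<Omega> \<T> n F (\<lambda>K y. grad (W K) y \<bullet> n F)) x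
          \<bullet> jump \<Omega> \<T> n F (\<lambda>K. surf_grad (n F) (V K)) x
        + surf_grad (n F) (avg \<Omega> \<T> n F (\<lambda>K y. grad (V K) y \<bullet> n F)) x
          \<bullet> jump \<Omega> \<T> n F (\<lambda>K. surf_grad (n F) (W K)) x" for F x
  define B where "B F x = avg \<Omega> \<T> n F (\<lambda>K. surf_laplacian (n F) (W K)) x
          * jump \<Omega> \<T> n F (\<lambda>K y. grad (V K) y \<bullet> n F) x
        + avg \<Omega> \<T> n F (\<lambda>K. surf_laplacian (n F) (V K)) x
          * jump \<Omega> \<T> n F (\<lambda>K y. grad (W K) y \<bullet> n F) x" for F x
  let ?P = "\<lambda>K F \<nu>. LINT x:F|surface_measure. parts_form \<nu> (W K) (V K) x"
  let ?in = "elem_in \<T> n" and ?out = "elem_out \<T> n"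
  let ?I = "\<I>" and ?B = "\<B>"
  have vol: "(\<Sum>K\<in>\<T>. LINT x:K|lebesgue. hessian (W K) x \<bullet> hessian (V K) x - laplacian (W K) x * laplacian (V K) x)
    = (\<Sum>F\<in>?I. ?P (?in F) F (n F) + ?P (?out F) F (- n F)) + (\<Sum>F\<in>?B. ?P (?in F) F (n F))"
  proof -
    have "(LINT x:K|lebesgue. hessian (W K) x \<bullet> hessian (V K) x - laplacian (W K) x * laplacian (V K) x)
      = (\<Sum>c\<in>verts K. ?P K (convex hull (verts K - {c})) (outer (verts K) c))" if K: "K \<in> \<T>" for K
    proof -
      interpret element "verts K" using K by (rule mesh_element)
      show ?thesis using element_parts[OF dim full_simplex_axioms WV[OF K]] mesh_element(2)[OF K] by simp
    qed
    then show ?thesis unfolding sum_elements_faces[of ?P, symmetric] by (rule sum.cong[OF refl])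
  qed
  have int: "?P (?in F) F (n F) + ?P (?out F) F (- n F) - (LINT x:F|surface_measure. A F x) + (LINT x:F|surface_measure. B F x)
     = (\<Sum>c\<in>verts F. interior_flux w v F c) / pi"
    if F: "F \<in> ?I" for F
  proof -
    have Ff: "F \<in> faces \<T>" using F by (simp add: interior_faces_def)
    obtain k where "face_basis (verts F) (n F) k" using face_basis_face[OF Ff] .
    then interpret fb: face_basis "verts F" "n F" k .
    note E = interior_face_elements[OF F]
    note P = WV[OF E(1)] WV[OF E(2)]
    have JA: "jump_poly w F \<in> polys p" "avg_poly v F \<in> polys p"
      unfolding jump_poly_def avg_poly_def W_def[symmetric] V_def[symmetric]
      by (rule polys_combination(1)[OF P(1,3)], rule polys_combination(1)[OF P(2,4)])
    have si: "set_integrable surface_measure F f" if "continuous_on UNIV f" for f :: "real^'n \<Rightarrow> real"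
      using fb.surf_int[OF that] faces_verts(1)[OF Ff] by simp
    have pt: "A F x = parts_form (n F) (W (?in F)) (V (?in F)) x + parts_form (- n F) (W (?out F)) (V (?out F)) x
        - (flux_form (n F) (jump_poly w F) (avg_poly v F) x - flux_form (n F) (avg_poly v F) (jump_poly w F) x) + B F x" for x
      using interior_face_identity[OF fb.normal P(1,3,2,4), of x] F
      unfolding A_def B_def jump_poly_def avg_poly_def W_def[symmetric] V_def[symmetric] by (simp add: jump_def avg_def[abs_def])
    have cB: "continuous_on UNIV (B F)"
      unfolding B_def jump_def avg_def if_P[OF F] surf_laplacian_eq[OF P(1)] surf_laplacian_eq[OF P(2)] surf_laplacian_eq[OF P(3)] surf_laplacian_eq[OF P(4)]
      by (intro continuous_intros continuous_hessian_mult[OF P(1)] continuous_hessian_mult[OF P(2)] continuous_hessian_mult[OF P(3)] continuous_hessian_mult[OF P(4)]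
        continuous_laplacian[OF P(1)] continuous_laplacian[OF P(2)] continuous_laplacian[OF P(3)] continuous_laplacian[OF P(4)] c1_grad polys_c1[OF P(1)] polys_c1[OF P(2)] polys_c1[OF P(3)] polys_c1[OF P(4)])
    note cont = continuous_parts_form[OF P(1,2), of "n F"] continuous_parts_form[OF P(3,4), of "- n F"]
      continuous_flux_form[OF JA(2,1), of "n F"] continuous_flux_form[OF JA(1,2), of "n F"] cB
    note S = cont[THEN si]
    note c = continuous_grad_inner[OF polys_c1(1)[OF JA(1)]] continuous_grad_inner[OF polys_c1(1)[OF JA(2)]]
    have sub: "interior_flux w v F c
      = (\<integral>x. (grad (jump_poly w F) x \<bullet> n F) * (grad (avg_poly v F) x \<bullet> outer (verts F) c) \<partial>ridge_measure (convex hull (verts F - {c})))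
      - (\<integral>x. (grad (avg_poly v F) x \<bullet> n F) * (grad (jump_poly w F) x \<bullet> outer (verts F) c) \<partial>ridge_measure (convex hull (verts F - {c})))"
      if "c \<in> verts F" for c
      unfolding interior_flux_def wedge_def
      by (intro Bochner_Integration.integral_diff integrable_ridge_measure fb.ridge_compact fb.ridge_ne that continuous_on_mult c)
    have e: "(\<Sum>c\<in>verts F. interior_flux w v F c)
      = (\<Sum>c\<in>verts F. \<integral>x. (grad (jump_poly w F) x \<bullet> n F) * (grad (avg_poly v F) x \<bullet> outer (verts F) c) \<partial>ridge_measure (convex hull (verts F - {c})))
      - (\<Sum>c\<in>verts F. \<integral>x. (grad (avg_poly v F) x \<bullet> n F) * (grad (jump_poly w F) x \<bullet> outer (verts F) c) \<partial>ridge_measure (convex hull (verts F - {c})))"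
      unfolding sum_subtractf[symmetric] by (rule sum.cong[OF refl sub])
    show ?thesis unfolding pt e diff_divide_distrib
      using S fb.face_flux[OF JA(2,1)] fb.face_flux[OF JA] faces_verts(1)[OF Ff, symmetric]
      by (simp add: set_integral_add set_integral_diff)
  qed
  have bdy: "?P (?in F) F (n F) - (LINT x:F|surface_measure. A F x) = - ((\<Sum>c\<in>verts F. boundary_flux w v F c) / pi)"
    if F: "F \<in> ?B" for F
  proof -
    have Ff: "F \<in> faces \<T>" using F by (simp add: boundary_faces_def)
    have nI: "F \<notin> ?I" using F by (simp add: interior_faces_def)
    obtain k where "face_basis (verts F) (n F) k" using face_basis_face[OF Ff] .
    then interpret fb: face_basis "verts F" "n F" k .
    note P = WV[OF boundary_face_elements(1)[OF F]]
    have si: "set_integrable surface_measure F f" if "continuous_on UNIV f" for f :: "real^'n \<Rightarrow> real"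
      using fb.surf_int[OF that] faces_verts(1)[OF Ff] by simp
    have pt: "A F x = flux_form (n F) (V (?in F)) (W (?in F)) x + parts_form (n F) (W (?in F)) (V (?in F)) x" for x
      using flux_form_surface[OF fb.normal P, of x] nI unfolding A_def by (simp add: jump_def avg_def[abs_def])
    show ?thesis unfolding pt
      using si[OF continuous_parts_form[OF P, of "n F"]] si[OF continuous_flux_form[OF P, of "n F"]]
        fb.face_flux[OF P] faces_verts(1)[OF Ff, symmetric]
      by (simp add: set_integral_add boundary_flux_def W_def V_def)
  qed
  have Bsub: "?B \<subseteq> faces \<T>" by (auto simp: boundary_faces_def)
  have "S_form \<Omega> \<T> n w v = (\<Sum>F\<in>?I. ?P (?in F) F (n F) + ?P (?out F) F (- n F)) + (\<Sum>F\<in>?B. ?P (?in F) F (n F))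
     - (\<Sum>F\<in>faces \<T>. LINT x:F|surface_measure. A F x) + (\<Sum>F\<in>?I. LINT x:F|surface_measure. B F x)"
    unfolding S_form_def W_def[symmetric] V_def[symmetric] vol A_def B_def ..
  also have "(\<Sum>F\<in>faces \<T>. LINT x:F|surface_measure. A F x) = (\<Sum>F\<in>?I. LINT x:F|surface_measure. A F x) + (\<Sum>F\<in>?B. LINT x:F|surface_measure. A F x)"
    unfolding interior_faces_def using Bsub finite_faces by (rule sum.subset_diff)
  finally have "S_form \<Omega> \<T> n w v = (\<Sum>F\<in>?I. ?P (?in F) F (n F) + ?P (?out F) F (- n F) - (LINT x:F|surface_measure. A F x) + (LINT x:F|surface_measure. B F x))
     + (\<Sum>F\<in>?B. ?P (?in F) F (n F) - (LINT x:F|surface_measure. A F x))"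
    by (simp add: sum.distrib sum_subtractf)
  also have "\<dots> = (\<Sum>F\<in>?I. (\<Sum>c\<in>verts F. interior_flux w v F c) / pi) + (\<Sum>F\<in>?B. - ((\<Sum>c\<in>verts F. boundary_flux w v F c) / pi))"
    by (intro arg_cong2[where f = "(+)"] sum.cong refl int bdy)
  finally show ?thesis by (simp add: sum_negf sum_divide_distrib)
qed

end

section \<open>Estimates on the ridges\<close>

text \<open>The two facets of a simplex that share a ridge supply orthonormal frames of the same
  plane, normal to the ridge, but of opposite orientation.\<close>

lemma (in full_simplex) wedge_cancel:
  assumes pq: "p \<in> W" "q \<in> W" "p \<noteq> q"
  shows "wedge (outer W p) (outer (W - {p}) q) y z + wedge (outer W q) (outer (W - {q}) p) y z = 0"
proof -
  define g where "g = bgrad W p"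
  define h where "h = bgrad W q"
  define g' where "g' = h - ((h \<bullet> g) / (g \<bullet> g)) *\<^sub>R g"
  define h' where "h' = g - ((g \<bullet> h) / (h \<bullet> h)) *\<^sub>R h"
  have nz: "g \<bullet> g \<noteq> 0" "h \<bullet> h \<noteq> 0" using bgrad_nz pq by (auto simp: g_def h_def)
  have o: "outer W p = (- 1 / norm g) *\<^sub>R g" "outer W q = (- 1 / norm h) *\<^sub>R h"
    "outer (W - {p}) q = (- 1 / norm g') *\<^sub>R g'" "outer (W - {q}) p = (- 1 / norm h') *\<^sub>R h'"
    using bgrad_facet[of p q] bgrad_facet[of q p] pq by (simp_all add: outer_def g_def h_def g'_def h'_def)
  \<comment> \<open>Both sides are the squared area of the parallelogram spanned by \<open>g\<close>
    and \<open>h\<close>.\<close>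
  have "(g \<bullet> g) * (g' \<bullet> g') = (h \<bullet> h) * (h' \<bullet> h')"
    using nz by (simp add: g'_def h'_def inner_diff_left inner_diff_right inner_commute[of h g] field_simps)
  then have "(norm g * norm g')\<^sup>2 = (norm h * norm h')\<^sup>2"
    by (simp add: power_mult_distrib dot_square_norm)
  then have eq: "norm g * norm g' = norm h * norm h'"
    by (rule power2_eq_imp_eq) auto
  have w: "wedge g g' y z = wedge g h y z" "wedge h h' y z = - wedge g h y z"
    by (simp_all add: wedge_def g'_def h'_def inner_diff_right algebra_simps)
  show ?thesis unfolding o wedge_scale w using eq by simp
qed

context mesh
begin

text \<open>Sums over ridges know a ridge by its vertex set \<open>D\<close>, so the opposite vertex
  of the face has to be recovered from \<open>D\<close>.\<close>

definition conormal :: "(real^'n) set \<Rightarrow> (real^'n) set \<Rightarrow> real^'n" where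
  "conormal F D = outer (verts F) (THE c. c \<in> verts F - D)"

lemma conormal_facet:
  assumes "c \<in> verts F" shows "conormal F (verts F - {c}) = outer (verts F) c"
proof -
  have "(THE c'. c' \<in> verts F - (verts F - {c})) = c" using assms by (intro the_equality) auto
  then show ?thesis by (simp add: conormal_def)
qed

lemma opposite_in_face:
  assumes F: "F \<in> faces \<T>" and D: "D \<subseteq> verts F" "Suc (card D) = CARD('n)"
  obtains c where "c \<in> verts F" "D = verts F - {c}"
proof -
  obtain K where K: "K \<in> \<T>" "verts F \<subseteq> verts K" using faces_verts(3)[OF F] by blast
  have f: "finite (verts F)" using finite_subset[OF K(2) finite_verts[OF K(1)]] .
  have "card (verts F - D) = 1"
    using card_Diff_subset[OF finite_subset[OF D(1) f] D(1)] faces_verts(2)[OF F] D(2) by simp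
  then obtain c where "verts F - D = {c}" by (auto simp: card_1_singleton_iff)
  then show thesis using that[of c] D(1) by blast
qed

text \<open>The orthogonal complement of the ridge directions is a plane; normal and conormal form
  an orthonormal basis of it, in which the last part expands vectors.\<close>

lemma conormal_frame:
  assumes F: "F \<in> faces \<T>" and D: "D \<subseteq> verts F" "Suc (card D) = CARD('n)"
  shows "norm (n F) = 1" "norm (conormal F D) = 1" "n F \<bullet> conormal F D = 0"
    "d \<in> directions D \<Longrightarrow> n F \<bullet> d = 0" "d \<in> directions D \<Longrightarrow> conormal F D \<bullet> d = 0"
    "(\<And>d. d \<in> directions D \<Longrightarrow> z \<bullet> d = 0) \<Longrightarrow> z = (z \<bullet> n F) *\<^sub>R n F + (z \<bullet> conormal F D) *\<^sub>R conormal F D"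
proof -
  obtain c where c: "c \<in> verts F" "D = verts F - {c}" using opposite_in_face[OF assms] .
  obtain k where "face_basis (verts F) (n F) k" using face_basis_face[OF F] .
  then interpret fb: face_basis "verts F" "n F" k .
  have \<mu>: "conormal F D = outer (verts F) c" unfolding c(2) by (rule conormal_facet[OF c(1)])
  have g: "bgrad (verts F) c \<noteq> 0" using fb.facet_ne[OF c(1)] fb.bgrad_nonzero[OF c(1)] by blast
  show n1: "norm (n F) = 1" by (rule fb.normal)
  show m1: "norm (conormal F D) = 1" unfolding \<mu> using g by (simp add: outer_def)
  show nm: "n F \<bullet> conormal F D = 0" unfolding \<mu> outer_def using fb.n_bgrad[of c] by simp
  have dir: "d \<in> directions D \<longleftrightarrow> n F \<bullet> d = 0 \<and> conormal F D \<bullet> d = 0" for d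
    unfolding \<mu> unfolding c(2) fb.directions_facet[OF c(1)] using fb.plane_directions[of d] g by (auto simp: outer_def)
  then show "d \<in> directions D \<Longrightarrow> n F \<bullet> d = 0" "d \<in> directions D \<Longrightarrow> conormal F D \<bullet> d = 0" by auto
  assume z: "\<And>d. d \<in> directions D \<Longrightarrow> z \<bullet> d = 0"
  define r where "r = z - (z \<bullet> n F) *\<^sub>R n F - (z \<bullet> conormal F D) *\<^sub>R conormal F D"
  have i: "n F \<bullet> n F = 1" "conormal F D \<bullet> conormal F D = 1" "conormal F D \<bullet> n F = 0"
    using n1 m1 nm by (auto simp: dot_square_norm inner_commute)
  have r: "n F \<bullet> r = 0" "conormal F D \<bullet> r = 0"
    by (simp_all add: r_def inner_diff_right i nm inner_commute)
  then have "z \<bullet> r = 0" using z dir by blast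
  then have "r \<bullet> r = 0" using r unfolding r_def inner_diff_left inner_scaleR_left by simp
  then have "r = 0" by simp
  then show "z = (z \<bullet> n F) *\<^sub>R n F + (z \<bullet> conormal F D) *\<^sub>R conormal F D"
    by (simp add: r_def algebra_simps)
qed

definition "interior_at D = {F \<in> \<I>. D \<subseteq> verts F}"
definition "boundary_at D = {F \<in> \<B>. D \<subseteq> verts F}"

lemma finite_at: "finite (interior_at D)" "finite (boundary_at D)"
  using finite_faces unfolding interior_at_def boundary_at_def interior_faces_def boundary_faces_def by auto

lemma faces_at: "F \<in> interior_at D \<Longrightarrow> F \<in> faces \<T>" "F \<in> boundary_at D \<Longrightarrow> F \<in> faces \<T>"
  "F \<in> interior_at D \<Longrightarrow> D \<subseteq> verts F" "F \<in> boundary_at D \<Longrightarrow> D \<subseteq> verts F"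
  by (auto simp: interior_at_def boundary_at_def interior_faces_def boundary_faces_def)

lemma patch_at:
  "F \<in> interior_at D \<Longrightarrow> left F \<in> patch D" "F \<in> interior_at D \<Longrightarrow> right F \<in> patch D"
  "F \<in> boundary_at D \<Longrightarrow> left F \<in> patch D"
proof -
  have *: "K \<in> patch D" if "F \<in> faces \<T>" "D \<subseteq> verts F" "K \<in> {K \<in> \<T>. F facet_of K}" for K F
    using facet_of_verts[of K F] that by (auto simp: patch_def)
  show "F \<in> interior_at D \<Longrightarrow> left F \<in> patch D" "F \<in> interior_at D \<Longrightarrow> right F \<in> patch D"
    using *[of F] interior_face_elements(4)[of F] by (auto simp: interior_at_def interior_faces_def)
  show "F \<in> boundary_at D \<Longrightarrow> left F \<in> patch D"
    using *[of F] boundary_face_elements(2)[of F] by (auto simp: boundary_at_def boundary_faces_def)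
qed

text \<open>Around a ridge the contributions of a single-valued field \<open>\<beta>\<close> cancel element by element.\<close>

lemma ridge_cancellation:
  assumes D: "Suc (card D) = CARD('n)"
  shows "(\<Sum>F\<in>interior_at D. wedge (n F) (conormal F D) (a (left F) - a (right F)) \<beta>)
    + (\<Sum>F\<in>boundary_at D. wedge (n F) (conormal F D) (a (left F)) \<beta>) = 0"
proof -
  define I where "I K F \<nu> = (if D \<subseteq> verts F then wedge \<nu> (conormal F D) (a K) \<beta> else 0)" for K F \<nu>
  have "(\<Sum>c\<in>verts K. I K (convex hull (verts K - {c})) (outer (verts K) c)) = 0" if K: "K \<in> \<T>" for K
  proof -
    interpret element "verts K" using K by (rule mesh_element)
    have I: "I K (convex hull (verts K - {c})) (outer (verts K) c)
      = (if D \<subseteq> verts K - {c} then wedge (outer (verts K) c) (conormal (convex hull (verts K - {c})) D) (a K) \<beta> else 0)"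
      if "c \<in> verts K" for c
      unfolding I_def verts_facet[OF K that] ..
    show ?thesis
    proof (cases "D \<subseteq> verts K")
      case False
      then show ?thesis using I by (intro sum.neutral) auto
    next
      case True
      \<comment> \<open>Two vertices lie off the ridge, so exactly two facets of \<open>K\<close>
        contain it: those opposite \<open>p\<close> and \<open>q\<close>.\<close>
      have "card (verts K - D) = 2"
        using card_Diff_subset[OF finite_subset[OF True finite] True] card_verts[OF K] D by simp
      then obtain p q where pq: "verts K - D = {p, q}" "p \<noteq> q" by (meson card_2_iff)
      have pqV: "p \<in> verts K" "q \<in> verts K" "p \<notin> D" "q \<notin> D" using pq by auto
      have Dp: "D = verts K - {p} - {q}" "D = verts K - {q} - {p}" using pq True by auto
      have con: "conormal (convex hull (verts K - {p})) D = outer (verts K - {p}) q"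
        "conormal (convex hull (verts K - {q})) D = outer (verts K - {q}) p"
        using conormal_facet[of q "convex hull (verts K - {p})"] conormal_facet[of p "convex hull (verts K - {q})"]
          verts_facet[OF K pqV(1)] verts_facet[OF K pqV(2)] pqV pq(2) Dp by auto
      have "(\<Sum>c\<in>verts K. I K (convex hull (verts K - {c})) (outer (verts K) c))
        = (\<Sum>c\<in>{p, q}. I K (convex hull (verts K - {c})) (outer (verts K) c))"
        using pqV pq finite I by (intro sum.mono_neutral_right) auto
      also have "\<dots> = wedge (outer (verts K) p) (outer (verts K - {p}) q) (a K) \<beta> + wedge (outer (verts K) q) (outer (verts K - {q}) p) (a K) \<beta>"
        using pq(2) True pqV by (simp add: I con subset_Diff_insert)
      also have "\<dots> = 0" by (rule wedge_cancel) (use pqV pq in auto)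
      finally show ?thesis .
    qed
  qed
  then have "0 = (\<Sum>K\<in>\<T>. \<Sum>c\<in>verts K. I K (convex hull (verts K - {c})) (outer (verts K) c))" by simp
  also have "\<dots> = (\<Sum>F\<in>\<I>. I (left F) F (n F) + I (right F) F (- n F))
    + (\<Sum>F\<in>\<B>. I (left F) F (n F))" by (rule sum_elements_faces)
  also have "(\<Sum>F\<in>\<I>. I (left F) F (n F) + I (right F) F (- n F))
    = (\<Sum>F\<in>interior_at D. wedge (n F) (conormal F D) (a (left F) - a (right F)) \<beta>)"
    unfolding interior_at_def using finite_faces
    by (intro sum.mono_neutral_cong_right) (auto simp: I_def wedge_minus wedge_diff interior_faces_def)
  also have "(\<Sum>F\<in>\<B>. I (left F) F (n F))
    = (\<Sum>F\<in>boundary_at D. wedge (n F) (conormal F D) (a (left F)) \<beta>)"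
    unfolding boundary_at_def using finite_faces
    by (intro sum.mono_neutral_cong_right) (auto simp: I_def boundary_faces_def)
  finally show ?thesis by simp
qed

text \<open>What the seminorm controls at a ridge: the whole gradient jump on interior faces, but on
  boundary faces only the tangential derivative along the conormal.\<close>

definition ridge_jump :: "(real^'n) set \<Rightarrow> ((real^'n) set \<Rightarrow> real^'n) \<Rightarrow> real" where
  "ridge_jump D b = (\<Sum>F\<in>interior_at D. norm (b (left F) - b (right F)))
     + (\<Sum>F\<in>boundary_at D. \<bar>b (left F) \<bullet> conormal F D\<bar>)"

lemma ridge_jump_bounds:
  "0 \<le> ridge_jump D b"
  "F \<in> interior_at D \<Longrightarrow> norm (b (left F) - b (right F)) \<le> ridge_jump D b"
  "F \<in> boundary_at D \<Longrightarrow> \<bar>b (left F) \<bullet> conormal F D\<bar> \<le> ridge_jump D b"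
proof -
  let ?i = "\<lambda>F. norm (b (left F) - b (right F))" and ?j = "\<lambda>F. \<bar>b (left F) \<bullet> conormal F D\<bar>"
  have 0: "0 \<le> sum ?i (interior_at D)" "0 \<le> sum ?j (boundary_at D)" by (intro sum_nonneg; simp)+
  then show "0 \<le> ridge_jump D b" by (simp add: ridge_jump_def)
  show "?i F \<le> ridge_jump D b" if F: "F \<in> interior_at D"
  proof -
    have "?i F \<le> sum ?i (interior_at D)" by (rule member_le_sum[OF F]) (auto simp: finite_at)
    then show ?thesis using 0 unfolding ridge_jump_def by linarith
  qed
  show "?j F \<le> ridge_jump D b" if F: "F \<in> boundary_at D"
  proof -
    have "?j F \<le> sum ?j (boundary_at D)" by (rule member_le_sum[OF F]) (auto simp: finite_at)
    then show ?thesis using 0 unfolding ridge_jump_def by linarith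
  qed
qed

text \<open>Without boundary faces at the ridge any gradient of the patch serves as \<beta>. If all
  boundary normals there are parallel, every boundary conormal is orthogonal to them, and \<beta>
  keeps only the uncontrolled normal component of one gradient. If two normals differ, the two
  conormals span the plane normal to the ridge, all components in that plane are controlled, and
  \<beta> is zero. Components along the ridge do not enter \<open>wedge\<close>. The last case
  determines the constant.\<close>

lemma ridge_reference_field:
  assumes D: "Suc (card D) = CARD('n)" "finite D" "patch D \<noteq> {}"
    and \<delta>: "0 < \<delta>" "\<delta> \<le> 1" "\<And>F F'. F \<in> \<B> \<Longrightarrow> F' \<in> \<B> \<Longrightarrow>
      (n F \<bullet> n F')\<^sup>2 \<noteq> 1 \<Longrightarrow> \<delta> \<le> 1 - (n F \<bullet> n F')\<^sup>2"
  shows "\<exists>\<beta>. (\<forall>F\<in>boundary_at D. \<beta> \<bullet> conormal F D = 0) \<and>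
    (\<forall>K\<in>patch D. \<forall>z. norm z = 1 \<longrightarrow> (\<forall>d\<in>directions D. z \<bullet> d = 0) \<longrightarrow>
       \<bar>(b K - \<beta>) \<bullet> z\<bar> \<le> (2 * real ((card (patch D))\<^sup>2) + 3) / \<delta> * ridge_jump D b)" (is "?Q" is "\<exists>\<beta>. _ \<and> (\<forall>K\<in>_. \<forall>z. _ \<longrightarrow> _ \<longrightarrow> _ \<le> ?M)")
proof -
  have ref: ?Q if Q: "\<And>F. F \<in> boundary_at D \<Longrightarrow> \<beta> \<bullet> conormal F D = 0"
    "\<And>K z. K \<in> patch D \<Longrightarrow> norm z = 1 \<Longrightarrow> (\<And>d. d \<in> directions D \<Longrightarrow> z \<bullet> d = 0) \<Longrightarrow>
       \<bar>(b K - \<beta>) \<bullet> z\<bar> \<le> ?M" for \<beta>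
  proof (rule exI[of _ \<beta>], intro conjI ballI allI impI)
    show "\<beta> \<bullet> conormal F D = 0" if "F \<in> boundary_at D" for F by (rule Q(1)[OF that])
    show "\<bar>(b K - \<beta>) \<bullet> z\<bar> \<le> ?M"
      if "K \<in> patch D" "norm z = 1" "\<forall>d\<in>directions D. z \<bullet> d = 0" for K z
      using that(3) by (intro Q(2) that) blast
  qed
  define J where "J = ridge_jump D b"
  define N where "N = real ((card (patch D))\<^sup>2)"
  have J0: "0 \<le> J" and N0: "0 \<le> N" using ridge_jump_bounds(1) by (auto simp: J_def N_def)
  have chain: "norm (b K - b K') \<le> N * J" if "K \<in> patch D" "K' \<in> patch D" for K K'
    unfolding N_def using ridge_jump_bounds(2)[of _ D b] J0
    by (intro patch_chain[OF D(1,2) that]) (auto simp: J_def interior_at_def)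
  have chain': "\<bar>(b K - b K') \<bullet> z\<bar> \<le> N * J" if "K \<in> patch D" "K' \<in> patch D" "norm z = 1" for K K' z
    using Cauchy_Schwarz_ineq2[of "b K - b K'" z] chain[OF that(1,2)] that(3) by simp
  have M: "t \<le> (2 * N + 3) / \<delta> * J" if "t \<le> (2 * N + 3) * J" for t
  proof -
    have "1 * ((2 * N + 3) * J) \<le> (1 / \<delta>) * ((2 * N + 3) * J)"
      using \<delta> J0 N0 by (intro mult_right_mono) auto
    then show ?thesis using that by simp
  qed
  consider "boundary_at D = {}" | F1 where "F1 \<in> boundary_at D" "\<forall>F\<in>boundary_at D. (n F \<bullet> n F1)\<^sup>2 = 1"
    | F1 F2 where "F1 \<in> boundary_at D" "F2 \<in> boundary_at D" "(n F1 \<bullet> n F2)\<^sup>2 \<noteq> 1" by blast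
  then show ?Q
  proof cases
    case 1
    obtain K0 where K0: "K0 \<in> patch D" using D(3) by blast
    show ?Q
    proof (rule ref[of "b K0"])
      show "\<bar>(b K - b K0) \<bullet> z\<bar> \<le> ?M"
        if "K \<in> patch D" "norm z = 1" for K z
      proof -
        have "N * J \<le> (2 * N + 3) * J" using J0 N0 by (intro mult_right_mono) auto
        then show ?thesis using M chain'[OF that(1) K0 that(2)] unfolding N_def J_def by force
      qed
    qed (use 1 in auto)
  next
    case 2
    note fr = conormal_frame[OF faces_at(2)[OF 2(1)] faces_at(4)[OF 2(1)] D(1)]
    let ?n = "n F1" and ?\<mu> = "conormal F1 D" and ?b = "b (left F1)"
    have nn: "?n \<bullet> ?n = 1" using fr(1) by (simp add: dot_square_norm)
    show ?Q
    proof (rule ref[of "(?b \<bullet> ?n) *\<^sub>R ?n"])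
      fix F assume F: "F \<in> boundary_at D"
      note fF = conormal_frame[OF faces_at(2)[OF F] faces_at(4)[OF F] D(1)]
      have "(norm (?n - (?n \<bullet> n F) *\<^sub>R n F))\<^sup>2 = 1 - (n F \<bullet> ?n)\<^sup>2"
        unfolding power2_norm_eq_inner using nn fF(1)[unfolded norm_eq_1]
        by (simp add: inner_diff_left inner_diff_right inner_commute power2_eq_square)
      then have "?n = (?n \<bullet> n F) *\<^sub>R n F" using 2(2) F by simp
      then have "?n \<bullet> conormal F D = 0" using fF(3) by (metis inner_scaleR_left mult_zero_right)
      then show "((?b \<bullet> ?n) *\<^sub>R ?n) \<bullet> conormal F D = 0" by simp
    next
      fix K z assume K: "K \<in> patch D" and z: "norm z = 1" "\<And>d. d \<in> directions D \<Longrightarrow> z \<bullet> d = 0"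
      have zz: "z = (z \<bullet> ?n) *\<^sub>R ?n + (z \<bullet> ?\<mu>) *\<^sub>R ?\<mu>" by (rule fr(6)[OF z(2)])
      have "(b K - (?b \<bullet> ?n) *\<^sub>R ?n) \<bullet> z = (b K - ?b) \<bullet> z + (?b \<bullet> z - (?b \<bullet> ?n) * (z \<bullet> ?n))"
        by (simp add: inner_diff_left inner_diff_right inner_commute)
      also have "?b \<bullet> z = (z \<bullet> ?n) * (?b \<bullet> ?n) + (z \<bullet> ?\<mu>) * (?b \<bullet> ?\<mu>)"
        by (subst zz) (simp add: inner_add_right)
      finally have e: "(b K - (?b \<bullet> ?n) *\<^sub>R ?n) \<bullet> z = (b K - ?b) \<bullet> z + (z \<bullet> ?\<mu>) * (?b \<bullet> ?\<mu>)" by simp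
      have "\<bar>z \<bullet> ?\<mu>\<bar> \<le> 1" using Cauchy_Schwarz_ineq2[of z ?\<mu>] z(1) fr(2) by simp
      then have "\<bar>z \<bullet> ?\<mu>\<bar> * \<bar>?b \<bullet> ?\<mu>\<bar> \<le> 1 * J"
        using ridge_jump_bounds(3)[OF 2(1), of b] by (intro mult_mono) (auto simp: J_def)
      then have "\<bar>(b K - ?b) \<bullet> z\<bar> + \<bar>(z \<bullet> ?\<mu>) * (?b \<bullet> ?\<mu>)\<bar> \<le> N * J + J"
        using chain'[OF K patch_at(3)[OF 2(1)] z(1)] by (simp add: abs_mult)
      then have "\<bar>(b K - (?b \<bullet> ?n) *\<^sub>R ?n) \<bullet> z\<bar> \<le> N * J + J"
        unfolding e by (rule order_trans[OF abs_triangle_ineq])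
      also have "\<dots> \<le> (2 * N + 3) * J"
        using mult_right_mono[of "N + 1" "2 * N + 3" J] J0 N0 by (simp add: algebra_simps)
      finally show "\<bar>(b K - (?b \<bullet> ?n) *\<^sub>R ?n) \<bullet> z\<bar> \<le> ?M"
        using M unfolding N_def J_def by blast
    qed
  next
    case 3
    note f1 = conormal_frame[OF faces_at(2)[OF 3(1)] faces_at(4)[OF 3(1)] D(1)]
    note f2 = conormal_frame[OF faces_at(2)[OF 3(2)] faces_at(4)[OF 3(2)] D(1)]
    let ?n = "n F1" and ?\<mu> = "conormal F1 D" and ?b = "b (left F1)"
    let ?m = "n F2" and ?\<nu> = "conormal F2 D" and ?b' = "b (left F2)"
    have \<delta>le: "\<delta> \<le> 1 - (?n \<bullet> ?m)\<^sup>2" using \<delta>(3) 3 by (auto simp: boundary_at_def)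
    have b1: "\<bar>?b \<bullet> ?\<mu>\<bar> \<le> J" "\<bar>?b' \<bullet> ?\<nu>\<bar> \<le> J"
      using ridge_jump_bounds(3)[OF 3(1), of b] ridge_jump_bounds(3)[OF 3(2), of b] by (auto simp: J_def)
    have b2: "\<bar>?b \<bullet> ?\<nu>\<bar> \<le> (N + 1) * J"
      using chain'[OF patch_at(3)[OF 3(1)] patch_at(3)[OF 3(2)] f2(2)] b1(2) by (simp add: inner_diff_left algebra_simps)
    have "?n = (?n \<bullet> ?m) *\<^sub>R ?m + (?n \<bullet> ?\<nu>) *\<^sub>R ?\<nu>" by (rule f2(6)) (rule f1(4))
    then have "?n \<bullet> ?n = (?n \<bullet> ?m) * (?n \<bullet> ?m) + (?n \<bullet> ?\<nu>) * (?n \<bullet> ?\<nu>)"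
      by (metis inner_add_right inner_scaleR_right)
    then have "(?n \<bullet> ?\<nu>)\<^sup>2 = 1 - (?n \<bullet> ?m)\<^sup>2" using f1(1) by (simp add: dot_square_norm power2_eq_square)
    \<comment> \<open>The squared sine of the angle is at least \<delta>, and
      \<open>\<delta> \<le> 1\<close> makes the square of \<delta> smaller still; this avoids a root
      of \<delta>.\<close>
    then have "\<delta>\<^sup>2 \<le> (?n \<bullet> ?\<nu>)\<^sup>2" using \<delta>le \<delta>(1,2) by (simp add: power2_eq_square mult_left_le order_trans[of "\<delta> * \<delta>" \<delta>])
    then have nv: "\<delta> \<le> \<bar>?n \<bullet> ?\<nu>\<bar>" using \<delta>(1) by (simp add: abs_le_square_iff[symmetric])
    have \<nu>e: "?\<nu> = (?\<nu> \<bullet> ?n) *\<^sub>R ?n + (?\<nu> \<bullet> ?\<mu>) *\<^sub>R ?\<mu>" by (rule f1(6)) (rule f2(5))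
    have e: "?b \<bullet> ?\<nu> = (?n \<bullet> ?\<nu>) * (?b \<bullet> ?n) + (?\<nu> \<bullet> ?\<mu>) * (?b \<bullet> ?\<mu>)"
      using arg_cong[OF \<nu>e, of "inner ?b"] by (simp add: inner_add_right inner_commute[of ?\<nu> ?n])
    have "\<bar>?\<nu> \<bullet> ?\<mu>\<bar> \<le> 1" using Cauchy_Schwarz_ineq2[of ?\<nu> ?\<mu>] f1(2) f2(2) by simp
    then have "\<bar>?\<nu> \<bullet> ?\<mu>\<bar> * \<bar>?b \<bullet> ?\<mu>\<bar> \<le> 1 * J" using b1 by (intro mult_mono) auto
    then have "\<bar>(?\<nu> \<bullet> ?\<mu>) * (?b \<bullet> ?\<mu>)\<bar> \<le> J" by (simp add: abs_mult)
    then have "\<bar>(?n \<bullet> ?\<nu>) * (?b \<bullet> ?n)\<bar> \<le> (N + 1) * J + J" using b2 unfolding e by linarith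
    then have "\<delta> * \<bar>?b \<bullet> ?n\<bar> \<le> (N + 2) * J"
      using mult_right_mono[OF nv abs_ge_zero[of "?b \<bullet> ?n"]] by (simp add: abs_mult algebra_simps)
    then have bn: "\<bar>?b \<bullet> ?n\<bar> \<le> (N + 2) / \<delta> * J" using \<delta>(1) by (simp add: field_simps)
    show ?Q
    proof (rule ref[of 0])
      fix K z assume K: "K \<in> patch D" and z: "norm z = 1" "\<And>d. d \<in> directions D \<Longrightarrow> z \<bullet> d = 0"
      have zz: "z = (z \<bullet> ?n) *\<^sub>R ?n + (z \<bullet> ?\<mu>) *\<^sub>R ?\<mu>" by (rule f1(6)[OF z(2)])
      have "?b \<bullet> z = (z \<bullet> ?n) * (?b \<bullet> ?n) + (z \<bullet> ?\<mu>) * (?b \<bullet> ?\<mu>)"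
        by (subst zz) (simp add: inner_add_right)
      then have "\<bar>?b \<bullet> z\<bar> \<le> \<bar>z \<bullet> ?n\<bar> * \<bar>?b \<bullet> ?n\<bar> + \<bar>z \<bullet> ?\<mu>\<bar> * \<bar>?b \<bullet> ?\<mu>\<bar>"
        unfolding abs_mult[symmetric] using abs_triangle_ineq by (metis (no_types))
      also have "\<dots> \<le> 1 * ((N + 2) / \<delta> * J) + 1 * J"
        using Cauchy_Schwarz_ineq2[of z ?n] Cauchy_Schwarz_ineq2[of z ?\<mu>] z(1) f1(1,2) bn b1
        by (intro add_mono mult_mono) auto
      finally have "\<bar>b K \<bullet> z\<bar> \<le> N * J + ((N + 2) / \<delta> * J + J)"
        using chain'[OF K patch_at(3)[OF 3(1)] z(1)] by (simp add: inner_diff_left)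
      also have "\<dots> = (N + 1) * J * 1 + (N + 2) / \<delta> * J" by (simp add: algebra_simps)
      also have "\<dots> \<le> (N + 1) * J * (1 / \<delta>) + (N + 2) / \<delta> * J"
        using \<delta> J0 N0 by (intro add_right_mono mult_left_mono) auto
      also have "\<dots> = (2 * N + 3) / \<delta> * J" by (simp add: add_divide_distrib algebra_simps)
      finally show "\<bar>(b K - 0) \<bullet> z\<bar> \<le> ?M"
        by (simp add: N_def J_def)
    qed simp
  qed
qed

text \<open>The vanishing sum of \<open>ridge_cancellation\<close> is subtracted, so that
  \<open>b\<close> enters only through its difference from \<beta>. Each interior term is a wedge of
  two products, whence the factor 2.\<close>

lemma ridge_bound:
  assumes D: "Suc (card D) = CARD('n)" "finite D" "patch D \<noteq> {}"
    and \<delta>: "0 < \<delta>" "\<delta> \<le> 1" "\<And>F F'. F \<in> \<B> \<Longrightarrow> F' \<in> \<B> \<Longrightarrow>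
      (n F \<bullet> n F')\<^sup>2 \<noteq> 1 \<Longrightarrow> \<delta> \<le> 1 - (n F \<bullet> n F')\<^sup>2"
  shows "\<bar>(\<Sum>F\<in>interior_at D. wedge (n F) (conormal F D) (a (left F) - a (right F))
        ((1/2) *\<^sub>R b (left F) + (1/2) *\<^sub>R b (right F)))
      - (\<Sum>F\<in>boundary_at D. (b (left F) \<bullet> n F) * (a (left F) \<bullet> conormal F D))\<bar>
    \<le> 2 * ((2 * real ((card (patch D))\<^sup>2) + 3) / \<delta>) * ridge_jump D a * ridge_jump D b"
proof -
  obtain \<beta> where "(\<forall>F\<in>boundary_at D. \<beta> \<bullet> conormal F D = 0) \<and>
    (\<forall>K\<in>patch D. \<forall>z. norm z = 1 \<longrightarrow> (\<forall>d\<in>directions D. z \<bullet> d = 0) \<longrightarrow>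
       \<bar>(b K - \<beta>) \<bullet> z\<bar> \<le> (2 * real ((card (patch D))\<^sup>2) + 3) / \<delta> * ridge_jump D b)"
    using ridge_reference_field[OF D \<delta>, of b] ..
  then have \<beta>: "\<And>F. F \<in> boundary_at D \<Longrightarrow> \<beta> \<bullet> conormal F D = 0"
    "\<And>K z. K \<in> patch D \<Longrightarrow> norm z = 1 \<Longrightarrow> (\<And>d. d \<in> directions D \<Longrightarrow> z \<bullet> d = 0) \<Longrightarrow>
       \<bar>(b K - \<beta>) \<bullet> z\<bar> \<le> (2 * real ((card (patch D))\<^sup>2) + 3) / \<delta> * ridge_jump D b"
    by simp_all
  define M where "M = (2 * real ((card (patch D))\<^sup>2) + 3) / \<delta> * ridge_jump D b"
  let ?in = "elem_in \<T> n" and ?out = "elem_out \<T> n"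
  have M0: "0 \<le> M" unfolding M_def using \<delta>(1) ridge_jump_bounds(1) by (intro mult_nonneg_nonneg) auto
  let ?X = "\<lambda>F y. wedge (n F) (conormal F D) (a (?in F) - a (?out F)) y"
  let ?B = "\<lambda>F. (1/2) *\<^sub>R b (?in F) + (1/2) *\<^sub>R b (?out F)"
  define f where "f F = ?X F (?B F) - ?X F \<beta>" for F
  define g where "g F = (b (?in F) \<bullet> n F) * (a (?in F) \<bullet> conormal F D) + wedge (n F) (conormal F D) (a (?in F)) \<beta>" for F
  have eq: "(\<Sum>F\<in>interior_at D. ?X F (?B F)) - (\<Sum>F\<in>boundary_at D. (b (?in F) \<bullet> n F) * (a (?in F) \<bullet> conormal F D))
    = sum f (interior_at D) - sum g (boundary_at D)"
    unfolding f_def g_def sum_subtractf sum.distrib using ridge_cancellation[OF D(1), of a \<beta>] by simp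
  have "\<bar>sum f (interior_at D) - sum g (boundary_at D)\<bar> \<le> \<bar>sum f (interior_at D)\<bar> + \<bar>sum g (boundary_at D)\<bar>"
    by (rule abs_triangle_ineq4)
  also have "\<dots> \<le> (\<Sum>F\<in>interior_at D. \<bar>f F\<bar>) + (\<Sum>F\<in>boundary_at D. \<bar>g F\<bar>)"
    by (rule add_mono[OF sum_abs sum_abs])
  also have "\<dots> \<le> (\<Sum>F\<in>interior_at D. 2 * M * norm (a (?in F) - a (?out F))) + (\<Sum>F\<in>boundary_at D. 2 * M * \<bar>a (?in F) \<bullet> conormal F D\<bar>)"
  proof (intro add_mono sum_mono)
    fix F assume F: "F \<in> interior_at D"
    note fr = conormal_frame[OF faces_at(1)[OF F] faces_at(3)[OF F] D(1)]
    let ?y = "a (?in F) - a (?out F)" and ?z = "?B F - \<beta>"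
    have z: "\<bar>?z \<bullet> u\<bar> \<le> M" if u: "norm u = 1" "\<And>d. d \<in> directions D \<Longrightarrow> u \<bullet> d = 0" for u
    proof -
      have "?z \<bullet> u = (1/2) * ((b (?in F) - \<beta>) \<bullet> u) + (1/2) * ((b (?out F) - \<beta>) \<bullet> u)"
        by (simp add: inner_diff_left inner_add_left field_simps)
      then show ?thesis
        using \<beta>(2)[OF patch_at(1)[OF F] u] \<beta>(2)[OF patch_at(2)[OF F] u] unfolding M_def[symmetric] by simp
    qed
    have "\<bar>wedge (n F) (conormal F D) ?y ?z\<bar> \<le> \<bar>?y \<bullet> n F\<bar> * \<bar>?z \<bullet> conormal F D\<bar> + \<bar>?z \<bullet> n F\<bar> * \<bar>?y \<bullet> conormal F D\<bar>"
      unfolding wedge_def abs_mult[symmetric] by (rule abs_triangle_ineq4)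
    also have "\<dots> \<le> norm ?y * M + M * norm ?y"
      using Cauchy_Schwarz_ineq2[of ?y "n F"] Cauchy_Schwarz_ineq2[of ?y "conormal F D"] fr(1,2) M0
        z[OF fr(1) fr(4)] z[OF fr(2) fr(5)] by (intro add_mono mult_mono) auto
    finally show "\<bar>f F\<bar> \<le> 2 * M * norm ?y"
      unfolding f_def wedge_diff(2)[symmetric] by (simp add: mult_ac)
  next
    fix F assume F: "F \<in> boundary_at D"
    note fr = conormal_frame[OF faces_at(2)[OF F] faces_at(4)[OF F] D(1)]
    \<comment> \<open>Since \<beta> is orthogonal to the conormal, the jump term of \<open>a\<close>
      keeps its conormal factor and only the normal component of \<open>b - \<beta>\<close>
      remains.\<close>
    have gF: "g F = ((b (?in F) - \<beta>) \<bullet> n F) * (a (?in F) \<bullet> conormal F D)"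
      unfolding g_def wedge_def \<beta>(1)[OF F] by (simp add: inner_diff_left algebra_simps)
    have "\<bar>g F\<bar> \<le> M * \<bar>a (?in F) \<bullet> conormal F D\<bar>"
      unfolding gF abs_mult M_def using \<beta>(2)[OF patch_at(3)[OF F] fr(1) fr(4)] by (intro mult_right_mono) auto
    also have "\<dots> \<le> 2 * M * \<bar>a (?in F) \<bullet> conormal F D\<bar>" using M0 by (intro mult_right_mono) auto
    finally show "\<bar>g F\<bar> \<le> 2 * M * \<bar>a (?in F) \<bullet> conormal F D\<bar>" .
  qed
  also have "\<dots> = 2 * M * ridge_jump D a"
    unfolding ridge_jump_def sum_distrib_left[symmetric] distrib_left ..
  also have "\<dots> = 2 * ((2 * real ((card (patch D))\<^sup>2) + 3) / \<delta>) * ridge_jump D a * ridge_jump D b"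
    by (simp add: M_def mult_ac)
  finally show ?thesis unfolding eq .
qed

end

section \<open>Summation over the ridges\<close>

text \<open>Replaces the Cauchy-Schwarz inequality for sums of integrals: estimates with a free
  weight \<open>t\<close> can be added up over all ridges, and \<open>t\<close> is optimised once at
  the end.\<close>

lemma le_geometric_mean:
  fixes s a b :: real
  assumes ab: "0 \<le> a" "0 \<le> b" and s: "\<And>t. 0 < t \<Longrightarrow> s \<le> t * a + b / t"
  shows "s \<le> 2 * (sqrt a * sqrt b)"
proof (rule field_le_epsilon)
  fix e :: real assume e: "0 < e"
  \<comment> \<open>The optimal weight \<open>sqrt b / sqrt a\<close> is perturbed to stay positive
    and defined when \<open>a\<close> or \<open>b\<close> vanishes; this \<epsilon> keeps the
    resulting error below \<open>e\<close>.\<close>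
  define \<epsilon> where "\<epsilon> = e / (sqrt a + sqrt b + 1)"
  have p: "0 < sqrt a + sqrt b + 1" using ab by (simp add: add_nonneg_pos)
  have \<epsilon>: "0 < \<epsilon>" using e p by (simp add: \<epsilon>_def)
  define t where "t = (sqrt b + \<epsilon>) / (sqrt a + \<epsilon>)"
  have pa: "0 < sqrt a + \<epsilon>" and pb: "0 < sqrt b + \<epsilon>" using ab \<epsilon> by (simp_all add: add_nonneg_pos)
  have "a \<le> sqrt a * (sqrt a + \<epsilon>)" "b \<le> sqrt b * (sqrt b + \<epsilon>)" using ab \<epsilon> by (simp_all add: distrib_left)
  then have "a / (sqrt a + \<epsilon>) \<le> sqrt a" "b / (sqrt b + \<epsilon>) \<le> sqrt b" using pa pb by (simp_all add: divide_le_eq)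
  then have "(sqrt b + \<epsilon>) * (a / (sqrt a + \<epsilon>)) \<le> (sqrt b + \<epsilon>) * sqrt a" "(sqrt a + \<epsilon>) * (b / (sqrt b + \<epsilon>)) \<le> (sqrt a + \<epsilon>) * sqrt b"
    using pa pb by (intro mult_left_mono; simp)+
  then have "t * a + b / t \<le> (sqrt b + \<epsilon>) * sqrt a + (sqrt a + \<epsilon>) * sqrt b"
    by (simp add: t_def mult.commute)
  also have "\<dots> = 2 * (sqrt a * sqrt b) + \<epsilon> * (sqrt a + sqrt b)" by (simp add: algebra_simps)
  also have "\<epsilon> * (sqrt a + sqrt b) \<le> \<epsilon> * (sqrt a + sqrt b + 1)" using \<epsilon> by (intro mult_left_mono) auto
  also have "\<dots> = e" using p by (simp add: \<epsilon>_def)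
  finally show "s \<le> 2 * (sqrt a * sqrt b) + e" using s[of t] pa pb by (simp add: t_def)
qed

context mesh
begin

text \<open>A ridge is represented by its vertices, so that faces sharing it refer to the same
  index.\<close>

definition ridges :: "(real^'n) set set" where
  "ridges = (\<Union>F\<in>faces \<T>. (\<lambda>c. verts F - {c}) ` verts F)"

lemma finite_face_verts: "F \<in> faces \<T> \<Longrightarrow> finite (verts F)"
  using faces_verts(2)[of F] dim by (intro card_ge_0_finite) auto

lemma finite_ridges: "finite ridges"
  unfolding ridges_def using finite_faces finite_face_verts by blast

lemma ridgeD:
  assumes "D \<in> ridges"
  shows "Suc (card D) = CARD('n)" "finite D" "D \<noteq> {}" "patch D \<noteq> {}" "compact (convex hull D)" "convex hull D \<noteq> {}"
proof -
  obtain F c where F: "F \<in> faces \<T>" "c \<in> verts F" "D = verts F - {c}" using assms by (auto simp: ridges_def)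
  have f: "finite (verts F)" by (rule finite_face_verts[OF F(1)])
  then show 1: "Suc (card D) = CARD('n)" "finite D" using faces_verts(2)[OF F(1)] F dim by auto
  then show D0: "D \<noteq> {}" using dim by auto
  then show "convex hull D \<noteq> {}" by simp
  show "compact (convex hull D)" using 1(2) by (rule finite_imp_compact_convex_hull)
  show "patch D \<noteq> {}" using faces_verts(3)[OF F(1)] F(3) by (auto simp: patch_def)
qed

lemma sum_faces_ridges:
  assumes A: "A \<subseteq> faces \<T>"
  shows "(\<Sum>F\<in>A. \<Sum>c\<in>verts F. h F (verts F - {c})) = (\<Sum>D\<in>ridges. \<Sum>F | F \<in> A \<and> D \<subseteq> verts F. h F D)"
proof -
  have "(\<Sum>c\<in>verts F. h F (verts F - {c})) = (\<Sum>D | D \<in> ridges \<and> D \<subseteq> verts F. h F D)" if "F \<in> A" for F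
  proof -
    have F: "F \<in> faces \<T>" using that A by blast
    have inj: "inj_on (\<lambda>c. verts F - {c}) (verts F)" by (auto simp: inj_on_def)
    have im: "{D. D \<in> ridges \<and> D \<subseteq> verts F} = (\<lambda>c. verts F - {c}) ` verts F"
    proof (intro equalityI subsetI)
      fix D assume "D \<in> {D. D \<in> ridges \<and> D \<subseteq> verts F}"
      then have D: "D \<in> ridges" "D \<subseteq> verts F" by auto
      obtain c where "c \<in> verts F" "D = verts F - {c}" using opposite_in_face[OF F D(2) ridgeD(1)[OF D(1)]] .
      then show "D \<in> (\<lambda>c. verts F - {c}) ` verts F" by blast
    qed (use F in \<open>auto simp: ridges_def\<close>)
    show ?thesis unfolding im sum.reindex[OF inj] by simp
  qed
  then have "(\<Sum>F\<in>A. \<Sum>c\<in>verts F. h F (verts F - {c})) = (\<Sum>F\<in>A. \<Sum>D | D \<in> ridges \<and> D \<subseteq> verts F. h F D)"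
    by (rule sum.cong[OF refl])
  also have "\<dots> = (\<Sum>D\<in>ridges. \<Sum>F | F \<in> A \<and> D \<subseteq> verts F. h F D)"
    by (rule sum.swap_restrict[OF finite_subset[OF A finite_faces] finite_ridges])
  finally show ?thesis .
qed

lemma sub_faces: "\<I> \<subseteq> faces \<T>" "\<B> \<subseteq> faces \<T>"
  by (auto simp: interior_faces_def boundary_faces_def)

text \<open>Each such face is a facet of an element of the patch, and an element has at most four
  facets.\<close>

lemma card_faces_at:
  assumes D: "D \<in> ridges"
  shows "card (interior_at D) \<le> 4 * card (patch D)" "card (boundary_at D) \<le> 4 * card (patch D)"
proof -
  let ?f = "\<lambda>(K, c). convex hull (verts K - {c})"
  have s: "F \<in> ?f ` Sigma (patch D) verts" if K: "K \<in> \<T>" "F facet_of K" and DF: "D \<subseteq> verts F" for F K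
  proof -
    obtain c where c: "c \<in> verts K" "F = convex hull (verts K - {c})" using facet_mesh[OF K(1)] K(2) by auto
    then have "D \<subseteq> verts K" using verts_facet[OF K(1) c(1)] DF by auto
    then show ?thesis using c K(1) by (force simp: patch_def)
  qed
  have s': "interior_at D \<subseteq> ?f ` Sigma (patch D) verts" "boundary_at D \<subseteq> ?f ` Sigma (patch D) verts"
  proof -
    have "F \<in> ?f ` Sigma (patch D) verts" if F: "F \<in> faces \<T>" "D \<subseteq> verts F" for F
      using F(1) s[OF _ _ F(2)] unfolding faces_def by blast
    then show "interior_at D \<subseteq> ?f ` Sigma (patch D) verts" "boundary_at D \<subseteq> ?f ` Sigma (patch D) verts"
      using faces_at by blast+
  qed
  have f: "finite (Sigma (patch D) verts)" using finite_patch finite_verts by (auto simp: patch_def)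
  have "card (Sigma (patch D) verts) = (\<Sum>K\<in>patch D. card (verts K))"
    using finite_patch finite_verts by (intro card_SigmaI) (auto simp: patch_def)
  also have "\<dots> = (\<Sum>K\<in>patch D. CARD('n) + 1)" by (intro sum.cong refl card_verts) (simp add: patch_def)
  also have "\<dots> \<le> 4 * card (patch D)" using dim by auto
  finally have c4: "card (Sigma (patch D) verts) \<le> 4 * card (patch D)" .
  have "card X \<le> 4 * card (patch D)" if "X \<subseteq> ?f ` Sigma (patch D) verts" for X
    using card_mono[OF finite_imageI[OF f] that] card_image_le[OF f, of ?f] c4 by linarith
  then show "card (interior_at D) \<le> 4 * card (patch D)" "card (boundary_at D) \<le> 4 * card (patch D)" using s' by blast+
qed

lemma surface_integral_null_face:
  assumes F: "F \<in> faces \<T>" and 0: "face_size F = 0"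
  shows "(LINT x:F|surface_measure. f x :: real) = 0"
proof -
  obtain k where "face_basis (verts F) (n F) k" using face_basis_face[OF F] .
  then interpret fb: face_basis "verts F" "n F" k .
  have cF: "compact F" "F \<subseteq> {x. n F \<bullet> x = k}" using fb.compact_F fb.F_plane faces_verts(1)[OF F] by auto
  have "measure surface_measure F = 0" using 0 dim by (auto simp: face_size_def)
  moreover have "emeasure surface_measure F < \<infinity>" by (rule emeasure_surface_finite[OF dim cF fb.normal])
  ultimately have "emeasure surface_measure F = 0" by (auto simp: measure_def enn2real_eq_0_iff)
  then have "F \<in> null_sets surface_measure"
    using cF(1) by (intro null_setsI) (auto simp: sets_surface_measure borel_compact)
  then have "AE x in surface_measure. indicator F x *\<^sub>R f x = 0"
    by (rule AE_not_in[THEN eventually_mono]) (auto simp: indicator_def)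
  then show ?thesis unfolding set_lebesgue_integral_def by (rule integral_eq_zero_AE)
qed

text \<open>Barycentric gradients are at most \<open>2 * \<theta>\<close> over the face size. One
  such factor in the trace inequality yields the weight of the gradient jumps, three in the conormal
  one the weight of the value jumps.\<close>

lemma scaled_traces:
  fixes C
  defines "C' \<equiv> C + 4 * C * C" and "\<theta> \<equiv> \<bar>shape_regularity \<T>\<bar>"
  assumes C: "interval_constant p C" and q: "q \<in> polys p" and F: "F \<in> faces \<T>" and c: "c \<in> verts F"
  shows "(\<integral>x. (q x)\<^sup>2 \<partial>ridge_measure (convex hull (verts F - {c})))
      \<le> (pi * (2 * \<theta>) * (2 * (2 + C'))) * (inverse (face_size F) * (LINT x:F|surface_measure. (q x)\<^sup>2))" (is ?A)
    and "(\<integral>x. (grad q x \<bullet> outer (verts F) c)\<^sup>2 \<partial>ridge_measure (convex hull (verts F - {c})))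
      \<le> (pi * (2 * \<theta>) * (2 * (2 + C')) * (9 * (2 * \<theta>)\<^sup>2 * C')) * (inverse (face_size F ^ 3) * (LINT x:F|surface_measure. (q x)\<^sup>2))" (is ?B)
proof -
  obtain k where "face_basis (verts F) (n F) k" using face_basis_face[OF F] .
  then interpret fb: face_basis "verts F" "n F" k .
  let ?S = "LINT x:F|surface_measure. (q x)\<^sup>2"
  have FF: "convex hull verts F = F" using faces_verts(1)[OF F] by simp
  have C0: "0 \<le> C'" "0 \<le> C" using C by (auto simp: interval_constant_def C'_def)
  have S0: "0 \<le> ?S" unfolding set_lebesgue_integral_def by (intro Bochner_Integration.integral_nonneg) auto
  note t = fb.trace_inequality[OF C q c, unfolded FF, folded C'_def]
  have m: "norm (bgrad (verts F) a) \<le> Max ((\<lambda>a. norm (bgrad (verts F) a)) ` verts F)" if "a \<in> verts F" for a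
    using that fb.finite by (intro Max_ge) auto
  note ct = fb.conormal_trace_inequality[OF C q c, unfolded FF, folded C'_def]
  have "?A \<and> ?B"
  proof (cases "face_size F = 0")
    \<comment> \<open>The right-hand sides vanish, and the unscaled inequalities, with the largest
      gradient norm as \<open>G\<close>, show that the left-hand sides do too.\<close>
    case True
    then have "?S = 0" by (rule surface_integral_null_face[OF F])
    then show ?thesis using t ct[OF m] by simp
  next
    case False
    then have h: "0 < face_size F" using face_size_nonneg[of F] by linarith
    have G: "norm (bgrad (verts F) a) \<le> 2 * \<theta> * inverse (face_size F)" if "a \<in> verts F" for a
      using bgrad_face_size[OF F that] h by (simp add: \<theta>_def field_simps)
    have "pi * norm (bgrad (verts F) c) * (2 * (2 + C') * ?S) \<le> pi * (2 * \<theta> * inverse (face_size F)) * (2 * (2 + C') * ?S)"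
      using G[OF c] C0 S0 by (intro mult_right_mono mult_left_mono) auto
    also have "\<dots> = (pi * (2 * \<theta>) * (2 * (2 + C'))) * (inverse (face_size F) * ?S)" by (simp only: mult_ac)
    finally have 1: ?A by (rule order_trans[OF t])
    have 2: ?B
    proof -
      have i3: "inverse (face_size F ^ 3) = inverse (face_size F) * (inverse (face_size F) * inverse (face_size F))"
        by (simp add: power3_eq_cube)
      show ?thesis using ct[OF G] unfolding i3 power_mult_distrib by (simp only: power2_eq_square[of \<theta>] power2_eq_square[of "inverse (face_size F)"] mult_ac)
    qed
    show ?thesis using 1 2 by blast
  qed
  then show ?A ?B by blast+
qed

definition "ridge_energy w D x = (\<Sum>F\<in>interior_at D. (norm (grad (jump_poly w F) x))\<^sup>2)
  + (\<Sum>F\<in>boundary_at D. (grad (piece w (left F)) x \<bullet> conormal F D)\<^sup>2)"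

context
  fixes p w
  assumes w: "w \<in> V0 p \<Omega> \<T>"
begin

lemma face_polys:
  "F \<in> \<I> \<Longrightarrow> jump_poly w F \<in> polys p" "F \<in> \<I> \<Longrightarrow> avg_poly w F \<in> polys p"
  "F \<in> \<B> \<Longrightarrow> piece w (left F) \<in> polys p"
  "F \<in> \<I> \<Longrightarrow> grad (jump_poly w F) x = grad (piece w (left F)) x - grad (piece w (right F)) x"
  "F \<in> \<I> \<Longrightarrow> grad (avg_poly w F) x = (1/2) *\<^sub>R grad (piece w (left F)) x + (1/2) *\<^sub>R grad (piece w (right F)) x"
proof -
  show "F \<in> \<B> \<Longrightarrow> piece w (left F) \<in> polys p"
    using piece_polys[OF w boundary_face_elements(1)] .
  assume F: "F \<in> \<I>"
  note P = polys_combination[OF piece_polys[OF w interior_face_elements(1)[OF F]] piece_polys[OF w interior_face_elements(2)[OF F]]]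
  show "jump_poly w F \<in> polys p" "avg_poly w F \<in> polys p"
    unfolding jump_poly_def avg_poly_def by (rule P(1))+
  show "grad (jump_poly w F) x = grad (piece w (left F)) x - grad (piece w (right F)) x"
    unfolding jump_poly_def P(2) by simp
  show "grad (avg_poly w F) x = (1/2) *\<^sub>R grad (piece w (left F)) x + (1/2) *\<^sub>R grad (piece w (right F)) x"
    unfolding avg_poly_def P(2) ..
qed

lemma continuous_face_grads:
  "F \<in> \<I> \<Longrightarrow> continuous_on UNIV (grad (jump_poly w F))"
  "F \<in> \<I> \<Longrightarrow> continuous_on UNIV (grad (avg_poly w F))"
  "F \<in> \<B> \<Longrightarrow> continuous_on UNIV (grad (piece w (left F)))"
  using face_polys(1-3) by (auto intro!: c1_grad polys_c1(1))

lemma continuous_ridge_energy: "continuous_on UNIV (ridge_energy w D)"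
  unfolding ridge_energy_def[abs_def] interior_at_def boundary_at_def
  by (intro continuous_intros continuous_face_grads) auto

text \<open>Cauchy-Schwarz over at most \<open>4 * card (patch D)\<close> faces of each kind, and a
  factor 2 for the square of the sum of the two kinds.\<close>

lemma ridge_jump_energy:
  assumes D: "D \<in> ridges"
  shows "(ridge_jump D (\<lambda>K. grad (piece w K) x))\<^sup>2 \<le> 8 * real (card (patch D)) * ridge_energy w D x"
proof -
  let ?f = "\<lambda>F. norm (grad (jump_poly w F) x)" and ?g = "\<lambda>F. \<bar>grad (piece w (left F)) x \<bullet> conormal F D\<bar>"
  let ?N = "real (card (patch D))"
  have e: "ridge_jump D (\<lambda>K. grad (piece w K) x) = sum ?f (interior_at D) + sum ?g (boundary_at D)"
    unfolding ridge_jump_def by (intro arg_cong2[where f = "(+)"] sum.cong refl) (simp add: interior_at_def face_polys(4))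
  have sq: "(sum f A)\<^sup>2 \<le> 4 * ?N * (\<Sum>F\<in>A. (f F)\<^sup>2)" if "card A \<le> 4 * card (patch D)" for f :: "(real^'n) set \<Rightarrow> real" and A
  proof -
    have "(sum f A)\<^sup>2 \<le> (\<Sum>F\<in>A. (f F)\<^sup>2) * real (card A)" by (rule sum_squared_le_sum_of_squares)
    also have "\<dots> \<le> (\<Sum>F\<in>A. (f F)\<^sup>2) * (4 * ?N)" using that by (intro mult_left_mono sum_nonneg) auto
    finally show ?thesis by (simp add: mult_ac)
  qed
  have "(sum ?f (interior_at D) + sum ?g (boundary_at D))\<^sup>2 \<le> 2 * (sum ?f (interior_at D))\<^sup>2 + 2 * (sum ?g (boundary_at D))\<^sup>2"
    unfolding power2_sum using sum_squares_bound[of "sum ?f (interior_at D)" "sum ?g (boundary_at D)"] by linarith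
  also have "\<dots> \<le> 2 * (4 * ?N * (\<Sum>F\<in>interior_at D. (?f F)\<^sup>2)) + 2 * (4 * ?N * (\<Sum>F\<in>boundary_at D. (?g F)\<^sup>2))"
    by (intro add_mono mult_left_mono sq card_faces_at D) auto
  also have "\<dots> = 8 * ?N * ridge_energy w D x" by (simp add: ridge_energy_def algebra_simps)
  finally show ?thesis unfolding e .
qed

lemma seminorm_square:
  "(jump_seminorm \<Omega> \<T> n w)\<^sup>2 \<ge> (\<Sum>F\<in>\<I>. inverse (face_size F) * (LINT x:F|surface_measure. (norm (grad (jump_poly w F) x))\<^sup>2))
    + (\<Sum>F\<in>\<B>. inverse (face_size F ^ 3) * (LINT x:F|surface_measure. (piece w (left F) x)\<^sup>2))"
proof -
  let ?q = "\<lambda>F. LINT x:F|surface_measure. inverse (face_size F) * (norm (jump \<Omega> \<T> n F (\<lambda>K. grad (piece w K)) x))\<^sup>2"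
  let ?r = "\<lambda>F. LINT x:F|surface_measure. inverse (face_size F ^ 3) * (jump \<Omega> \<T> n F (piece w) x)\<^sup>2"
  have q0: "0 \<le> ?q F" "0 \<le> ?r F" for F
    unfolding set_lebesgue_integral_def using face_size_nonneg[of F]
    by (intro Bochner_Integration.integral_nonneg; simp)+
  have "(jump_seminorm \<Omega> \<T> n w)\<^sup>2 = (\<Sum>F\<in>\<I>. ?q F) + (\<Sum>F\<in>faces \<T>. ?r F)"
    unfolding jump_seminorm_def by (intro real_sqrt_pow2 add_nonneg_nonneg sum_nonneg q0)
  moreover have "(\<Sum>F\<in>\<B>. ?r F) \<le> (\<Sum>F\<in>faces \<T>. ?r F)"
    by (intro sum_mono2 finite_faces sub_faces q0)
  moreover have "(\<Sum>F\<in>\<I>. ?q F) = (\<Sum>F\<in>\<I>. inverse (face_size F) * (LINT x:F|surface_measure. (norm (grad (jump_poly w F) x))\<^sup>2))"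
  proof (rule sum.cong[OF refl])
    fix F assume F: "F \<in> \<I>"
    show "?q F = inverse (face_size F) * (LINT x:F|surface_measure. (norm (grad (jump_poly w F) x))\<^sup>2)"
      unfolding jump_def if_P[OF F] face_polys(4)[OF F] by simp
  qed
  moreover have "(\<Sum>F\<in>\<B>. ?r F) = (\<Sum>F\<in>\<B>. inverse (face_size F ^ 3) * (LINT x:F|surface_measure. (piece w (left F) x)\<^sup>2))"
  proof (rule sum.cong[OF refl])
    fix F assume "F \<in> \<B>"
    then have F: "F \<notin> \<I>" by (simp add: interior_faces_def)
    show "?r F = inverse (face_size F ^ 3) * (LINT x:F|surface_measure. (piece w (left F) x)\<^sup>2)"
      unfolding jump_def if_not_P[OF F] by simp
  qed
  ultimately show ?thesis by linarith
qed

text \<open>On interior faces the trace inequality is applied to each partial derivative of the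
  jump, on boundary faces the conormal one to the trace of \<open>w\<close> itself. Every face has
  at most three ridges, which accounts for the factor 3.\<close>

lemma ridge_energy_seminorm:
  fixes C
  defines "C' \<equiv> C + 4 * C * C" and "\<theta> \<equiv> \<bar>shape_regularity \<T>\<bar>"
  assumes C: "interval_constant p C"
  shows "(\<Sum>D\<in>ridges. \<integral>x. ridge_energy w D x \<partial>ridge_measure (convex hull D))
    \<le> 3 * (pi * (2 * \<theta>) * (2 * (2 + C')) * (1 + 9 * (2 * \<theta>)\<^sup>2 * C')) * (jump_seminorm \<Omega> \<T> n w)\<^sup>2"
proof -
  let ?E = "\<lambda>D f. \<integral>x. f x \<partial>ridge_measure (convex hull D)"
  let ?I = "\<I>" and ?B = "\<B>"
  define L1 where "L1 = pi * (2 * \<theta>) * (2 * (2 + C'))"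
  define L2 where "L2 = L1 * (9 * (2 * \<theta>)\<^sup>2 * C')"
  have C0: "0 \<le> C'" using C by (auto simp: interval_constant_def C'_def)
  have L0: "0 \<le> L1" "0 \<le> L2" using C0 by (auto simp: L1_def L2_def \<theta>_def)
  let ?f = "\<lambda>F x. (norm (grad (jump_poly w F) x))\<^sup>2"
  let ?g = "\<lambda>F D x. (grad (piece w (left F)) x \<bullet> conormal F D)\<^sup>2"
  let ?P = "\<lambda>F. inverse (face_size F) * (LINT x:F|surface_measure. ?f F x)"
  let ?Q = "\<lambda>F. inverse (face_size F ^ 3) * (LINT x:F|surface_measure. (piece w (left F) x)\<^sup>2)"
  have PQ0: "0 \<le> ?P F" "0 \<le> ?Q F" for F
    unfolding set_lebesgue_integral_def using face_size_nonneg[of F]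
    by (intro mult_nonneg_nonneg Bochner_Integration.integral_nonneg; simp)+
  have cf: "continuous_on UNIV (?f F)" if "F \<in> ?I" for F
    using continuous_face_grads(1)[OF that] by (intro continuous_intros)
  have cg: "continuous_on UNIV (?g F D)" if "F \<in> ?B" for F D
    using continuous_face_grads(3)[OF that] by (intro continuous_intros)
  have "(\<Sum>D\<in>ridges. ?E D (ridge_energy w D)) = (\<Sum>D\<in>ridges. (\<Sum>F | F \<in> ?I \<and> D \<subseteq> verts F. ?E D (?f F)) + (\<Sum>F | F \<in> ?B \<and> D \<subseteq> verts F. ?E D (?g F D)))"
  proof (rule sum.cong[OF refl])
    fix D assume D: "D \<in> ridges"
    have i: "integrable (ridge_measure (convex hull D)) (?f F)" if "F \<in> interior_at D" for F
      using that cf by (intro integrable_ridge_measure ridgeD[OF D]) (auto simp: interior_at_def)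
    have j: "integrable (ridge_measure (convex hull D)) (?g F D)" if "F \<in> boundary_at D" for F
      using that cg by (intro integrable_ridge_measure ridgeD[OF D]) (auto simp: boundary_at_def)
    have "?E D (ridge_energy w D) = ?E D (\<lambda>x. \<Sum>F\<in>interior_at D. ?f F x) + ?E D (\<lambda>x. \<Sum>F\<in>boundary_at D. ?g F D x)"
      unfolding ridge_energy_def by (intro Bochner_Integration.integral_add Bochner_Integration.integrable_sum i j)
    also have "?E D (\<lambda>x. \<Sum>F\<in>interior_at D. ?f F x) = (\<Sum>F\<in>interior_at D. ?E D (?f F))"
      by (rule Bochner_Integration.integral_sum[OF i])
    also have "?E D (\<lambda>x. \<Sum>F\<in>boundary_at D. ?g F D x) = (\<Sum>F\<in>boundary_at D. ?E D (?g F D))"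
      by (rule Bochner_Integration.integral_sum[OF j])
    finally show "?E D (ridge_energy w D) = (\<Sum>F | F \<in> ?I \<and> D \<subseteq> verts F. ?E D (?f F)) + (\<Sum>F | F \<in> ?B \<and> D \<subseteq> verts F. ?E D (?g F D))"
      unfolding interior_at_def boundary_at_def .
  qed
  also have "\<dots> = (\<Sum>F\<in>?I. \<Sum>c\<in>verts F. ?E (verts F - {c}) (?f F)) + (\<Sum>F\<in>?B. \<Sum>c\<in>verts F. ?E (verts F - {c}) (?g F (verts F - {c})))"
    unfolding sum.distrib sum_faces_ridges[OF sub_faces(1), of "\<lambda>F D. ?E D (?f F)", symmetric]
      sum_faces_ridges[OF sub_faces(2), of "\<lambda>F D. ?E D (?g F D)", symmetric] ..
  also have "\<dots> \<le> (\<Sum>F\<in>?I. \<Sum>c\<in>verts F. L1 * ?P F) + (\<Sum>F\<in>?B. \<Sum>c\<in>verts F. L2 * ?Q F)"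
  proof (intro add_mono sum_mono)
    fix F c assume F: "F \<in> ?I" and c: "c \<in> verts F"
    have Ff: "F \<in> faces \<T>" using F sub_faces by blast
    obtain k where "face_basis (verts F) (n F) k" using face_basis_face[OF Ff] .
    then interpret fb: face_basis "verts F" "n F" k .
    note q = face_polys(1)[OF F]
    have pq: "partial_deriv i (jump_poly w F) \<in> polys p" for i by (rule polys_c1(2)[OF q])
    have ci: "continuous_on UNIV (\<lambda>x. (partial_deriv i (jump_poly w F) x)\<^sup>2)" for i
      by (intro continuous_intros c1_continuous polys_c1(1)[OF pq])
    have ff: "?f F x = (\<Sum>i\<in>UNIV. (partial_deriv i (jump_poly w F) x)\<^sup>2)" for x
      unfolding power2_norm_eq_inner inner_vec_def grad_nth by (simp add: power2_eq_square)
    have "?E (verts F - {c}) (?f F) = (\<Sum>i\<in>UNIV. ?E (verts F - {c}) (\<lambda>x. (partial_deriv i (jump_poly w F) x)\<^sup>2))"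
      unfolding ff by (intro Bochner_Integration.integral_sum integrable_ridge_measure fb.ridge_compact fb.ridge_ne c ci)
    also have "\<dots> \<le> (\<Sum>i\<in>UNIV. L1 * (inverse (face_size F) * (LINT x:F|surface_measure. (partial_deriv i (jump_poly w F) x)\<^sup>2)))"
      unfolding L1_def C'_def \<theta>_def by (intro sum_mono scaled_traces(1)[OF C pq Ff c])
    also have "\<dots> = L1 * (inverse (face_size F) * (\<Sum>i\<in>UNIV. LINT x:F|surface_measure. (partial_deriv i (jump_poly w F) x)\<^sup>2))"
      by (simp only: sum_distrib_left)
    also have "(\<Sum>i\<in>UNIV. LINT x:F|surface_measure. (partial_deriv i (jump_poly w F) x)\<^sup>2) = (LINT x:F|surface_measure. ?f F x)"
      unfolding ff set_lebesgue_integral_def scaleR_sum_right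
      using fb.surf_int[OF ci] faces_verts(1)[OF Ff]
      by (intro Bochner_Integration.integral_sum[symmetric]) (simp add: set_integrable_def)
    finally show "?E (verts F - {c}) (?f F) \<le> L1 * ?P F" .
  next
    fix F c assume F: "F \<in> ?B" and c: "c \<in> verts F"
    have Ff: "F \<in> faces \<T>" using F sub_faces by blast
    show "?E (verts F - {c}) (?g F (verts F - {c})) \<le> L2 * ?Q F"
      unfolding conormal_facet[OF c] L2_def L1_def C'_def \<theta>_def
      by (rule scaled_traces(2)[OF C face_polys(3)[OF F] Ff c])
  qed
  also have "\<dots> = (\<Sum>F\<in>?I. real CARD('n) * (L1 * ?P F)) + (\<Sum>F\<in>?B. real CARD('n) * (L2 * ?Q F))"
    by (intro arg_cong2[where f = "(+)"] sum.cong refl) (auto simp: faces_verts(2) subsetD[OF sub_faces(1)] subsetD[OF sub_faces(2)])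
  also have "\<dots> \<le> (\<Sum>F\<in>?I. 3 * ((L1 + L2) * ?P F)) + (\<Sum>F\<in>?B. 3 * ((L1 + L2) * ?Q F))"
  proof -
    have "real CARD('n) * (l * X) \<le> 3 * ((L1 + L2) * X)" if "0 \<le> X" "0 \<le> l" "l \<le> L1 + L2" for l X :: real
      using that dim by (intro mult_mono mult_nonneg_nonneg) auto
    then show ?thesis using L0 by (intro add_mono sum_mono) (simp_all add: PQ0)
  qed
  also have "\<dots> = 3 * (L1 + L2) * ((\<Sum>F\<in>?I. ?P F) + (\<Sum>F\<in>?B. ?Q F))"
    by (simp only: sum_distrib_left[symmetric] distrib_left[of 3, symmetric] distrib_left[of "L1 + L2", symmetric] mult.assoc)
  also have "\<dots> \<le> 3 * (L1 + L2) * (jump_seminorm \<Omega> \<T> n w)\<^sup>2"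
    using seminorm_square L0 by (intro mult_left_mono) auto
  also have "L1 + L2 = L1 * (1 + 9 * (2 * \<theta>)\<^sup>2 * C')" by (simp add: L2_def distrib_left)
  finally show ?thesis by (simp only: L1_def)
qed

end

definition "ridge_form w v D x = (\<Sum>F\<in>interior_at D. wedge (n F) (conormal F D) (grad (jump_poly w F) x) (grad (avg_poly v F) x))
      - (\<Sum>F\<in>boundary_at D. (grad (piece v (left F)) x \<bullet> n F) * (grad (piece w (left F)) x \<bullet> conormal F D))"

lemma S_form_ridge_sum:
  assumes w: "w \<in> V0 p \<Omega> \<T>" and v: "v \<in> V0 p \<Omega> \<T>"
  shows "S_form \<Omega> \<T> n w v = (\<Sum>D\<in>ridges. \<integral>x. ridge_form w v D x \<partial>ridge_measure (convex hull D)) / pi"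
    and "D \<in> ridges \<Longrightarrow> integrable (ridge_measure (convex hull D)) (ridge_form w v D)"
proof -
  let ?I = "\<I>" and ?B = "\<B>"
  let ?f = "\<lambda>F D x. wedge (n F) (conormal F D) (grad (jump_poly w F) x) (grad (avg_poly v F) x)"
  let ?g = "\<lambda>F D x. (grad (piece v (left F)) x \<bullet> n F) * (grad (piece w (left F)) x \<bullet> conormal F D)"
  let ?E = "\<lambda>D f. \<integral>x. f x \<partial>ridge_measure (convex hull D)"
  have i: "integrable (ridge_measure (convex hull D)) (?f F D)" if "D \<in> ridges" "F \<in> interior_at D" for F D
    unfolding wedge_def using that(2) continuous_face_grads[OF w] continuous_face_grads[OF v]
    by (intro integrable_ridge_measure ridgeD[OF that(1)] continuous_intros) (auto simp: interior_at_def)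
  have j: "integrable (ridge_measure (convex hull D)) (?g F D)" if "D \<in> ridges" "F \<in> boundary_at D" for F D
    using that(2) continuous_face_grads[OF w] continuous_face_grads[OF v]
    by (intro integrable_ridge_measure ridgeD[OF that(1)] continuous_intros) (auto simp: boundary_at_def)
  show int: "integrable (ridge_measure (convex hull D)) (ridge_form w v D)" if "D \<in> ridges" for D
    unfolding ridge_form_def by (intro Bochner_Integration.integrable_diff Bochner_Integration.integrable_sum i j that)
  have "S_form \<Omega> \<T> n w v = (\<Sum>F\<in>?I. \<Sum>c\<in>verts F. ?E (verts F - {c}) (?f F (verts F - {c}))) / pi
     - (\<Sum>F\<in>?B. \<Sum>c\<in>verts F. ?E (verts F - {c}) (?g F (verts F - {c}))) / pi"
    unfolding S_form_ridges[OF w v]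
    by (intro arg_cong2[where f = "(-)"] arg_cong2[where f = "(/)"] sum.cong refl) (simp_all add: conormal_facet interior_flux_def boundary_flux_def)
  also have "\<dots> = ((\<Sum>D\<in>ridges. \<Sum>F | F \<in> ?I \<and> D \<subseteq> verts F. ?E D (?f F D)) - (\<Sum>D\<in>ridges. \<Sum>F | F \<in> ?B \<and> D \<subseteq> verts F. ?E D (?g F D))) / pi"
    unfolding sum_faces_ridges[OF sub_faces(1), of "\<lambda>F D. ?E D (?f F D)"]
      sum_faces_ridges[OF sub_faces(2), of "\<lambda>F D. ?E D (?g F D)"] by (simp add: diff_divide_distrib)
  also have "\<dots> = (\<Sum>D\<in>ridges. ?E D (ridge_form w v D)) / pi"
    unfolding sum_subtractf[symmetric] interior_at_def[symmetric] boundary_at_def[symmetric]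
  proof (intro arg_cong2[where f = "(/)"] sum.cong refl)
    fix D assume D: "D \<in> ridges"
    have "?E D (ridge_form w v D)
      = ?E D (\<lambda>x. \<Sum>F\<in>interior_at D. ?f F D x) - ?E D (\<lambda>x. \<Sum>F\<in>boundary_at D. ?g F D x)"
      unfolding ridge_form_def by (intro Bochner_Integration.integral_diff Bochner_Integration.integrable_sum i j D)
    also have "?E D (\<lambda>x. \<Sum>F\<in>interior_at D. ?f F D x) = (\<Sum>F\<in>interior_at D. ?E D (?f F D))"
      by (rule Bochner_Integration.integral_sum[OF i[OF D]])
    also have "?E D (\<lambda>x. \<Sum>F\<in>boundary_at D. ?g F D x) = (\<Sum>F\<in>boundary_at D. ?E D (?g F D))"
      by (rule Bochner_Integration.integral_sum[OF j[OF D]])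
    finally show "(\<Sum>F\<in>interior_at D. ?E D (?f F D)) - (\<Sum>F\<in>boundary_at D. ?E D (?g F D))
      = ?E D (ridge_form w v D)" ..
  qed
  finally show "S_form \<Omega> \<T> n w v = (\<Sum>D\<in>ridges. ?E D (ridge_form w v D)) / pi" .
qed

text \<open>\<open>N\<close> bounds the number of elements at a ridge. The factors stem, in order,
  from \<open>le_geometric_mean\<close>, \<open>ridge_bound\<close>,
  \<open>ridge_jump_energy\<close> and \<open>ridge_energy_seminorm\<close>; the final division by
  \<open>pi\<close> comes from \<open>ridge_measure\<close>.\<close>

definition (in -) stability_constant :: "nat \<Rightarrow> real \<Rightarrow> real \<Rightarrow> real \<Rightarrow> real" where
  "stability_constant d \<delta> C \<theta> =
     (let N = (4 * \<bar>\<theta>\<bar>) ^ d; C' = C + 4 * C * C in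
      2 * ((2 * N\<^sup>2 + 3) / \<delta> * (8 * N) * (3 * (pi * (2 * \<bar>\<theta>\<bar>) * (2 * (2 + C')) * (1 + 9 * (2 * \<bar>\<theta>\<bar>)\<^sup>2 * C')))) / pi)"

text \<open>\<open>ridge_bound\<close> holds at every point of a ridge; it is turned into squares
  with a weight \<open>t\<close>, integrated, summed over the ridges and compared with the seminorms
  before \<open>t\<close> is optimised.\<close>

lemma S_form_bound:
  assumes w: "w \<in> V0 p \<Omega> \<T>" and v: "v \<in> V0 p \<Omega> \<T>" and C: "interval_constant p C"
    and \<delta>: "0 < \<delta>" "\<delta> \<le> 1" "\<And>F F'. F \<in> \<B> \<Longrightarrow> F' \<in> \<B> \<Longrightarrow>
      (n F \<bullet> n F')\<^sup>2 \<noteq> 1 \<Longrightarrow> \<delta> \<le> 1 - (n F \<bullet> n F')\<^sup>2"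
  shows "\<bar>S_form \<Omega> \<T> n w v\<bar> \<le> stability_constant CARD('n) \<delta> C (shape_regularity \<T>) * jump_seminorm \<Omega> \<T> n w * jump_seminorm \<Omega> \<T> n v"
proof -
  define \<theta> where "\<theta> = \<bar>shape_regularity \<T>\<bar>"
  define C' where "C' = C + 4 * C * C"
  define N where "N = (4 * \<theta>) ^ CARD('n)"
  define M where "M = (2 * N\<^sup>2 + 3) / \<delta>"
  define L where "L = 3 * (pi * (2 * \<theta>) * (2 * (2 + C')) * (1 + 9 * (2 * \<theta>)\<^sup>2 * C'))"
  define k where "k = M * (8 * N) * L / pi"
  have C0: "0 \<le> C'" using C by (auto simp: interval_constant_def C'_def)
  have \<theta>0: "0 \<le> \<theta>" by (simp add: \<theta>_def)
  have N0: "0 \<le> N" using \<theta>0 by (simp add: N_def)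
  have M0: "0 \<le> M" using \<delta>(1) by (simp add: M_def)
  have L0: "0 \<le> L" using C0 \<theta>0 by (simp add: L_def)
  have k0: "0 \<le> k" using M0 N0 L0 by (simp add: k_def)
  let ?E = "\<lambda>D f. \<integral>x. f x \<partial>ridge_measure (convex hull D)"
  let ?a = "(jump_seminorm \<Omega> \<T> n w)\<^sup>2" and ?b = "(jump_seminorm \<Omega> \<T> n v)\<^sup>2"
  have en: "(\<Sum>D\<in>ridges. ?E D (ridge_energy w D)) \<le> L * ?a" "(\<Sum>D\<in>ridges. ?E D (ridge_energy v D)) \<le> L * ?b"
    using ridge_energy_seminorm[OF w C] ridge_energy_seminorm[OF v C] by (simp_all add: L_def C'_def \<theta>_def)
  have "\<bar>S_form \<Omega> \<T> n w v\<bar> \<le> t * (k * ?a) + (k * ?b) / t" if t: "0 < t" for t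
  proof -
    \<comment> \<open>A weighted Young inequality with the same \<open>t\<close> at all ridges and
      points; separate Cauchy-Schwarz steps for integrals and sums are thereby avoided.\<close>
    have pt: "\<bar>ridge_form w v D x\<bar> \<le> M * (8 * N) * (t * ridge_energy w D x + ridge_energy v D x / t)" if D: "D \<in> ridges" for D x
    proof -
      define A where "A = ridge_jump D (\<lambda>K. grad (piece w K) x)"
      define B where "B = ridge_jump D (\<lambda>K. grad (piece v K) x)"
      define m where "m = real (card (patch D))"
      have m: "0 \<le> m" "m \<le> N" unfolding m_def N_def \<theta>_def using card_patch[OF ridgeD(3)[OF D]] by auto
      have q0: "0 \<le> ridge_energy w D x" "0 \<le> ridge_energy v D x" unfolding ridge_energy_def by (intro add_nonneg_nonneg sum_nonneg; simp)+
      have h: "ridge_form w v D x = (\<Sum>F\<in>interior_at D. wedge (n F) (conormal F D) (grad (piece w (left F)) x - grad (piece w (right F)) x)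
          ((1/2) *\<^sub>R grad (piece v (left F)) x + (1/2) *\<^sub>R grad (piece v (right F)) x))
        - (\<Sum>F\<in>boundary_at D. (grad (piece v (left F)) x \<bullet> n F) * (grad (piece w (left F)) x \<bullet> conormal F D))"
        unfolding ridge_form_def by (intro arg_cong2[where f = "(-)"] sum.cong refl) (simp add: interior_at_def face_polys(4)[OF w] face_polys(5)[OF v])
      have AB0: "0 \<le> A" "0 \<le> B" unfolding A_def B_def by (rule ridge_jump_bounds(1))+
      have "\<bar>ridge_form w v D x\<bar> \<le> 2 * ((2 * m\<^sup>2 + 3) / \<delta>) * A * B"
        unfolding h A_def B_def m_def
        using ridge_bound[OF ridgeD(1,2,4)[OF D] \<delta>, of "\<lambda>K. grad (piece w K) x" "\<lambda>K. grad (piece v K) x"] by simp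
      also have "\<dots> = (2 * m\<^sup>2 + 3) / \<delta> * (2 * A * B)" by simp
      also have "\<dots> \<le> M * (t * A\<^sup>2 + B\<^sup>2 / t)"
      proof (rule mult_mono)
        have "m\<^sup>2 \<le> N\<^sup>2" using m by (intro power_mono) auto
        then show "(2 * m\<^sup>2 + 3) / \<delta> \<le> M" unfolding M_def using \<delta>(1) by (intro divide_right_mono) auto
        have "0 \<le> (t * A - B)\<^sup>2 / t" using t by simp
        also have "\<dots> = t * A\<^sup>2 + B\<^sup>2 / t - 2 * A * B" using t by (simp add: power2_diff power_mult_distrib field_simps power2_eq_square)
        finally show "2 * A * B \<le> t * A\<^sup>2 + B\<^sup>2 / t" by simp
      qed (use M0 AB0 in auto)
      also have "\<dots> \<le> M * (t * (8 * N * ridge_energy w D x) + (8 * N * ridge_energy v D x) / t)"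
      proof (intro mult_left_mono add_mono divide_right_mono M0)
        show "A\<^sup>2 \<le> 8 * N * ridge_energy w D x"
          using ridge_jump_energy[OF w D, of x] mult_right_mono[of "8 * m" "8 * N", OF _ q0(1)] m by (simp add: A_def m_def)
        show "B\<^sup>2 \<le> 8 * N * ridge_energy v D x"
          using ridge_jump_energy[OF v D, of x] mult_right_mono[of "8 * m" "8 * N", OF _ q0(2)] m by (simp add: B_def m_def)
      qed (use t in auto)
      also have "\<dots> = M * (8 * N) * (t * ridge_energy w D x + ridge_energy v D x / t)" by (simp add: algebra_simps)
      finally show ?thesis .
    qed
    have ridge: "\<bar>?E D (ridge_form w v D)\<bar> \<le> M * (8 * N) * (t * ?E D (ridge_energy w D) + ?E D (ridge_energy v D) / t)" if D: "D \<in> ridges" for D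
    proof -
      note ie = integrable_ridge_measure[OF ridgeD(5,6)[OF D] continuous_ridge_energy[OF w]]
        integrable_ridge_measure[OF ridgeD(5,6)[OF D] continuous_ridge_energy[OF v]]
      have "\<bar>?E D (ridge_form w v D)\<bar> \<le> ?E D (\<lambda>x. \<bar>ridge_form w v D x\<bar>)" by (rule integral_abs_bound)
      also have "\<dots> \<le> ?E D (\<lambda>x. M * (8 * N) * (t * ridge_energy w D x + ridge_energy v D x / t))"
        by (intro Bochner_Integration.integral_mono integrable_abs S_form_ridge_sum(2)[OF w v D] pt[OF D]
          Bochner_Integration.integrable_add integrable_mult_right integrable_divide ie)
      also have "\<dots> = M * (8 * N) * (t * ?E D (ridge_energy w D) + ?E D (ridge_energy v D) / t)"
        using ie by simp
      finally show ?thesis .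
    qed
    have "\<bar>S_form \<Omega> \<T> n w v\<bar> = \<bar>\<Sum>D\<in>ridges. ?E D (ridge_form w v D)\<bar> / pi"
      unfolding S_form_ridge_sum(1)[OF w v] by simp
    also have "\<dots> \<le> (\<Sum>D\<in>ridges. M * (8 * N) * (t * ?E D (ridge_energy w D) + ?E D (ridge_energy v D) / t)) / pi"
      by (intro divide_right_mono order_trans[OF sum_abs] sum_mono ridge) auto
    also have "\<dots> = M * (8 * N) * (t * (\<Sum>D\<in>ridges. ?E D (ridge_energy w D)) + (\<Sum>D\<in>ridges. ?E D (ridge_energy v D)) / t) / pi"
      by (simp only: sum_distrib_left[symmetric] sum.distrib sum_divide_distrib[symmetric])
    also have "\<dots> \<le> M * (8 * N) * (t * (L * ?a) + (L * ?b) / t) / pi"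
      using en t M0 N0 by (intro divide_right_mono mult_left_mono add_mono) auto
    also have "\<dots> = t * (k * ?a) + (k * ?b) / t" by (simp add: k_def add_divide_distrib algebra_simps)
    finally show ?thesis .
  qed
  then have "\<bar>S_form \<Omega> \<T> n w v\<bar> \<le> 2 * (sqrt (k * ?a) * sqrt (k * ?b))"
    by (intro le_geometric_mean mult_nonneg_nonneg k0) auto
  also have "sqrt (k * ?a) * sqrt (k * ?b) = k * jump_seminorm \<Omega> \<T> n w * jump_seminorm \<Omega> \<T> n v"
  proof -
    have j0: "0 \<le> jump_seminorm \<Omega> \<T> n u" for u
      unfolding jump_seminorm_def set_lebesgue_integral_def
      by (intro real_sqrt_ge_zero add_nonneg_nonneg sum_nonneg Bochner_Integration.integral_nonneg) (simp_all add: face_size_nonneg)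
    have "sqrt (k * ?a) * sqrt (k * ?b) = (sqrt k * sqrt k) * (jump_seminorm \<Omega> \<T> n w * jump_seminorm \<Omega> \<T> n v)"
      using j0 by (simp add: real_sqrt_mult)
    then show ?thesis using k0 by simp
  qed
  finally show ?thesis
    unfolding stability_constant_def Let_def k_def M_def N_def L_def C'_def \<theta>_def by (simp add: mult.assoc)
qed

end

theorem theorem5p3:
  fixes \<Omega> :: "(real^'n) set" and p :: nat
  assumes "CARD('n) \<in> {2, 3}"
    and "open \<Omega>" and "bounded \<Omega>" and "convex \<Omega>" and "polytope (closure \<Omega>)"
    and "p \<ge> 2"
  shows "\<exists>C :: real \<Rightarrow> real. \<forall>s\<in>{0, 1}. \<forall>\<T> n.
           conforming_mesh \<Omega> \<T> \<longrightarrow> face_normals \<Omega> \<T> n \<longrightarrow>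
           (\<forall>w\<in>FE_space s p \<Omega> \<T>. \<forall>v\<in>FE_space s p \<Omega> \<T>.
              \<bar>S_form \<Omega> \<T> n w v\<bar>
                \<le> C (shape_regularity \<T>) * jump_seminorm \<Omega> \<T> n w * jump_seminorm \<Omega> \<T> n v)"
proof -
  obtain \<delta> where \<delta>: "0 < \<delta>" "\<delta> \<le> 1"
    "\<And>\<T> n F F'. mesh \<Omega> \<T> n \<Longrightarrow> F \<in> boundary_faces \<Omega> \<T> \<Longrightarrow> F' \<in> boundary_faces \<Omega> \<T> \<Longrightarrow>
      (n F \<bullet> n F')\<^sup>2 \<noteq> 1 \<Longrightarrow> \<delta> \<le> 1 - (n F \<bullet> n F')\<^sup>2"
    using boundary_angle_bound[OF assms(5)] by metis
  obtain C where C: "interval_constant p C" using interval_constant_exists by blast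
  show ?thesis
  \<comment> \<open>\<delta> depends on \<Omega> only and \<open>C\<close> on \<open>p\<close> only,
    both fixed before the mesh. The case \<open>s = 1\<close> is contained in \<open>s = 0\<close>,
    since \<open>V1\<close> is a subspace of \<open>V0\<close>.\<close>
  proof (intro exI[of _ "stability_constant CARD('n) \<delta> C"] ballI allI impI)
    fix s \<T> n w v
    assume m: "conforming_mesh \<Omega> \<T>" "face_normals \<Omega> \<T> n" and wv: "w \<in> FE_space s p \<Omega> \<T>" "v \<in> FE_space s p \<Omega> \<T>"
    have mesh: "mesh \<Omega> \<T> n" using assms m by unfold_locales
    then interpret mesh \<Omega> \<T> n .
    have "w \<in> V0 p \<Omega> \<T>" "v \<in> V0 p \<Omega> \<T>" using wv by (auto simp: FE_space_def V1_def split: if_splits)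
    then show "\<bar>S_form \<Omega> \<T> n w v\<bar> \<le> stability_constant CARD('n) \<delta> C (shape_regularity \<T>) * jump_seminorm \<Omega> \<T> n w * jump_seminorm \<Omega> \<T> n v"
      by (rule S_form_bound[OF _ _ C \<delta>(1,2)]) (rule \<delta>(3)[OF mesh])
  qed
qed

end
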